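(* Let $M$ be a $d\times d$ dilation matrix, $d_M:=|\det(M)|$, and let $\Gamma_M=\{\gamma_1,\dots,\gamma_{d_M}\}:=[M[0,1)^d]\cap\mathbb{Z}^d$ with $\gamma_1:=0$. Let $a,\tilde a\in l_0(\mathbb{Z}^d)$ be $M$-interpolatory filters with $\widehat{a}(0)=\widehat{\tilde a}(0)=1$. Suppose $n_1,n_2$ are positive integers such that $n_1+n_2=\min\{\operatorname{sr}(a,M),\operatorname{sr}(\tilde a,M)\}$. Then one can construct a dual $M$-framelet filter bank $(\{a;b_1,\dots,b_s\},\{\tilde a;\tilde b_1,\dots,\tilde b_s\})$ with $b_l,\tilde b_l\in l_0(\mathbb{Z}^d)$ such that $$b_l(Mk)=\tilde b_l(Mk)=0,\quad\forall k\in\mathbb{Z}^d\setminus\{0\},\quad l=1,\dots,s,$$ and $$\min_{1\le l\le s}\operatorname{vm}(b_l)\ge n_1,\qquad \min_{1\le l\le s}\operatorname{vm}(\tilde b_l)\ge n_2.$$ The construction is as follows. (S1) For $j=2,\dots,d_M$, define $h_j\in l_0(\mathbb{Z}^d)$ by $$\widehat{h_j}(\xi):=d_M^{-1}-d_M\overline{\widehat{a^{[\gamma_j,M]}}(\xi)}\,\widehat{\tilde a^{[\gamma_j,M]}}(\xi),\quad\xi\in\mathbb{R}^d.$$ For every $j=2,\dots,d_M$ there exist $s_j\in\mathbb{N}$ and $u_{j,t},\tilde u_{j,t}\in l_0(\mathbb{Z}^d)$, $t=1,\dots,s_j$, such that $$\widehat{h_j}(\xi)=\sum_{t=1}^{s_j}\overline{\widehat{u_{j,t}}(\xi)}\,\widehat{\tilde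 u_{j,t}}(\xi),\quad\forall\xi\in\mathbb{R}^d,$$ and $$\widehat{u_{j,t}}(\xi)=\mathcal{O}(\|\xi\|^{n_1}),\quad \widehat{\tilde u_{j,t}}(\xi)=\mathcal{O}(\|\xi\|^{n_2}),\quad\xi\to0,\quad t=1,\dots,s_j.$$ (S2) For any filters $u_{j,t},\tilde u_{j,t}$ as in (S1), define filters in $l_0(\mathbb{Z}^d)$ by $$\widehat{b_1}(\xi):=\widehat{a}(\xi)-1,\quad \widehat{\tilde b_1}(\xi):=1-\widehat{\tilde a}(\xi),$$ $$\widehat{b_j}(\xi):=d_M^{-1/2}-d_M^{1/2}e^{-i\gamma_j\cdot\xi}\widehat{a^{[\gamma_j,M]}}(M^{\mathsf T}\xi),\quad \widehat{\tilde b_j}(\xi):=d_M^{-1/2}-d_M^{1/2}e^{-i\gamma_j\cdot\xi}\widehat{\tilde a^{[\gamma_j,M]}}(M^{\mathsf T}\xi),\quad j=2,\dots,d_M,$$ $$\widehat{b_{j,t}}(\xi):=e^{-i\gamma_j\cdot\xi}\widehat{u_{j,t}}(M^{\mathsf T}\xi),\quad \widehat{\tilde b_{j,t}}(\xi):=e^{-i\gamma_j\cdot\xi}\widehat{\tilde u_{j,t}}(M^{\mathsf T}\xi),\quad t=1,\dots,s_j,\ j=2,\dots,d_M.$$ Let $b_1,\dots,b_s$ be the list consisting of $b_1,\dots,b_{d_M}$ and all $b_{j,t}$ ($t=1,\dots,s_j$, $j=2,\dots,d_M$), and let $\tilde b_1,\dots,\tilde b_s$ be the correspondingly ordered list consisting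 of $\tilde b_1,\dots,\tilde b_{d_M}$ and all $\tilde b_{j,t}$. Then $b_1,\dots,b_s,\tilde b_1,\dots,\tilde b_s$ satisfy all the claims above. Moreover, let $\phi$ and $\tilde\phi$ be the standard $M$-refinable functions of $a$ and $\tilde a$. If $\operatorname{sm}_\infty(a,M)>0$ and $\operatorname{sm}_\infty(\tilde a,M)>0$, then, defining $\psi_l,\tilde\psi_l$ by $$\widehat{\psi_l}(\xi):=\widehat{b_l}(M^{-\mathsf T}\xi)\widehat{\phi}(M^{-\mathsf T}\xi),\quad \widehat{\tilde\psi_l}(\xi):=\widehat{\tilde b_l}(M^{-\mathsf T}\xi)\widehat{\tilde\phi}(M^{-\mathsf T}\xi),\quad l=1,\dots,s,$$ the pair $(\{\phi;\psi_1,\dots,\psi_s\},\{\tilde\phi;\tilde\psi_1,\dots,\tilde\psi_s\})$ is a dual $M$-framelet in $L_2(\mathbb{R}^d)$ such that $\phi$ and $\tilde\phi$ are both fundamental, $\min_{1\le l\le s}\operatorname{vm}(\psi_l)\ge n_1$ and $\min_{1\le l\le s}\operatorname{vm}(\tilde\psi_l)\ge n_2$.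
   Context: A $d\times d$ dilation matrix is a matrix $M\in\mathbb{Z}^{d\times d}$ all of whose eigenvalues are greater than one in modulus; $d_M:=|\det M|$; $M^{-\mathsf T}:=(M^{\mathsf T})^{-1}$. $l_0(\mathbb{Z}^d)$ is the space of finitely supported sequences $u:\mathbb{Z}^d\to\mathbb{C}$ (filters), with Fourier series $\widehat u(\xi):=\sum_{k\in\mathbb{Z}^d}u(k)e^{-ik\cdot\xi}$. For $f\in L_1(\mathbb{R}^d)$, $\widehat f(\xi):=\int_{\mathbb{R}^d}f(x)e^{-ix\cdot\xi}dx$, extended to $L_2$ and tempered distributions. $\boldsymbol\delta(0)=1$ and $\boldsymbol\delta(x)=0$ for $x\neq0$. For functions smooth near $\xi_0$, $f(\xi)=g(\xi)+\mathcal{O}(\|\xi-\xi_0\|^m)$ as $\xi\to\xi_0$ means $\partial^\mu f(\xi_0)=\partial^\mu g(\xi_0)$ for all $\mu\in\mathbb{N}_0^d$ with $|\mu|<m$. $\Omega_M:=[M^{-\mathsf T}\mathbb{Z}^d]\cap[0,1)^d$. For $\gamma\in\mathbb{Z}^d$, the coset filter is $u^{[\gamma,M]}(k):=u(\gamma+Mk)$, $k\in\mathbb{Z}^d$. A filter $a$ is $M$-interpolatory if $a(Mk)=d_M^{-1}\boldsymbol\delta(k)$ for all $k\in\mathbb{Z}^d$. $\operatorname{sr}(a,M)$ (order of sum rules) is the largest $m\in\mathbb{N}_0$ such that $\widehat a(\xi+2\pi\omega)=\mathcal{O}(\|\xi\|^m)$ as $\xi\to0$ for all $\omega\in\Omega_M\setminus\{0\}$.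 For a filter $u$ (resp. a compactly supported distribution $\psi$), $\operatorname{vm}(u)$ (resp. $\operatorname{vm}(\psi)$) is the supremum of $m\in\mathbb{N}_0$ with $\widehat u(\xi)=\mathcal{O}(\|\xi\|^m)$ (resp. $\widehat\psi(\xi)=\mathcal{O}(\|\xi\|^m)$) as $\xi\to0$. $(\{a;b_1,\dots,b_s\},\{\tilde a;\tilde b_1,\dots,\tilde b_s\})$ is a dual $M$-framelet filter bank if $$\overline{\widehat a(\xi)}\,\widehat{\tilde a}(\xi+2\pi\omega)+\sum_{l=1}^s\overline{\widehat{b_l}(\xi)}\,\widehat{\tilde b_l}(\xi+2\pi\omega)=\boldsymbol\delta(\omega),\quad\xi\in\mathbb{R}^d,\ \omega\in\Omega_M.$$ The standard $M$-refinable function (distribution) $\phi$ of a filter $a$ with $\widehat a(0)=1$ is defined by $\widehat\phi(\xi):=\prod_{j=1}^\infty\widehat a((M^{\mathsf T})^{-j}\xi)$. A function $\phi$ is fundamental if it is continuous and $\phi(k)=\boldsymbol\delta(k)$ for all $k\in\mathbb{Z}^d$. Smoothness exponent: with $m:=\operatorname{sr}(a,M)$, define $a_n$ by $\widehat{a_n}(\xi):=\widehat a(\xi)\widehat a(M^{\mathsf T}\xi)\cdots\widehat a((M^{\mathsf T})^{n-1}\xi)$ and $\nabla^\mu\boldsymbol\delta$ by $\widehat{\nabla^\mu\boldsymbol\delta}(\xi)=(1-e^{-i\xi_1})^{\mu_1}\cdots(1-e^{-i\xi_d})^{\mu_d}$. Put $\rho_m(a,M)_\infty:=|\det M|\sup\{\lim_{n\to\infty}\|(\nabla^\mu\boldsymbol\delta)*a_n\|_{\ell_\infty(\mathbb{Z}^d)}^{1/n}:\mu\in\mathbb{N}_0^d,|\mu|=m\}$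 (with $*$ convolution of sequences) and $\operatorname{sm}_\infty(a,M):=-\log_{\rho(M)}(\rho_m(a,M)_\infty)$, where $\rho(M)$ is the spectral radius of $M$. Framelets: for functions $\psi_l$ put $\psi_{l;j,k}:=d_M^{j/2}\psi_l(M^j\cdot-k)$. $\{\phi;\psi_1,\dots,\psi_s\}\subset L_2(\mathbb{R}^d)$ is an $M$-framelet in $L_2(\mathbb{R}^d)$ if there are constants $C_1,C_2>0$ with $C_1\|f\|_2^2\le\sum_{k\in\mathbb{Z}^d}|\langle f,\phi(\cdot-k)\rangle|^2+\sum_{l=1}^s\sum_{j=0}^\infty\sum_{k\in\mathbb{Z}^d}|\langle f,\psi_{l;j,k}\rangle|^2\le C_2\|f\|_2^2$ for all $f\in L_2(\mathbb{R}^d)$. $(\{\phi;\psi_1,\dots,\psi_s\},\{\tilde\phi;\tilde\psi_1,\dots,\tilde\psi_s\})$ is a dual $M$-framelet in $L_2(\mathbb{R}^d)$ if both are $M$-framelets in $L_2(\mathbb{R}^d)$ and $f=\sum_{k}\langle f,\phi(\cdot-k)\rangle\tilde\phi(\cdot-k)+\sum_{l=1}^s\sum_{j=0}^\infty\sum_{k}\langle f,\psi_{l;j,k}\rangle\tilde\psi_{l;j,k}$ for all $f\in L_2(\mathbb{R}^d)$, with unconditional convergence in $L_2(\mathbb{R}^d)$. *)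

theory Defs
  imports "HOL-Analysis.Analysis" "HOL-Library.Extended_Nat"
begin

text \<open>
  The dimension \<open>d\<close> is the cardinality of the finite index type \<open>'n\<close>; lattice points are elements
  of \<^typ>\<open>int^'n\<close> and filters are finitely supported functions on the lattice.
\<close>

type_synonym 'n filt = "int^'n \<Rightarrow> complex"
type_synonym 'n cfun = "real^'n \<Rightarrow> complex"

definition rvec :: "int^'n \<Rightarrow> real^'n" where
  "rvec k = (\<chi> i. of_int (k $ i))"

definition rmat :: "int^'n^'n \<Rightarrow> real^'n^'n" where
  "rmat M = (\<chi> i j. of_int (M $ i $ j))"

definition cmat :: "int^'n^'n \<Rightarrow> complex^'n^'n" where
  "cmat M = (\<chi> i j. of_int (M $ i $ j))"

definition mat_T :: "int^'n^'n \<Rightarrow> real^'n \<Rightarrow> real^'n" where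
  "mat_T M \<xi> = transpose (rmat M) *v \<xi>"

definition mat_inv_T :: "int^'n^'n \<Rightarrow> real^'n \<Rightarrow> real^'n" where
  "mat_inv_T M \<xi> = matrix_inv (transpose (rmat M)) *v \<xi>"

definition eigenvalues :: "int^'n^'n \<Rightarrow> complex set" where
  "eigenvalues M = {z. \<exists>v. v \<noteq> 0 \<and> cmat M *v v = z *s v}"

definition dilation_matrix :: "int^'n^'n \<Rightarrow> bool" where
  "dilation_matrix M \<longleftrightarrow> (\<forall>z\<in>eigenvalues M. 1 < norm z)"

definition spec_radius :: "int^'n^'n \<Rightarrow> real" where
  "spec_radius M = (SUP z\<in>eigenvalues M. norm z)"

definition d_M :: "int^'n^'n \<Rightarrow> nat" where
  "d_M M = nat \<bar>det M\<bar>"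

definition unit_cube :: "(real^'n) set" where
  "unit_cube = {x. \<forall>i. 0 \<le> x $ i \<and> x $ i < 1}"

definition Omega_M :: "int^'n^'n \<Rightarrow> (real^'n) set" where
  "Omega_M M = range (\<lambda>k. mat_inv_T M (rvec k)) \<inter> unit_cube"

definition Gamma_M :: "int^'n^'n \<Rightarrow> (int^'n) set" where
  "Gamma_M M = {k. rvec k \<in> (\<lambda>x. rmat M *v x) ` unit_cube}"


subsection \<open>Filters and their Fourier series\<close>

definition l0 :: "('n::finite) filt set" where
  "l0 = {u. finite {k. u k \<noteq> 0}}"

definition fseries :: "('n::finite) filt \<Rightarrow> 'n cfun" where
  "fseries u \<xi> = (\<Sum>k | u k \<noteq> 0. u k * exp (- \<i> * complex_of_real (rvec k \<bullet> \<xi>)))"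

definition has_fseries :: "('n::finite) filt \<Rightarrow> 'n cfun \<Rightarrow> bool" where
  "has_fseries u F \<longleftrightarrow> u \<in> l0 \<and> (\<forall>\<xi>. fseries u \<xi> = F \<xi>)"

text \<open>The filter specified through its Fourier series; it is unique if it exists.\<close>

definition filter_of :: "('n::finite) cfun \<Rightarrow> 'n filt" where
  "filter_of F = (THE u. has_fseries u F)"

definition coset_filter :: "int^'n^'n \<Rightarrow> int^'n \<Rightarrow> 'n filt \<Rightarrow> 'n filt" where
  "coset_filter M g u k = u (g + M *v k)"

definition interpolatory :: "int^'n^'n \<Rightarrow> 'n filt \<Rightarrow> bool" where
  "interpolatory M a \<longleftrightarrow> (\<forall>k. a (M *v k) = (if k = 0 then 1 / of_nat (d_M M) else 0))"


subsection \<open>Agreement of derivatives, sum rules and vanishing moments\<close>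

definition partial :: "'n \<Rightarrow> ('n::finite) cfun \<Rightarrow> 'n cfun" where
  "partial i f x = vector_derivative (\<lambda>t. f (x + t *\<^sub>R axis i 1)) (at 0)"

text \<open>
  The partial derivative of multi-index \<open>\<mu>\<close>. The coordinates are processed in an arbitrary fixed
  order; the order is irrelevant for smooth functions, the only ones to which this is applied.
\<close>

definition mpartial :: "nat^'n \<Rightarrow> 'n cfun \<Rightarrow> 'n cfun" where
  "mpartial \<mu> = fold (\<lambda>i. partial i ^^ (\<mu> $ i)) (SOME xs. distinct xs \<and> set xs = UNIV)"

definition mdeg :: "nat^'n \<Rightarrow> nat" where
  "mdeg \<mu> = (\<Sum>i\<in>UNIV. \<mu> $ i)"

text \<open>\<open>f(\<xi>) = g(\<xi>) + O(\<parallel>\<xi> - \<xi>\<^sub>0\<parallel>^m)\<close> as \<open>\<xi> \<rightarrow> \<xi>\<^sub>0\<close>, for functions that are smooth near \<open>\<xi>\<^sub>0\<close>.\<close>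

definition agree_order :: "'n cfun \<Rightarrow> 'n cfun \<Rightarrow> real^'n \<Rightarrow> nat \<Rightarrow> bool" where
  "agree_order f g \<xi>0 m \<longleftrightarrow> (\<forall>\<mu>. mdeg \<mu> < m \<longrightarrow> mpartial \<mu> f \<xi>0 = mpartial \<mu> g \<xi>0)"

definition vanish_order :: "('n::finite) cfun \<Rightarrow> nat \<Rightarrow> bool" where
  "vanish_order f m \<longleftrightarrow> agree_order f (\<lambda>_. 0) 0 m"

definition sr :: "'n filt \<Rightarrow> int^'n^'n \<Rightarrow> nat" where
  "sr a M = (GREATEST m. \<forall>\<omega>\<in>Omega_M M - {0}. vanish_order (\<lambda>\<xi>. fseries a (\<xi> + (2 * pi) *\<^sub>R \<omega>)) m)"

definition vm_filt :: "('n::finite) filt \<Rightarrow> enat" where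
  "vm_filt u = (SUP m\<in>{m. vanish_order (fseries u) m}. enat m)"


subsection \<open>Dual framelet filter banks\<close>

definition dual_filter_bank ::
  "int^'n^'n \<Rightarrow> 'n filt \<Rightarrow> 'n filt list \<Rightarrow> 'n filt \<Rightarrow> 'n filt list \<Rightarrow> bool" where
  "dual_filter_bank M a bs a' bs' \<longleftrightarrow> length bs = length bs' \<and>
     (\<forall>\<xi>. \<forall>\<omega>\<in>Omega_M M.
        cnj (fseries a \<xi>) * fseries a' (\<xi> + (2 * pi) *\<^sub>R \<omega>)
        + (\<Sum>l<length bs. cnj (fseries (bs ! l) \<xi>) * fseries (bs' ! l) (\<xi> + (2 * pi) *\<^sub>R \<omega>))
        = (if \<omega> = 0 then 1 else 0))"

definition filter_bank_claims ::
  "int^'n^'n \<Rightarrow> 'n filt \<Rightarrow> 'n filt \<Rightarrow> nat \<Rightarrow> nat \<Rightarrow> 'n filt list \<Rightarrow> 'n filt list \<Rightarrow> bool" where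
  "filter_bank_claims M a a' n1 n2 bs bs' \<longleftrightarrow>
     set bs \<subseteq> l0 \<and> set bs' \<subseteq> l0 \<and> bs \<noteq> [] \<and>
     dual_filter_bank M a bs a' bs' \<and>
     (\<forall>b\<in>set bs \<union> set bs'. \<forall>k. k \<noteq> 0 \<longrightarrow> b (M *v k) = 0) \<and>
     enat n1 \<le> Min (vm_filt ` set bs) \<and>
     enat n2 \<le> Min (vm_filt ` set bs')"


subsection \<open>The construction\<close>

definition h_series :: "int^'n^'n \<Rightarrow> 'n filt \<Rightarrow> 'n filt \<Rightarrow> int^'n \<Rightarrow> 'n cfun" where
  "h_series M a a' g \<xi> = 1 / of_nat (d_M M)
     - of_nat (d_M M) * cnj (fseries (coset_filter M g a) \<xi>) * fseries (coset_filter M g a') \<xi>"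

definition h_filter :: "int^'n^'n \<Rightarrow> 'n filt \<Rightarrow> 'n filt \<Rightarrow> int^'n \<Rightarrow> 'n filt" where
  "h_filter M a a' g = filter_of (h_series M a a' g)"

definition h_factorization ::
  "('n::finite) filt \<Rightarrow> nat \<Rightarrow> nat \<Rightarrow> nat \<Rightarrow> (nat \<Rightarrow> 'n filt) \<Rightarrow> (nat \<Rightarrow> 'n filt) \<Rightarrow> bool" where
  "h_factorization h n1 n2 s u u' \<longleftrightarrow> 1 \<le> s \<and>
     (\<forall>t\<in>{1..s}. u t \<in> l0 \<and> u' t \<in> l0) \<and>
     (\<forall>\<xi>. fseries h \<xi> = (\<Sum>t=1..s. cnj (fseries (u t) \<xi>) * fseries (u' t) \<xi>)) \<and>
     (\<forall>t\<in>{1..s}. vanish_order (fseries (u t)) n1 \<and> vanish_order (fseries (u' t)) n2)"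

text \<open>
  The Fourier series of \<open>b\<^sub>j\<close> for \<open>2 \<le> j \<le> d\<^sub>M\<close>, followed by those of all \<open>b\<^sub>j\<^sub>,\<^sub>t\<close>; the dual filters have
  the same shape.
\<close>

definition coset_series ::
  "int^'n^'n \<Rightarrow> (nat \<Rightarrow> int^'n) \<Rightarrow> 'n filt \<Rightarrow> (nat \<Rightarrow> nat) \<Rightarrow> (nat \<Rightarrow> nat \<Rightarrow> 'n filt) \<Rightarrow> 'n cfun list" where
  "coset_series M \<gamma> a s u =
     map (\<lambda>j \<xi>. complex_of_real (real (d_M M) powr (-1/2))
            - complex_of_real (real (d_M M) powr (1/2)) * exp (- \<i> * complex_of_real (rvec (\<gamma> j) \<bullet> \<xi>))
              * fseries (coset_filter M (\<gamma> j) a) (mat_T M \<xi>))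
         [2..<Suc (d_M M)]
     @ concat (map (\<lambda>j. map (\<lambda>t \<xi>. exp (- \<i> * complex_of_real (rvec (\<gamma> j) \<bullet> \<xi>))
                                    * fseries (u j t) (mat_T M \<xi>))
                             [1..<Suc (s j)])
                    [2..<Suc (d_M M)])"

definition b_series ::
  "int^'n^'n \<Rightarrow> (nat \<Rightarrow> int^'n) \<Rightarrow> 'n filt \<Rightarrow> (nat \<Rightarrow> nat) \<Rightarrow> (nat \<Rightarrow> nat \<Rightarrow> 'n filt) \<Rightarrow> 'n cfun list" where
  "b_series M \<gamma> a s u = (\<lambda>\<xi>. fseries a \<xi> - 1) # coset_series M \<gamma> a s u"

definition b_dual_series ::
  "int^'n^'n \<Rightarrow> (nat \<Rightarrow> int^'n) \<Rightarrow> 'n filt \<Rightarrow> (nat \<Rightarrow> nat) \<Rightarrow> (nat \<Rightarrow> nat \<Rightarrow> 'n filt) \<Rightarrow> 'n cfun list" where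
  "b_dual_series M \<gamma> a' s u' = (\<lambda>\<xi>. 1 - fseries a' \<xi>) # coset_series M \<gamma> a' s u'"


subsection \<open>Smoothness exponent\<close>

definition conv :: "('n::finite) filt \<Rightarrow> 'n filt \<Rightarrow> 'n filt" where
  "conv u v k = (\<Sum>j | u j \<noteq> 0. u j * v (k - j))"

definition linf_norm :: "('n::finite) filt \<Rightarrow> real" where
  "linf_norm u = (SUP k. norm (u k))"

definition iter_filter :: "'n filt \<Rightarrow> int^'n^'n \<Rightarrow> nat \<Rightarrow> 'n filt" where
  "iter_filter a M n = filter_of (\<lambda>\<xi>. \<Prod>i<n. fseries a ((mat_T M ^^ i) \<xi>))"

definition nabla_delta :: "nat^'n \<Rightarrow> 'n filt" where
  "nabla_delta \<mu> = filter_of (\<lambda>\<xi>. \<Prod>i\<in>UNIV. (1 - exp (- \<i> * complex_of_real (\<xi> $ i))) ^ (\<mu> $ i))"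

definition rho_inf :: "nat \<Rightarrow> 'n filt \<Rightarrow> int^'n^'n \<Rightarrow> real" where
  "rho_inf m a M = real (d_M M) *
     (SUP \<mu>\<in>{\<mu>. mdeg \<mu> = m}.
        lim (\<lambda>n. linf_norm (conv (nabla_delta \<mu>) (iter_filter a M n)) powr (1 / real n)))"

text \<open>Extended real valued, so that \<open>\<rho> = 0\<close> yields \<open>\<infinity>\<close> instead of the junk value of \<^const>\<open>log\<close> at 0.\<close>

definition sm_inf :: "'n filt \<Rightarrow> int^'n^'n \<Rightarrow> ereal" where
  "sm_inf a M = (let \<rho> = rho_inf (sr a M) a M in
     if \<rho> = 0 then \<infinity> else ereal (- log (spec_radius M) \<rho>))"


subsection \<open>Functions, refinable functions and framelets\<close>

definition fourier :: "('n::finite) cfun \<Rightarrow> 'n cfun" where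
  "fourier f \<xi> = (\<integral>x. f x * exp (- \<i> * complex_of_real (x \<bullet> \<xi>)) \<partial>lborel)"

text \<open>
  The function \<open>f\<close> is integrable with Fourier transform \<open>F\<close>. Since \<open>F\<close> determines \<open>f\<close> up to a null
  set, this says that the tempered distribution with Fourier transform \<open>F\<close> is (represented by) the
  function \<open>f\<close>.
\<close>

definition has_fourier :: "('n::finite) cfun \<Rightarrow> 'n cfun \<Rightarrow> bool" where
  "has_fourier f F \<longleftrightarrow> integrable lborel f \<and> (\<forall>\<xi>. fourier f \<xi> = F \<xi>)"

definition refinable_fourier :: "int^'n^'n \<Rightarrow> 'n filt \<Rightarrow> 'n cfun" where
  "refinable_fourier M a \<xi> = prodinf (\<lambda>j. fseries a ((mat_inv_T M ^^ Suc j) \<xi>))"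

definition standard_refinable :: "int^'n^'n \<Rightarrow> 'n filt \<Rightarrow> 'n cfun \<Rightarrow> bool" where
  "standard_refinable M a \<phi> \<longleftrightarrow> has_fourier \<phi> (refinable_fourier M a)"

definition fundamental :: "('n::finite) cfun \<Rightarrow> bool" where
  "fundamental \<phi> \<longleftrightarrow> continuous_on UNIV \<phi> \<and> (\<forall>k. \<phi> (rvec k) = (if k = 0 then 1 else 0))"

definition compactly_supported :: "('n::finite) cfun \<Rightarrow> bool" where
  "compactly_supported f \<longleftrightarrow> compact (closure {x. f x \<noteq> 0})"

definition vm_fun :: "('n::finite) cfun \<Rightarrow> enat" where
  "vm_fun \<psi> = (SUP m\<in>{m. vanish_order (fourier \<psi>) m}. enat m)"

definition wavelet_series :: "int^'n^'n \<Rightarrow> 'n cfun \<Rightarrow> 'n filt \<Rightarrow> 'n cfun" where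
  "wavelet_series M \<phi> b \<xi> = fseries b (mat_inv_T M \<xi>) * fourier \<phi> (mat_inv_T M \<xi>)"

definition L2 :: "('n::finite) cfun set" where
  "L2 = {f. f \<in> borel_measurable lborel \<and> integrable lborel (\<lambda>x. (norm (f x))\<^sup>2)}"

definition L2_norm :: "('n::finite) cfun \<Rightarrow> real" where
  "L2_norm f = sqrt (\<integral>x. (norm (f x))\<^sup>2 \<partial>lborel)"

definition L2_inner :: "('n::finite) cfun \<Rightarrow> 'n cfun \<Rightarrow> complex" where
  "L2_inner f g = (\<integral>x. f x * cnj (g x) \<partial>lborel)"

definition shift :: "'n cfun \<Rightarrow> int^'n \<Rightarrow> 'n cfun" where
  "shift f k x = f (x - rvec k)"

definition dilate_shift :: "int^'n^'n \<Rightarrow> 'n cfun \<Rightarrow> nat \<Rightarrow> int^'n \<Rightarrow> 'n cfun" where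
  "dilate_shift M f j k x =
     complex_of_real (real (d_M M) powr (real j / 2)) * f (((\<lambda>y. rmat M *v y) ^^ j) x - rvec k)"

text \<open>The sums of squares are taken in \<^typ>\<open>ennreal\<close>, where they always exist.\<close>

definition framelet :: "int^'n^'n \<Rightarrow> 'n cfun \<Rightarrow> 'n cfun list \<Rightarrow> bool" where
  "framelet M \<phi> \<psi>s \<longleftrightarrow> \<phi> \<in> L2 \<and> set \<psi>s \<subseteq> L2 \<and>
     (\<exists>C1 C2 :: real. 0 < C1 \<and> 0 < C2 \<and> (\<forall>f\<in>L2.
        let S = (\<Sum>\<^sub>\<infinity>k\<in>UNIV. ennreal ((norm (L2_inner f (shift \<phi> k)))\<^sup>2))
              + (\<Sum>l<length \<psi>s. \<Sum>\<^sub>\<infinity>j\<in>UNIV. \<Sum>\<^sub>\<infinity>k\<in>UNIV.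
                   ennreal ((norm (L2_inner f (dilate_shift M (\<psi>s ! l) j k)))\<^sup>2))
        in ennreal (C1 * (L2_norm f)\<^sup>2) \<le> S \<and> S \<le> ennreal (C2 * (L2_norm f)\<^sup>2)))"

fun framelet_elem ::
  "int^'n^'n \<Rightarrow> 'n cfun \<Rightarrow> 'n cfun list \<Rightarrow> (int^'n) + nat \<times> nat \<times> (int^'n) \<Rightarrow> 'n cfun" where
  "framelet_elem M \<phi> \<psi>s (Inl k) = shift \<phi> k"
| "framelet_elem M \<phi> \<psi>s (Inr (l, j, k)) = dilate_shift M (\<psi>s ! l) j k"

text \<open>
  Unconditional convergence of the expansion of \<open>f\<close> is convergence, in the norm of \<open>L\<^sub>2\<close>, of the net
  of its finite partial sums.
\<close>

definition dual_framelet ::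
  "int^'n^'n \<Rightarrow> 'n cfun \<Rightarrow> 'n cfun list \<Rightarrow> 'n cfun \<Rightarrow> 'n cfun list \<Rightarrow> bool" where
  "dual_framelet M \<phi> \<psi>s \<phi>' \<psi>s' \<longleftrightarrow>
     length \<psi>s = length \<psi>s' \<and> framelet M \<phi> \<psi>s \<and> framelet M \<phi>' \<psi>s' \<and>
     (\<forall>f\<in>L2.
        ((\<lambda>I. L2_norm (\<lambda>x. f x - (\<Sum>i\<in>I. L2_inner f (framelet_elem M \<phi> \<psi>s i)
                                           * framelet_elem M \<phi>' \<psi>s' i x))) \<longlongrightarrow> 0)
        (finite_subsets_at_top (UNIV <+> {..<length \<psi>s} \<times> UNIV \<times> UNIV)))"

end

theory Submission
  imports Defs "HOL-Computational_Algebra.Fundamental_Theorem_Algebra"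
begin

text \<open>
  Since \<open>a\<close> is interpolatory, the sum rules determine the moments of every coset filter: they are those of a
  point mass up to the order \<open>n\<^sub>1 + n\<^sub>2\<close>. Hence \<open>h\<^sub>j\<close> has vanishing moments of order \<open>n\<^sub>1 + n\<^sub>2\<close>, that is, it lies in
  the corresponding power of the ideal generated by the first differences, and splitting the differences of
  each term gives the factorization. The identities of the filter bank follow by comparing coset
  components.

  The condition on the smoothness exponent gives geometric decay of high order differences of
  \<open>d\<^sub>M\<^sup>n a\<^sub>n\<close>. A discrete Landau inequality turns this into decay of the first differences, so that the
  subdivision scheme converges to a refinable function \<open>\<phi>\<close> with a modulus of continuity on the scale of \<open>M\<^sup>-\<^sup>n\<close>.
  This regularity and the vanishing mean of the \<open>\<psi>\<^sub>l\<close> bound their Gram matrix, and Schur's test yields Bessel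
  bounds. The filter bank identity makes the sum over the levels below \<open>J\<close> telescope to a quasi-projection at
  level \<open>J\<close>, which tends to the identity because the shifts of the dual refinable function form a partition of
  unity. With the Bessel bounds this weak expansion becomes unconditional in \<open>L\<^sub>2\<close> and gives the lower frame
  bounds by duality.
\<close>

section \<open>Powers of the inverse of a dilation matrix\<close>

definition polact :: "complex^'n^'n \<Rightarrow> complex poly \<Rightarrow> complex^'n \<Rightarrow> complex^'n" where
  "polact B p v = (\<Sum>i\<le>degree p. coeff p i *s ((\<lambda>x. B *v x) ^^ i) v)"

lemma polact_ge:
  assumes "degree p \<le> N"
  shows "polact B p v = (\<Sum>i\<le>N. coeff p i *s ((\<lambda>x. B *v x) ^^ i) v)"
  unfolding polact_def
  by (rule sum.mono_neutral_left) (use assms in \<open>auto simp: coeff_eq_0\<close>)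

lemma mv_sum: "B *v (\<Sum>i\<in>I. f i) = (\<Sum>i\<in>I. B *v (f i :: 'a::comm_ring_1^'n))"
  by (induction I rule: infinite_finite_induct) (auto simp: matrix_vector_right_distrib)

lemma funpow_mv_add:
  fixes B :: "'a::comm_ring_1^'n^'n"
  shows "((\<lambda>x. B *v x) ^^ i) (v + w) = ((\<lambda>x. B *v x) ^^ i) v + ((\<lambda>x. B *v x) ^^ i) w"
  by (induction i) (auto simp: matrix_vector_right_distrib)

lemma funpow_mv_scale:
  fixes B :: "'a::field^'n^'n"
  shows "((\<lambda>x. B *v x) ^^ i) (c *s v) = c *s ((\<lambda>x. B *v x) ^^ i) v"
  by (induction i) (auto simp: vector_scalar_commute)

lemma polact_root_factor:
  "polact B ([:- l, 1:] * q) v = polact B q (B *v v - l *s v)"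
proof -
  let ?P = "\<lambda>i. ((\<lambda>x. B *v x) ^^ i)"
  let ?N = "Suc (degree q)"
  have deg: "degree ([:- l, 1:] * q) \<le> ?N"
    by (rule order_trans[OF degree_mult_le]) auto
  have co: "coeff ([:- l, 1:] * q) i = - l * coeff q i + (case i of 0 \<Rightarrow> 0 | Suc j \<Rightarrow> coeff q j)" for i
    by (auto simp: coeff_pCons split: nat.split)
  have "polact B ([:- l, 1:] * q) v
      = (\<Sum>i\<le>?N. (- l * coeff q i) *s ?P i v + (case i of 0 \<Rightarrow> 0 | Suc j \<Rightarrow> coeff q j) *s ?P i v)"
    unfolding polact_ge[OF deg] co vector_sadd_rdistrib ..
  also have "\<dots> = (\<Sum>i\<le>?N. (- l * coeff q i) *s ?P i v) + (\<Sum>i\<le>?N. (case i of 0 \<Rightarrow> 0 | Suc j \<Rightarrow> coeff q j) *s ?P i v)"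
    by (rule sum.distrib)
  also have "(\<Sum>i\<le>?N. (case i of 0 \<Rightarrow> 0 | Suc j \<Rightarrow> coeff q j) *s ?P i v)
      = (\<Sum>i\<le>degree q. coeff q i *s ?P i (B *v v))"
    by (subst sum.atMost_Suc_shift) (simp add: funpow_swap1)
  also have "(\<Sum>i\<le>?N. (- l * coeff q i) *s ?P i v) = (\<Sum>i\<le>degree q. (- l * coeff q i) *s ?P i v)"
    by (simp add: coeff_eq_0)
  also have "\<dots> + (\<Sum>i\<le>degree q. coeff q i *s ?P i (B *v v))
      = (\<Sum>i\<le>degree q. coeff q i *s ?P i (B *v v + (-l) *s v))"
    unfolding sum.distrib[symmetric] funpow_mv_add funpow_mv_scale
    by (intro sum.cong refl) (simp add: vector_add_ldistrib mult.commute)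
  finally show ?thesis by (simp add: polact_def)
qed

lemma polact_commute: "polact B q (B *v v - l *s v) = B *v polact B q v - l *s polact B q v"
proof -
  have "B *v v - l *s v = B *v v + (- l) *s v" by simp
  hence "polact B q (B *v v - l *s v) = (\<Sum>i\<le>degree q. coeff q i *s ((\<lambda>x. B *v x) ^^ i) (B *v v + (-l) *s v))"
    by (simp only: polact_def)
  also have "\<dots> = (\<Sum>i\<le>degree q. coeff q i *s (B *v (((\<lambda>x. B *v x) ^^ i) v)) 
       - l *s (coeff q i *s (((\<lambda>x. B *v x) ^^ i) v)))"
    by (intro sum.cong refl, subst funpow_mv_add, subst funpow_mv_scale)
       (simp add: funpow_swap1 vector_add_ldistrib mult.commute)
  also have "\<dots> = B *v polact B q v - l *s polact B q v"
    by (simp add: polact_def sum_subtractf mv_sum vector_scalar_commute vec.scale_sum_right)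
  finally show ?thesis .
qed

lemma geometric_recursion:
  fixes x :: "nat \<Rightarrow> 'a::real_normed_vector"
  assumes step: "\<And>n. norm (x (Suc n)) \<le> l * norm (x n) + C * \<rho> ^ n" and l: "0 \<le> l" "l < \<rho>" and C: "0 \<le> C"
  shows "\<exists>D. \<forall>n. norm (x n) \<le> D * \<rho> ^ n"
proof -
  define D where "D = max (norm (x 0)) (C / (\<rho> - l))"
  have D: "C \<le> D * (\<rho> - l)" 
    using l by (simp add: D_def field_simps max_def pos_divide_le_eq split: if_splits)
  have "norm (x n) \<le> D * \<rho> ^ n" for n
  proof (induction n)
    case 0 show ?case by (simp add: D_def)
  next
    case (Suc n)
    have "norm (x (Suc n)) \<le> l * (D * \<rho> ^ n) + C * \<rho> ^ n"
      using step[of n] mult_left_mono[OF Suc l(1)] by linarith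
    also have "\<dots> \<le> l * (D * \<rho> ^ n) + (D * (\<rho> - l)) * \<rho> ^ n"
      using D l by (intro add_left_mono mult_right_mono) auto
    also have "\<dots> = D * \<rho> ^ Suc n" by (simp add: algebra_simps)
    finally show ?case .
  qed
  thus ?thesis by blast
qed

lemma norm_vector_scalar: "norm (c *s (v :: complex^'n)) = norm c * norm v"
  by (simp add: norm_vec_def L2_set_right_distrib norm_mult)

lemma power_decay_annihilated:
  fixes B :: "complex^'n^'n"
  assumes eig: "\<And>z w. w \<noteq> 0 \<Longrightarrow> B *v w = z *s w \<Longrightarrow> norm z < 1"
  shows "p \<noteq> 0 \<Longrightarrow> polact B p v = 0 \<Longrightarrow> \<exists>C \<rho>. 0 < \<rho> \<and> \<rho> < 1 \<and> (\<forall>n. norm (((\<lambda>x. B *v x) ^^ n) v) \<le> C * \<rho> ^ n)"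
proof (induction "degree p" arbitrary: p v)
  case 0
  then obtain c where "p = [:c:]" "c \<noteq> 0" by (metis degree_eq_zeroE pCons_0_0)
  with 0 have "v = 0" by (simp add: polact_def vector_mul_eq_0)
  have "((\<lambda>x. B *v x) ^^ n) 0 = 0" for n by (induction n) auto
  thus ?case using \<open>v = 0\<close> by (intro exI[of _ 0] exI[of _ "1/2"]) auto
next
  case (Suc d)
  from Suc have "\<not> constant (poly p)" by (simp add: constant_degree)
  from fundamental_theorem_of_algebra[OF this] obtain l where "poly p l = 0" by blast
  then obtain q where q: "p = [:- l, 1:] * q" by (auto simp: poly_eq_0_iff_dvd elim: dvdE)
  have q0: "q \<noteq> 0" using q Suc by auto
  have "degree p = Suc (degree q)" unfolding q using q0 by (subst degree_mult_eq) auto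
    with Suc(2) have degq: "d = degree q" by simp
  show ?case
  proof (cases "polact B q v = 0")
    case True thus ?thesis using Suc(1)[OF degq q0] by blast
  next
    case False
    have "polact B q (B *v v - l *s v) = 0" using Suc(4) unfolding q polact_root_factor .
    hence "B *v polact B q v = l *s polact B q v" unfolding polact_commute by simp
    hence l: "norm l < 1" using eig False by blast
    from Suc(1)[OF degq q0 \<open>polact B q (B *v v - l *s v) = 0\<close>] obtain C \<rho> where
      C: "0 < \<rho>" "\<rho> < 1" "\<And>n. norm (((\<lambda>x. B *v x) ^^ n) (B *v v - l *s v)) \<le> C * \<rho> ^ n" by blast
    have C0: "0 \<le> C" using order_trans[OF norm_ge_zero C(3)[of 0]] by simp
    define r where "r = max \<rho> ((1 + norm l) / 2)"
    have r: "\<rho> \<le> r" "norm l < r" "r < 1" "0 < r" using l C by (auto simp: r_def less_max_iff_disj)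
    have "norm (((\<lambda>x. B *v x) ^^ Suc n) v) \<le> norm l * norm (((\<lambda>x. B *v x) ^^ n) v) + C * r ^ n" for n
    proof -
      have "((\<lambda>x. B *v x) ^^ Suc n) v = ((\<lambda>x. B *v x) ^^ n) (l *s v + (B *v v - l *s v))"
        by (simp add: funpow_swap1)
      also have "\<dots> = l *s ((\<lambda>x. B *v x) ^^ n) v + ((\<lambda>x. B *v x) ^^ n) (B *v v - l *s v)"
        by (subst funpow_mv_add) (simp only: funpow_mv_scale)
      finally have "norm (((\<lambda>x. B *v x) ^^ Suc n) v)
          \<le> norm (l *s ((\<lambda>x. B *v x) ^^ n) v) + norm (((\<lambda>x. B *v x) ^^ n) (B *v v - l *s v))"
        by (simp only: norm_triangle_ineq)
      also have "\<dots> \<le> norm l * norm (((\<lambda>x. B *v x) ^^ n) v) + C * \<rho> ^ n"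
        unfolding norm_vector_scalar using C(3)[of n] by simp
      also have "C * \<rho> ^ n \<le> C * r ^ n" using C0 C(1) r by (intro mult_left_mono power_mono) auto
      finally show ?thesis by simp
    qed
    hence "\<exists>D. \<forall>n. norm (((\<lambda>x. B *v x) ^^ n) v) \<le> D * r ^ n"
      by (rule geometric_recursion) (use r C0 in auto)
    thus ?thesis using r by blast
  qed
qed

lemma annihilating_poly_exists:
  fixes B :: "complex^'n^'n"
  shows "\<exists>p. p \<noteq> 0 \<and> polact B p v = 0"
proof -
  let ?x = "\<lambda>i. ((\<lambda>x. B *v x) ^^ i) v"
  define N where "N = DIM(complex^'n)"
  show ?thesis
  proof (cases "inj_on ?x {..N}")
    case False
    then obtain i j where ij: "i < j" "?x i = ?x j" 
      unfolding inj_on_def by (metis linorder_neqE_nat)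
    define p where "p = monom (1::complex) i - monom 1 j"
    have "coeff p i = 1" using ij by (simp add: p_def)
    hence "p \<noteq> 0" by auto
    have deg: "degree p \<le> j" unfolding p_def using ij
      by (intro degree_diff_le) (auto simp: degree_monom_eq)
    have "polact B p v = (\<Sum>k\<le>j. (if k = i then ?x k else 0) - (if k = j then ?x k else 0))"
      unfolding polact_ge[OF deg] by (intro sum.cong refl) (use ij in \<open>auto simp: p_def\<close>)
    also have "\<dots> = 0" using ij by (simp add: sum_subtractf)
    finally show ?thesis using \<open>p \<noteq> 0\<close> by blast
  next
    case True
    have "card (?x ` {..N}) = Suc N" using card_image[OF True] by simp
    hence "dependent (?x ` {..N})" by (intro dependent_biggerset) (auto simp: N_def)
    then obtain u where u: "\<exists>y\<in>?x ` {..N}. u y \<noteq> 0" "(\<Sum>y\<in>?x ` {..N}. u y *\<^sub>R y) = 0"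
      by (auto simp: dependent_finite)
    define p where "p = (\<Sum>i\<le>N. monom (complex_of_real (u (?x i))) i)"
    have co: "coeff p i = (if i \<le> N then complex_of_real (u (?x i)) else 0)" for i
      by (simp add: p_def coeff_sum)
    have "p \<noteq> 0"
    proof
      assume "p = 0"
      hence "\<forall>i\<le>N. u (?x i) = 0" using co by (metis coeff_0 of_real_eq_0_iff)
      thus False using u(1) by auto
    qed
    have deg: "degree p \<le> N" by (rule degree_le) (simp add: co)
    have sc: "complex_of_real c *s w = c *\<^sub>R w" for c and w :: "complex^'n"
      unfolding vec_eq_iff vector_smult_component vector_scaleR_component by (simp add: scaleR_conv_of_real)
    have "polact B p v = (\<Sum>i\<le>N. u (?x i) *\<^sub>R ?x i)"
      unfolding polact_ge[OF deg] by (intro sum.cong refl) (simp add: co sc)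
    also have "\<dots> = 0" using u(2) sum.reindex[OF True, of "\<lambda>y. u y *\<^sub>R y"] by (simp add: o_def)
    finally show ?thesis using \<open>p \<noteq> 0\<close> by blast
  qed
qed

definition cvec :: "real^'n \<Rightarrow> complex^'n" where "cvec x = (\<chi> i. complex_of_real (x $ i))"

lemma norm_cvec [simp]: "norm (cvec x) = norm x"
  by (simp add: cvec_def norm_vec_def)

lemma cvec_eq_0 [simp]: "cvec x = 0 \<longleftrightarrow> x = 0"
  by (simp add: cvec_def vec_eq_iff)

lemma matrix_inv_cancel:
  fixes A :: "real^'n^'n"
  assumes "invertible A"
  shows "A ** matrix_inv A = mat 1" "matrix_inv A ** A = mat 1"
proof -
  have "\<exists>A'. A ** A' = mat 1 \<and> A' ** A = mat 1" using assms unfolding invertible_def by blast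
  from someI_ex[OF this] show "A ** matrix_inv A = mat 1" "matrix_inv A ** A = mat 1"
    unfolding matrix_inv_def by auto
qed

lemma cmat_cvec: "cmat M *v cvec x = cvec (rmat M *v x)"
  by (simp add: cmat_def cvec_def rmat_def matrix_vector_mult_def vec_eq_iff)

lemma dilation_invertible:
  assumes "dilation_matrix M"
  shows "invertible (rmat M)"
proof -
  have "x = 0" if "rmat M *v x = 0" for x
  proof (rule ccontr)
    assume "x \<noteq> 0"
    have "cmat M *v cvec x = 0 *s cvec x" using that by (simp add: cmat_cvec)
    hence "0 \<in> eigenvalues M" using \<open>x \<noteq> 0\<close> cvec_eq_0[of x] unfolding eigenvalues_def mem_Collect_eq by blast
    thus False using assms unfolding dilation_matrix_def by force
  qed
  thus ?thesis
    by (metis (no_types) invertible_left_inverse matrix_left_invertible_ker)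
qed

lemma matrix_inv_decay:
  fixes M :: "int^'n^'n"
  assumes "dilation_matrix M"
  shows "\<exists>C \<rho>. 0 < \<rho> \<and> \<rho> < 1 \<and> 0 < C \<and> (\<forall>n x. norm (((\<lambda>x. matrix_inv (rmat M) *v x) ^^ n) x) \<le> C * \<rho> ^ n * norm x)"
proof -
  define R where "R = matrix_inv (rmat M)"
  have inv: "rmat M ** R = mat 1" using matrix_inv_cancel[OF dilation_invertible[OF assms]] by (simp add: R_def)
  define B where "B = (\<chi> i j. complex_of_real (R $ i $ j))"
  have MB: "cmat M *v (B *v w) = w" for w
  proof -
    have "(cmat M ** B) $ i $ j = (mat 1 :: complex^'n^'n) $ i $ j" for i j
    proof -
      have "(cmat M ** B) $ i $ j = complex_of_real ((rmat M ** R) $ i $ j)"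
        by (simp add: matrix_matrix_mult_def cmat_def B_def rmat_def)
      thus ?thesis by (simp add: inv mat_def)
    qed
    hence "cmat M ** B = mat 1" by (simp add: vec_eq_iff)
    thus ?thesis by (simp add: matrix_vector_mul_assoc)
  qed
  have eig: "norm z < 1" if "w \<noteq> 0" "B *v w = z *s w" for z w
  proof -
    have "w = z *s (cmat M *v w)" using MB[of w] that by (simp add: vector_scalar_commute)
    moreover from this have "z \<noteq> 0" using that by auto
    ultimately have "cmat M *v w = inverse z *s w"
      by (metis (no_types, lifting) left_inverse vector_smult_assoc vector_smult_lid)
    hence "1 < norm (inverse z)" using assms that unfolding dilation_matrix_def eigenvalues_def by blast
    thus ?thesis using \<open>z \<noteq> 0\<close> by (metis norm_inverse one_less_inverse_iff)
  qed
  have Bc: "((\<lambda>x. B *v x) ^^ n) (cvec x) = cvec (((\<lambda>x. R *v x) ^^ n) x)" for n x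
    by (induction n) (auto simp: B_def cvec_def matrix_vector_mult_def vec_eq_iff)
  have "\<exists>C \<rho>. 0 < \<rho> \<and> \<rho> < 1 \<and> (\<forall>n. norm (((\<lambda>x. R *v x) ^^ n) x) \<le> C * \<rho> ^ n)" for x
  proof -
    obtain p where p: "p \<noteq> 0" "polact B p (cvec x) = 0" using annihilating_poly_exists[of B "cvec x"] by blast
    have "\<exists>C \<rho>. 0 < \<rho> \<and> \<rho> < 1 \<and> (\<forall>n. norm (((\<lambda>x. B *v x) ^^ n) (cvec x)) \<le> C * \<rho> ^ n)"
      by (rule power_decay_annihilated[OF _ p]) (rule eig)
    thus ?thesis unfolding Bc norm_cvec .
  qed
  then obtain C \<rho> where C: "\<And>x. 0 < \<rho> x" "\<And>x. \<rho> x < 1" 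
    "\<And>x n. norm (((\<lambda>x. R *v x) ^^ n) x) \<le> C x * \<rho> x ^ n" by metis
  define r where "r = Max (range (\<lambda>i::'n. \<rho> (axis i 1)))"
  have rge: "\<rho> (axis i 1) \<le> r" for i by (simp add: r_def)
  have "r \<in> range (\<lambda>i::'n. \<rho> (axis i 1))" unfolding r_def by (rule Max_in) auto
  hence r: "0 < r" "r < 1" using C by auto
  define D where "D = 1 + (\<Sum>i::'n\<in>UNIV. \<bar>C (axis i 1)\<bar>)"
  have "norm (((\<lambda>x. R *v x) ^^ n) x) \<le> D * r ^ n * norm x" for n x
  proof -
    have lin: "linear ((\<lambda>x. R *v x) ^^ n)"
    proof (induction n)
      case (Suc n)
      show ?case using linear_compose[OF Suc matrix_vector_mul_linear[of R]] by (simp add: o_def)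
    qed (simp add: linear_ident)
    have "((\<lambda>x. R *v x) ^^ n) x = ((\<lambda>x. R *v x) ^^ n) (\<Sum>i\<in>UNIV. x $ i *\<^sub>R axis i 1)"
      using basis_expansion[of x] by (simp add: scalar_mult_eq_scaleR)
    also have "\<dots> = (\<Sum>i\<in>UNIV. x $ i *\<^sub>R ((\<lambda>x. R *v x) ^^ n) (axis i 1))"
      by (simp add: linear_sum[OF lin] linear_scale[OF lin])
    finally have "norm (((\<lambda>x. R *v x) ^^ n) x) \<le> (\<Sum>i\<in>UNIV. norm (x $ i *\<^sub>R ((\<lambda>x. R *v x) ^^ n) (axis i 1)))"
      by (simp only: norm_sum)
    also have "\<dots> \<le> (\<Sum>i\<in>UNIV. norm x * (\<bar>C (axis i 1)\<bar> * r ^ n))"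
    proof (rule sum_mono)
      fix i :: 'n
      have "norm (((\<lambda>x. R *v x) ^^ n) (axis i 1)) \<le> C (axis i 1) * \<rho> (axis i 1) ^ n" by (rule C)
      also have "\<dots> \<le> \<bar>C (axis i 1)\<bar> * r ^ n"
        using C(1)[of "axis i 1"] rge[of i] by (intro mult_mono power_mono) auto
      finally show "norm (x $ i *\<^sub>R ((\<lambda>x. R *v x) ^^ n) (axis i 1)) \<le> norm x * (\<bar>C (axis i 1)\<bar> * r ^ n)"
        by (simp add: mult_mono component_le_norm_cart)
    qed
    also have "\<dots> = (D - 1) * r ^ n * norm x"
      by (simp add: D_def sum_distrib_left sum_distrib_right algebra_simps)
    also have "\<dots> \<le> D * r ^ n * norm x" using r by (intro mult_right_mono) auto
    finally show ?thesis .
  qed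
  moreover have "0 < D" unfolding D_def by (smt (verit) sum_nonneg abs_ge_zero)
  ultimately show ?thesis using r unfolding R_def by blast
qed

section \<open>The algebra of filters\<close>

lemma rvec_0 [simp]: "rvec 0 = 0"
  by (simp add: rvec_def vec_eq_iff)

lemma rvec_add: "rvec (j + k) = rvec j + rvec k"
  by (simp add: rvec_def vec_eq_iff)

lemma rvec_diff: "rvec (j - k) = rvec j - rvec k"
  by (simp add: rvec_def vec_eq_iff)

lemma rvec_minus: "rvec (- k) = - rvec k"
  by (simp add: rvec_def vec_eq_iff)

lemma rvec_component [simp]: "rvec k $ i = of_int (k $ i)"
  by (simp add: rvec_def)

lemma rvec_eq_iff [simp]: "rvec j = rvec k \<longleftrightarrow> j = k"
  by (simp add: vec_eq_iff)

lemma rvec_eq_0 [simp]: "rvec k = 0 \<longleftrightarrow> k = 0"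
  by (simp add: vec_eq_iff)

lemma rvec_mv: "rvec (M *v k) = rmat M *v rvec k"
  by (simp add: rvec_def rmat_def matrix_vector_mult_def vec_eq_iff)

lemma inner_mat_T: "rvec k \<bullet> mat_T M \<xi> = rvec (M *v k) \<bullet> \<xi>"
  unfolding mat_T_def rvec_mv transpose_matrix_vector
  by (metis dot_lmul_matrix inner_commute)

definition chr :: "int^'n \<Rightarrow> real^'n \<Rightarrow> complex" where
  "chr k \<xi> = exp (- \<i> * complex_of_real (rvec k \<bullet> \<xi>))"

lemma chr_0 [simp]: "chr 0 \<xi> = 1" "chr k 0 = 1"
  by (simp_all add: chr_def)

lemma chr_add: "chr (j + k) \<xi> = chr j \<xi> * chr k \<xi>"
  by (simp add: chr_def rvec_add inner_add_left ring_distribs exp_diff flip: exp_add)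

lemma chr_add_right: "chr k (\<xi> + \<eta>) = chr k \<xi> * chr k \<eta>"
  by (simp add: chr_def inner_add_right ring_distribs exp_diff flip: exp_add)

lemma chr_minus: "chr (- k) \<xi> = cnj (chr k \<xi>)"
  by (simp add: chr_def rvec_minus exp_cnj)

lemma chr_nonzero [simp]: "chr k \<xi> \<noteq> 0"
  by (simp add: chr_def)

lemma chr_cnj_mult [simp]: "cnj (chr k \<xi>) * chr k \<xi> = 1"
  by (metis add.left_inverse chr_0(1) chr_add chr_minus)

lemma chr_mat_T: "chr k (mat_T M \<xi>) = chr (M *v k) \<xi>"
  by (simp add: chr_def inner_mat_T)

definition pair :: "('n::finite) filt \<Rightarrow> (int^'n \<Rightarrow> complex) \<Rightarrow> complex" where
  "pair u p = (\<Sum>k | u k \<noteq> 0. u k * p k)"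

lemma l0_finite: "u \<in> l0 \<Longrightarrow> finite {k. u k \<noteq> 0}"
  by (simp add: l0_def)

lemma l0I: "finite F \<Longrightarrow> {k. u k \<noteq> 0} \<subseteq> F \<Longrightarrow> u \<in> l0"
  using finite_subset unfolding l0_def by auto

lemma pair_superset:
  assumes "finite F" "{k. u k \<noteq> 0} \<subseteq> F"
  shows "pair u p = (\<Sum>k\<in>F. u k * p k)"
  unfolding pair_def by (rule sum.mono_neutral_left) (use assms in auto)

lemma l0_zero [simp]: "(\<lambda>k. 0) \<in> l0"
  by (simp add: l0_def)

lemma l0_add: "u \<in> l0 \<Longrightarrow> v \<in> l0 \<Longrightarrow> (\<lambda>k. u k + v k) \<in> l0"
  by (rule l0I[of "{k. u k \<noteq> 0} \<union> {k. v k \<noteq> 0}"]) (auto simp: l0_def)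

lemma l0_mult: "u \<in> l0 \<Longrightarrow> (\<lambda>k. u k * f k) \<in> l0"
  by (rule l0I[of "{k. u k \<noteq> 0}"]) (auto simp: l0_def)

lemma l0_scale: "u \<in> l0 \<Longrightarrow> (\<lambda>k. c * u k) \<in> l0"
  by (rule l0I[of "{k. u k \<noteq> 0}"]) (auto simp: l0_def)

lemma l0_diff: "u \<in> l0 \<Longrightarrow> v \<in> l0 \<Longrightarrow> (\<lambda>k. u k - v k) \<in> l0"
  by (rule l0I[of "{k. u k \<noteq> 0} \<union> {k. v k \<noteq> 0}"]) (auto simp: l0_def)

lemma pair_add_left:
  assumes "u \<in> l0" "v \<in> l0"
  shows "pair (\<lambda>k. u k + v k) p = pair u p + pair v p"
proof -
  define F where "F = {k. u k \<noteq> 0} \<union> {k. v k \<noteq> 0}"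
  have F: "finite F" using assms by (simp add: F_def l0_def)
  have "pair (\<lambda>k. u k + v k) p = (\<Sum>k\<in>F. (u k + v k) * p k)" "pair u p = (\<Sum>k\<in>F. u k * p k)"
    "pair v p = (\<Sum>k\<in>F. v k * p k)" by (rule pair_superset[OF F]; auto simp: F_def)+
  thus ?thesis by (simp add: sum.distrib ring_distribs)
qed

lemma pair_scale_left: "pair (\<lambda>k. c * u k) p = c * pair u p"
  by (cases "c = 0") (simp_all add: pair_def sum_distrib_left mult.assoc)

lemma pair_diff_left: "u \<in> l0 \<Longrightarrow> v \<in> l0 \<Longrightarrow> pair (\<lambda>k. u k - v k) p = pair u p - pair v p"
  using pair_add_left[of u "\<lambda>k. (-1) * v k" p] pair_scale_left[of "-1" v p]
  by (simp add: l0_scale[of v "-1", simplified])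

lemma pair_add_right: "pair u (\<lambda>k. p k + q k) = pair u p + pair u q"
  by (simp add: pair_def sum.distrib ring_distribs)

lemma pair_scale_right: "pair u (\<lambda>k. c * p k) = c * pair u p"
  by (simp add: pair_def sum_distrib_left algebra_simps)

lemma pair_diff_right: "pair u (\<lambda>k. p k - q k) = pair u p - pair u q"
  by (simp add: pair_def sum_subtractf ring_distribs)

lemma pair_sum_right: "pair u (\<lambda>k. \<Sum>i\<in>I. p i k) = (\<Sum>i\<in>I. pair u (p i))"
  unfolding pair_def sum_distrib_left by (rule sum.swap)

lemma pair_cong: "(\<And>k. u k \<noteq> 0 \<Longrightarrow> p k = q k) \<Longrightarrow> pair u p = pair u q"
  by (simp add: pair_def)

lemma pair_zero [simp]: "pair u (\<lambda>k. 0) = 0" "pair (\<lambda>k. 0) p = 0"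
  by (simp_all add: pair_def)

lemma pair_weight: "(\<And>k. w k \<noteq> 0) \<Longrightarrow> pair (\<lambda>k. u k * w k) p = pair u (\<lambda>k. w k * p k)"
  by (simp add: pair_def mult.assoc)

lemma pair_swap: "pair u (\<lambda>j. pair v (\<lambda>k. p j k)) = pair v (\<lambda>k. pair u (\<lambda>j. p j k))"
  unfolding pair_def sum_distrib_left by (subst sum.swap) (simp add: algebra_simps)

definition delta :: "('n::finite) filt" where "delta k = (if k = 0 then 1 else 0)"

lemma delta_l0 [simp]: "delta \<in> l0"
  by (rule l0I[of "{0}"]) (auto simp: delta_def)

lemma pair_delta [simp]: "pair delta p = p 0"
  by (subst pair_superset[of "{0}"]) (auto simp: delta_def)

definition push :: "(int^'n \<Rightarrow> int^'n) \<Rightarrow> ('n::finite) filt \<Rightarrow> 'n filt" where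
  "push \<tau> u k = (\<Sum>j | u j \<noteq> 0 \<and> \<tau> j = k. u j)"

lemma push_support: "{k. push \<tau> u k \<noteq> 0} \<subseteq> \<tau> ` {j. u j \<noteq> 0}"
proof
  fix k assume "k \<in> {k. push \<tau> u k \<noteq> 0}"
  hence "{j. u j \<noteq> 0 \<and> \<tau> j = k} \<noteq> {}" unfolding push_def by force
  thus "k \<in> \<tau> ` {j. u j \<noteq> 0}" by auto
qed

lemma push_l0: "u \<in> l0 \<Longrightarrow> push \<tau> u \<in> l0"
  by (rule l0I[OF _ push_support]) (simp add: l0_def)

lemma pair_push:
  assumes "u \<in> l0"
  shows "pair (push \<tau> u) p = pair u (\<lambda>j. p (\<tau> j))"
proof -
  let ?S = "{j. u j \<noteq> 0}"
  have fin: "finite ?S" using assms by (rule l0_finite)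
  have "pair (push \<tau> u) p = (\<Sum>k\<in>\<tau> ` ?S. push \<tau> u k * p k)"
    by (rule pair_superset) (use fin push_support in auto)
  also have "\<dots> = (\<Sum>k\<in>\<tau> ` ?S. \<Sum>j\<in>{j\<in>?S. \<tau> j = k}. u j * p (\<tau> j))"
    by (intro sum.cong refl) (simp add: push_def sum_distrib_right)
  also have "\<dots> = pair u (\<lambda>j. p (\<tau> j))"
    unfolding pair_def by (rule sum.image_gen[OF fin, symmetric])
  finally show ?thesis .
qed

lemma push_inj [simp]:
  assumes "inj \<tau>" shows "push \<tau> u (\<tau> j) = u j"
proof -
  have "{i. u i \<noteq> 0 \<and> \<tau> i = \<tau> j} = (if u j = 0 then {} else {j})" using assms by (auto simp: inj_def)
  thus ?thesis by (simp add: push_def)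
qed

lemma push_outside: "k \<notin> range \<tau> \<Longrightarrow> push \<tau> u k = 0"
  unfolding push_def by (rule sum.neutral) auto

lemma conv_pair: "conv u v k = pair u (\<lambda>j. v (k - j))"
  by (simp add: conv_def pair_def)

lemma conv_support: "{k. conv u v k \<noteq> 0} \<subseteq> (\<lambda>(j, k). j + k) ` ({j. u j \<noteq> 0} \<times> {k. v k \<noteq> 0})"
proof
  fix k assume "k \<in> {k. conv u v k \<noteq> 0}"
  hence "(\<Sum>j | u j \<noteq> 0. u j * v (k - j)) \<noteq> 0" by (simp add: conv_def)
  then obtain j where "u j \<noteq> 0" "v (k - j) \<noteq> 0" by (metis (mono_tags, lifting) mem_Collect_eq mult_zero_right sum.neutral)
  thus "k \<in> (\<lambda>(j, k). j + k) ` ({j. u j \<noteq> 0} \<times> {k. v k \<noteq> 0})"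
    by (intro image_eqI[of _ _ "(j, k - j)"]) auto
qed

lemma conv_l0: "u \<in> l0 \<Longrightarrow> v \<in> l0 \<Longrightarrow> conv u v \<in> l0"
  by (rule l0I[OF _ conv_support]) (simp add: l0_def)

lemma pair_conv:
  assumes "u \<in> l0" "v \<in> l0"
  shows "pair (conv u v) p = pair u (\<lambda>j. pair v (\<lambda>k. p (j + k)))"
proof -
  let ?U = "{j. u j \<noteq> 0}" and ?V = "{k. v k \<noteq> 0}"
  let ?F = "(\<lambda>(j, k). j + k) ` (?U \<times> ?V)"
  have fin: "finite ?U" "finite ?V" using assms by (simp_all add: l0_finite)
  hence finF: "finite ?F" by simp
  have "pair (conv u v) p = (\<Sum>k\<in>?F. conv u v k * p k)"
    by (rule pair_superset[OF finF conv_support])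
  also have "\<dots> = (\<Sum>k\<in>?F. \<Sum>j\<in>?U. u j * (v (k - j) * p k))"
    by (simp add: conv_def sum_distrib_right mult.assoc)
  also have "\<dots> = (\<Sum>j\<in>?U. u j * (\<Sum>k\<in>?F. v (k - j) * p k))"
    by (subst sum.swap) (simp add: sum_distrib_left)
  also have "\<dots> = (\<Sum>j\<in>?U. u j * (\<Sum>k\<in>?V. v k * p (j + k)))"
  proof (rule sum.cong[OF refl], rule arg_cong2[OF refl, of _ _ "(*)"])
    fix j assume j: "j \<in> ?U"
    have "(\<Sum>k\<in>?F. v (k - j) * p k) = (\<Sum>k\<in>(+) j ` ?V. v (k - j) * p k)"
      by (rule sum.mono_neutral_right) (use finF j in \<open>force simp: image_iff\<close>)+
    also have "\<dots> = (\<Sum>k\<in>?V. v k * p (j + k))"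
      by (subst sum.reindex) auto
    finally show "(\<Sum>k\<in>?F. v (k - j) * p k) = (\<Sum>k\<in>?V. v k * p (j + k))" .
  qed
  finally show ?thesis by (simp add: pair_def)
qed

lemma fseries_pair: "fseries u \<xi> = pair u (\<lambda>k. chr k \<xi>)"
  by (simp add: fseries_def pair_def chr_def)

lemma fseries_conv: "u \<in> l0 \<Longrightarrow> v \<in> l0 \<Longrightarrow> fseries (conv u v) \<xi> = fseries u \<xi> * fseries v \<xi>"
  by (simp add: fseries_pair pair_conv chr_add pair_scale_right)
     (simp add: mult.commute[of _ "pair v _"] pair_scale_right)

lemma fseries_push_mat: "u \<in> l0 \<Longrightarrow> fseries (push (\<lambda>k. g + M *v k) u) \<xi> = chr g \<xi> * fseries u (mat_T M \<xi>)"
  by (simp add: fseries_pair pair_push chr_add pair_scale_right chr_mat_T)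

lemma fseries_up: "u \<in> l0 \<Longrightarrow> fseries (push (\<lambda>k. M *v k) u) \<xi> = fseries u (mat_T M \<xi>)"
  using fseries_push_mat[of u 0 M] by simp

definition adj :: "('n::finite) filt \<Rightarrow> 'n filt" where "adj u k = cnj (u (- k))"

lemma adj_support: "{k. adj u k \<noteq> 0} = uminus ` {k. u k \<noteq> 0}"
  by (auto simp: adj_def image_iff) (metis minus_minus)

lemma adj_l0: "u \<in> l0 \<Longrightarrow> adj u \<in> l0"
  by (simp add: l0_def adj_support)

lemma pair_adj: "pair (adj u) p = cnj (pair u (\<lambda>k. cnj (p (- k))))"
  unfolding pair_def adj_support
  by (subst sum.reindex) (auto simp: adj_def)

lemma fseries_adj: "fseries (adj u) \<xi> = cnj (fseries u \<xi>)"
  by (simp add: fseries_pair pair_adj chr_minus)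

section \<open>Moments and vanishing order\<close>

definition fmono :: "nat^'n \<Rightarrow> real^'n \<Rightarrow> complex" where
  "fmono \<nu> x = (\<Prod>i\<in>UNIV. (- \<i> * complex_of_real (x $ i)) ^ (\<nu> $ i))"

lemma fmono_0 [simp]: "fmono 0 x = 1"
  by (simp add: fmono_def)

lemma fmono_add_axis: "fmono (\<nu> + axis i 1) x = - \<i> * complex_of_real (x $ i) * fmono \<nu> x"
proof -
  have "fmono (\<nu> + axis i 1) x = (\<Prod>j\<in>UNIV. (- \<i> * complex_of_real (x $ j)) ^ (\<nu> $ j) *
      (if j = i then - \<i> * complex_of_real (x $ j) else 1))"
    unfolding fmono_def by (intro prod.cong refl) (auto simp: axis_def)
  also have "\<dots> = fmono \<nu> x * (- \<i> * complex_of_real (x $ i))"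
    unfolding prod.distrib fmono_def by simp
  finally show ?thesis by (simp add: mult.commute)
qed

lemma mdeg_add_axis: "mdeg (\<nu> + axis i 1) = Suc (mdeg \<nu>)"
proof -
  have "mdeg (\<nu> + axis i 1) = (\<Sum>j\<in>UNIV. \<nu> $ j + (if j = i then 1 else 0))"
    unfolding mdeg_def by (intro sum.cong refl) (auto simp: axis_def)
  thus ?thesis by (simp add: sum.distrib mdeg_def)
qed

lemma mdeg_eq_0: "mdeg \<nu> = 0 \<longleftrightarrow> \<nu> = 0"
  by (auto simp: mdeg_def vec_eq_iff)

lemma mpartial_family:
  fixes G :: "nat^'n \<Rightarrow> 'n cfun"
  assumes "\<And>\<nu> i. partial i (G \<nu>) = G (\<nu> + axis i 1)"
  shows "mpartial \<mu> (G 0) = G \<mu>"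
proof -
  have pow: "(partial i ^^ r) (G \<nu>) = G (\<nu> + axis i r)" for i r \<nu>
  proof (induction r)
    case (Suc r)
    have "axis i (Suc r) = axis i r + (axis i 1 :: nat^'n)" by (simp add: axis_def vec_eq_iff)
    thus ?case using Suc assms by (simp add: add.assoc)
  qed (simp add: axis_def vec_eq_iff[of _ 0] flip: zero_vec_def)
  have fold: "distinct xs \<Longrightarrow> fold (\<lambda>i. partial i ^^ (\<mu> $ i)) xs (G \<nu>) = G (\<nu> + (\<chi> i. if i \<in> set xs then \<mu> $ i else 0))"
    for xs \<nu>
  proof (induction xs arbitrary: \<nu>)
    case Nil
    have "(\<chi> i. if i \<in> set [] then \<mu> $ i else 0) = 0" by (simp add: vec_eq_iff)
    thus ?case by simp
  next
    case (Cons x xs)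
    have "\<nu> + axis x (\<mu> $ x) + (\<chi> i. if i \<in> set xs then \<mu> $ i else 0)
      = \<nu> + (\<chi> i. if i \<in> set (x # xs) then \<mu> $ i else 0)"
      using Cons(2) by (auto simp: vec_eq_iff axis_def)
    thus ?case using Cons by (simp add: pow)
  qed
  define xs where "xs = (SOME xs :: 'n list. distinct xs \<and> set xs = UNIV)"
  have "\<exists>xs :: 'n list. distinct xs \<and> set xs = UNIV" using finite_distinct_list[of "UNIV :: 'n set"] by auto
  from someI_ex[OF this] have xs: "distinct xs" "set xs = UNIV" unfolding xs_def by auto
  have "(\<chi> i. if i \<in> set xs then \<mu> $ i else 0) = \<mu>" using xs by (simp add: vec_eq_iff)
  thus ?thesis using fold[OF xs(1), of 0] by (simp add: mpartial_def xs_def)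
qed

lemma partialI: "((\<lambda>t. f (x + t *\<^sub>R axis i 1)) has_vector_derivative D) (at 0) \<Longrightarrow> partial i f x = D"
  unfolding partial_def by (rule vector_derivative_at)

lemma chr_has_derivative:
  "((\<lambda>t. c * chr k (x + t *\<^sub>R axis i 1)) has_vector_derivative (- \<i> * complex_of_real (rvec k $ i) * (c * chr k x))) (at 0)"
proof -
  have "chr k (x + t *\<^sub>R axis i 1) = exp (- \<i> * complex_of_real (rvec k \<bullet> x) + of_real t * (- \<i> * complex_of_real (rvec k $ i)))" for t
    by (simp add: chr_def inner_add_right inner_axis algebra_simps)
  moreover have "((\<lambda>t. c * exp (- \<i> * complex_of_real (rvec k \<bullet> x) + of_real t * (- \<i> * complex_of_real (rvec k $ i))))
    has_vector_derivative (- \<i> * complex_of_real (rvec k $ i) * (c * chr k x))) (at 0)"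
    unfolding chr_def
    by (rule has_vector_derivative_eq_rhs, rule has_vector_derivative_real_field)
       (auto intro!: derivative_eq_intros)
  ultimately show ?thesis by simp
qed

lemma mpartial_fseries:
  "mpartial \<mu> (\<lambda>\<xi>. fseries u (\<xi> + \<eta>)) \<xi> = pair u (\<lambda>k. fmono \<mu> (rvec k) * chr k (\<xi> + \<eta>))"
proof -
  define G where "G = (\<lambda>\<nu> \<xi>. pair u (\<lambda>k. fmono \<nu> (rvec k) * chr k (\<xi> + \<eta>)))"
  have "partial i (G \<nu>) = G (\<nu> + axis i 1)" for \<nu> i
  proof
    fix x
    have "((\<lambda>t. \<Sum>k | u k \<noteq> 0. (u k * fmono \<nu> (rvec k)) * chr k ((x + \<eta>) + t *\<^sub>R axis i 1)) has_vector_derivative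
       (\<Sum>k | u k \<noteq> 0. - \<i> * complex_of_real (rvec k $ i) * ((u k * fmono \<nu> (rvec k)) * chr k (x + \<eta>)))) (at 0)"
      by (intro has_vector_derivative_sum chr_has_derivative)
    thus "partial i (G \<nu>) x = G (\<nu> + axis i 1) x"
      by (intro partialI) (simp add: G_def pair_def fmono_add_axis[simplified] algebra_simps)
  qed
  from mpartial_family[of G, OF this, of \<mu>] have "mpartial \<mu> (G 0) \<xi> = G \<mu> \<xi>" by simp
  moreover have "G 0 = (\<lambda>\<xi>. fseries u (\<xi> + \<eta>))" by (simp add: G_def fseries_pair)
  ultimately show ?thesis by (simp add: G_def)
qed

lemma mpartial_zero: "mpartial \<mu> (\<lambda>_::real^'n. 0) \<xi> = 0"
proof -
  have "partial i (\<lambda>_::real^'n. 0) = (\<lambda>_. 0)" for i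
    by (rule ext, rule partialI) simp
  from mpartial_family[of "\<lambda>_ _. 0", OF this, of \<mu>] show ?thesis by simp
qed

inductive pdeg :: "nat \<Rightarrow> (real^'n \<Rightarrow> complex) \<Rightarrow> bool" where
  pdeg_const: "pdeg 0 (\<lambda>x. c)"
| pdeg_coord: "pdeg n p \<Longrightarrow> pdeg (Suc n) (\<lambda>x. complex_of_real (x $ i) * p x)"
| pdeg_add: "pdeg n p \<Longrightarrow> pdeg n q \<Longrightarrow> pdeg n (\<lambda>x. p x + q x)"
| pdeg_Suc: "pdeg n p \<Longrightarrow> pdeg (Suc n) p"

lemma pdeg_le: "pdeg n p \<Longrightarrow> n \<le> m \<Longrightarrow> pdeg m p"
  by (induction m) (auto intro: pdeg_Suc simp: le_Suc_eq)

lemma pdeg_scale: "pdeg n p \<Longrightarrow> pdeg n (\<lambda>x. c * p x)"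
proof (induction rule: pdeg.induct)
  case (pdeg_coord n p i)
  from pdeg.pdeg_coord[OF this(2), of i] show ?case by (simp add: algebra_simps)
next
  case (pdeg_add n p q)
  from pdeg.pdeg_add[OF this(3,4)] show ?case by (simp add: algebra_simps)
qed (auto intro: pdeg.intros)

lemma pdeg_mult: "pdeg m p \<Longrightarrow> pdeg n q \<Longrightarrow> pdeg (m + n) (\<lambda>x. p x * q x)"
proof (induction rule: pdeg.induct)
  case (pdeg_const c)
  thus ?case by (simp add: pdeg_scale)
next
  case (pdeg_coord n p i)
  from pdeg.pdeg_coord[OF this(2)[OF this(3)], of i] show ?case by (simp add: algebra_simps)
next
  case (pdeg_add n p q')
  from pdeg.pdeg_add[OF this(3)[OF this(5)] this(4)[OF this(5)]] show ?case by (simp add: algebra_simps)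
qed (auto intro: pdeg.intros)

lemma pdeg_sum: "(\<And>i. i \<in> I \<Longrightarrow> pdeg n (p i)) \<Longrightarrow> pdeg n (\<lambda>x. \<Sum>i\<in>I. p i x)"
  by (induction I rule: infinite_finite_induct) (auto intro: pdeg.intros pdeg_le[OF pdeg_const])

lemma pdeg_linear: "pdeg 1 (\<lambda>x. complex_of_real (x $ i))"
  using pdeg_coord[OF pdeg_const[of 1], of i] by simp

lemma pdeg_affine: "pdeg n p \<Longrightarrow> pdeg n (\<lambda>x. p (A *v x + b))"
proof (induction rule: pdeg.induct)
  case (pdeg_coord n p i)
  have "pdeg 1 (\<lambda>x. complex_of_real ((A *v x + b) $ i))"
    unfolding matrix_vector_mult_def
    by (simp del: One_nat_def, intro pdeg_add pdeg_sum pdeg_scale pdeg_linear pdeg_le[OF pdeg_const]) simp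
  from pdeg_mult[OF this pdeg_coord(2)] show ?case by simp
qed (auto intro: pdeg.intros)

lemma pdeg_power: "pdeg m p \<Longrightarrow> pdeg (m * r) (\<lambda>x. p x ^ r)"
  by (induction r) (auto intro: pdeg_const pdeg_mult)

lemma pdeg_prod: "(\<And>i. i \<in> I \<Longrightarrow> pdeg (d i) (p i)) \<Longrightarrow> pdeg (\<Sum>i\<in>I. d i) (\<lambda>x. \<Prod>i\<in>I. p i x)"
  by (induction I rule: infinite_finite_induct) (auto intro: pdeg_const pdeg_mult)

lemma pdeg_monomial: "pdeg (mdeg \<nu>) (fmono \<nu>)"
proof -
  have "pdeg (\<Sum>i\<in>UNIV. 1 * \<nu> $ i) (\<lambda>x. \<Prod>i\<in>UNIV. (- \<i> * complex_of_real (x $ i)) ^ (\<nu> $ i))"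
    by (intro pdeg_prod pdeg_power pdeg_scale pdeg_linear)
  thus ?thesis by (simp add: mdeg_def fmono_def[abs_def])
qed

definition vmom :: "nat \<Rightarrow> ('n::finite) filt \<Rightarrow> bool" where
  "vmom m u \<longleftrightarrow> (\<forall>n p. n < m \<longrightarrow> pdeg n p \<longrightarrow> pair u (\<lambda>k. p (rvec k)) = 0)"

lemma vmomD: "vmom m u \<Longrightarrow> pdeg n p \<Longrightarrow> n < m \<Longrightarrow> pair u (\<lambda>k. p (rvec k)) = 0"
  by (auto simp: vmom_def)

lemma vmom_le: "vmom m u \<Longrightarrow> n \<le> m \<Longrightarrow> vmom n u"
  unfolding vmom_def by (meson less_le_trans)

lemma vmom_iff_mono: "vmom m u \<longleftrightarrow> (\<forall>\<nu>. mdeg \<nu> < m \<longrightarrow> pair u (\<lambda>k. fmono \<nu> (rvec k)) = 0)"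
proof
  assume R: "\<forall>\<nu>. mdeg \<nu> < m \<longrightarrow> pair u (\<lambda>k. fmono \<nu> (rvec k)) = 0"
  have "pdeg n p \<Longrightarrow> mdeg \<nu> + n < m \<Longrightarrow> pair u (\<lambda>k. fmono \<nu> (rvec k) * p (rvec k)) = 0" for n p \<nu>
  proof (induction arbitrary: \<nu> rule: pdeg.induct)
    case (pdeg_const c)
    thus ?case using R pair_scale_right[of u c] by (simp add: mult.commute)
  next
    case (pdeg_coord n p i)
    have "pair u (\<lambda>k. fmono (\<nu> + axis i 1) (rvec k) * p (rvec k)) = 0"
      by (rule pdeg_coord) (use pdeg_coord in \<open>simp add: mdeg_add_axis[simplified]\<close>)
    hence "\<i> * pair u (\<lambda>k. fmono (\<nu> + axis i 1) (rvec k) * p (rvec k)) = 0" by simp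
    thus ?case unfolding pair_scale_right[symmetric] fmono_add_axis by (simp add: algebra_simps)
  next
    case (pdeg_add n p q)
    thus ?case by (simp add: ring_distribs pair_add_right)
  next
    case (pdeg_Suc n p)
    thus ?case by simp
  qed
  from this[of _ _ 0] show "vmom m u" by (simp add: vmom_def mdeg_def)
qed (auto intro: vmomD pdeg_monomial)

lemma vanish_order_shift_iff:
  "vanish_order (\<lambda>\<xi>. fseries u (\<xi> + \<eta>)) m \<longleftrightarrow> vmom m (\<lambda>k. u k * chr k \<eta>)"
  unfolding vanish_order_def agree_order_def mpartial_fseries mpartial_zero vmom_iff_mono
  by (simp add: pair_weight mult.commute)

lemma vanish_order_iff: "vanish_order (fseries u) m \<longleftrightarrow> vmom m u"
  using vanish_order_shift_iff[of u 0 m] by simp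

lemma moments_determine:
  assumes "u \<in> l0" "\<And>m. vmom m u"
  shows "u k = 0"
proof (rule ccontr)
  assume k: "u k \<noteq> 0"
  let ?S = "{j. u j \<noteq> 0} - {k}"
  define p where "p = (\<lambda>x::real^'a. \<Prod>j\<in>?S. \<Sum>i\<in>UNIV. (complex_of_real (x $ i) + - complex_of_real (rvec j $ i)) ^ 2)"
  have fin: "finite {j. u j \<noteq> 0}" using assms by (simp add: l0_finite)
  have "pdeg (\<Sum>j\<in>?S. 1 * 2) p" unfolding p_def
    by (intro pdeg_prod pdeg_sum pdeg_power pdeg_add pdeg_linear pdeg_le[OF pdeg_const]) simp
  hence "pair u (\<lambda>j. p (rvec j)) = 0" using assms(2)[of "Suc (\<Sum>j\<in>?S. 1 * 2)"] by (auto intro: vmomD)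
  also have "pair u (\<lambda>j. p (rvec j)) = (\<Sum>j\<in>{k}. u j * p (rvec j))"
    unfolding pair_def
  proof (rule sum.mono_neutral_right)
    show "\<forall>j\<in>{j. u j \<noteq> 0} - {k}. u j * p (rvec j) = 0"
    proof
      fix j assume "j \<in> ?S"
      hence "p (rvec j) = 0" unfolding p_def using fin by (intro prod_zero) (auto intro!: bexI[of _ j])
      thus "u j * p (rvec j) = 0" by simp
    qed
  qed (use fin k in auto)
  finally have "p (rvec k) = 0" using k by simp
  then obtain j where j: "j \<in> ?S" "(\<Sum>i\<in>UNIV. (complex_of_real (rvec k $ i) + - complex_of_real (rvec j $ i)) ^ 2) = 0"
    using fin by (auto simp: p_def)
  have "complex_of_real (\<Sum>i\<in>UNIV. (rvec k $ i - rvec j $ i)\<^sup>2) = 0" using j(2) by simp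
  hence "(\<Sum>i\<in>UNIV. (rvec k $ i - rvec j $ i)\<^sup>2) = 0" by (simp only: of_real_eq_0_iff)
  hence "\<forall>i. rvec k $ i = rvec j $ i" by (simp add: sum_nonneg_eq_0_iff)
  hence "k = j" by (simp add: vec_eq_iff)
  thus False using j by simp
qed

lemma fseries_unique:
  assumes "u \<in> l0" "v \<in> l0" "\<And>\<xi>. fseries u \<xi> = fseries v \<xi>"
  shows "u = v"
proof
  fix k
  let ?w = "\<lambda>k. u k - v k"
  have w: "?w \<in> l0" using assms by (simp add: l0_diff)
  have "fseries ?w = (\<lambda>_. 0)" using assms by (auto simp: fseries_pair pair_diff_left)
  hence "vanish_order (fseries ?w) m" for m by (simp add: vanish_order_def agree_order_def)
  hence "?w k = 0" by (intro moments_determine[OF w]) (simp add: vanish_order_iff)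
  thus "u k = v k" by simp
qed

lemma filter_of_eq: "has_fseries u F \<Longrightarrow> filter_of F = u"
  unfolding filter_of_def has_fseries_def
  by (rule the_equality) (auto intro: fseries_unique)

lemma has_fseries_filter_of: "has_fseries u F \<Longrightarrow> has_fseries (filter_of F) F"
  by (simp add: filter_of_eq)

section \<open>Filters with vanishing moments as sums of differences\<close>

lemma has_fseries_add: "has_fseries u F \<Longrightarrow> has_fseries v G \<Longrightarrow> has_fseries (\<lambda>k. u k + v k) (\<lambda>\<xi>. F \<xi> + G \<xi>)"
  by (simp add: has_fseries_def l0_add fseries_pair pair_add_left)

lemma has_fseries_diff: "has_fseries u F \<Longrightarrow> has_fseries v G \<Longrightarrow> has_fseries (\<lambda>k. u k - v k) (\<lambda>\<xi>. F \<xi> - G \<xi>)"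
  by (simp add: has_fseries_def l0_diff fseries_pair pair_diff_left)

lemma has_fseries_scale: "has_fseries u F \<Longrightarrow> has_fseries (\<lambda>k. c * u k) (\<lambda>\<xi>. c * F \<xi>)"
  by (simp add: has_fseries_def l0_scale fseries_pair pair_scale_left)

lemma has_fseries_conv: "has_fseries u F \<Longrightarrow> has_fseries v G \<Longrightarrow> has_fseries (conv u v) (\<lambda>\<xi>. F \<xi> * G \<xi>)"
  by (simp add: has_fseries_def conv_l0 fseries_conv)

lemma has_fseries_adj: "has_fseries u F \<Longrightarrow> has_fseries (adj u) (\<lambda>\<xi>. cnj (F \<xi>))"
  by (simp add: has_fseries_def adj_l0 fseries_adj)

lemma has_fseries_delta: "has_fseries delta (\<lambda>\<xi>. 1)"
  by (simp add: has_fseries_def fseries_pair)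

lemma has_fseries_self: "u \<in> l0 \<Longrightarrow> has_fseries u (fseries u)"
  by (simp add: has_fseries_def)

lemma has_fseries_l0: "has_fseries u F \<Longrightarrow> u \<in> l0"
  by (simp add: has_fseries_def)

lemma has_fseriesD: "has_fseries u F \<Longrightarrow> fseries u \<xi> = F \<xi>"
  by (simp add: has_fseries_def)

lemma ex_has_fseries_prod:
  "finite I \<Longrightarrow> (\<And>i. i \<in> I \<Longrightarrow> \<exists>u. has_fseries u (F i)) \<Longrightarrow> \<exists>u. has_fseries u (\<lambda>\<xi>. \<Prod>i\<in>I. F i \<xi>)"
proof (induction I rule: finite_induct)
  case (insert i I)
  then obtain u v where "has_fseries u (F i)" "has_fseries v (\<lambda>\<xi>. \<Prod>i\<in>I. F i \<xi>)" by blast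
  from has_fseries_conv[OF this] insert show ?case by auto
qed (auto intro: has_fseries_delta)

definition l1 :: "int^'n \<Rightarrow> nat" where "l1 k = nat (\<Sum>i\<in>UNIV. \<bar>k $ i\<bar>)"

lemma l1_step:
  fixes k :: "int^'n"
  assumes "k \<noteq> 0"
  obtains i e where "e = axis i 1 \<or> e = - axis i 1" "l1 k = Suc (l1 (k - e))"
proof -
  obtain i where i: "k $ i \<noteq> 0" using assms by (auto simp: vec_eq_iff)
  define e where "e = (if k $ i > 0 then axis i 1 else - axis i 1 :: int^'n)"
  have "(\<Sum>j\<in>UNIV. \<bar>(k - e) $ j\<bar>) = (\<Sum>j\<in>UNIV. \<bar>k $ j\<bar> - (if j = i then 1 else 0))"
    using i by (intro sum.cong refl) (auto simp: e_def axis_def)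
  also have "\<dots> = (\<Sum>j\<in>UNIV. \<bar>k $ j\<bar>) - 1" by (simp add: sum_subtractf)
  finally have "(\<Sum>j\<in>UNIV. \<bar>(k - e) $ j\<bar>) = (\<Sum>j\<in>UNIV. \<bar>k $ j\<bar>) - 1" .
  moreover have "\<bar>k $ i\<bar> \<le> (\<Sum>j\<in>UNIV. \<bar>k $ j\<bar>)" by (rule member_le_sum) auto
  ultimately have "l1 k = Suc (l1 (k - e))" using i unfolding l1_def by linarith
  thus thesis using that[of e i] by (auto simp: e_def)
qed

lemma int_vec_induct:
  fixes k :: "int^'n"
  assumes "P 0" and up: "\<And>k i. P k \<Longrightarrow> P (k + axis i 1)" and down: "\<And>k i. P k \<Longrightarrow> P (k - axis i 1)"
  shows "P k"
proof (induction "l1 k" arbitrary: k rule: less_induct)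
  case less
  show ?case
  proof (cases "k = 0")
    case False
    then obtain i e where e: "e = axis i 1 \<or> e = - axis i 1" "l1 k = Suc (l1 (k - e))" by (rule l1_step)
    hence "P (k - e)" using less[of "k - e"] by simp
    thus ?thesis using up[of "k - e" i] down[of "k - e" i] e(1) by auto
  qed (simp add: assms)
qed

definition dif :: "'n \<Rightarrow> ('n::finite) filt \<Rightarrow> 'n filt" where
  "dif i u k = u k - u (k - axis i 1)"

lemma push_translate: "push (\<lambda>k. e + k) u k = u (k - e)"
  using push_inj[of "\<lambda>k. e + k" u "k - e"] by (simp add: inj_def)

lemma translate_l0: "u \<in> l0 \<Longrightarrow> (\<lambda>k. u (k - e)) \<in> l0"
  using push_l0[of u "\<lambda>k. e + k"] by (simp add: push_translate[abs_def])

lemma pair_translate: "u \<in> l0 \<Longrightarrow> pair (\<lambda>k. u (k - e)) p = pair u (\<lambda>k. p (k + e))"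
  using pair_push[of u "\<lambda>k. e + k" p] unfolding push_translate[abs_def] by (simp only: add.commute)

lemma dif_l0: "u \<in> l0 \<Longrightarrow> dif i u \<in> l0"
  unfolding dif_def[abs_def] by (intro l0_diff translate_l0)

lemma pair_dif: "u \<in> l0 \<Longrightarrow> pair (dif i u) p = pair u (\<lambda>k. p k - p (k + axis i 1))"
  unfolding dif_def[abs_def] by (simp add: pair_diff_left translate_l0 pair_translate pair_diff_right)

lemma fseries_dif: "u \<in> l0 \<Longrightarrow> fseries (dif i u) \<xi> = (1 - chr (axis i 1) \<xi>) * fseries u \<xi>"
  by (simp add: fseries_pair pair_dif chr_add pair_diff_right algebra_simps flip: pair_scale_right)

lemma dif_diff: "dif i (\<lambda>k. u k - v k) = (\<lambda>k. dif i u k - dif i v k)"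
  by (simp add: dif_def fun_eq_iff)

lemma dif_scale: "dif i (\<lambda>k. c * u k) = (\<lambda>k. c * dif i u k)"
  by (simp add: dif_def fun_eq_iff algebra_simps)

lemma dif_sum: "dif i (\<lambda>k. \<Sum>t\<in>T. u t k) = (\<lambda>k. \<Sum>t\<in>T. dif i (u t) k)"
  by (simp add: dif_def fun_eq_iff sum_subtractf)

text \<open>The \<open>n\<close>-th power of the ideal generated by the first differences of \<^const>\<open>delta\<close>.\<close>

inductive idl :: "nat \<Rightarrow> ('n::finite) filt \<Rightarrow> bool" where
  idl_0: "u \<in> l0 \<Longrightarrow> idl 0 u"
| idl_dif: "idl n u \<Longrightarrow> idl (Suc n) (dif i u)"
| idl_add: "idl n u \<Longrightarrow> idl n v \<Longrightarrow> idl n (\<lambda>k. u k + v k)"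

lemma idl_l0: "idl n u \<Longrightarrow> u \<in> l0"
  by (induction rule: idl.induct) (auto intro: dif_l0 l0_add)

lemma idl_scale: "idl n u \<Longrightarrow> idl n (\<lambda>k. c * u k)"
proof (induction rule: idl.induct)
  case (idl_dif n u i)
  from idl.idl_dif[OF this(2), of i] show ?case by (simp add: dif_scale)
next
  case (idl_add n u v)
  from idl.idl_add[OF this(3,4)] show ?case by (simp add: distrib_left)
qed (auto intro: idl.idl_0 l0_scale)

lemma idl_diff: "idl n u \<Longrightarrow> idl n v \<Longrightarrow> idl n (\<lambda>k. u k - v k)"
  using idl_add[OF _ idl_scale[of n v "-1"], of u] by simp

lemma idl_zero: "idl n (\<lambda>k. 0)"
proof (induction n)
  case (Suc n)
  show ?case using idl_dif[OF Suc] by (simp add: dif_def[abs_def])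
qed (auto intro: idl_0)

lemma idl_sum: "(\<And>t. t \<in> T \<Longrightarrow> idl n (u t)) \<Longrightarrow> idl n (\<lambda>k. \<Sum>t\<in>T. u t k)"
  by (induction T rule: infinite_finite_induct) (auto intro: idl_zero idl_add)

lemma idl_translate: "idl n u \<Longrightarrow> idl n (\<lambda>k. u (k - e))"
proof (induction rule: idl.induct)
  case (idl_dif n u i)
  from idl.idl_dif[OF this(2), of i] show ?case by (simp add: dif_def[abs_def] algebra_simps)
next
  case (idl_add n u v)
  from idl.idl_add[OF this(3,4)] show ?case by (simp add: distrib_left)
qed (auto intro: idl.idl_0 translate_l0)

lemma idl_translate_diff:
  assumes u: "idl n u"
  shows "idl (Suc n) (\<lambda>k. u (k - e) - u k)"
proof (induction e rule: int_vec_induct)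
  case 1 thus ?case by (simp add: idl_zero)
next
  case (2 e i)
  have "idl (Suc n) (\<lambda>k. (u (k - e) - u k) - dif i (\<lambda>k. u (k - e)) k)"
    by (rule idl_diff[OF 2(1) idl_dif[OF idl_translate[OF u]]])
  thus ?case by (simp add: dif_def diff_diff_eq add.commute)
next
  case (3 e i)
  have "idl (Suc n) (\<lambda>k. (u (k - e) - u k) + dif i (\<lambda>k. u (k - (e - axis i 1))) k)"
    by (rule idl_add[OF 3(1) idl_dif[OF idl_translate[OF u]]])
  thus ?case by (simp add: dif_def diff_diff_eq)
qed

lemma pdeg_difference:
  "pdeg n p \<Longrightarrow> case n of 0 \<Rightarrow> \<forall>x. p x - p (x + e) = 0 | Suc m \<Rightarrow> pdeg m (\<lambda>x. p x - p (x + e))"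
proof (induction rule: pdeg.induct)
  case (pdeg_const c) show ?case by simp
next
  case (pdeg_coord n p i)
  have 1: "pdeg n (\<lambda>x. complex_of_real (x $ i) * (p x - p (x + e)))"
    using pdeg_coord(2) by (cases n) (auto intro: pdeg.pdeg_coord pdeg_le[OF pdeg_const])
  have "pdeg n (\<lambda>x. p (mat 1 *v x + e))" by (rule pdeg_affine) fact
  hence "pdeg n (\<lambda>x. (- complex_of_real (e $ i)) * p (x + e))" by (intro pdeg_scale) simp
  from pdeg_add[OF 1 this] show ?case by (simp add: algebra_simps)
next
  case (pdeg_add n p q)
  show ?case
  proof (cases n)
    case 0 with pdeg_add show ?thesis by (simp add: algebra_simps)
  next
    case (Suc m)
    with pdeg_add have "pdeg m (\<lambda>x. (p x - p (x + e)) + (q x - q (x + e)))" by (intro pdeg.pdeg_add) auto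
    thus ?thesis by (simp add: Suc algebra_simps)
  qed
next
  case (pdeg_Suc n p)
  show ?case
  proof (cases n)
    case 0
    with pdeg_Suc have "(\<lambda>x. p x - p (x + e)) = (\<lambda>x. 0)" by auto
    with 0 show ?thesis by (simp add: pdeg_const)
  next
    case (Suc m)
    with pdeg_Suc show ?thesis by (auto intro: pdeg.pdeg_Suc)
  qed
qed

lemma vmom_dif:
  fixes u :: "'n::finite filt"
  shows "u \<in> l0 \<Longrightarrow> vmom n u \<Longrightarrow> vmom (Suc n) (dif i u)"
  unfolding vmom_def
proof (intro allI impI)
  fix m and p :: "real^'n \<Rightarrow> complex" assume u: "u \<in> l0" "\<forall>m p. m < n \<longrightarrow> pdeg m p \<longrightarrow> pair u (\<lambda>k. p (rvec k)) = 0" "m < Suc n" "pdeg m p"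
  have "pair (dif i u) (\<lambda>k. p (rvec k)) = pair u (\<lambda>k. p (rvec k) - p (rvec k + rvec (axis i 1)))"
    using u by (simp add: pair_dif rvec_add)
  also have "\<dots> = 0"
    using pdeg_difference[OF u(4), of "rvec (axis i 1)"] u(2,3) by (cases m) auto
  finally show "pair (dif i u) (\<lambda>k. p (rvec k)) = 0" .
qed

lemma vmom_add: "u \<in> l0 \<Longrightarrow> v \<in> l0 \<Longrightarrow> vmom n u \<Longrightarrow> vmom n v \<Longrightarrow> vmom n (\<lambda>k. u k + v k)"
  by (simp add: vmom_def pair_add_left)

lemma vmom_diff: "u \<in> l0 \<Longrightarrow> v \<in> l0 \<Longrightarrow> vmom n u \<Longrightarrow> vmom n v \<Longrightarrow> vmom n (\<lambda>k. u k - v k)"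
  by (simp add: vmom_def pair_diff_left)

lemma idl_vmom: "idl n u \<Longrightarrow> vmom n u"
  by (induction rule: idl.induct) (auto intro: vmom_dif vmom_add dest: idl_l0 simp: vmom_def[of 0])

lemma pdeg_cnj: "pdeg n p \<Longrightarrow> pdeg n (\<lambda>x. cnj (p x))"
  by (induction rule: pdeg.induct) (auto intro: pdeg.intros)

lemma vmom_adj:
  fixes u :: "'n::finite filt"
  assumes "vmom n u"
  shows "vmom n (adj u)"
  unfolding vmom_def
proof (intro allI impI)
  fix m and p :: "real^'n \<Rightarrow> complex" assume p: "m < n" "pdeg m p"
  have "pdeg m (\<lambda>x. cnj (p ((- mat 1) *v x + 0)))" by (intro pdeg_cnj pdeg_affine p)
  from vmomD[OF assms this p(1)] show "pair (adj u) (\<lambda>k. p (rvec k)) = 0"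
    using matrix_vector_mult_diff_rdistrib[of 0 "mat 1 :: real^'n^'n"] by (simp add: pair_adj rvec_minus)
qed

lemma nabla_delta_has_fseries:
  "has_fseries (nabla_delta \<mu>) (\<lambda>\<xi>. \<Prod>i\<in>UNIV. (1 - chr (axis i 1) \<xi>) ^ (\<mu> $ i))"
proof -
  have chr: "exp (- \<i> * complex_of_real (\<xi> $ i)) = chr (axis i 1) \<xi>" for \<xi> and i :: 'a
  proof -
    have "rvec (axis i 1) = axis i 1" by (simp add: vec_eq_iff axis_def)
    thus ?thesis by (simp add: chr_def inner_axis')
  qed
  have "\<exists>u. has_fseries u (\<lambda>\<xi>. \<Prod>i\<in>(UNIV::'a set). (1 - chr (axis i 1) \<xi>) ^ (\<mu> $ i))"
  proof (rule ex_has_fseries_prod)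
    fix i :: 'a
    have "has_fseries (dif i delta) (\<lambda>\<xi>. 1 - chr (axis i 1) \<xi>)"
      by (simp add: has_fseries_def dif_l0 fseries_dif) (simp add: fseries_pair)
    hence "\<exists>u. has_fseries u (\<lambda>\<xi>. \<Prod>j\<in>{..<\<mu> $ i}. 1 - chr (axis i 1) \<xi>)"
      by (intro ex_has_fseries_prod) auto
    thus "\<exists>u. has_fseries u (\<lambda>\<xi>. (1 - chr (axis i 1) \<xi>) ^ (\<mu> $ i))" by simp
  qed auto
  thus ?thesis unfolding nabla_delta_def chr by (blast intro: has_fseries_filter_of)
qed

lemma nabla_delta_l0: "nabla_delta \<mu> \<in> l0"
  using nabla_delta_has_fseries has_fseries_l0 by blast

lemma nabla_delta_0: "nabla_delta 0 = delta"
  by (rule fseries_unique) (simp_all add: nabla_delta_l0 has_fseriesD[OF nabla_delta_has_fseries] has_fseriesD[OF has_fseries_delta])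

lemma nabla_delta_add_axis: "nabla_delta (\<mu> + axis i 1) = dif i (nabla_delta \<mu>)"
proof (rule fseries_unique)
  fix \<xi>
  have "fseries (nabla_delta (\<mu> + axis i 1)) \<xi> = (\<Prod>j\<in>UNIV. (1 - chr (axis j 1) \<xi>) ^ (\<mu> $ j) *
      (if j = i then 1 - chr (axis j 1) \<xi> else 1))"
    unfolding has_fseriesD[OF nabla_delta_has_fseries] by (intro prod.cong refl) (auto simp: axis_def)
  also have "\<dots> = fseries (nabla_delta \<mu>) \<xi> * (1 - chr (axis i 1) \<xi>)"
    unfolding prod.distrib has_fseriesD[OF nabla_delta_has_fseries] by simp
  finally show "fseries (nabla_delta (\<mu> + axis i 1)) \<xi> = fseries (dif i (nabla_delta \<mu>)) \<xi>"
    by (simp add: fseries_dif nabla_delta_l0)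
qed (simp_all add: nabla_delta_l0 dif_l0)

lemma nat_vec_dest:
  fixes \<mu> :: "nat^'n"
  assumes "\<mu> $ i \<noteq> 0"
  obtains \<mu>' where "\<mu> = \<mu>' + axis i 1"
proof
  show "\<mu> = (\<mu> - axis i 1) + axis i 1" using assms by (simp add: vec_eq_iff axis_def)
qed

lemma finite_mdeg: "finite {\<mu>::nat^'n. mdeg \<mu> = n}"
proof -
  have "{\<mu>::nat^'n. mdeg \<mu> = n} \<subseteq> vec_lambda ` (PiE UNIV (\<lambda>_. {..n}))"
  proof
    fix \<mu> :: "nat^'n" assume "\<mu> \<in> {\<mu>. mdeg \<mu> = n}"
    hence "(\<lambda>i. \<mu> $ i) \<in> PiE UNIV (\<lambda>_. {..n})"
      unfolding mdeg_def by (auto simp: member_le_sum)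
    thus "\<mu> \<in> vec_lambda ` (PiE UNIV (\<lambda>_. {..n}))" by (metis imageI vec_lambda_eta)
  qed
  thus ?thesis by (rule finite_subset) (simp add: finite_PiE)
qed

lemma idl_leading_part:
  "idl n u \<Longrightarrow> \<exists>c. idl (Suc n) (\<lambda>k. u k - (\<Sum>\<mu> | mdeg \<mu> = n. c \<mu> * nabla_delta \<mu> k))"
proof (induction rule: idl.induct)
  case (idl_0 u)
  have fin: "finite {j. u j \<noteq> 0}" using idl_0 by (simp add: l0_finite)
  have "idl (Suc 0) (\<lambda>k. \<Sum>j | u j \<noteq> 0. u j * (delta (k - j) - delta k))"
    by (intro idl_sum idl_scale idl_translate_diff idl.idl_0) simp
  moreover have "(\<Sum>j | u j \<noteq> 0. u j * (delta (k - j) - delta k)) = u k - pair u (\<lambda>_. 1) * delta k" for k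
  proof -
    have "(\<Sum>j | u j \<noteq> 0. u j * delta (k - j)) = (\<Sum>j | u j \<noteq> 0. if j = k then u j else 0)"
      by (intro sum.cong refl) (auto simp: delta_def)
    also have "\<dots> = u k" using fin by simp
    finally show ?thesis
      by (simp add: ring_distribs sum_subtractf pair_def sum_distrib_right)
  qed
  ultimately show ?case
    by (intro exI[of _ "\<lambda>_. pair u (\<lambda>_. 1)"]) (simp add: mdeg_eq_0 nabla_delta_0)
next
  case (idl_dif n u i)
  then obtain c where c: "idl (Suc n) (\<lambda>k. u k - (\<Sum>\<mu> | mdeg \<mu> = n. c \<mu> * nabla_delta \<mu> k))" by blast
  define c' where "c' = (\<lambda>\<nu> :: nat^'a. if \<nu> $ i = 0 then 0 else c (\<nu> - axis i 1))"
  have c': "c' (\<mu> + axis i 1) = c \<mu>" for \<mu> :: "nat^'a" by (simp add: c'_def axis_def)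
  have "(\<Sum>\<nu> | mdeg \<nu> = Suc n. c' \<nu> * nabla_delta \<nu> k) = (\<Sum>\<mu> | mdeg \<mu> = n. c \<mu> * dif i (nabla_delta \<mu>) k)" for k
  proof -
    have "(\<Sum>\<nu> | mdeg \<nu> = Suc n. c' \<nu> * nabla_delta \<nu> k)
        = (\<Sum>\<nu>\<in>(\<lambda>\<mu>. \<mu> + axis i 1) ` {\<mu>. mdeg \<mu> = n}. c' \<nu> * nabla_delta \<nu> k)"
    proof (rule sum.mono_neutral_right)
      show "(\<lambda>\<mu>::nat^'a. \<mu> + axis i 1) ` {\<mu>. mdeg \<mu> = n} \<subseteq> {\<nu>. mdeg \<nu> = Suc n}"
        by (auto simp: mdeg_add_axis[simplified])
      show "\<forall>\<nu>\<in>{\<nu>. mdeg \<nu> = Suc n} - (\<lambda>\<mu>. \<mu> + axis i 1) ` {\<mu>. mdeg \<mu> = n}. c' \<nu> * nabla_delta \<nu> k = 0"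
      proof
        fix \<nu> :: "nat^'a" assume \<nu>: "\<nu> \<in> {\<nu>. mdeg \<nu> = Suc n} - (\<lambda>\<mu>. \<mu> + axis i 1) ` {\<mu>. mdeg \<mu> = n}"
        have "\<nu> $ i = 0"
        proof (rule ccontr)
          assume "\<nu> $ i \<noteq> 0"
          then obtain \<mu> where "\<nu> = \<mu> + axis i 1" by (rule nat_vec_dest)
          with \<nu> show False by (auto simp: mdeg_add_axis[simplified])
        qed
        thus "c' \<nu> * nabla_delta \<nu> k = 0" by (simp add: c'_def)
      qed
    qed (rule finite_mdeg)
    also have "\<dots> = (\<Sum>\<mu> | mdeg \<mu> = n. c \<mu> * dif i (nabla_delta \<mu>) k)"
      by (subst sum.reindex) (auto simp: inj_on_def c'[simplified] nabla_delta_add_axis[simplified])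
    finally show ?thesis .
  qed
  moreover from idl.idl_dif[OF c, of i]
  have "idl (Suc (Suc n)) (\<lambda>k. dif i u k - (\<Sum>\<mu> | mdeg \<mu> = n. c \<mu> * dif i (nabla_delta \<mu>) k))"
    by (simp add: dif_diff dif_sum dif_scale)
  ultimately have "idl (Suc (Suc n)) (\<lambda>k. dif i u k - (\<Sum>\<nu> | mdeg \<nu> = Suc n. c' \<nu> * nabla_delta \<nu> k))"
    by (simp only:)
  thus ?case by (intro exI[of _ c'])
next
  case (idl_add n u v)
  then obtain c c' where "idl (Suc n) (\<lambda>k. u k - (\<Sum>\<mu> | mdeg \<mu> = n. c \<mu> * nabla_delta \<mu> k))"
    "idl (Suc n) (\<lambda>k. v k - (\<Sum>\<mu> | mdeg \<mu> = n. c' \<mu> * nabla_delta \<mu> k))" by blast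
  from idl.idl_add[OF this] show ?case
    by (intro exI[of _ "\<lambda>\<mu>. c \<mu> + c' \<mu>"]) (simp add: ring_distribs sum.distrib algebra_simps)
qed

definition binom :: "nat^'n \<Rightarrow> real^'n \<Rightarrow> complex" where
  "binom \<nu> x = (\<Prod>i\<in>UNIV. complex_of_real (x $ i) gchoose (\<nu> $ i))"

lemma pdeg_binom: "pdeg (mdeg \<nu>) (binom \<nu>)"
  unfolding mdeg_def binom_def[abs_def]
proof (rule pdeg_prod)
  fix i
  have "pdeg (\<Sum>j<\<nu> $ i. 1) (\<lambda>x. \<Prod>j<\<nu> $ i. complex_of_real (x $ i) + - of_nat j)"
    by (intro pdeg_prod pdeg_add pdeg_linear pdeg_le[OF pdeg_const]) simp
  from pdeg_scale[OF this, of "1 / fact (\<nu> $ i)"]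
  show "pdeg (\<nu> $ i) (\<lambda>x. complex_of_real (x $ i) gchoose (\<nu> $ i))"
    by (simp add: gbinomial_prod_rev atLeast0LessThan)
qed

lemma binom_shift: "binom (\<nu> + axis i 1) (x + axis i 1) = binom (\<nu> + axis i 1) x + binom \<nu> x"
proof -
  define R where "R = (\<Prod>j\<in>UNIV - {i}. complex_of_real (x $ j) gchoose (\<nu> $ j))"
  have split: "(\<Prod>j\<in>UNIV. f j) = f i * (\<Prod>j\<in>UNIV - {i}. f j)" for f :: "'a \<Rightarrow> complex"
    by (rule prod.remove) auto
  have "binom (\<nu> + axis i 1) (x + axis i 1) = ((complex_of_real (x $ i) + 1) gchoose (Suc (\<nu> $ i))) * R"
    unfolding binom_def split R_def by (intro arg_cong2[of _ _ _ _ "(*)"] prod.cong) (auto simp: axis_def)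
  moreover have "binom (\<nu> + axis i 1) x = (complex_of_real (x $ i) gchoose (Suc (\<nu> $ i))) * R"
    unfolding binom_def split R_def by (intro arg_cong2[of _ _ _ _ "(*)"] prod.cong) (auto simp: axis_def)
  moreover have "binom \<nu> x = (complex_of_real (x $ i) gchoose (\<nu> $ i)) * R"
    unfolding binom_def split R_def by (intro arg_cong2[of _ _ _ _ "(*)"] prod.cong) (auto simp: axis_def)
  ultimately show ?thesis by (simp add: gbinomial_Suc_Suc ring_distribs)
qed

lemma binom_shift_0: "\<nu> $ i = 0 \<Longrightarrow> binom \<nu> (x + axis i 1) = binom \<nu> x"
  unfolding binom_def by (intro prod.cong refl) (auto simp: axis_def)

lemma pair_nabla_binom:
  "mdeg \<mu> = n \<Longrightarrow> mdeg \<nu> = n \<Longrightarrow> pair (nabla_delta \<mu>) (\<lambda>k. binom \<nu> (rvec k)) = (if \<mu> = \<nu> then (- 1) ^ n else 0)"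
proof (induction n arbitrary: \<mu> \<nu>)
  case 0
  thus ?case by (simp add: mdeg_eq_0 nabla_delta_0 binom_def)
next
  case (Suc n)
  then obtain i where i: "\<mu> $ i \<noteq> 0" by (metis mdeg_eq_0 nat.distinct(1) vec_eq_iff zero_index)
  then obtain \<mu>' where \<mu>: "\<mu> = \<mu>' + axis i 1" by (rule nat_vec_dest)
  have d\<mu>: "mdeg \<mu>' = n" using Suc(2) by (simp add: \<mu> mdeg_add_axis[simplified])
  have rv: "rvec (axis i 1) = axis i 1" by (simp add: vec_eq_iff axis_def)
  have eq: "pair (nabla_delta \<mu>) (\<lambda>k. binom \<nu> (rvec k))
      = pair (nabla_delta \<mu>') (\<lambda>k. binom \<nu> (rvec k) - binom \<nu> (rvec k + axis i 1))"
    unfolding \<mu> nabla_delta_add_axis pair_dif[OF nabla_delta_l0] rvec_add rv ..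
  show ?case
  proof (cases "\<nu> $ i = 0")
    case True
    hence "\<mu> \<noteq> \<nu>" using i by auto
    thus ?thesis using True by (simp add: eq binom_shift_0[simplified])
  next
    case False
    then obtain \<nu>' where \<nu>: "\<nu> = \<nu>' + axis i 1" by (rule nat_vec_dest)
    have d\<nu>: "mdeg \<nu>' = n" using Suc(3) by (simp add: \<nu> mdeg_add_axis[simplified])
    have "pair (nabla_delta \<mu>) (\<lambda>k. binom \<nu> (rvec k)) = pair (nabla_delta \<mu>') (\<lambda>k. (-1) * binom \<nu>' (rvec k))"
      using eq unfolding \<nu> binom_shift by simp
    also have "\<dots> = (-1) * (if \<mu>' = \<nu>' then (- 1) ^ n else 0)"
      unfolding pair_scale_right by (simp add: Suc.IH[OF d\<mu> d\<nu>])
    finally show ?thesis by (simp add: \<mu> \<nu>)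
  qed
qed

lemma vmom_imp_idl: "u \<in> l0 \<Longrightarrow> vmom n u \<Longrightarrow> idl n u"
proof (induction n)
  case 0 thus ?case by (simp add: idl_0)
next
  case (Suc n)
  hence "idl n u" using vmom_le[of "Suc n" u n] by auto
  then obtain c where c: "idl (Suc n) (\<lambda>k. u k - (\<Sum>\<mu> | mdeg \<mu> = n. c \<mu> * nabla_delta \<mu> k))"
    using idl_leading_part by blast
  define w where "w = (\<lambda>k. \<Sum>\<mu> | mdeg \<mu> = n. c \<mu> * nabla_delta \<mu> k)"
  have wl0: "w \<in> l0" unfolding w_def
    by (rule idl_l0[of 0]) (intro idl_sum idl_scale idl_0 nabla_delta_l0)
  have "vmom (Suc n) (\<lambda>k. u k - (u k - w k))"
    using vmom_diff[OF Suc(2) idl_l0[OF c] Suc(3) idl_vmom[OF c]] unfolding w_def .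
  hence w: "vmom (Suc n) w" by simp
  have "c \<nu> = 0" if \<nu>: "mdeg \<nu> = n" for \<nu>
  proof -
    have pw: "pair (\<lambda>k. \<Sum>\<mu>\<in>S. c \<mu> * nabla_delta \<mu> k) p = (\<Sum>\<mu>\<in>S. c \<mu> * pair (nabla_delta \<mu>) p)" if "finite S" for S p
      using that
    proof (induction S rule: finite_induct)
      case (insert x F)
      have "(\<lambda>k. \<Sum>\<mu>\<in>F. c \<mu> * nabla_delta \<mu> k) \<in> l0"
        by (rule idl_l0[of 0]) (intro idl_sum idl_scale idl_0 nabla_delta_l0)
      thus ?case using insert by (simp add: pair_add_left l0_scale nabla_delta_l0 pair_scale_left)
    qed simp
    have "0 = pair w (\<lambda>k. binom \<nu> (rvec k))" using vmomD[OF w pdeg_binom[of \<nu>]] \<nu> by simp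
    also have "\<dots> = (\<Sum>\<mu> | mdeg \<mu> = n. c \<mu> * (if \<mu> = \<nu> then (- 1) ^ n else 0))"
      unfolding w_def pw[OF finite_mdeg] using \<nu> by (intro sum.cong refl) (simp add: pair_nabla_binom)
    also have "\<dots> = c \<nu> * (- 1) ^ n" using \<nu> by (subst sum.remove[of _ \<nu>]) (auto simp: finite_mdeg intro: sum.neutral)
    finally show ?thesis by simp
  qed
  hence "w = (\<lambda>k. 0)" by (auto simp: w_def)
  moreover have "idl (Suc n) (\<lambda>k. u k - w k)" using c unfolding w_def .
  ultimately show ?case by simp
qed

lemma idl_factor:
  "idl n h \<Longrightarrow> n = n1 + n2 \<Longrightarrow> \<exists>L. (\<forall>(g, w)\<in>set L. idl n1 g \<and> idl n2 w) \<and>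
     (\<forall>\<xi>. fseries h \<xi> = (\<Sum>(g, w)\<leftarrow>L. fseries g \<xi> * fseries w \<xi>))"
proof (induction arbitrary: n1 n2 rule: idl.induct)
  case (idl_0 u)
  thus ?case by (intro exI[of _ "[(delta, u)]"]) (simp add: idl.idl_0 has_fseriesD[OF has_fseries_delta])
next
  case (idl_dif n u i)
  show ?case
  proof (cases n1)
    case 0
    thus ?thesis using idl_dif idl.idl_dif[of n u i]
      by (intro exI[of _ "[(delta, dif i u)]"]) (simp add: idl.idl_0 has_fseriesD[OF has_fseries_delta])
  next
    case (Suc m)
    from idl_dif(2)[of m n2] idl_dif(3) Suc obtain L where
      L: "\<forall>(g, w)\<in>set L. idl m g \<and> idl n2 w" "\<And>\<xi>. fseries u \<xi> = (\<Sum>(g, w)\<leftarrow>L. fseries g \<xi> * fseries w \<xi>)" by auto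
    have "fseries (dif i u) \<xi> = (\<Sum>(g, w)\<leftarrow>map (\<lambda>(g, w). (dif i g, w)) L. fseries g \<xi> * fseries w \<xi>)" for \<xi>
    proof -
      have "fseries (dif i u) \<xi> = (\<Sum>(g, w)\<leftarrow>L. (1 - chr (axis i 1) \<xi>) * (fseries g \<xi> * fseries w \<xi>))"
        using idl_l0[OF idl_dif(1)] L(2)[of \<xi>]
        by (simp add: fseries_dif case_prod_unfold sum_list_const_mult)
      also have "\<dots> = (\<Sum>(g, w)\<leftarrow>L. fseries (dif i g) \<xi> * fseries w \<xi>)"
      proof -
        have "g \<in> l0" if "(g, w) \<in> set L" for g w using that L(1) by (auto intro: idl_l0)
        thus ?thesis by (intro arg_cong[of _ _ sum_list] map_cong refl) (auto simp: fseries_dif)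
      qed
      finally show ?thesis by (simp add: o_def case_prod_unfold)
    qed
    moreover have "\<forall>(g, w)\<in>set (map (\<lambda>(g, w). (dif i g, w)) L). idl n1 g \<and> idl n2 w"
      using L(1) Suc by (auto intro: idl.idl_dif)
    ultimately show ?thesis by blast
  qed
next
  case (idl_add n u v)
  from idl_add(3)[OF idl_add(5)] obtain L where L:
    "\<forall>(g, w)\<in>set L. idl n1 g \<and> idl n2 w" "\<And>\<xi>. fseries u \<xi> = (\<Sum>(g, w)\<leftarrow>L. fseries g \<xi> * fseries w \<xi>)"
    by blast
  from idl_add(4)[OF idl_add(5)] obtain L' where L':
    "\<forall>(g, w)\<in>set L'. idl n1 g \<and> idl n2 w" "\<And>\<xi>. fseries v \<xi> = (\<Sum>(g, w)\<leftarrow>L'. fseries g \<xi> * fseries w \<xi>)"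
    by blast
  have "fseries (\<lambda>k. u k + v k) \<xi> = fseries u \<xi> + fseries v \<xi>" for \<xi>
    using idl_l0[OF idl_add(1)] idl_l0[OF idl_add(2)] by (simp add: fseries_pair pair_add_left)
  thus ?case using L L' by (intro exI[of _ "L @ L'"]) auto
qed

lemma h_factorization_exists:
  assumes "h \<in> l0" "vmom (n1 + n2) h"
  shows "\<exists>s u u'. h_factorization h n1 n2 s u u'"
proof -
  obtain L where L: "\<And>g w. (g, w) \<in> set L \<Longrightarrow> idl n1 g \<and> idl n2 w"
    "\<And>\<xi>. fseries h \<xi> = (\<Sum>(g, w)\<leftarrow>L. fseries g \<xi> * fseries w \<xi>)"
    using idl_factor[OF vmom_imp_idl[OF assms] refl] by auto
  define K where "K = ((\<lambda>k. 0, \<lambda>k. 0)) # L"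
  define u where "u = (\<lambda>t. adj (fst (K ! (t - 1))))"
  define u' where "u' = (\<lambda>t. snd (K ! (t - 1)))"
  have K: "idl n1 (fst (K ! (t - 1)))" "idl n2 (snd (K ! (t - 1)))" if "t \<in> {1..length K}" for t
  proof -
    have "K ! (t - 1) \<in> set K" using that by (intro nth_mem) auto
    moreover have "idl n1 (fst x)" "idl n2 (snd x)" if "x \<in> set K" for x
      using that L(1)[of "fst x" "snd x"] by (auto simp: K_def idl_zero)
    ultimately show "idl n1 (fst (K ! (t - 1)))" "idl n2 (snd (K ! (t - 1)))" by auto
  qed
  have sum: "fseries h \<xi> = (\<Sum>t=1..length K. cnj (fseries (u t) \<xi>) * fseries (u' t) \<xi>)" for \<xi>
  proof -
    have "fseries h \<xi> = (\<Sum>(g, w)\<leftarrow>K. fseries g \<xi> * fseries w \<xi>)"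
      by (simp add: K_def L(2)) (simp add: fseries_pair)
    also have "\<dots> = (\<Sum>t<length K. fseries (fst (K ! t)) \<xi> * fseries (snd (K ! t)) \<xi>)"
      by (simp add: sum_list_sum_nth case_prod_unfold atLeast0LessThan)
    also have "\<dots> = (\<Sum>t=1..length K. fseries (fst (K ! (t - 1))) \<xi> * fseries (snd (K ! (t - 1))) \<xi>)"
      by (rule sum.reindex_bij_witness[of _ "\<lambda>t. t - 1" Suc]) auto
    finally show ?thesis by (simp add: u_def u'_def fseries_adj)
  qed
  have "h_factorization h n1 n2 (length K) u u'"
    unfolding h_factorization_def vanish_order_iff
  proof (intro conjI ballI allI)
    fix t assume "t \<in> {1..length K}"
    from K[OF this] show "u t \<in> l0" "u' t \<in> l0" "vmom n1 (u t)" "vmom n2 (u' t)"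
      by (auto simp: u_def u'_def intro: adj_l0 idl_l0 vmom_adj idl_vmom)
  next
    fix \<xi> show "fseries h \<xi> = (\<Sum>t=1..length K. cnj (fseries (u t) \<xi>) * fseries (u' t) \<xi>)" by (rule sum)
  qed (simp add: K_def)
  thus ?thesis by blast
qed

section \<open>Cosets of the dilated lattice\<close>

lemma finite_int_box: "finite {k::int^'n. \<forall>i. \<bar>k $ i\<bar> \<le> N}"
proof -
  have "{k::int^'n. \<forall>i. \<bar>k $ i\<bar> \<le> N} \<subseteq> vec_lambda ` (PiE UNIV (\<lambda>_. {-N..N}))"
  proof
    fix k :: "int^'n" assume "k \<in> {k. \<forall>i. \<bar>k $ i\<bar> \<le> N}"
    hence "(\<lambda>i. k $ i) \<in> PiE UNIV (\<lambda>_. {-N..N})" by (auto simp: abs_le_iff minus_le_iff)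
    thus "k \<in> vec_lambda ` (PiE UNIV (\<lambda>_. {-N..N}))" by (metis imageI vec_lambda_eta)
  qed
  thus ?thesis by (rule finite_subset) (simp add: finite_PiE)
qed

lemma finite_int_ball: "finite {k::int^'n. norm (rvec k - c) \<le> R}"
proof -
  have "{k::int^'n. norm (rvec k - c) \<le> R} \<subseteq> {k. \<forall>i. \<bar>k $ i\<bar> \<le> \<lceil>R + norm c\<rceil>}"
  proof safe
    fix k :: "int^'n" and i assume k: "norm (rvec k - c) \<le> R"
    have "\<bar>rvec k $ i\<bar> \<le> norm (rvec k)" by (rule component_le_norm_cart)
    also have "\<dots> \<le> norm (rvec k - c) + norm c" by norm
    finally have "\<bar>real_of_int (k $ i)\<bar> \<le> R + norm c" using k by simp
    thus "\<bar>k $ i\<bar> \<le> \<lceil>R + norm c\<rceil>" by linarith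
  qed
  thus ?thesis by (rule finite_subset) (rule finite_int_box)
qed

lemma finite_int_bounded: "finite {k::int^'n. norm (rvec k) \<le> R}"
  using finite_int_ball[of 0 R] by simp

lemma norm_rvec_ge_1: "k \<noteq> 0 \<Longrightarrow> 1 \<le> norm (rvec k)"
proof -
  assume "k \<noteq> 0"
  then obtain i where "k $ i \<noteq> 0" by (auto simp: vec_eq_iff)
  hence "1 \<le> \<bar>rvec k $ i\<bar>" by (simp add: abs_if)
  also have "\<dots> \<le> norm (rvec k)" by (rule component_le_norm_cart)
  finally show ?thesis .
qed

lemma rvec_axis: "rvec (axis i 1) = axis i 1"
  by (simp add: vec_eq_iff axis_def)

definition vfloor :: "real^'n \<Rightarrow> int^'n" where "vfloor x = (\<chi> i. \<lfloor>x $ i\<rfloor>)"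

definition vfrac :: "real^'n \<Rightarrow> real^'n" where "vfrac x = x - rvec (vfloor x)"

lemma vfrac_cube: "vfrac x \<in> unit_cube"
  by (simp add: vfrac_def vfloor_def unit_cube_def) linarith

lemma vfloor_rvec [simp]: "vfloor (rvec k) = k"
  by (simp add: vfloor_def vec_eq_iff)

lemma vfloor_diff: "vfloor (x - rvec k) = vfloor x - k"
  by (simp add: vfloor_def vec_eq_iff)

lemma cube_diff_rvec:
  assumes "x \<in> unit_cube" "y \<in> unit_cube" "x - y = rvec k"
  shows "k = 0" "x = y"
proof -
  have "k $ i = 0" for i
  proof -
    have "x $ i - y $ i = of_int (k $ i)" using arg_cong[OF assms(3), of "\<lambda>v. v $ i"] by simp
    moreover have "0 \<le> x $ i" "x $ i < 1" "0 \<le> y $ i" "y $ i < 1" using assms by (auto simp: unit_cube_def)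
    ultimately show ?thesis by linarith
  qed
  thus "k = 0" by (simp add: vec_eq_iff)
  thus "x = y" using assms(3) by simp
qed

lemma norm_cube: "x \<in> unit_cube \<Longrightarrow> norm x \<le> CARD('n)" for x :: "real^'n"
proof -
  assume "x \<in> unit_cube"
  hence "\<bar>x $ i\<bar> \<le> 1" for i by (auto simp: unit_cube_def abs_if intro: less_imp_le dest: spec[of _ i])
  hence "(\<Sum>i\<in>UNIV. \<bar>x $ i\<bar>) \<le> (\<Sum>i\<in>(UNIV::'n set). 1)" by (intro sum_mono)
  thus ?thesis using norm_le_l1_cart[of x] by simp
qed

lemma chr_2pi_rvec [simp]: "chr k ((2 * pi) *\<^sub>R rvec j) = 1"
proof -
  have "rvec k \<bullet> rvec j = of_int (\<Sum>i\<in>UNIV. k $ i * j $ i)" by (simp add: inner_vec_def)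
  then obtain n where "rvec k \<bullet> rvec j = of_int n" by blast
  thus ?thesis unfolding chr_def by (subst exp_eq_1) (auto intro!: exI[of _ "-n"])
qed

lemma sum_character_zero:
  fixes h :: "'a \<Rightarrow> complex"
  assumes "finite S" "inj_on f S" "f ` S \<subseteq> S" "\<And>s. s \<in> S \<Longrightarrow> h (f s) = c * h s" "c \<noteq> 1"
  shows "(\<Sum>s\<in>S. h s) = 0"
proof -
  have "f ` S = S" using assms by (simp add: endo_inj_surj)
  hence "(\<Sum>s\<in>S. h s) = (\<Sum>s\<in>S. h (f s))" using sum.reindex[OF assms(2), of h] by simp
  also have "\<dots> = c * (\<Sum>s\<in>S. h s)" using assms by (simp add: sum_distrib_left)
  finally show ?thesis using assms(5) by (simp add: algebra_simps)
qed

lemma chr_axis: "chr (axis i 1) \<xi> = exp (- \<i> * complex_of_real (\<xi> $ i))"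
  by (simp add: chr_def rvec_axis[simplified] inner_axis')

lemma exp_2pi_nonint:
  assumes "r \<notin> \<int>"
  shows "exp (- \<i> * complex_of_real (2 * pi * r)) \<noteq> 1"
proof
  assume "exp (- \<i> * complex_of_real (2 * pi * r)) = 1"
  then obtain n :: int where "- (2 * pi * r) = of_int (2 * n) * pi" by (auto simp: exp_eq_1)
  hence "pi * (r + of_int n) = 0" by (simp add: algebra_simps)
  hence "r = of_int (- n)" by simp
  thus False using assms by (metis Ints_of_int)
qed

locale dilation =
  fixes M :: "int^'n^'n"
  assumes dil: "dilation_matrix M"
begin

abbreviation "fwd x \<equiv> rmat M *v x"
abbreviation "bwd x \<equiv> matrix_inv (rmat M) *v x"

lemma inv: "invertible (rmat M)"
  by (rule dilation_invertible[OF dil])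

lemma fwd_bwd [simp]: "fwd (bwd x) = x"
  by (simp add: matrix_vector_mul_assoc matrix_inv_cancel[OF inv])

lemma bwd_fwd [simp]: "bwd (fwd x) = x"
  by (simp add: matrix_vector_mul_assoc matrix_inv_cancel[OF inv])

lemma mat_T_inv [simp]: "mat_T M (mat_inv_T M x) = x" "mat_inv_T M (mat_T M x) = x"
proof -
  have "invertible (transpose (rmat M))" using inv by (simp add: invertible_det_nz)
  from matrix_inv_cancel[OF this]
  show "mat_T M (mat_inv_T M x) = x" "mat_inv_T M (mat_T M x) = x"
    by (simp_all add: mat_T_def mat_inv_T_def matrix_vector_mul_assoc del: transpose_matrix_vector)
qed

lemma inner_fwd: "x \<bullet> mat_T M y = fwd x \<bullet> y"
  unfolding mat_T_def transpose_matrix_vector by (metis dot_lmul_matrix inner_commute)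

lemma inner_bwd: "x \<bullet> mat_inv_T M y = bwd x \<bullet> y"
  using inner_fwd[of "bwd x" "mat_inv_T M y"] by simp

lemma mv_inj: "M *v j = M *v k \<longleftrightarrow> j = k"
proof
  assume "M *v j = M *v k"
  hence "fwd (rvec j) = fwd (rvec k)" by (metis rvec_mv)
  hence "rvec j = rvec k" by (metis bwd_fwd)
  thus "j = k" by simp
qed simp

lemma inj_mv: "inj (\<lambda>k. M *v k)" "inj (\<lambda>k. g + M *v k)"
  by (auto simp: inj_def mv_inj)

lemma mv_eq_0 [simp]: "M *v k = 0 \<longleftrightarrow> k = 0"
  using mv_inj[of k 0] by simp

lemma Gamma_iff: "g \<in> Gamma_M M \<longleftrightarrow> bwd (rvec g) \<in> unit_cube"
proof
  assume "g \<in> Gamma_M M"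
  then obtain x where "rvec g = fwd x" "x \<in> unit_cube" by (auto simp: Gamma_M_def)
  thus "bwd (rvec g) \<in> unit_cube" by simp
next
  assume "bwd (rvec g) \<in> unit_cube"
  thus "g \<in> Gamma_M M" unfolding Gamma_M_def by (auto intro!: image_eqI[of _ _ "bwd (rvec g)"])
qed

lemma Gamma_0: "0 \<in> Gamma_M M"
  by (simp add: Gamma_iff unit_cube_def)

lemma Gamma_rep: "\<exists>g\<in>Gamma_M M. \<exists>k. n = g + M *v k"
proof
  let ?k = "vfloor (bwd (rvec n))"
  show "\<exists>k. n = (n - M *v ?k) + M *v k" by (intro exI[of _ ?k]) simp
  have "bwd (rvec (n - M *v ?k)) = vfrac (bwd (rvec n))"
    by (simp add: rvec_diff rvec_mv vfrac_def matrix_vector_mult_diff_distrib)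
  thus "n - M *v ?k \<in> Gamma_M M" by (simp add: Gamma_iff vfrac_cube)
qed

lemma Gamma_unique:
  assumes "g \<in> Gamma_M M" "g' \<in> Gamma_M M" "g + M *v k = g' + M *v k'"
  shows "g = g'" "k = k'"
proof -
  have "g - g' = M *v (k' - k)" using assms(3) by (simp add: matrix_vector_mult_diff_distrib algebra_simps)
  hence "rvec g - rvec g' = fwd (rvec (k' - k))" by (metis rvec_diff rvec_mv)
  hence "bwd (rvec g) - bwd (rvec g') = rvec (k' - k)"
    by (metis bwd_fwd matrix_vector_mult_diff_distrib)
  from cube_diff_rvec[OF _ _ this] assms have "bwd (rvec g) = bwd (rvec g')" by (simp add: Gamma_iff)
  hence "rvec g = rvec g'" by (metis fwd_bwd)
  thus "g = g'" by simp
  thus "k = k'" using assms(3) by (simp add: mv_inj)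
qed

lemma fwd_bound: "\<exists>B>0. \<forall>x. norm (fwd x) \<le> B * norm x"
proof -
  obtain B where "B > 0" "\<And>x. norm (fwd x) \<le> B * norm x"
    using linear_bounded_pos[OF matrix_vector_mul_linear[of "rmat M"]] by blast
  thus ?thesis by blast
qed

lemma finite_Gamma: "finite (Gamma_M M)"
proof -
  obtain B where B: "B > 0" "\<And>x. norm (fwd x) \<le> B * norm x" using fwd_bound by blast
  have "Gamma_M M \<subseteq> {k. norm (rvec k) \<le> B * CARD('n)}"
  proof
    fix g assume "g \<in> Gamma_M M"
    then obtain x where "rvec g = fwd x" "x \<in> unit_cube" by (auto simp: Gamma_M_def)
    hence "norm (rvec g) \<le> B * norm x" "norm x \<le> CARD('n)" using B(2) norm_cube by auto
    hence "norm (rvec g) \<le> B * CARD('n)" using B(1) by (meson mult_left_mono less_imp_le order_trans)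
    thus "g \<in> {k. norm (rvec k) \<le> B * CARD('n)}" by simp
  qed
  thus ?thesis by (rule finite_subset) (rule finite_int_bounded)
qed

lemma mat_T_rvec: "mat_T M (rvec k) = rvec (transpose M *v k)"
proof -
  have "transpose (rmat M) = rmat (transpose M)" by (simp add: rmat_def transpose_def vec_eq_iff)
  thus ?thesis by (simp only: mat_T_def rvec_mv)
qed

lemma mat_inv_T_add: "mat_inv_T M (x + y) = mat_inv_T M x + mat_inv_T M y"
  by (simp add: mat_inv_T_def matrix_vector_right_distrib)

lemma mat_T_scale: "mat_T M (c *\<^sub>R x) = c *\<^sub>R mat_T M x"
  by (simp add: mat_T_def matrix_vector_mult_scaleR)

lemma mat_T_add: "mat_T M (x + y) = mat_T M x + mat_T M y"
  by (simp add: mat_T_def matrix_vector_right_distrib)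

lemma mat_T_diff: "mat_T M (x - y) = mat_T M x - mat_T M y"
  by (simp add: mat_T_def matrix_vector_mult_diff_distrib)

lemma Omega_iff: "\<omega> \<in> Omega_M M \<longleftrightarrow> (\<exists>k. mat_T M \<omega> = rvec k) \<and> \<omega> \<in> unit_cube"
proof -
  have "\<omega> \<in> range (\<lambda>k. mat_inv_T M (rvec k)) \<longleftrightarrow> (\<exists>k. mat_T M \<omega> = rvec k)"
  proof
    assume "\<exists>k. mat_T M \<omega> = rvec k"
    then obtain k where "mat_T M \<omega> = rvec k" by blast
    hence "\<omega> = mat_inv_T M (rvec k)" by (metis mat_T_inv(2))
    thus "\<omega> \<in> range (\<lambda>k. mat_inv_T M (rvec k))" by blast
  qed auto
  thus ?thesis by (simp add: Omega_M_def)
qed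

lemma Omega_0: "0 \<in> Omega_M M"
  unfolding Omega_iff by (auto simp: mat_T_def unit_cube_def intro!: exI[of _ 0])

lemma vfrac_Omega: "vfrac (mat_inv_T M (rvec k)) \<in> Omega_M M"
  unfolding Omega_iff
proof
  have "mat_T M (vfrac (mat_inv_T M (rvec k))) = rvec (k - transpose M *v vfloor (mat_inv_T M (rvec k)))"
    by (simp only: vfrac_def rvec_diff mat_T_rvec[symmetric] mat_T_diff mat_T_inv)
  thus "\<exists>j. mat_T M (vfrac (mat_inv_T M (rvec k))) = rvec j" by blast
qed (rule vfrac_cube)

lemma finite_Omega: "finite (Omega_M M)"
proof -
  obtain B where B: "B > 0" "\<And>x. norm (mat_T M x) \<le> B * norm x"
    using linear_bounded_pos[OF matrix_vector_mul_linear[of "transpose (rmat M)"]] unfolding mat_T_def by blast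
  have "Omega_M M \<subseteq> (\<lambda>k. mat_inv_T M (rvec k)) ` {k. norm (rvec k) \<le> B * CARD('n)}"
  proof
    fix \<omega> assume "\<omega> \<in> Omega_M M"
    then obtain k where k: "mat_T M \<omega> = rvec k" "\<omega> \<in> unit_cube" unfolding Omega_iff by blast
    have "norm (rvec k) \<le> B * norm \<omega>" "norm \<omega> \<le> CARD('n)" using B(2)[of \<omega>] k norm_cube by auto
    hence "norm (rvec k) \<le> B * CARD('n)" using B(1) by (meson mult_left_mono less_imp_le order_trans)
    moreover have "\<omega> = mat_inv_T M (rvec k)" using k by (metis mat_T_inv(2))
    ultimately show "\<omega> \<in> (\<lambda>k. mat_inv_T M (rvec k)) ` {k. norm (rvec k) \<le> B * CARD('n)}" by blast
  qed
  thus ?thesis by (rule finite_subset) (simp add: finite_int_bounded)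
qed

lemma chr_lattice_Omega:
  assumes "\<omega> \<in> Omega_M M"
  shows "chr (M *v k) ((2 * pi) *\<^sub>R \<omega>) = 1"
proof -
  obtain j where "mat_T M \<omega> = rvec j" using assms unfolding Omega_iff by blast
  hence "mat_T M ((2 * pi) *\<^sub>R \<omega>) = (2 * pi) *\<^sub>R rvec j" by (simp add: mat_T_scale)
  thus ?thesis by (metis chr_2pi_rvec chr_mat_T)
qed

lemma sum_chr_Gamma:
  assumes "\<omega> \<in> Omega_M M"
  shows "(\<Sum>g\<in>Gamma_M M. chr g ((2 * pi) *\<^sub>R \<omega>)) = (if \<omega> = 0 then of_nat (card (Gamma_M M)) else 0)"
proof (cases "\<omega> = 0")
  case False
  then obtain i where i: "\<omega> $ i \<noteq> 0" by (auto simp: vec_eq_iff)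
  have "0 \<le> \<omega> $ i" "\<omega> $ i < 1" using assms by (auto simp: Omega_iff unit_cube_def)
  hence "\<omega> $ i \<notin> \<int>" using i by (auto elim!: Ints_cases)
  hence c: "chr (axis i 1) ((2 * pi) *\<^sub>R \<omega>) \<noteq> 1"
    using exp_2pi_nonint[of "\<omega> $ i"] unfolding chr_axis by simp
  obtain f h where f: "\<And>g. f g \<in> Gamma_M M" "\<And>g. g + axis i 1 = f g + M *v h g"
  proof -
    have "\<forall>g. \<exists>x k. x \<in> Gamma_M M \<and> g + axis i 1 = x + M *v k" using Gamma_rep by blast
    thus ?thesis using that by metis
  qed
  have "(\<Sum>g\<in>Gamma_M M. chr g ((2 * pi) *\<^sub>R \<omega>)) = 0"
  proof (rule sum_character_zero[OF finite_Gamma _ _ _ c])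
    show "inj_on f (Gamma_M M)"
    proof (rule inj_onI)
      fix g g' assume g: "g \<in> Gamma_M M" "g' \<in> Gamma_M M" "f g = f g'"
      have "(g + axis i 1) - (g' + axis i 1) = (f g + M *v h g) - (f g' + M *v h g')" unfolding f(2) ..
      hence "g + M *v (h g') = g' + M *v (h g)" using g(3) by (simp add: algebra_simps)
      thus "g = g'" using Gamma_unique(1) g by blast
    qed
    show "f ` Gamma_M M \<subseteq> Gamma_M M" using f by auto
    fix g assume "g \<in> Gamma_M M"
    have "chr (f g) ((2 * pi) *\<^sub>R \<omega>) = chr (f g + M *v h g) ((2 * pi) *\<^sub>R \<omega>)"
      by (simp add: chr_add chr_lattice_Omega[OF assms])
    also have "\<dots> = chr (axis i 1) ((2 * pi) *\<^sub>R \<omega>) * chr g ((2 * pi) *\<^sub>R \<omega>)"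
      unfolding f(2)[symmetric] chr_add by simp
    finally show "chr (f g) ((2 * pi) *\<^sub>R \<omega>) = chr (axis i 1) ((2 * pi) *\<^sub>R \<omega>) * chr g ((2 * pi) *\<^sub>R \<omega>)" .
  qed
  thus ?thesis using False by simp
qed simp

definition lat :: "int^'n \<Rightarrow> bool" where "lat k \<longleftrightarrow> k \<in> range (\<lambda>j. M *v j)"

lemma sum_chr_Omega:
  "(\<Sum>\<omega>\<in>Omega_M M. chr g ((2 * pi) *\<^sub>R \<omega>)) = (if lat g then of_nat (card (Omega_M M)) else 0)"
proof (cases "lat g")
  case True
  then obtain k where "g = M *v k" by (auto simp: lat_def)
  thus ?thesis using True by (simp add: chr_lattice_Omega)
next
  case False
  have "\<exists>i. bwd (rvec g) $ i \<notin> \<int>"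
  proof (rule ccontr)
    assume "\<not> ?thesis"
    hence "bwd (rvec g) $ i = of_int \<lfloor>bwd (rvec g) $ i\<rfloor>" for i by (metis Ints_cases floor_of_int)
    hence "bwd (rvec g) = rvec (vfloor (bwd (rvec g)))" by (simp add: vec_eq_iff vfloor_def)
    hence "rvec g = rvec (M *v vfloor (bwd (rvec g)))" by (metis fwd_bwd rvec_mv)
    hence "lat g" unfolding lat_def by (metis rangeI rvec_eq_iff)
    thus False using \<open>\<not> lat g\<close> by blast
  qed
  then obtain i where i: "bwd (rvec g) $ i \<notin> \<int>" by blast
  define \<theta> where "\<theta> = mat_inv_T M (rvec (axis i 1))"
  have "rvec g \<bullet> \<theta> = bwd (rvec g) $ i"
    unfolding \<theta>_def inner_bwd rvec_axis by (simp add: inner_axis)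
  hence c: "chr g ((2 * pi) *\<^sub>R \<theta>) \<noteq> 1" using exp_2pi_nonint[OF i] by (simp add: chr_def)
  define f where "f = (\<lambda>\<omega>. vfrac (\<omega> + \<theta>))"
  have "(\<Sum>\<omega>\<in>Omega_M M. chr g ((2 * pi) *\<^sub>R \<omega>)) = 0"
  proof (rule sum_character_zero[OF finite_Omega _ _ _ c])
    show "inj_on f (Omega_M M)"
    proof (rule inj_onI)
      fix x y assume xy: "x \<in> Omega_M M" "y \<in> Omega_M M" "f x = f y"
      have "x - y = rvec (vfloor (x + \<theta>) - vfloor (y + \<theta>))"
        using xy(3) by (simp add: f_def vfrac_def rvec_diff algebra_simps)
      with cube_diff_rvec xy show "x = y" unfolding Omega_iff by blast
    qed
    show "f ` Omega_M M \<subseteq> Omega_M M"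
    proof safe
      fix \<omega> assume "\<omega> \<in> Omega_M M"
      then obtain j where "mat_T M \<omega> = rvec j" unfolding Omega_iff by blast
      hence "\<omega> + \<theta> = mat_inv_T M (rvec (j + axis i 1))"
        unfolding \<theta>_def rvec_add mat_inv_T_add by (metis mat_T_inv(2))
      thus "f \<omega> \<in> Omega_M M" unfolding f_def using vfrac_Omega by simp
    qed
    fix \<omega> assume "\<omega> \<in> Omega_M M"
    have "chr g ((2 * pi) *\<^sub>R (\<omega> + \<theta>)) = chr g ((2 * pi) *\<^sub>R f \<omega> + (2 * pi) *\<^sub>R rvec (vfloor (\<omega> + \<theta>)))"
      by (simp add: f_def vfrac_def algebra_simps)
    also have "\<dots> = chr g ((2 * pi) *\<^sub>R f \<omega>)" by (simp add: chr_add_right)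
    finally show "chr g ((2 * pi) *\<^sub>R f \<omega>) = chr g ((2 * pi) *\<^sub>R \<theta>) * chr g ((2 * pi) *\<^sub>R \<omega>)"
      by (simp only: scaleR_add_right chr_add_right mult.commute)
  qed
  thus ?thesis using False by simp
qed

lemma decay: "\<exists>C \<rho>. 0 < \<rho> \<and> \<rho> < 1 \<and> 0 < C \<and> (\<forall>n x. norm (((\<lambda>x. bwd x) ^^ n) x) \<le> C * \<rho> ^ n * norm x)"
  by (rule matrix_inv_decay[OF dil])

lemma inner_bwd_pow: "x \<bullet> (mat_inv_T M ^^ n) y = ((\<lambda>x. bwd x) ^^ n) x \<bullet> y"
proof (induction n arbitrary: x)
  case (Suc n)
  have "x \<bullet> (mat_inv_T M ^^ Suc n) y = bwd x \<bullet> (mat_inv_T M ^^ n) y" by (simp add: inner_bwd)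
  also have "\<dots> = ((\<lambda>x. bwd x) ^^ Suc n) x \<bullet> y" by (subst Suc) (simp add: funpow_swap1)
  finally show ?case .
qed simp

lemma decay_T: "\<exists>C \<rho>. 0 < \<rho> \<and> \<rho> < 1 \<and> 0 < C \<and> (\<forall>n x. norm ((mat_inv_T M ^^ n) x) \<le> C * \<rho> ^ n * norm x)"
proof -
  obtain C \<rho> where C: "0 < \<rho>" "\<rho> < 1" "0 < C" "\<And>n x. norm (((\<lambda>x. bwd x) ^^ n) x) \<le> C * \<rho> ^ n * norm x"
    using decay by blast
  have "norm ((mat_inv_T M ^^ n) x) \<le> C * \<rho> ^ n * norm x" for n x
  proof (cases "(mat_inv_T M ^^ n) x = 0")
    case False
    let ?y = "(mat_inv_T M ^^ n) x"
    have "norm ?y * norm ?y = ?y \<bullet> ?y" by (simp add: dot_square_norm power2_eq_square)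
    also have "\<dots> = ((\<lambda>x. bwd x) ^^ n) ?y \<bullet> x" by (rule inner_bwd_pow)
    also have "\<dots> \<le> norm (((\<lambda>x. bwd x) ^^ n) ?y) * norm x" by (rule norm_cauchy_schwarz)
    also have "\<dots> \<le> (C * \<rho> ^ n * norm ?y) * norm x" by (intro mult_right_mono C) auto
    finally have "norm ?y * norm ?y \<le> norm ?y * (C * \<rho> ^ n * norm x)" by (simp add: mult_ac)
    thus ?thesis using False by simp
  qed (use C in auto)
  thus ?thesis using C by blast
qed

lemma Omega_nontrivial: "\<exists>\<omega>\<in>Omega_M M. \<omega> \<noteq> 0"
proof (rule ccontr)
  assume "\<not> ?thesis"
  hence "vfrac (mat_inv_T M (rvec k)) = 0" for k using vfrac_Omega by blast
  hence int: "\<exists>j. mat_inv_T M (rvec k) = rvec j" for k by (metis eq_iff_diff_eq_0 vfrac_def)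
  have ints: "\<exists>j. (mat_inv_T M ^^ n) (rvec k) = rvec j" for n k
  proof (induction n)
    case (Suc n) thus ?case using int by (metis comp_apply funpow.simps(2))
  qed auto
  obtain C \<rho> where C: "0 < \<rho>" "\<rho> < 1" "0 < C" "\<And>n x. norm ((mat_inv_T M ^^ n) x) \<le> C * \<rho> ^ n * norm x"
    using decay_T by blast
  obtain i :: 'n where True by blast
  let ?e = "axis i 1 :: int^'n"
  have "(\<lambda>n. C * \<rho> ^ n * norm (rvec ?e)) \<longlonglongrightarrow> C * 0 * norm (rvec ?e)"
    using C by (intro tendsto_intros) auto
  hence "eventually (\<lambda>n. C * \<rho> ^ n * norm (rvec ?e) < 1) sequentially"
    by (rule order_tendstoD) simp
  then obtain n where n: "C * \<rho> ^ n * norm (rvec ?e) < 1" by (auto simp: eventually_sequentially)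
  obtain j where j: "(mat_inv_T M ^^ n) (rvec ?e) = rvec j" using ints by blast
  have "norm (rvec j) < 1" using C(4)[of n "rvec ?e"] n j by simp
  hence "j = 0" using norm_rvec_ge_1 by fastforce
  have "(mat_T M ^^ n) ((mat_inv_T M ^^ n) x) = x" for x
    by (induction n arbitrary: x) (simp_all add: funpow_swap1)
  hence "rvec ?e = (mat_T M ^^ n) 0" using j \<open>j = 0\<close> by (metis rvec_0)
  also have "\<dots> = 0" by (induction n) (auto simp: mat_T_def)
  finally show False by (simp add: rvec_axis[simplified] axis_eq_0_iff)
qed

lemma sr_sum_rules:
  assumes a: "a \<in> l0" "fseries a 0 = 1" and \<omega>: "\<omega> \<in> Omega_M M - {0}"
  shows "vmom (sr a M) (\<lambda>k. a k * chr k ((2 * pi) *\<^sub>R \<omega>))"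
proof -
  define P where "P m \<longleftrightarrow> (\<forall>\<omega>\<in>Omega_M M - {0}. vanish_order (\<lambda>\<xi>. fseries a (\<xi> + (2 * pi) *\<^sub>R \<omega>)) m)" for m
  have P_iff: "P m \<longleftrightarrow> (\<forall>\<omega>\<in>Omega_M M - {0}. vmom m (\<lambda>k. a k * chr k ((2 * pi) *\<^sub>R \<omega>)))" for m
    unfolding P_def vanish_order_shift_iff ..
  have mono: "P n" if "P m" "n \<le> m" for m n using that vmom_le unfolding P_iff by blast
  have "\<exists>b. \<not> P b"
  proof (rule ccontr)
    assume "\<not> ?thesis"
    obtain \<omega> where \<omega>: "\<omega> \<in> Omega_M M - {0}" using Omega_nontrivial by blast
    have "a k = 0" for k
    proof -
      have "a k * chr k ((2 * pi) *\<^sub>R \<omega>) = 0"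
        by (rule moments_determine[OF l0_mult[OF a(1)]]) (use \<open>\<not> (\<exists>b. \<not> P b)\<close> \<omega> P_iff in blast)
      thus ?thesis by simp
    qed
    hence "fseries a 0 = 0" by (simp add: fseries_def)
    thus False using a(2) by simp
  qed
  then obtain b where "\<not> P b" by blast
  hence b: "m \<le> b" if "P m" for m using mono[OF that] by (metis nle_le)
  have "P 0" by (simp add: P_iff vmom_def)
  from GreatestI_nat[of P, OF this b] have "P (sr a M)" unfolding sr_def P_def by simp
  thus ?thesis using \<omega> unfolding P_iff by blast
qed

lemma pair_restrict: "pair (\<lambda>k. if Q k then u k else 0) p = pair u (\<lambda>k. if Q k then p k else 0)"
  if "u \<in> l0"
  by (subst (1 2) pair_superset[OF l0_finite[OF that]]) (auto intro: sum.cong)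

lemma push_coset: "push (\<lambda>k. g + M *v k) (coset_filter M g u) = (\<lambda>k. if lat (k - g) then u k else 0)"
proof
  fix k
  show "push (\<lambda>k. g + M *v k) (coset_filter M g u) k = (if lat (k - g) then u k else 0)"
  proof (cases "lat (k - g)")
    case True
    then obtain j where "k - g = M *v j" by (auto simp: lat_def)
    hence "k = g + M *v j" by (simp add: algebra_simps)
    thus ?thesis using True push_inj[OF inj_mv(2), of g "coset_filter M g u" j] by (simp add: coset_filter_def)
  next
    case False
    hence "k \<notin> range (\<lambda>k. g + M *v k)" by (auto simp: lat_def)
    thus ?thesis using False by (simp add: push_outside)
  qed
qed

lemma coset_filter_l0: "u \<in> l0 \<Longrightarrow> coset_filter M g u \<in> l0"
proof -
  assume u: "u \<in> l0"
  have "{k. coset_filter M g u k \<noteq> 0} = (\<lambda>k. g + M *v k) -` {k. u k \<noteq> 0}" by (auto simp: coset_filter_def)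
  thus ?thesis using finite_vimageI[OF l0_finite[OF u] inj_mv(2)] by (simp add: l0_def)
qed

lemma l0_restrict: "u \<in> l0 \<Longrightarrow> (\<lambda>k. if Q k then u k else 0) \<in> l0"
  by (rule l0I[of "{k. u k \<noteq> 0}"]) (auto simp: l0_def)

lemma pair_coset:
  assumes "u \<in> l0"
  shows "pair (coset_filter M g u) (\<lambda>k. p (g + M *v k)) = pair (\<lambda>k. if lat (k - g) then u k else 0) p"
  using pair_push[OF coset_filter_l0[OF assms], of "\<lambda>k. g + M *v k" g p] by (simp add: push_coset)

lemma lat_0 [simp]: "lat 0"
  unfolding lat_def by (auto intro!: image_eqI[of _ _ 0])

lemma interpolatory_at_0:
  assumes "a \<in> l0" "interpolatory M a"
  shows "pair (\<lambda>k. if lat k then a k else 0) p = p 0 / of_nat (d_M M)"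
proof -
  have "(\<lambda>k. if lat k then a k else 0) = (\<lambda>k. 1 / of_nat (d_M M) * delta k)"
    using assms by (auto simp: lat_def interpolatory_def delta_def fun_eq_iff)
       (metis matrix_vector_mult_0_right rangeI)
  thus ?thesis by (simp only: pair_scale_left pair_delta) simp
qed

text \<open>Sum rules say that the moments of \<open>a\<close> over a coset do not depend on the coset; for an
  interpolatory filter the trivial coset contributes only the value at the origin.\<close>

lemma coset_moments:
  assumes a: "a \<in> l0" "fseries a 0 = 1" "interpolatory M a" and p: "pdeg n p" "n < sr a M"
  shows "pair (\<lambda>k. if lat (k - g) then a k else 0) (\<lambda>k. p (rvec k)) = p 0 / of_nat (d_M M)"
proof -
  define N where "N = (of_nat (card (Omega_M M)) :: complex)"
  have N0: "N \<noteq> 0" unfolding N_def using finite_Omega Omega_0 by (auto simp: card_eq_0_iff)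
  have key: "N * pair (\<lambda>k. if lat (k - g) then a k else 0) (\<lambda>k. p (rvec k)) = pair a (\<lambda>k. p (rvec k))" for g
  proof -
    have "N * pair (\<lambda>k. if lat (k - g) then a k else 0) (\<lambda>k. p (rvec k))
        = pair a (\<lambda>k. N * (if lat (k - g) then p (rvec k) else 0))"
      by (simp only: pair_restrict[OF a(1)] pair_scale_right)
    also have "\<dots> = pair a (\<lambda>k. \<Sum>\<omega>\<in>Omega_M M. chr (- g) ((2 * pi) *\<^sub>R \<omega>) * (chr k ((2 * pi) *\<^sub>R \<omega>) * p (rvec k)))"
    proof (rule pair_cong)
      fix k
      have "N * (if lat (k - g) then p (rvec k) else 0) = (\<Sum>\<omega>\<in>Omega_M M. chr (- g + k) ((2 * pi) *\<^sub>R \<omega>)) * p (rvec k)"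
        by (simp add: sum_chr_Omega N_def)
      thus "N * (if lat (k - g) then p (rvec k) else 0) = (\<Sum>\<omega>\<in>Omega_M M. chr (- g) ((2 * pi) *\<^sub>R \<omega>) * (chr k ((2 * pi) *\<^sub>R \<omega>) * p (rvec k)))"
        by (simp only: chr_add sum_distrib_right mult.assoc)
    qed
    also have "\<dots> = (\<Sum>\<omega>\<in>Omega_M M. chr (- g) ((2 * pi) *\<^sub>R \<omega>) * pair (\<lambda>k. a k * chr k ((2 * pi) *\<^sub>R \<omega>)) (\<lambda>k. p (rvec k)))"
      by (simp only: pair_sum_right pair_scale_right pair_weight[OF chr_nonzero])
    also have "\<dots> = (\<Sum>\<omega>\<in>{0}. chr (- g) ((2 * pi) *\<^sub>R \<omega>) * pair (\<lambda>k. a k * chr k ((2 * pi) *\<^sub>R \<omega>)) (\<lambda>k. p (rvec k)))"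
      by (rule sum.mono_neutral_right)
         (use finite_Omega Omega_0 vmomD[OF sr_sum_rules[OF a(1,2)] p] in auto)
    finally show ?thesis by simp
  qed
  have "N * pair (\<lambda>k. if lat (k - g) then a k else 0) (\<lambda>k. p (rvec k))
      = N * pair (\<lambda>k. if lat k then a k else 0) (\<lambda>k. p (rvec k))"
    using key[of g] key[of 0] by simp
  hence "pair (\<lambda>k. if lat (k - g) then a k else 0) (\<lambda>k. p (rvec k))
      = pair (\<lambda>k. if lat k then a k else 0) (\<lambda>k. p (rvec k))"
    using N0 by (simp only: mult_cancel_left) simp
  thus ?thesis using interpolatory_at_0[OF a(1,3)] by simp
qed

end

section \<open>The filter bank\<close>

lemma list_all2_concat_map:
  "(\<And>j. j \<in> set js \<Longrightarrow> list_all2 P (f j) (g j)) \<Longrightarrow> list_all2 P (concat (map f js)) (concat (map g js))"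
  by (induction js) (auto intro: list_all2_appendI)

lemma zip_concat_map:
  "(\<And>j. j \<in> set js \<Longrightarrow> length (f j) = length (g j)) \<Longrightarrow>
    zip (concat (map f js)) (concat (map g js)) = concat (map (\<lambda>j. zip (f j) (g j)) js)"
  by (induction js) auto

lemma sum_list_concat_map: "sum_list (map h (concat (map f js))) = (\<Sum>j\<leftarrow>js. sum_list (map h (f j)))"
  by (induction js) auto

lemma sum_list_upt: "(\<Sum>j\<leftarrow>[m..<n]. f j) = (\<Sum>j\<in>{m..<n}. f j)"
  by (simp add: interv_sum_list_conv_sum_set_nat)

lemma sum_nth_zip:
  "length xs = length ys \<Longrightarrow> (\<Sum>l<length xs. h (xs ! l) (ys ! l)) = (\<Sum>(x, y)\<leftarrow>zip xs ys. h x y)"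
  by (simp add: sum_list_sum_nth atLeast0LessThan case_prod_unfold)

locale dilation_card = dilation M for M :: "int^'n^'n" +
  assumes card_Gamma: "card (Gamma_M M) = d_M M"
begin

lemma d_pos: "0 < d_M M"
  using card_Gamma finite_Gamma Gamma_0 by (metis card_gt_0_iff empty_iff)

lemma sum_lat: "(\<Sum>g\<in>Gamma_M M. if lat (k - g) then x else 0) = (x :: complex)"
proof -
  obtain g0 j where g0: "g0 \<in> Gamma_M M" "k = g0 + M *v j" using Gamma_rep by blast
  have "lat (k - g) \<longleftrightarrow> g = g0" if "g \<in> Gamma_M M" for g
  proof
    assume "lat (k - g)"
    then obtain i where "k - g = M *v i" by (auto simp: lat_def)
    hence "g + M *v i = g0 + M *v j" using g0(2) by (simp add: algebra_simps)
    thus "g = g0" using Gamma_unique(1) that g0 by blast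
  qed (use g0 in \<open>auto simp: lat_def\<close>)
  hence "(\<Sum>g\<in>Gamma_M M. if lat (k - g) then x else 0) = (\<Sum>g\<in>Gamma_M M. if g = g0 then x else 0)"
    by (intro sum.cong) auto
  thus ?thesis using g0 finite_Gamma by simp
qed

lemma pair_coset_sum:
  assumes "u \<in> l0"
  shows "pair u p = (\<Sum>g\<in>Gamma_M M. pair (\<lambda>k. if lat (k - g) then u k else 0) p)"
  by (simp only: pair_restrict[OF assms] pair_sum_right[symmetric] sum_lat)

lemma fseries_polyphase:
  assumes "u \<in> l0"
  shows "fseries u \<xi> = (\<Sum>g\<in>Gamma_M M. chr g \<xi> * fseries (coset_filter M g u) (mat_T M \<xi>))"
  unfolding fseries_pair[of u] pair_coset_sum[OF assms] push_coset[symmetric]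
  by (simp add: fseries_push_mat[OF coset_filter_l0[OF assms]] flip: fseries_pair)

lemma fseries_periodic: "fseries u (\<xi> + (2 * pi) *\<^sub>R rvec k) = fseries u \<xi>"
  by (simp add: fseries_pair chr_add_right)

definition cr :: complex where "cr = complex_of_real (real (d_M M) powr (-1/2))"
definition cq :: complex where "cq = complex_of_real (real (d_M M) powr (1/2))"

lemma crq: "cr * cr = 1 / of_nat (d_M M)" "cq * cq = of_nat (d_M M)" "cr * cq = 1" "cnj cr = cr" "cnj cq = cq"
proof -
  have "real (d_M M) powr (-1/2) * real (d_M M) powr (-1/2) = 1 / real (d_M M)"
    using d_pos by (simp add: powr_minus_divide flip: powr_add)
  thus "cr * cr = 1 / of_nat (d_M M)"
    unfolding cr_def of_real_mult[symmetric] by (simp only: of_real_divide of_real_1 of_real_of_nat_eq)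
  have "real (d_M M) powr (1/2) * real (d_M M) powr (1/2) = real (d_M M)"
    using d_pos by (simp flip: powr_add)
  thus "cq * cq = of_nat (d_M M)"
    unfolding cq_def of_real_mult[symmetric] by (simp only: of_real_of_nat_eq)
  have "real (d_M M) powr (-1/2) * real (d_M M) powr (1/2) = 1"
    using d_pos by (simp flip: powr_add)
  thus "cr * cq = 1" unfolding cr_def cq_def of_real_mult[symmetric] by simp
qed (simp_all add: cr_def cq_def)

definition bcoset :: "int^'n \<Rightarrow> 'n filt \<Rightarrow> 'n filt" where
  "bcoset g a k = cr * delta k - cq * (if lat (k - g) then a k else 0)"

definition coset_list :: "(nat \<Rightarrow> int^'n) \<Rightarrow> 'n filt \<Rightarrow> (nat \<Rightarrow> nat) \<Rightarrow> (nat \<Rightarrow> nat \<Rightarrow> 'n filt) \<Rightarrow> 'n filt list" where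
  "coset_list \<gamma> a s u = map (\<lambda>j. bcoset (\<gamma> j) a) [2..<Suc (d_M M)]
     @ concat (map (\<lambda>j. map (\<lambda>t. push (\<lambda>k. \<gamma> j + M *v k) (u j t)) [1..<Suc (s j)]) [2..<Suc (d_M M)])"

lemma bcoset_l0: "a \<in> l0 \<Longrightarrow> bcoset g a \<in> l0"
  unfolding bcoset_def[abs_def] by (intro l0_diff l0_scale l0_restrict delta_l0)

lemma bcoset_has_fseries:
  assumes "a \<in> l0"
  shows "has_fseries (bcoset g a) (\<lambda>\<xi>. cr - cq * chr g \<xi> * fseries (coset_filter M g a) (mat_T M \<xi>))"
proof -
  have "fseries (bcoset g a) \<xi> = cr - cq * fseries (push (\<lambda>k. g + M *v k) (coset_filter M g a)) \<xi>" for \<xi>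
    unfolding fseries_pair push_coset bcoset_def[abs_def]
    by (simp add: pair_diff_left l0_scale l0_restrict assms pair_scale_left)
  thus ?thesis
    using assms by (simp add: has_fseries_def bcoset_l0 fseries_push_mat coset_filter_l0 mult.assoc)
qed

lemma coset_list_has_fseries:
  assumes "a \<in> l0" "\<And>j t. j \<in> {2..d_M M} \<Longrightarrow> t \<in> {1..s j} \<Longrightarrow> u j t \<in> l0"
  shows "list_all2 has_fseries (coset_list \<gamma> a s u) (coset_series M \<gamma> a s u)"
  unfolding coset_list_def coset_series_def
proof (intro list_all2_appendI list_all2_concat_map)
  show "list_all2 has_fseries (map (\<lambda>j. bcoset (\<gamma> j) a) [2..<Suc (d_M M)])
     (map (\<lambda>j \<xi>. complex_of_real (real (d_M M) powr (- 1 / 2)) -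
        complex_of_real (real (d_M M) powr (1 / 2)) * exp (- \<i> * complex_of_real (rvec (\<gamma> j) \<bullet> \<xi>)) *
        fseries (coset_filter M (\<gamma> j) a) (mat_T M \<xi>)) [2..<Suc (d_M M)])"
    using bcoset_has_fseries[OF assms(1)] unfolding cr_def cq_def chr_def
    by (simp add: list.rel_map list_all2_same)
  fix j assume "j \<in> set [2..<Suc (d_M M)]"
  hence j: "j \<in> {2..d_M M}" by auto
  have "has_fseries (push (\<lambda>k. \<gamma> j + M *v k) (u j t)) (\<lambda>\<xi>. chr (\<gamma> j) \<xi> * fseries (u j t) (mat_T M \<xi>))"
    if "t \<in> {1..s j}" for t
    using assms(2)[OF j that] by (simp add: has_fseries_def push_l0 fseries_push_mat)
  thus "list_all2 has_fseries (map (\<lambda>t. push (\<lambda>k. \<gamma> j + M *v k) (u j t)) [1..<Suc (s j)])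
     (map (\<lambda>t \<xi>. exp (- \<i> * complex_of_real (rvec (\<gamma> j) \<bullet> \<xi>)) * fseries (u j t) (mat_T M \<xi>)) [1..<Suc (s j)])"
    by (auto simp: list.rel_map list_all2_same chr_def simp del: upt_Suc)
qed

lemma map_filter_of: "list_all2 has_fseries us Fs \<Longrightarrow> map filter_of Fs = us"
  by (induction rule: list_all2_induct) (auto simp: filter_of_eq)

lemma vmom_bcoset:
  assumes a: "a \<in> l0" "fseries a 0 = 1" "interpolatory M a" and m: "m \<le> sr a M"
  shows "vmom m (bcoset g a)"
  unfolding vmom_def
proof (intro allI impI)
  fix n and p :: "real^'n \<Rightarrow> complex" assume "n < m" "pdeg n p"
  hence "pair (bcoset g a) (\<lambda>k. p (rvec k)) = cr * p 0 - cq * (p 0 / of_nat (d_M M))"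
    using m unfolding bcoset_def[abs_def]
    by (simp add: pair_diff_left l0_scale l0_restrict a pair_scale_left coset_moments[OF a])
  also have "p 0 / of_nat (d_M M) = cr * cr * p 0" using crq(1) by simp
  also have "cr * p 0 - cq * (cr * cr * p 0) = cr * p 0 * (1 - cr * cq)" by (simp add: algebra_simps)
  finally show "pair (bcoset g a) (\<lambda>k. p (rvec k)) = 0" by (simp add: crq)
qed

lemma vmom_minus_delta:
  assumes a: "a \<in> l0" "fseries a 0 = 1" "interpolatory M a" and m: "m \<le> sr a M"
  shows "vmom m (\<lambda>k. a k - delta k)"
  unfolding vmom_def
proof (intro allI impI)
  fix n and p :: "real^'n \<Rightarrow> complex" assume n: "n < m" "pdeg n p"
  have "pair a (\<lambda>k. p (rvec k)) = (\<Sum>g\<in>Gamma_M M. p 0 / of_nat (d_M M))"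
    unfolding pair_coset_sum[OF a(1)] using n m by (intro sum.cong refl coset_moments[OF a]) auto
  also have "\<dots> = p 0" using d_pos by (simp add: card_Gamma)
  finally show "pair (\<lambda>k. a k - delta k) (\<lambda>k. p (rvec k)) = 0"
    by (simp add: pair_diff_left a)
qed

lemma vmom_uminus: "vmom m u \<Longrightarrow> vmom m (\<lambda>k. - u k)"
  using pair_scale_left[of "-1" u] by (simp add: vmom_def)

lemma vmom_push:
  assumes "u \<in> l0" "vmom m u"
  shows "vmom m (push (\<lambda>k. g + M *v k) u)"
  unfolding vmom_def
proof (intro allI impI)
  fix n and p :: "real^'n \<Rightarrow> complex" assume n: "n < m" "pdeg n p"
  have "pdeg n (\<lambda>x. p (rmat M *v x + rvec g))" by (rule pdeg_affine[OF n(2)])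
  from vmomD[OF assms(2) this n(1)] show "pair (push (\<lambda>k. g + M *v k) u) (\<lambda>k. p (rvec k)) = 0"
    by (simp add: pair_push[OF assms(1)] rvec_add rvec_mv add.commute)
qed

lemma coset_filter_moment:
  assumes a: "a \<in> l0" "fseries a 0 = 1" "interpolatory M a" and p: "pdeg n p" "n < sr a M"
  shows "pair (coset_filter M g a) (\<lambda>k. p (rvec k)) = p (bwd (- rvec g)) / of_nat (d_M M)"
proof -
  define q where "q = (\<lambda>x. p (matrix_inv (rmat M) *v x + bwd (- rvec g)))"
  have q: "pdeg n q" unfolding q_def by (rule pdeg_affine[OF p(1)])
  have "bwd (rvec (g + M *v k)) + bwd (- rvec g) = bwd (fwd (rvec k))" for k
    unfolding matrix_vector_right_distrib[symmetric] by (simp add: rvec_add rvec_mv)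
  hence "pair (coset_filter M g a) (\<lambda>k. p (rvec k)) = pair (coset_filter M g a) (\<lambda>k. q (rvec (g + M *v k)))"
    by (simp add: q_def)
  also have "\<dots> = q 0 / of_nat (d_M M)" unfolding pair_coset[OF a(1), of g "\<lambda>k. q (rvec k)"] by (rule coset_moments[OF a q p(2)])
  finally show ?thesis by (simp add: q_def)
qed

lemma h_filter_props:
  assumes a: "a \<in> l0" "fseries a 0 = 1" "interpolatory M a"
    and a': "a' \<in> l0" "fseries a' 0 = 1" "interpolatory M a'"
    and m: "m \<le> sr a M" "m \<le> sr a' M"
  shows "has_fseries (h_filter M a a' g) (h_series M a a' g)" "vmom m (h_filter M a a' g)"
proof -
  let ?c = "coset_filter M g a" and ?c' = "coset_filter M g a'" and ?d = "of_nat (d_M M) :: complex"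
  define v where "v = conv (adj ?c) ?c'"
  define h where "h = (\<lambda>k. 1 / ?d * delta k - ?d * v k)"
  have c: "?c \<in> l0" "?c' \<in> l0" using a a' by (simp_all add: coset_filter_l0)
  have v: "v \<in> l0" using c by (simp add: v_def conv_l0 adj_l0)
  have h: "has_fseries h (h_series M a a' g)"
    using has_fseries_diff[OF has_fseries_scale[OF has_fseries_delta, of "1 / ?d"] has_fseries_scale[OF
        has_fseries_conv[OF has_fseries_adj[OF has_fseries_self[OF c(1)]] has_fseries_self[OF c(2)]], of ?d]]
    unfolding h_def v_def h_series_def[abs_def] by (simp add: mult.assoc)
  hence eq: "h_filter M a a' g = h" unfolding h_filter_def by (rule filter_of_eq)
  show "has_fseries (h_filter M a a' g) (h_series M a a' g)" unfolding eq by (rule h)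
  show "vmom m (h_filter M a a' g)" unfolding eq vmom_def
  proof (intro allI impI)
    fix n and p :: "real^'n \<Rightarrow> complex" assume n: "n < m" "pdeg n p"
    let ?z = "bwd (- rvec g)"
    have 1: "pair ?c' (\<lambda>k. p (- rvec j + rvec k)) = p (- rvec j + ?z) / ?d" for j
    proof -
      have "pdeg n (\<lambda>x. p (mat 1 *v x + (- rvec j)))" by (rule pdeg_affine[OF n(2)])
      hence "pdeg n (\<lambda>x. p (- rvec j + x))" by (simp add: add.commute)
      from coset_filter_moment[OF a' this] n m show ?thesis by simp
    qed
    have 2: "pair ?c (\<lambda>k. cnj (p (- rvec k + ?z))) = cnj (p (- ?z + ?z)) / ?d"
    proof -
      have "pdeg n (\<lambda>x. cnj (p ((- mat 1) *v x + ?z)))" by (intro pdeg_cnj pdeg_affine n)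
      hence "pdeg n (\<lambda>x. cnj (p (- x + ?z)))"
        using matrix_vector_mult_diff_rdistrib[of 0 "mat 1 :: real^'n^'n"] by simp
      from coset_filter_moment[OF a this] n m show ?thesis by simp
    qed
    have "pair v (\<lambda>k. p (rvec k)) = cnj (pair ?c (\<lambda>j. cnj (p (- rvec j + ?z)) / ?d))"
    proof -
      have "pair v (\<lambda>k. p (rvec k)) = cnj (pair ?c (\<lambda>j. cnj (pair ?c' (\<lambda>k. p (- rvec j + rvec k)))))"
        unfolding v_def using c by (simp add: pair_conv adj_l0 pair_adj rvec_add rvec_minus)
      thus ?thesis unfolding 1 by simp
    qed
    also have "\<dots> = p 0 / (?d * ?d)"
      using pair_scale_right[of ?c "1 / ?d" "\<lambda>j. cnj (p (- rvec j + ?z))"] 2 by simp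
    finally have "pair h (\<lambda>k. p (rvec k)) = 1 / ?d * p 0 - ?d * (p 0 / (?d * ?d))"
      unfolding h_def using v by (simp add: pair_diff_left l0_scale pair_scale_left del: times_divide_eq_left times_divide_eq_right)
    also have "\<dots> = 0" using d_pos by simp
    finally show "pair h (\<lambda>k. p (rvec k)) = 0" .
  qed
qed

lemma filter_bank_sum:
  assumes \<gamma>: "bij_betw \<gamma> {1..d_M M} (Gamma_M M)" "\<gamma> 1 = 0"
    and a: "a \<in> l0" "interpolatory M a" and a': "a' \<in> l0" "interpolatory M a'"
    and h: "\<And>j. j \<in> {2..d_M M} \<Longrightarrow> h_series M a a' (\<gamma> j) (mat_T M \<xi>) =
       (\<Sum>t=1..s j. cnj (fseries (u j t) (mat_T M \<xi>)) * fseries (u' j t) (mat_T M \<xi>))"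
    and \<omega>: "\<omega> \<in> Omega_M M"
  defines "\<eta> \<equiv> \<xi> + (2 * pi) *\<^sub>R \<omega>"
  shows "cnj (fseries a \<xi>) * fseries a' \<eta> + (\<Sum>(F, G)\<leftarrow>zip (b_series M \<gamma> a s u) (b_dual_series M \<gamma> a' s u'). cnj (F \<xi>) * G \<eta>)
    = (if \<omega> = 0 then 1 else 0)"
proof -
  let ?d = "of_nat (d_M M) :: complex" and ?J = "{2..d_M M}"
  define x where "x j = chr (\<gamma> j) ((2 * pi) *\<^sub>R \<omega>)" for j
  define \<alpha> where "\<alpha> j = chr (\<gamma> j) \<xi> * fseries (coset_filter M (\<gamma> j) a) (mat_T M \<xi>)" for j
  define \<beta> where "\<beta> j = chr (\<gamma> j) \<xi> * fseries (coset_filter M (\<gamma> j) a') (mat_T M \<xi>)" for j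
  obtain \<kappa> where "mat_T M \<omega> = rvec \<kappa>" using \<omega> unfolding Omega_iff by blast
  hence T\<eta>: "fseries v (mat_T M \<eta>) = fseries v (mat_T M \<xi>)" for v
    unfolding \<eta>_def by (simp add: mat_T_add mat_T_scale fseries_periodic)
  have chr\<eta>: "chr (\<gamma> j) \<eta> = x j * chr (\<gamma> j) \<xi>" for j by (simp add: \<eta>_def x_def chr_add_right)
  have split: "(\<Sum>g\<in>Gamma_M M. f g) = f 0 + (\<Sum>j\<in>?J. f (\<gamma> j))" for f :: "int^'n \<Rightarrow> complex"
  proof -
    have "(\<Sum>g\<in>Gamma_M M. f g) = (\<Sum>j\<in>{1..d_M M}. f (\<gamma> j))"
      by (rule sum.reindex_bij_betw[OF \<gamma>(1), symmetric])
    also have "\<dots> = f (\<gamma> 1) + (\<Sum>j\<in>?J. f (\<gamma> j))"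
      using d_pos by (subst sum.atLeast_Suc_atMost) (auto simp: numeral_2_eq_2)
    finally show ?thesis using \<gamma>(2) by simp
  qed
  have co0: "fseries (coset_filter M 0 v) y = 1 / ?d" if "interpolatory M v" for v y
  proof -
    have "coset_filter M 0 v = (\<lambda>k. 1 / ?d * delta k)"
      using that by (auto simp: coset_filter_def interpolatory_def delta_def)
    thus ?thesis by (simp add: fseries_pair pair_scale_left del: times_divide_eq_left)
  qed
  have A: "fseries a \<xi> = 1 / ?d + (\<Sum>j\<in>?J. \<alpha> j)"
    unfolding fseries_polyphase[OF a(1)] split \<alpha>_def using co0[OF a(2)] by simp
  have B: "fseries a' \<eta> = 1 / ?d + (\<Sum>j\<in>?J. x j * \<beta> j)"
    unfolding fseries_polyphase[OF a'(1)] split \<beta>_def T\<eta> chr\<eta> using co0[OF a'(2)] by (simp add: mult.assoc)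
  have X: "1 + (\<Sum>j\<in>?J. x j) = (if \<omega> = 0 then ?d else 0)"
    using split[of "\<lambda>g. chr g ((2 * pi) *\<^sub>R \<omega>)"]
    unfolding sum_chr_Gamma[OF \<omega>] card_Gamma x_def[symmetric] by (simp only: chr_0)
  have coset: "(cr - cq * chr (\<gamma> j) \<xi> * fseries (coset_filter M (\<gamma> j) a) (mat_T M \<xi>)) = cr - cq * \<alpha> j"
    "(cr - cq * chr (\<gamma> j) \<eta> * fseries (coset_filter M (\<gamma> j) a') (mat_T M \<eta>)) = cr - cq * (x j * \<beta> j)" for j
    by (simp_all add: \<alpha>_def \<beta>_def T\<eta> chr\<eta>)
  have ut: "(\<Sum>t=1..s j. cnj (chr (\<gamma> j) \<xi> * fseries (u j t) (mat_T M \<xi>)) * (chr (\<gamma> j) \<eta> * fseries (u' j t) (mat_T M \<eta>)))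
      = x j * (1 / ?d - ?d * cnj (\<alpha> j) * \<beta> j)" if j: "j \<in> ?J" for j
  proof -
    have "(\<Sum>t=1..s j. cnj (chr (\<gamma> j) \<xi> * fseries (u j t) (mat_T M \<xi>)) * (chr (\<gamma> j) \<eta> * fseries (u' j t) (mat_T M \<eta>)))
      = (\<Sum>t=1..s j. (cnj (chr (\<gamma> j) \<xi>) * chr (\<gamma> j) \<xi>) * (x j * (cnj (fseries (u j t) (mat_T M \<xi>)) * fseries (u' j t) (mat_T M \<xi>))))"
      by (intro sum.cong refl) (simp add: T\<eta> chr\<eta> algebra_simps del: chr_cnj_mult)
    also have "\<dots> = x j * h_series M a a' (\<gamma> j) (mat_T M \<xi>)"
      unfolding h[OF j] by (simp add: sum_distrib_left)
    also have "h_series M a a' (\<gamma> j) (mat_T M \<xi>) = 1 / ?d - ?d * ((cnj (chr (\<gamma> j) \<xi>) * chr (\<gamma> j) \<xi>) *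
        (cnj (fseries (coset_filter M (\<gamma> j) a) (mat_T M \<xi>)) * fseries (coset_filter M (\<gamma> j) a') (mat_T M \<xi>)))"
      by (simp add: h_series_def)
    also have "\<dots> = 1 / ?d - ?d * cnj (\<alpha> j) * \<beta> j"
      unfolding \<alpha>_def \<beta>_def by (simp add: algebra_simps del: chr_cnj_mult)
    finally show ?thesis .
  qed
  have e1: "(\<Sum>(F, G)\<leftarrow>zip (b_series M \<gamma> a s u) (b_dual_series M \<gamma> a' s u'). cnj (F \<xi>) * G \<eta>)
    = cnj (fseries a \<xi> - 1) * (1 - fseries a' \<eta>)
      + ((\<Sum>j\<in>?J. cnj (cr - cq * \<alpha> j) * (cr - cq * (x j * \<beta> j)))
      + (\<Sum>j\<in>?J. x j * (1 / ?d - ?d * cnj (\<alpha> j) * \<beta> j)))"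
  proof -
    have "zip (coset_series M \<gamma> a s u) (coset_series M \<gamma> a' s u') =
        map (\<lambda>j. ((\<lambda>\<xi>. cr - cq * chr (\<gamma> j) \<xi> * fseries (coset_filter M (\<gamma> j) a) (mat_T M \<xi>)),
                  (\<lambda>\<xi>. cr - cq * chr (\<gamma> j) \<xi> * fseries (coset_filter M (\<gamma> j) a') (mat_T M \<xi>)))) [2..<Suc (d_M M)]
        @ concat (map (\<lambda>j. map (\<lambda>t. ((\<lambda>\<xi>. chr (\<gamma> j) \<xi> * fseries (u j t) (mat_T M \<xi>)),
                                    (\<lambda>\<xi>. chr (\<gamma> j) \<xi> * fseries (u' j t) (mat_T M \<xi>)))) [1..<Suc (s j)]) [2..<Suc (d_M M)])"
      unfolding coset_series_def cr_def[symmetric] cq_def[symmetric] chr_def[symmetric]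
      by (subst zip_append) (simp_all add: zip_concat_map zip_map_map zip_same_conv_map o_def del: upt_Suc)
    hence "(\<Sum>(F, G)\<leftarrow>zip (b_series M \<gamma> a s u) (b_dual_series M \<gamma> a' s u'). cnj (F \<xi>) * G \<eta>)
      = cnj (fseries a \<xi> - 1) * (1 - fseries a' \<eta>) +
        ((\<Sum>j\<in>?J. cnj (cr - cq * \<alpha> j) * (cr - cq * (x j * \<beta> j))) +
        (\<Sum>j\<in>?J. \<Sum>t=1..s j. cnj (chr (\<gamma> j) \<xi> * fseries (u j t) (mat_T M \<xi>)) * (chr (\<gamma> j) \<eta> * fseries (u' j t) (mat_T M \<eta>))))"
      unfolding b_series_def b_dual_series_def
      by (simp add: sum_list_concat_map sum_list_upt o_def coset atLeastLessThanSuc_atLeastAtMost del: upt_Suc complex_cnj_mult complex_cnj_diff)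
    thus ?thesis using ut by simp
  qed
  have e2: "(\<Sum>j\<in>?J. cnj (cr - cq * \<alpha> j) * (cr - cq * (x j * \<beta> j)))
      + (\<Sum>j\<in>?J. x j * (1 / ?d - ?d * cnj (\<alpha> j) * \<beta> j))
      = (\<Sum>j\<in>?J. 1 / ?d) - cnj (\<Sum>j\<in>?J. \<alpha> j) - (\<Sum>j\<in>?J. x j * \<beta> j) + (\<Sum>j\<in>?J. x j) / ?d"
  proof -
    have "cnj (cr - cq * \<alpha> j) * (cr - cq * (x j * \<beta> j)) + x j * (1 / ?d - ?d * cnj (\<alpha> j) * \<beta> j)
        = 1 / ?d - cnj (\<alpha> j) - x j * \<beta> j + x j / ?d" for j
    proof -
      have "cnj (cr - cq * \<alpha> j) * (cr - cq * (x j * \<beta> j)) = cr * cr - (cr * cq) * (cnj (\<alpha> j) + x j * \<beta> j) + (cq * cq) * (cnj (\<alpha> j) * (x j * \<beta> j))"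
        by (simp add: crq(4,5) algebra_simps)
      thus ?thesis unfolding crq by (simp add: algebra_simps)
    qed
    thus ?thesis
      unfolding cnj_sum sum_divide_distrib sum.distrib[symmetric] sum_subtractf[symmetric] by (intro sum.cong refl)
  qed
  have e3: "(\<Sum>j\<in>?J. 1 / ?d) = 1 - 1 / ?d"
    using d_pos by (simp add: field_simps of_nat_diff)
  have alg: "(c + p) * (c + q) + ((c + p - 1) * (1 - (c + q)) + (1 - c - p - q + r * c)) = (1 + r) * c" for c p q r :: complex
    by (simp add: algebra_simps)
  have cd: "cnj (1 / ?d) = 1 / ?d" by simp
  have "cnj (fseries a \<xi>) * fseries a' \<eta> + (\<Sum>(F, G)\<leftarrow>zip (b_series M \<gamma> a s u) (b_dual_series M \<gamma> a' s u'). cnj (F \<xi>) * G \<eta>)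
    = (1 + (\<Sum>j\<in>?J. x j)) / ?d"
    unfolding e1 unfolding e2 unfolding e3 A B complex_cnj_add complex_cnj_diff cd complex_cnj_one
    using alg[of "1 / ?d" "cnj (\<Sum>j\<in>?J. \<alpha> j)" "\<Sum>j\<in>?J. x j * \<beta> j" "\<Sum>j\<in>?J. x j"]
    by (simp only: times_divide_eq_right mult_1_right)
  thus ?thesis using X d_pos by (auto split: if_splits)
qed

lemma filter_bank:
  assumes \<gamma>: "bij_betw \<gamma> {1..d_M M} (Gamma_M M)" "\<gamma> 1 = 0"
    and a: "a \<in> l0" "fseries a 0 = 1" "interpolatory M a" and a': "a' \<in> l0" "fseries a' 0 = 1" "interpolatory M a'"
    and n: "n1 + n2 = min (sr a M) (sr a' M)"
    and fac: "\<And>j. j \<in> {2..d_M M} \<Longrightarrow> h_factorization (h_filter M a a' (\<gamma> j)) n1 n2 (s j) (u j) (u' j)"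
  defines "bs \<equiv> map filter_of (b_series M \<gamma> a s u)" and "bs' \<equiv> map filter_of (b_dual_series M \<gamma> a' s u')"
  shows "list_all2 has_fseries bs (b_series M \<gamma> a s u)" "list_all2 has_fseries bs' (b_dual_series M \<gamma> a' s u')"
    "filter_bank_claims M a a' n1 n2 bs bs'"
    "\<forall>b\<in>set bs. b \<in> l0 \<and> vmom n1 b" "\<forall>b\<in>set bs'. b \<in> l0 \<and> vmom n2 b"
proof -
  define cs where "cs = (\<lambda>k. a k - delta k) # coset_list \<gamma> a s u"
  define cs' where "cs' = (\<lambda>k. delta k - a' k) # coset_list \<gamma> a' s u'"
  have u: "u j t \<in> l0" "u' j t \<in> l0" "vmom n1 (u j t)" "vmom n2 (u' j t)" if "j \<in> {2..d_M M}" "t \<in> {1..s j}" for j t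
    using fac[OF that(1)] that(2) unfolding h_factorization_def vanish_order_iff by auto
  have h1: "has_fseries (\<lambda>k. a k - delta k) (\<lambda>\<xi>. fseries a \<xi> - 1)" "has_fseries (\<lambda>k. delta k - a' k) (\<lambda>\<xi>. 1 - fseries a' \<xi>)"
    using a a' by (auto intro!: has_fseries_diff has_fseries_self has_fseries_delta)
  have cs: "list_all2 has_fseries cs (b_series M \<gamma> a s u)"
    unfolding cs_def b_series_def using h1(1) coset_list_has_fseries[OF a(1), of s u \<gamma>] u by simp
  have cs': "list_all2 has_fseries cs' (b_dual_series M \<gamma> a' s u')"
    unfolding cs'_def b_dual_series_def using h1(2) coset_list_has_fseries[OF a'(1), of s u' \<gamma>] u by simp
  have bs: "bs = cs" unfolding bs_def using cs by (rule map_filter_of)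
  have bs': "bs' = cs'" unfolding bs'_def using cs' by (rule map_filter_of)
  show 1: "list_all2 has_fseries bs (b_series M \<gamma> a s u)" unfolding bs by (rule cs)
  show 2: "list_all2 has_fseries bs' (b_dual_series M \<gamma> a' s u')" unfolding bs' by (rule cs')
  have \<gamma>2: "\<gamma> j \<in> Gamma_M M" "\<not> lat (\<gamma> j)" if "j \<in> {2..d_M M}" for j
  proof -
    show G: "\<gamma> j \<in> Gamma_M M" using \<gamma>(1) that by (auto simp: bij_betw_def)
    show "\<not> lat (\<gamma> j)"
    proof
      assume "lat (\<gamma> j)"
      then obtain k where "\<gamma> j = M *v k" by (auto simp: lat_def)
      hence "\<gamma> j + M *v 0 = 0 + M *v k" by simp
      from Gamma_unique(1)[OF G Gamma_0 this] have "\<gamma> j = \<gamma> 1" using \<gamma>(2) by simp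
      hence "j = 1" by (rule inj_onD[OF bij_betw_imp_inj_on[OF \<gamma>(1)]]) (use that in auto)
      thus False using that by simp
    qed
  qed
  have set: "b = (\<lambda>k. a k - delta k) \<or> b = (\<lambda>k. delta k - a k) \<or> (\<exists>j\<in>{2..d_M M}. b = bcoset (\<gamma> j) a) \<or>
      (\<exists>j\<in>{2..d_M M}. \<exists>t\<in>{1..s j}. b = push (\<lambda>k. \<gamma> j + M *v k) (u j t))"
    if "b = (\<lambda>k. a k - delta k) \<or> b = (\<lambda>k. delta k - a k) \<or> b \<in> set (coset_list \<gamma> a s u)" for b a u
    using that unfolding coset_list_def by (auto simp del: upt_Suc) fastforce+
  have vm: "b \<in> l0 \<and> vmom m b \<and> (\<forall>k. k \<noteq> 0 \<longrightarrow> b (M *v k) = 0)"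
    if b: "b = (\<lambda>k. a k - delta k) \<or> b = (\<lambda>k. delta k - a k) \<or> b \<in> set (coset_list \<gamma> a s u)"
      and a: "a \<in> l0" "fseries a 0 = 1" "interpolatory M a" and m: "m \<le> sr a M"
      and u: "\<And>j t. j \<in> {2..d_M M} \<Longrightarrow> t \<in> {1..s j} \<Longrightarrow> u j t \<in> l0 \<and> vmom m (u j t)" for b a u m
  proof -
    consider "b = (\<lambda>k. a k - delta k)" | "b = (\<lambda>k. delta k - a k)" | j where "j \<in> {2..d_M M}" "b = bcoset (\<gamma> j) a"
      | j t where "j \<in> {2..d_M M}" "t \<in> {1..s j}" "b = push (\<lambda>k. \<gamma> j + M *v k) (u j t)"
      using set[OF b] by blast
    moreover have z: "a (M *v k) = 0" "delta (M *v k) = 0" if "k \<noteq> 0" for k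
      using that a(3) by (simp_all add: interpolatory_def delta_def)
    ultimately show ?thesis
    proof cases
      case 1
      thus ?thesis using a m z by (simp add: l0_diff vmom_minus_delta)
    next
      case 2
      thus ?thesis using a z vmom_uminus[OF vmom_minus_delta[OF a m]] by (simp add: l0_diff)
    next
      case 3
      have "b (M *v k) = 0" if "k \<noteq> 0" for k
      proof -
        have "\<not> lat (M *v k - \<gamma> j)"
        proof
          assume "lat (M *v k - \<gamma> j)"
          then obtain i where "M *v k - \<gamma> j = M *v i" by (auto simp: lat_def)
          hence "\<gamma> j = M *v (k - i)" by (simp add: matrix_vector_mult_diff_distrib algebra_simps)
          hence "lat (\<gamma> j)" by (simp add: lat_def)
          thus False using \<gamma>2 3 by blast
        qed
        thus ?thesis using that by (simp add: 3 bcoset_def delta_def)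
      qed
      thus ?thesis using a m by (simp add: 3 bcoset_l0 vmom_bcoset)
    next
      case 4
      have "b (M *v k) = 0" for k
        unfolding 4
      proof (rule push_outside, rule notI)
        assume "M *v k \<in> range (\<lambda>k. \<gamma> j + M *v k)"
        then obtain i where "M *v k = \<gamma> j + M *v i" by auto
        hence "\<gamma> j = M *v (k - i)" by (simp add: matrix_vector_mult_diff_distrib algebra_simps)
        hence "lat (\<gamma> j)" by (simp add: lat_def)
        thus False using \<gamma>2 4 by blast
      qed
      thus ?thesis using u[OF 4(1,2)] by (simp add: 4(3) push_l0 vmom_push)
    qed
  qed
  have vb: "b \<in> l0 \<and> vmom n1 b \<and> (\<forall>k. k \<noteq> 0 \<longrightarrow> b (M *v k) = 0)" if "b \<in> set bs" for b
    using vm[of b a u n1] that u a n unfolding bs cs_def by auto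
  have vb': "b \<in> l0 \<and> vmom n2 b \<and> (\<forall>k. k \<noteq> 0 \<longrightarrow> b (M *v k) = 0)" if "b \<in> set bs'" for b
    using vm[of b a' u' n2] that u a' n unfolding bs' cs'_def by auto
  show "\<forall>b\<in>set bs. b \<in> l0 \<and> vmom n1 b" "\<forall>b\<in>set bs'. b \<in> l0 \<and> vmom n2 b" using vb vb' by auto
  have vmf: "enat n \<le> Min (vm_filt ` set L)" if "L \<noteq> []" "\<And>b. b \<in> set L \<Longrightarrow> vmom n b" for L :: "'n filt list" and n
  proof -
    have "enat n \<le> vm_filt b" if "b \<in> set L" for b
      unfolding vm_filt_def by (rule SUP_upper) (use \<open>\<And>b. b \<in> set L \<Longrightarrow> vmom n b\<close> that in \<open>simp add: vanish_order_iff\<close>)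
    thus ?thesis using that(1) by simp
  qed
  have len: "length bs = length bs'" "length (b_series M \<gamma> a s u) = length bs" "length (b_dual_series M \<gamma> a' s u') = length bs'"
    using 1 2 by (auto simp: bs_def bs'_def b_series_def b_dual_series_def coset_series_def length_concat o_def)
  have dual: "dual_filter_bank M a bs a' bs'"
    unfolding dual_filter_bank_def
  proof (intro conjI allI ballI)
    fix \<xi> \<omega> assume \<omega>: "\<omega> \<in> Omega_M M"
    have hs: "h_series M a a' (\<gamma> j) y = (\<Sum>t=1..s j. cnj (fseries (u j t) y) * fseries (u' j t) y)" if "j \<in> {2..d_M M}" for j y
      using has_fseriesD[OF h_filter_props(1)[OF a a' order_refl, of "\<gamma> j"], of y] fac[OF that] 
        has_fseriesD[OF h_filter_props(1)[OF a a', of 0 "\<gamma> j"], of y]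
      unfolding h_factorization_def by simp
    have "(\<Sum>l<length bs. cnj (fseries (bs ! l) \<xi>) * fseries (bs' ! l) (\<xi> + (2 * pi) *\<^sub>R \<omega>))
        = (\<Sum>l<length (b_series M \<gamma> a s u). cnj ((b_series M \<gamma> a s u ! l) \<xi>) * (b_dual_series M \<gamma> a' s u' ! l) (\<xi> + (2 * pi) *\<^sub>R \<omega>))"
    proof (rule sum.cong)
      fix l assume "l \<in> {..<length (b_series M \<gamma> a s u)}"
      hence l: "l < length bs" "l < length bs'" using len by auto
      show "cnj (fseries (bs ! l) \<xi>) * fseries (bs' ! l) (\<xi> + (2 * pi) *\<^sub>R \<omega>)
        = cnj ((b_series M \<gamma> a s u ! l) \<xi>) * (b_dual_series M \<gamma> a' s u' ! l) (\<xi> + (2 * pi) *\<^sub>R \<omega>)"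
        using has_fseriesD[OF list_all2_nthD[OF 1 l(1)]] has_fseriesD[OF list_all2_nthD[OF 2 l(2)]] by simp
    qed (use len in simp)
    also have "\<dots> = (\<Sum>(F, G)\<leftarrow>zip (b_series M \<gamma> a s u) (b_dual_series M \<gamma> a' s u'). cnj (F \<xi>) * G (\<xi> + (2 * pi) *\<^sub>R \<omega>))"
      using len by (intro sum_nth_zip) simp
    finally show "cnj (fseries a \<xi>) * fseries a' (\<xi> + (2 * pi) *\<^sub>R \<omega>)
        + (\<Sum>l<length bs. cnj (fseries (bs ! l) \<xi>) * fseries (bs' ! l) (\<xi> + (2 * pi) *\<^sub>R \<omega>)) = (if \<omega> = 0 then 1 else 0)"
      using filter_bank_sum[OF \<gamma> a(1,3) a'(1,3) hs \<omega>] by simp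
  qed (rule len)
  show "filter_bank_claims M a a' n1 n2 bs bs'"
    unfolding filter_bank_claims_def
  proof (intro conjI dual)
    have ne: "bs \<noteq> []" "bs' \<noteq> []" by (auto simp: bs cs_def bs' cs'_def)
    show "bs \<noteq> []" by (rule ne)
    show "enat n1 \<le> Min (vm_filt ` set bs)" by (rule vmf[OF ne(1)]) (use vb in auto)
    show "enat n2 \<le> Min (vm_filt ` set bs')" by (rule vmf[OF ne(2)]) (use vb' in auto)
    show "set bs \<subseteq> l0" using vb by auto
    show "set bs' \<subseteq> l0" using vb' by auto
    show "\<forall>b\<in>set bs \<union> set bs'. \<forall>k. k \<noteq> 0 \<longrightarrow> b (M *v k) = 0" using vb vb' by (metis Un_iff)
  qed
qed

end

section \<open>Growth of iterated filters\<close>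

lemma submultiplicative_root_convergent:
  fixes x :: "nat \<Rightarrow> real"
  assumes x: "\<And>n. 0 \<le> x n" and C: "0 < C" and sub: "\<And>n p. x (n + p) \<le> C * x n * x p"
  shows "convergent (\<lambda>n. x n powr (1 / real n))"
proof -
  define y where "y n = C * x n" for n
  have y: "0 \<le> y n" "y (n + p) \<le> y n * y p" for n p
    using x C mult_left_mono[OF sub[of n p], of C] by (auto simp: y_def mult_ac)
  define L where "L = (INF p\<in>{1..}. y p powr (1 / real p))"
  have bdd: "bdd_below ((\<lambda>p. y p powr (1 / real p)) ` {1..})" by (auto intro: bdd_belowI[of _ 0])
  have L0: "0 \<le> L" unfolding L_def by (intro cINF_greatest) auto
  have low: "L \<le> y n powr (1 / real n)" if "1 \<le> n" for n
    unfolding L_def by (rule cINF_lower[OF bdd]) (use that in auto)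
  have "(\<lambda>n. y n powr (1 / real n)) \<longlonglongrightarrow> L"
  proof (rule LIMSEQ_I)
    fix e :: real assume e: "0 < e"
    define t where "t = L + e / 2"
    have t: "0 < t" "L < t" using e L0 by (auto simp: t_def)
    obtain p where p: "1 \<le> p" "y p powr (1 / real p) < t"
      using t(2) cINF_less_iff[OF _ bdd, of t] unfolding L_def by auto
    have "y p = (y p powr (1 / real p)) ^ p" using p(1) y(1)[of p]
      by (cases "y p = 0") (auto simp: powr_powr simp flip: powr_realpow)
    also have "\<dots> \<le> t ^ p" using p(2) by (intro power_mono) auto
    finally have yp: "y p \<le> t ^ p" .
    define D where "D = 1 + (\<Sum>r<p. y r / t ^ r)"
    have D: "0 < D" unfolding D_def using y t by (intro add_pos_nonneg sum_nonneg) auto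
    have yD: "y n \<le> D * t ^ n" for n
    proof (induction n rule: less_induct)
      case (less n)
      show ?case
      proof (cases "n < p")
        case True
        have "y n / t ^ n \<le> (\<Sum>r<p. y r / t ^ r)" using True y t by (intro member_le_sum) auto
        hence "y n / t ^ n \<le> D" by (simp add: D_def)
        thus ?thesis using t by (simp add: field_simps)
      next
        case False
        have "y n \<le> y p * y (n - p)" using y(2)[of p "n - p"] False by simp
        also have "\<dots> \<le> t ^ p * (D * t ^ (n - p))"
          using yp less[of "n - p"] p(1) False y t by (intro mult_mono) auto
        also have "\<dots> = D * t ^ n" using False by (simp add: mult_ac flip: power_add)
        finally show ?thesis .
      qed
    qed
    have "(\<lambda>n. D powr (1 / real n) * t) \<longlonglongrightarrow> D powr 0 * t"
      using D by (intro tendsto_mult tendsto_powr tendsto_const lim_1_over_n) auto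
    hence "(\<lambda>n. D powr (1 / real n) * t) \<longlonglongrightarrow> t" using D by simp
    hence "eventually (\<lambda>n. D powr (1 / real n) * t < L + e) sequentially"
      by (rule order_tendstoD) (use e in \<open>simp add: t_def\<close>)
    then obtain N where N: "\<And>n. n \<ge> N \<Longrightarrow> D powr (1 / real n) * t < L + e" by (auto simp: eventually_sequentially)
    show "\<exists>N. \<forall>n\<ge>N. norm (y n powr (1 / real n) - L) < e"
    proof (intro exI allI impI)
      fix n assume n: "max 1 N \<le> n"
      have "y n powr (1 / real n) \<le> (D * t ^ n) powr (1 / real n)"
        using yD y by (intro powr_mono2) auto
      also have "\<dots> = D powr (1 / real n) * t"
        using n D t by (simp add: powr_mult powr_powr flip: powr_realpow)
      also have "\<dots> < L + e" using N n by simp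
      finally show "norm (y n powr (1 / real n) - L) < e" using low[of n] n by simp
    qed
  qed
  moreover have "(\<lambda>n. (1 / C) powr (1 / real n)) \<longlonglongrightarrow> (1 / C) powr 0"
    using C by (intro tendsto_powr tendsto_const lim_1_over_n) auto
  ultimately have "(\<lambda>n. (1 / C) powr (1 / real n) * y n powr (1 / real n)) \<longlonglongrightarrow> (1 / C) powr 0 * L"
    by (intro tendsto_mult)
  moreover have "(1 / C) powr (1 / real n) * y n powr (1 / real n) = x n powr (1 / real n)" for n
    using C x by (simp add: y_def flip: powr_mult)
  ultimately show ?thesis unfolding convergent_def by auto
qed

lemma geometric_bound_of_root_limit:
  fixes x :: "nat \<Rightarrow> real"
  assumes x: "\<And>n. 0 \<le> x n" and lim: "(\<lambda>n. x n powr (1 / real n)) \<longlonglongrightarrow> L" and s: "L < s" "0 < s"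
  shows "\<exists>K. \<forall>n. x n \<le> K * s ^ n"
proof -
  from order_tendstoD(2)[OF lim s(1)] obtain N where N: "\<And>n. n \<ge> N \<Longrightarrow> x n powr (1 / real n) < s"
    by (auto simp: eventually_sequentially)
  define K where "K = 1 + (\<Sum>r\<le>N. x r / s ^ r)"
  have sum0: "0 \<le> (\<Sum>r\<le>N. x r / s ^ r)" using x s by (intro sum_nonneg) auto
  have "x n \<le> K * s ^ n" for n
  proof (cases "n \<le> N")
    case True
    have "x n / s ^ n \<le> (\<Sum>r\<le>N. x r / s ^ r)" using True x s by (intro member_le_sum) auto
    hence "x n / s ^ n \<le> K" by (simp add: K_def)
    thus ?thesis using s by (simp add: field_simps)
  next
    case False
    hence n: "n > 0" by simp
    have "x n = (x n powr (1 / real n)) ^ n" using n x[of n]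
      by (cases "x n = 0") (auto simp: powr_powr simp flip: powr_realpow)
    also have "\<dots> \<le> s ^ n" using N[of n] False by (intro power_mono) auto
    also have "\<dots> \<le> K * s ^ n" using sum0 s by (simp add: K_def)
    finally show ?thesis .
  qed
  thus ?thesis by blast
qed

definition seminorm :: "(('n::finite) filt \<Rightarrow> real) \<Rightarrow> bool" where
  "seminorm p \<longleftrightarrow> (\<forall>f\<in>l0. 0 \<le> p f) \<and> (\<forall>f\<in>l0. \<forall>g\<in>l0. p (\<lambda>k. f k + g k) \<le> p f + p g)
     \<and> (\<forall>c. \<forall>f\<in>l0. p (\<lambda>k. c * f k) \<le> norm c * p f)"

lemma seminormD:
  assumes "seminorm p"
  shows "f \<in> l0 \<Longrightarrow> 0 \<le> p f" "f \<in> l0 \<Longrightarrow> g \<in> l0 \<Longrightarrow> p (\<lambda>k. f k + g k) \<le> p f + p g"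
    "f \<in> l0 \<Longrightarrow> p (\<lambda>k. c * f k) \<le> norm c * p f"
  using assms by (auto simp: seminorm_def)

text \<open>By Gaussian elimination on the values at the points of \<open>K\<close>.\<close>

lemma finite_span_bound:
  fixes S :: "('n::finite) filt set"
  assumes "finite K" "\<And>s k. s \<in> S \<Longrightarrow> k \<notin> K \<Longrightarrow> s k = 0"
  shows "\<exists>B C. finite B \<and> B \<subseteq> S \<and> 0 \<le> C \<and>
    (\<forall>p s. seminorm p \<longrightarrow> s \<in> S \<longrightarrow> p s \<le> C * (\<Sum>k\<in>K. norm (s k)) * (\<Sum>b\<in>B. p b))"
  using assms
proof (induction K arbitrary: S rule: finite_induct)
  case empty
  have "p s \<le> 0" if "seminorm p" "s \<in> S" for p s
  proof -
    have "s = (\<lambda>k. 0 * delta k)" using empty that by auto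
    thus ?thesis using seminormD(3)[OF that(1) delta_l0, of 0] by simp
  qed
  thus ?case by (intro exI[of _ "{}"] exI[of _ 0]) auto
next
  case (insert k K)
  have l0: "s \<in> l0" if "s \<in> S" for s
    by (rule l0I[of "insert k K"]) (use insert.hyps insert.prems that in blast)+
  show ?case
  proof (cases "\<forall>s\<in>S. s k = 0")
    case True
    have "s j = 0" if "s \<in> S" "j \<notin> K" for s j using True insert.prems that by (metis insert_iff)
    with insert.IH[of S] obtain B C where
      "finite B \<and> B \<subseteq> S \<and> 0 \<le> C \<and> (\<forall>p s. seminorm p \<longrightarrow> s \<in> S \<longrightarrow> p s \<le> C * (\<Sum>k\<in>K. norm (s k)) * (\<Sum>b\<in>B. p b))"
      by blast
    thus ?thesis using True insert.hyps by (intro exI[of _ B] exI[of _ C]) auto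
  next
    case False
    then obtain b0 where b0: "b0 \<in> S" "b0 k \<noteq> 0" by blast
    define red where "red s = (\<lambda>i. s i + (- (s k / b0 k)) * b0 i)" for s
    have red0: "f j = 0" if "f \<in> red ` S" "j \<notin> K" for f j
    proof (cases "j = k")
      case False
      with that insert.prems b0(1) have "b0 j = 0" "s j = 0" if "s \<in> S" for s using that by blast+
      thus ?thesis using \<open>f \<in> red ` S\<close> by (auto simp: red_def)
    qed (use that b0 in \<open>auto simp: red_def\<close>)
    obtain B' C' where B': "finite B'" "B' \<subseteq> red ` S" "0 \<le> C'"
      and bound: "\<And>p s. seminorm p \<Longrightarrow> s \<in> red ` S \<Longrightarrow> p s \<le> C' * (\<Sum>k\<in>K. norm (s k)) * (\<Sum>b\<in>B'. p b)"
      using insert.IH[of "red ` S"] red0 by blast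
    obtain B1 where B1: "finite B1" "B1 \<subseteq> S" "B' = red ` B1" using finite_subset_image[OF B'(1,2)] by blast
    define B where "B = insert b0 B1"
    define q where "q = 1 + (\<Sum>j\<in>K. norm (b0 j)) / norm (b0 k)"
    define E where "E = 1 + (\<Sum>b\<in>B1. norm (b k / b0 k))"
    have q0: "0 \<le> q" "0 \<le> E" by (auto simp: q_def E_def sum_nonneg)
    have main: "p s \<le> (C' * q * E + 1 / norm (b0 k)) * (\<Sum>j\<in>insert k K. norm (s j)) * (\<Sum>b\<in>B. p b)"
      if p: "seminorm p" and s: "s \<in> S" for p s
    proof -
      define N where "N = (\<Sum>j\<in>insert k K. norm (s j))"
      define P where "P = (\<Sum>b\<in>B. p b)"
      have pnn: "0 \<le> p b" if "b \<in> B" for b using that b0(1) B1 l0 seminormD(1)[OF p] by (auto simp: B_def)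
      have P: "0 \<le> P" "p b0 \<le> P" "(\<Sum>b\<in>B1. p b) \<le> P"
        unfolding P_def using pnn B1 by (auto simp: B_def intro!: sum_nonneg member_le_sum sum_mono2)
      have N: "0 \<le> N" "norm (s k) \<le> N" "(\<Sum>j\<in>K. norm (s j)) \<le> N"
      proof -
        show "0 \<le> N" unfolding N_def by (intro sum_nonneg) auto
        show "norm (s k) \<le> N" "(\<Sum>j\<in>K. norm (s j)) \<le> N"
          unfolding N_def using insert.hyps by (simp_all add: sum_nonneg)
      qed
      have redl0: "red b \<in> l0" if "b \<in> S" for b
        unfolding red_def using that b0(1) l0 by (intro l0_add l0_scale) auto
      have "p s = p (\<lambda>i. red s i + (s k / b0 k) * b0 i)" by (simp add: red_def)
      also have "\<dots> \<le> p (red s) + p (\<lambda>i. (s k / b0 k) * b0 i)"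
        using redl0[OF s] l0[OF b0(1)] by (intro seminormD(2)[OF p] l0_scale) auto
      also have "p (\<lambda>i. (s k / b0 k) * b0 i) \<le> norm (s k / b0 k) * p b0"
        by (rule seminormD(3)[OF p l0[OF b0(1)]])
      also have "\<dots> \<le> (N / norm (b0 k)) * P"
        using N P seminormD(1)[OF p l0[OF b0(1)]] unfolding norm_divide by (intro mult_mono divide_right_mono) auto
      also have "p (red s) \<le> C' * (\<Sum>j\<in>K. norm (red s j)) * (\<Sum>b\<in>B'. p b)"
        using bound[OF p] s by blast
      also have "\<dots> \<le> C' * (q * N) * (E * P)"
      proof (intro mult_mono mult_left_mono B'(3))
        have "(\<Sum>j\<in>K. norm (red s j)) \<le> (\<Sum>j\<in>K. norm (s j) + norm (s k) / norm (b0 k) * norm (b0 j))"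
        proof (rule sum_mono)
          fix j
          have "norm (red s j) \<le> norm (s j) + norm ((- (s k / b0 k)) * b0 j)" unfolding red_def by (rule norm_triangle_ineq)
          thus "norm (red s j) \<le> norm (s j) + norm (s k) / norm (b0 k) * norm (b0 j)" by (simp add: norm_mult norm_divide)
        qed
        also have "\<dots> = (\<Sum>j\<in>K. norm (s j)) + norm (s k) * ((\<Sum>j\<in>K. norm (b0 j)) / norm (b0 k))"
          by (simp add: sum.distrib sum_distrib_left sum_divide_distrib)
        also have "\<dots> \<le> N + N * ((\<Sum>j\<in>K. norm (b0 j)) / norm (b0 k))"
          using N by (intro add_mono mult_right_mono) (auto simp: sum_nonneg)
        finally show "(\<Sum>j\<in>K. norm (red s j)) \<le> q * N" by (simp add: q_def algebra_simps)
        have "(\<Sum>b\<in>B'. p b) \<le> (\<Sum>b\<in>B1. p (red b))"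
          unfolding B1(3) using B1 redl0 seminormD(1)[OF p] by (intro sum_image_le[unfolded o_def]) auto
        also have "\<dots> \<le> (\<Sum>b\<in>B1. p b + norm (b k / b0 k) * p b0)"
        proof (rule sum_mono)
          fix b assume "b \<in> B1"
          hence b: "b \<in> l0" using B1 l0 by auto
          have "p (red b) \<le> p b + p (\<lambda>i. (- (b k / b0 k)) * b0 i)"
            unfolding red_def using b l0[OF b0(1)] by (intro seminormD(2)[OF p] l0_scale) auto
          also have "p (\<lambda>i. (- (b k / b0 k)) * b0 i) \<le> norm (- (b k / b0 k)) * p b0"
            by (rule seminormD(3)[OF p l0[OF b0(1)]])
          finally show "p (red b) \<le> p b + norm (b k / b0 k) * p b0" by simp
        qed
        also have "\<dots> = (\<Sum>b\<in>B1. p b) + (\<Sum>b\<in>B1. norm (b k / b0 k)) * p b0"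
          by (simp add: sum.distrib sum_distrib_right)
        also have "\<dots> \<le> P + (\<Sum>b\<in>B1. norm (b k / b0 k)) * P"
          using P by (intro add_mono mult_left_mono) (auto simp: sum_nonneg)
        finally show "(\<Sum>b\<in>B'. p b) \<le> E * P" by (simp add: E_def algebra_simps)
        show "0 \<le> (\<Sum>b\<in>B'. p b)" unfolding B1(3) using B1 redl0 seminormD(1)[OF p] by (intro sum_nonneg) auto
      qed (use q0 N B' in \<open>auto intro: sum_nonneg\<close>)
      finally show ?thesis unfolding N_def[symmetric] P_def[symmetric] by (simp add: algebra_simps)
    qed
    have "0 \<le> C' * q * E + 1 / norm (b0 k)" using B'(3) q0 by simp
    thus ?thesis using main B1 b0(1) by (intro exI[of _ B] exI[of _ "C' * q * E + 1 / norm (b0 k)"]) (auto simp: B_def)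
  qed
qed

lemma linf_bdd: "u \<in> l0 \<Longrightarrow> bdd_above (range (\<lambda>k. norm (u k)))"
proof -
  assume u: "u \<in> l0"
  have "range (\<lambda>k. norm (u k)) \<subseteq> insert 0 ((\<lambda>k. norm (u k)) ` {k. u k \<noteq> 0})" by auto
  moreover have "finite (insert 0 ((\<lambda>k. norm (u k)) ` {k. u k \<noteq> 0}))" using l0_finite[OF u] by simp
  ultimately show ?thesis by (meson bdd_above_finite finite_subset)
qed

lemma linf_ge: "u \<in> l0 \<Longrightarrow> norm (u k) \<le> linf_norm u"
  unfolding linf_norm_def by (rule cSUP_upper[OF UNIV_I linf_bdd])

lemma linf_le: "(\<And>k. norm (u k) \<le> B) \<Longrightarrow> linf_norm u \<le> B"
  unfolding linf_norm_def by (rule cSUP_least) auto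

lemma linf_nonneg: "u \<in> l0 \<Longrightarrow> 0 \<le> linf_norm u"
  using linf_ge[of u 0] norm_ge_zero order_trans by blast

lemma conv_comm: "u \<in> l0 \<Longrightarrow> v \<in> l0 \<Longrightarrow> conv u v = conv v u"
  by (rule fseries_unique) (simp_all add: conv_l0 fseries_conv)

lemma conv_delta: "u \<in> l0 \<Longrightarrow> conv u delta = u"
  by (rule fseries_unique) (simp_all add: conv_l0 fseries_conv has_fseriesD[OF has_fseries_delta])

lemma conv_dif: "u \<in> l0 \<Longrightarrow> w \<in> l0 \<Longrightarrow> conv (dif i u) w = dif i (conv u w)"
  by (rule fseries_unique) (simp_all add: conv_l0 dif_l0 fseries_conv fseries_dif)

lemma conv_norm_le:
  assumes "u \<in> l0" "\<And>k. norm (v k) \<le> B" and v: "v \<in> l0"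
  shows "norm (conv v u k) \<le> (\<Sum>j | u j \<noteq> 0. norm (u j)) * B"
proof -
  have "norm (conv v u k) = norm (\<Sum>j | u j \<noteq> 0. u j * v (k - j))"
    using conv_comm[OF v assms(1)] by (simp add: conv_def)
  also have "\<dots> \<le> (\<Sum>j | u j \<noteq> 0. norm (u j) * B)"
    by (intro sum_norm_le) (simp add: norm_mult assms mult_left_mono)
  finally show ?thesis by (simp add: sum_distrib_right)
qed

lemma seminorm_conv: "u \<in> l0 \<Longrightarrow> seminorm (\<lambda>v. linf_norm (conv v u))"
  unfolding seminorm_def
proof (intro conjI ballI allI)
  assume u: "u \<in> l0"
  fix f :: "'a filt" assume f: "f \<in> l0"
  show "0 \<le> linf_norm (conv f u)" using u f by (intro linf_nonneg conv_l0)
  { fix g :: "'a filt" assume g: "g \<in> l0"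
    have "conv (\<lambda>k. f k + g k) u k = conv f u k + conv g u k" for k
      unfolding conv_pair by (rule pair_add_left[OF f g])
    thus "linf_norm (conv (\<lambda>k. f k + g k) u) \<le> linf_norm (conv f u) + linf_norm (conv g u)"
      using linf_ge[OF conv_l0[OF f u]] linf_ge[OF conv_l0[OF g u]]
      by (intro linf_le) (auto intro!: norm_triangle_mono) }
  fix c
  have "conv (\<lambda>k. c * f k) u k = c * conv f u k" for k unfolding conv_pair by (rule pair_scale_left)
  thus "linf_norm (conv (\<lambda>k. c * f k) u) \<le> norm c * linf_norm (conv f u)"
    using linf_ge[OF conv_l0[OF f u]] by (intro linf_le) (auto simp: norm_mult mult_left_mono)
qed

context dilation
begin

lemma funpow_up:
  assumes "a \<in> l0"
  shows "((push (\<lambda>k. M *v k)) ^^ i) a \<in> l0" "fseries (((push (\<lambda>k. M *v k)) ^^ i) a) \<xi> = fseries a ((mat_T M ^^ i) \<xi>)"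
proof -
  show l: "((push (\<lambda>k. M *v k)) ^^ i) a \<in> l0" for i using assms by (induction i) (auto intro: push_l0)
  show "fseries (((push (\<lambda>k. M *v k)) ^^ i) a) \<xi> = fseries a ((mat_T M ^^ i) \<xi>)"
  proof (induction i arbitrary: \<xi>)
    case (Suc i)
    have "fseries (((push (\<lambda>k. M *v k)) ^^ Suc i) a) \<xi> = fseries a ((mat_T M ^^ i) (mat_T M \<xi>))"
      using Suc by (simp add: fseries_up l)
    thus ?case by (simp add: funpow_swap1)
  qed simp
qed

lemma iter_filter_has_fseries:
  assumes "a \<in> l0"
  shows "has_fseries (iter_filter a M n) (\<lambda>\<xi>. \<Prod>i<n. fseries a ((mat_T M ^^ i) \<xi>))"
proof -
  have "\<exists>u. has_fseries u (\<lambda>\<xi>. \<Prod>i<n. fseries a ((mat_T M ^^ i) \<xi>))"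
    by (rule ex_has_fseries_prod) (use funpow_up[OF assms] in \<open>auto simp: has_fseries_def\<close>)
  thus ?thesis unfolding iter_filter_def by (blast intro: has_fseries_filter_of)
qed

lemma iter_l0: "a \<in> l0 \<Longrightarrow> iter_filter a M n \<in> l0"
  using iter_filter_has_fseries has_fseries_l0 by blast

lemma iter_0: "a \<in> l0 \<Longrightarrow> iter_filter a M 0 = delta"
  by (rule fseries_unique) (simp_all add: iter_l0 has_fseriesD[OF iter_filter_has_fseries] has_fseriesD[OF has_fseries_delta])

lemma iter_Suc: "a \<in> l0 \<Longrightarrow> iter_filter a M (Suc n) = conv (push (\<lambda>k. M *v k) (iter_filter a M n)) a"
  by (rule fseries_unique)
     (simp_all add: iter_l0 conv_l0 push_l0 has_fseriesD[OF iter_filter_has_fseries] fseries_conv fseries_up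
       prod.lessThan_Suc_shift funpow_swap1 mult.commute del: prod.lessThan_Suc)

lemma funpow_push: "u \<in> l0 \<Longrightarrow> pair (((push (\<lambda>k. M *v k)) ^^ n) u) p = pair u (\<lambda>k. p (((\<lambda>k. M *v k) ^^ n) k))"
proof (induction n arbitrary: p)
  case (Suc n)
  thus ?case using funpow_up(1)[OF Suc(2), of n] by (simp add: pair_push)
qed simp

lemma iter_Suc': "a \<in> l0 \<Longrightarrow> iter_filter a M (Suc n) k = pair a (\<lambda>j. iter_filter a M n (k - ((\<lambda>k. M *v k) ^^ n) j))"
proof -
  assume a: "a \<in> l0"
  have "iter_filter a M (Suc n) = conv (((push (\<lambda>k. M *v k)) ^^ n) a) (iter_filter a M n)"
    by (rule fseries_unique)
       (simp_all add: iter_l0 a conv_l0 funpow_up has_fseriesD[OF iter_filter_has_fseries[OF a]] fseries_conv mult.commute)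
  thus ?thesis using funpow_push[OF a] by (simp add: conv_pair)
qed

lemma iter_Suc_pair: "a \<in> l0 \<Longrightarrow> iter_filter a M (Suc n) k = pair (iter_filter a M n) (\<lambda>j. a (k - M *v j))"
  by (simp add: iter_Suc conv_pair pair_push iter_l0)

definition trans :: "'n filt \<Rightarrow> int^'n \<Rightarrow> 'n filt \<Rightarrow> 'n filt" where
  "trans a g v = coset_filter M g (conv v a)"

lemma trans_l0: "a \<in> l0 \<Longrightarrow> v \<in> l0 \<Longrightarrow> trans a g v \<in> l0"
  by (simp add: trans_def coset_filter_l0 conv_l0)

lemma conv_iter_coset:
  assumes a: "a \<in> l0" and v: "v \<in> l0"
  shows "conv v (iter_filter a M (Suc n)) (g + M *v k) = conv (trans a g v) (iter_filter a M n) k"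
proof -
  let ?U = "push (\<lambda>k. M *v k) (iter_filter a M n)"
  have "conv v (iter_filter a M (Suc n)) = conv ?U (conv v a)"
    by (rule fseries_unique) (simp_all add: a v iter_l0 conv_l0 push_l0 iter_Suc fseries_conv)
  hence "conv v (iter_filter a M (Suc n)) (g + M *v k) = pair (iter_filter a M n) (\<lambda>j. conv v a (g + M *v k - M *v j))"
    by (simp add: conv_pair[of ?U] pair_push iter_l0 a)
  also have "\<dots> = conv (iter_filter a M n) (trans a g v) k"
    unfolding conv_pair[of "iter_filter a M n"]
    by (rule pair_cong) (simp add: trans_def coset_filter_def matrix_vector_mult_diff_distrib algebra_simps)
  finally show ?thesis using conv_comm[OF trans_l0[OF a v] iter_l0[OF a]] by simp
qed

primrec words :: "'n filt \<Rightarrow> nat \<Rightarrow> 'n filt \<Rightarrow> 'n filt set" where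
  "words a 0 v = {v}"
| "words a (Suc n) v = (\<Union>g\<in>Gamma_M M. words a n (trans a g v))"

lemma words_l0: "a \<in> l0 \<Longrightarrow> v \<in> l0 \<Longrightarrow> w \<in> words a n v \<Longrightarrow> w \<in> l0"
  by (induction n arbitrary: v) (auto intro: trans_l0)

lemma words_le:
  assumes a: "a \<in> l0"
  shows "v \<in> l0 \<Longrightarrow> w \<in> words a n v \<Longrightarrow> linf_norm (conv w (iter_filter a M p)) \<le> linf_norm (conv v (iter_filter a M (n + p)))"
proof (induction n arbitrary: v)
  case (Suc n)
  then obtain g where g: "w \<in> words a n (trans a g v)" by auto
  have "linf_norm (conv w (iter_filter a M p)) \<le> linf_norm (conv (trans a g v) (iter_filter a M (n + p)))"
    using Suc(1)[OF trans_l0[OF a Suc(2)] g] .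
  also have "\<dots> \<le> linf_norm (conv v (iter_filter a M (Suc (n + p))))"
    by (rule linf_le) (simp add: conv_iter_coset[OF a Suc(2), symmetric] linf_ge conv_l0 iter_l0 a Suc(2))
  finally show ?case by simp
qed simp

lemma words_ge:
  assumes a: "a \<in> l0"
  shows "v \<in> l0 \<Longrightarrow> (\<And>w. w \<in> words a n v \<Longrightarrow> linf_norm (conv w (iter_filter a M p)) \<le> B) \<Longrightarrow>
     linf_norm (conv v (iter_filter a M (n + p))) \<le> B"
proof (induction n arbitrary: v)
  case (Suc n)
  show ?case
  proof (rule linf_le)
    fix k
    obtain g j where g: "g \<in> Gamma_M M" "k = g + M *v j" using Gamma_rep by blast
    have "norm (conv v (iter_filter a M (Suc n + p)) k) = norm (conv (trans a g v) (iter_filter a M (n + p)) j)"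
      using conv_iter_coset[OF a Suc(2), of "n + p" g j] by (simp add: g(2))
    also have "\<dots> \<le> linf_norm (conv (trans a g v) (iter_filter a M (n + p)))"
      by (intro linf_ge conv_l0 trans_l0 a Suc(2) iter_l0)
    also have "\<dots> \<le> B" by (rule Suc(1)) (use Suc g a in \<open>auto intro: trans_l0\<close>)
    finally show "norm (conv v (iter_filter a M (Suc n + p)) k) \<le> B" .
  qed
qed simp

lemma bwd_pow_add: "((\<lambda>x. bwd x) ^^ n) (x + y) = ((\<lambda>x. bwd x) ^^ n) x + ((\<lambda>x. bwd x) ^^ n) y"
  by (induction n) (auto simp: matrix_vector_right_distrib)

lemma words_support:
  assumes a: "a \<in> l0" and v: "v \<in> l0"
  shows "\<exists>K. finite K \<and> (\<forall>n. \<forall>w\<in>words a n v. \<forall>k. k \<notin> K \<longrightarrow> w k = 0)"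
proof -
  obtain C \<rho> where C: "0 < \<rho>" "\<rho> < 1" "0 < C" "\<And>n x. norm (((\<lambda>x. bwd x) ^^ n) x) \<le> C * \<rho> ^ n * norm x"
    using decay by blast
  define D where "D = (\<Sum>s | a s \<noteq> 0. \<Sum>g\<in>Gamma_M M. norm (rvec (s - g)))"
  have D: "norm (rvec (s - g)) \<le> D" if "a s \<noteq> 0" "g \<in> Gamma_M M" for s g
  proof -
    have "norm (rvec (s - g)) \<le> (\<Sum>g\<in>Gamma_M M. norm (rvec (s - g)))"
      using that finite_Gamma by (intro member_le_sum) auto
    also have "\<dots> \<le> D" unfolding D_def using that l0_finite[OF a]
      by (intro member_le_sum[where f = "\<lambda>s. \<Sum>g\<in>Gamma_M M. norm (rvec (s - g))"]) (auto intro: sum_nonneg)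
    finally show ?thesis .
  qed
  have D0: "0 \<le> D" unfolding D_def by (intro sum_nonneg) auto
  define R where "R = C * D * \<rho> / (1 - \<rho>) + C * (\<Sum>k | v k \<noteq> 0. norm (rvec k))"
  have R: "(R + C * D) * \<rho> \<le> R"
  proof -
    have "C * D * \<rho> / (1 - \<rho>) \<le> R" unfolding R_def using C by (simp add: sum_nonneg)
    hence "C * D * \<rho> \<le> R * (1 - \<rho>)" using C by (simp add: field_simps)
    thus ?thesis by (simp add: algebra_simps)
  qed
  define Q where "Q w \<longleftrightarrow> w \<in> l0 \<and> (\<forall>k. w k \<noteq> 0 \<longrightarrow> (\<forall>p. norm (((\<lambda>x. bwd x) ^^ p) (rvec k)) \<le> R * \<rho> ^ p))" for w :: "'n filt"
  have "Q v" unfolding Q_def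
  proof (intro conjI allI impI v)
    fix k p assume "v k \<noteq> 0"
    hence "norm (rvec k) \<le> (\<Sum>k | v k \<noteq> 0. norm (rvec k))" using l0_finite[OF v] by (intro member_le_sum) auto
    hence "C * norm (rvec k) \<le> R" unfolding R_def using C D0 by (intro add_increasing mult_left_mono) auto
    hence "C * \<rho> ^ p * norm (rvec k) \<le> R * \<rho> ^ p" using C by (simp add: mult_right_mono mult_ac)
    thus "norm (((\<lambda>x. bwd x) ^^ p) (rvec k)) \<le> R * \<rho> ^ p" using C(4) order_trans by blast
  qed
  have Qt: "Q (trans a g w)" if "Q w" "g \<in> Gamma_M M" for g w
    unfolding Q_def
  proof (intro conjI allI impI)
    show "trans a g w \<in> l0" using that a by (auto simp: Q_def intro: trans_l0)
    fix k p assume "trans a g w k \<noteq> 0"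
    hence "conv w a (g + M *v k) \<noteq> 0" by (simp add: trans_def coset_filter_def)
    then obtain j s where js: "w j \<noteq> 0" "a s \<noteq> 0" "g + M *v k = j + s" using conv_support[of w a] by auto
    have "M *v k = j + (s - g)" using js(3) by (simp add: algebra_simps)
    hence "bwd (rvec (M *v k)) = bwd (rvec j + rvec (s - g))" by (simp add: rvec_add)
    hence "rvec k = bwd (rvec j + rvec (s - g))" by (simp add: rvec_mv)
    hence "((\<lambda>x. bwd x) ^^ p) (rvec k) = ((\<lambda>x. bwd x) ^^ Suc p) (rvec j) + ((\<lambda>x. bwd x) ^^ Suc p) (rvec (s - g))"
      by (simp add: bwd_pow_add[symmetric] funpow_swap1 matrix_vector_right_distrib)
    hence "norm (((\<lambda>x. bwd x) ^^ p) (rvec k)) \<le> R * \<rho> ^ Suc p + C * \<rho> ^ Suc p * D"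
      using that(1) js(1) C(4)[of "Suc p" "rvec (s - g)"] D[OF js(2) that(2)] C
        mult_left_mono[OF D[OF js(2) that(2)], of "C * \<rho> ^ Suc p"] norm_triangle_ineq
      unfolding Q_def by (smt (verit, best) mult_nonneg_nonneg zero_le_power)
    also have "\<dots> = ((R + C * D) * \<rho>) * \<rho> ^ p" by (simp add: algebra_simps)
    also have "\<dots> \<le> R * \<rho> ^ p" using R C by (intro mult_right_mono) auto
    finally show "norm (((\<lambda>x. bwd x) ^^ p) (rvec k)) \<le> R * \<rho> ^ p" .
  qed
  have Qw: "Q w" if "Q v" "w \<in> words a n v" for n v w
    using that by (induction n arbitrary: v) (auto intro: Qt)
  have "w k = 0" if "w \<in> words a n v" "k \<notin> {k. norm (rvec k) \<le> R}" for w n k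
  proof (rule ccontr)
    assume "w k \<noteq> 0"
    with Qw[OF \<open>Q v\<close> that(1)] have "norm (((\<lambda>x. bwd x) ^^ 0) (rvec k)) \<le> R * \<rho> ^ 0" unfolding Q_def by blast
    thus False using that by simp
  qed
  thus ?thesis using finite_int_bounded by blast
qed

lemma iter_root_convergent:
  assumes a: "a \<in> l0" and v: "v \<in> l0"
  shows "convergent (\<lambda>n. linf_norm (conv v (iter_filter a M n)) powr (1 / real n))"
proof -
  define x where "x n = linf_norm (conv v (iter_filter a M n))" for n
  have x0: "0 \<le> x n" for n unfolding x_def by (intro linf_nonneg conv_l0 v iter_l0 a)
  define S where "S = (\<Union>n. words a n v)"
  obtain K where K: "finite K" "\<And>n w k. w \<in> words a n v \<Longrightarrow> k \<notin> K \<Longrightarrow> w k = 0"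
    using words_support[OF a v] by blast
  obtain B C where B: "finite B" "B \<subseteq> S" "0 \<le> C"
    and bound: "\<And>p s. seminorm p \<Longrightarrow> s \<in> S \<Longrightarrow> p s \<le> C * (\<Sum>k\<in>K. norm (s k)) * (\<Sum>b\<in>B. p b)"
    using finite_span_bound[OF K(1), of S] K(2) unfolding S_def by blast
  have "\<exists>n. b \<in> words a n v" if "b \<in> B" for b using B that by (auto simp: S_def)
  then obtain len where len: "\<And>b. b \<in> B \<Longrightarrow> b \<in> words a (len b) v" by metis
  define L where "L j = (\<Sum>i | iter_filter a M j i \<noteq> 0. norm (iter_filter a M j i))" for j
  have L0: "0 \<le> L j" for j unfolding L_def by (intro sum_nonneg) auto
  have wx: "norm (w k) \<le> x n" if "w \<in> words a n v" for w n k
  proof -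
    have w: "w \<in> l0" using words_l0 a v that by blast
    have "norm (w k) \<le> linf_norm (conv w (iter_filter a M 0))"
      using linf_ge[OF w] by (simp add: iter_0 a conv_delta w)
    also have "\<dots> \<le> x n" using words_le[OF a v that, of 0] by (simp add: x_def)
    finally show ?thesis .
  qed
  have xL: "x (p + j) \<le> L j * x p" for p j
    unfolding x_def
  proof (rule words_ge[OF a v])
    fix w assume w: "w \<in> words a p v"
    have wl0: "w \<in> l0" using words_l0 a v w by blast
    show "linf_norm (conv w (iter_filter a M j)) \<le> L j * linf_norm (conv v (iter_filter a M p))"
      unfolding L_def
      by (intro linf_le conv_norm_le[OF iter_l0[OF a] _ wl0]) (rule wx[OF w, unfolded x_def])
  qed
  define C' where "C' = 1 + C * real (card K) * (\<Sum>b\<in>B. L (len b))"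
  have C': "0 < C'" unfolding C'_def using B(3) L0 by (intro add_pos_nonneg mult_nonneg_nonneg sum_nonneg) auto
  have "x (n + p) \<le> C' * x n * x p" for n p
    unfolding x_def[of "n + p"]
  proof (rule words_ge[OF a v])
    fix w assume w: "w \<in> words a n v"
    let ?p = "\<lambda>v. linf_norm (conv v (iter_filter a M p))"
    have "?p w \<le> C * (\<Sum>k\<in>K. norm (w k)) * (\<Sum>b\<in>B. ?p b)"
      by (rule bound) (use w in \<open>auto simp: S_def intro: seminorm_conv iter_l0 a\<close>)
    also have "\<dots> \<le> C * (real (card K) * x n) * (\<Sum>b\<in>B. L (len b) * x p)"
    proof (intro mult_mono mult_left_mono B(3))
      show "(\<Sum>k\<in>K. norm (w k)) \<le> real (card K) * x n" by (rule sum_bounded_above) (rule wx[OF w])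
      show "(\<Sum>b\<in>B. ?p b) \<le> (\<Sum>b\<in>B. L (len b) * x p)"
      proof (rule sum_mono)
        fix b assume b: "b \<in> B"
        have "?p b \<le> x (len b + p)" using words_le[OF a v len[OF b], of p] by (simp add: x_def)
        also have "\<dots> \<le> L (len b) * x p" using xL[of p "len b"] by (simp add: add.commute)
        finally show "?p b \<le> L (len b) * x p" .
      qed
      show "0 \<le> (\<Sum>b\<in>B. ?p b)"
      proof (rule sum_nonneg)
        fix b assume "b \<in> B"
        hence "b \<in> l0" using len words_l0[OF a v] by blast
        thus "0 \<le> ?p b" by (intro linf_nonneg conv_l0 iter_l0 a)
      qed
    qed (use x0 B(3) in \<open>auto intro: sum_nonneg\<close>)
    also have "\<dots> = (C' - 1) * x n * x p" by (simp add: C'_def sum_distrib_right sum_distrib_left mult_ac)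
    also have "\<dots> \<le> C' * x n * x p" using x0 by (intro mult_right_mono) auto
    finally show "?p w \<le> C' * x n * x p" .
  qed
  from submultiplicative_root_convergent[OF x0 C' this] show ?thesis by (simp add: x_def)
qed

end

section \<open>The spectral radius\<close>

lemma eigenvalues_nonempty: "eigenvalues (M :: int^'n^'n) \<noteq> {}"
proof -
  have "p \<noteq> 0 \<Longrightarrow> v \<noteq> 0 \<Longrightarrow> polact (cmat M) p v = 0 \<Longrightarrow> eigenvalues M \<noteq> {}" for p v
  proof (induction "degree p" arbitrary: p)
    case 0
    then obtain c where "p = [:c:]" "c \<noteq> 0" by (metis degree_eq_zeroE pCons_0_0)
    with 0 show ?case by (simp add: polact_def vector_mul_eq_0)
  next
    case (Suc d)
    from Suc(2) have "\<not> constant (poly p)" by (simp add: constant_degree)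
    from fundamental_theorem_of_algebra[OF this] obtain l where "poly p l = 0" by blast
    then obtain q where q: "p = [:- l, 1:] * q" by (auto simp: poly_eq_0_iff_dvd elim: dvdE)
    have q0: "q \<noteq> 0" using q Suc by auto
    have "degree p = Suc (degree q)" unfolding q using q0 by (subst degree_mult_eq) auto
    with Suc(2) have degq: "d = degree q" by simp
    show ?case
    proof (cases "polact (cmat M) q v = 0")
      case True thus ?thesis using Suc(1)[OF degq q0 Suc(4)] by blast
    next
      case False
      have "cmat M *v polact (cmat M) q v = l *s polact (cmat M) q v"
        using Suc(5) unfolding q polact_root_factor polact_commute by simp
      thus ?thesis using False unfolding eigenvalues_def by blast
    qed
  qed
  moreover obtain p where "p \<noteq> 0" "polact (cmat M) p (cvec (axis undefined 1)) = 0"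
    using annihilating_poly_exists by blast
  moreover have "cvec (axis undefined 1 :: real^'n) \<noteq> 0" by (simp add: axis_eq_0_iff)
  ultimately show ?thesis by blast
qed

lemma eigenvalues_bdd: "bdd_above (norm ` eigenvalues (M :: int^'n^'n))"
proof -
  have "linear (\<lambda>v. cmat M *v v)"
    by (rule linearI) (simp_all add: matrix_vector_right_distrib, simp add: matrix_vector_mult_def vec_eq_iff scaleR_sum_right)
  then obtain B where B: "B > 0" "\<And>v. norm (cmat M *v v) \<le> B * norm v" using linear_bounded_pos by blast
  have "norm z \<le> B" if z: "z \<in> eigenvalues M" for z
  proof -
    obtain v where v: "v \<noteq> 0" "cmat M *v v = z *s v" using z unfolding eigenvalues_def by blast
    have "norm z * norm v \<le> B * norm v" using B(2)[of v] unfolding v(2) norm_vector_scalar .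
    thus ?thesis using v(1) by simp
  qed
  thus ?thesis by (auto intro: bdd_aboveI[of _ B])
qed

lemma spec_radius_gt_1: "dilation_matrix M \<Longrightarrow> 1 < spec_radius M"
proof -
  assume M: "dilation_matrix M"
  obtain z where z: "z \<in> eigenvalues M" using eigenvalues_nonempty by blast
  hence "1 < norm z" using M by (auto simp: dilation_matrix_def)
  also have "norm z \<le> spec_radius M" unfolding spec_radius_def by (rule cSUP_upper[OF z eigenvalues_bdd])
  finally show ?thesis .
qed

section \<open>Smoothness and decay of differences\<close>

lemma axis_zero [simp]: "axis i 0 = 0"
  by (simp add: axis_def vec_eq_iff)

lemma axis_Suc_int: "(axis i (int (Suc j)) :: int^'n) = axis i (int j) + axis i 1"
  by (simp add: axis_def vec_eq_iff)

text \<open>The free parameter \<open>N\<close> allows to trade the size of \<open>g\<close> against its second differences, as in the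
  inequality of Landau.\<close>

lemma landau_step:
  fixes g :: "('n::finite) filt"
  assumes X: "\<And>k. norm (g k) \<le> X" and Y: "\<And>k. norm (dif i (dif i g) k) \<le> Y" and N: "1 \<le> N"
  shows "norm (dif i g k) \<le> 2 * X / real N + real N * Y"
proof -
  let ?h = "dif i g"
  have Y0: "0 \<le> Y" using Y norm_ge_zero order_trans by blast
  have tele: "(\<Sum>j<n. ?h (k - axis i (int j))) = g k - g (k - axis i (int n))" for n
  proof (induction n)
    case 0
    show ?case by simp
  next
    case (Suc n)
    thus ?case by (simp add: axis_Suc_int[simplified] dif_def algebra_simps)
  qed
  have step: "norm (?h k - ?h (k - axis i (int j))) \<le> real j * Y" for j
  proof (induction j)
    case 0
    show ?case by simp
  next
    case (Suc j)
    have "?h k - ?h (k - axis i (int (Suc j))) = (?h k - ?h (k - axis i (int j))) + dif i ?h (k - axis i (int j))"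
      unfolding dif_def[of i ?h] by (simp add: axis_Suc_int[simplified] algebra_simps)
    also have "norm \<dots> \<le> real j * Y + Y" using Suc Y by (intro norm_triangle_mono)
    finally show ?case by (simp add: algebra_simps)
  qed
  have "of_nat N * ?h k = (\<Sum>j<N. ?h (k - axis i (int j))) + (\<Sum>j<N. ?h k - ?h (k - axis i (int j)))"
    by (simp add: sum_subtractf)
  also have "norm \<dots> \<le> 2 * X + real N * (real N * Y)"
  proof (rule norm_triangle_mono)
    show "norm (\<Sum>j<N. ?h (k - axis i (int j))) \<le> 2 * X"
      unfolding tele using X[of k] X[of "k - axis i (int N)"] norm_triangle_ineq4[of "g k" "g (k - axis i (int N))"] by linarith
    have "norm (\<Sum>j<N. ?h k - ?h (k - axis i (int j))) \<le> (\<Sum>j<N. real N * Y)"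
    proof (rule sum_norm_le)
      fix j assume "j \<in> {..<N}"
      hence "real j * Y \<le> real N * Y" using Y0 by (intro mult_right_mono) auto
      thus "norm (?h k - ?h (k - axis i (int j))) \<le> real N * Y" using step[of j] by linarith
    qed
    thus "norm (\<Sum>j<N. ?h k - ?h (k - axis i (int j))) \<le> real N * (real N * Y)" by simp
  qed
  finally have "real N * norm (?h k) \<le> 2 * X + real N * (real N * Y)" by (simp add: norm_mult)
  thus ?thesis using N by (simp add: field_simps)
qed

lemma dif_pow_bound:
  assumes "\<And>k. norm (g k) \<le> X"
  shows "norm ((dif i ^^ j) g k) \<le> 2 ^ j * X"
proof (induction j arbitrary: k)
  case (Suc j)
  have "norm ((dif i ^^ Suc j) g k) \<le> norm ((dif i ^^ j) g k) + norm ((dif i ^^ j) g (k - axis i 1))"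
    by (simp add: dif_def[of i "(dif i ^^ j) g"] norm_triangle_ineq4)
  also have "\<dots> \<le> 2 ^ j * X + 2 ^ j * X" by (intro add_mono Suc)
  finally show ?case by (simp add: algebra_simps)
qed (simp add: assms)

lemma difference_decay_step:
  fixes g :: "nat \<Rightarrow> ('n::finite) filt"
  assumes B: "\<And>n k. norm (g n k) \<le> B n"
    and D: "\<And>n k. norm ((dif i ^^ Suc (Suc j)) (g n) k) \<le> C * q ^ n * B n" and q: "0 < q" "q < 1" and C: "0 \<le> C"
  shows "\<exists>C' r. 0 < r \<and> r < 1 \<and> 0 \<le> C' \<and> (\<forall>n k. norm ((dif i ^^ Suc j) (g n) k) \<le> C' * r ^ n * B n)"
proof -
  define r where "r = sqrt q"
  have r: "0 < r" "r < 1" "r * r = q" using q by (auto simp: r_def)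
  have B0: "0 \<le> B n" for n using B[of n 0] norm_ge_zero order_trans by blast
  have "norm ((dif i ^^ Suc j) (g n) k) \<le> (2 * 2 ^ j + 2 * C) * r ^ n * B n" for n k
  proof -
    define N where "N = nat \<lceil>1 / r ^ n\<rceil>"
    have rn: "0 < r ^ n" "r ^ n \<le> 1" using r by (auto simp: power_le_one)
    have N1: "1 / r ^ n \<le> real N" unfolding N_def by linarith
    have "0 < 1 / r ^ n" using rn by simp
    hence "real N \<le> 1 / r ^ n + 1" unfolding N_def by linarith
    also have "\<dots> \<le> 1 / r ^ n + 1 / r ^ n" using rn by (intro add_left_mono) (simp add: le_divide_eq)
    also have "\<dots> = 2 / r ^ n" by simp
    finally have N2: "real N \<le> 2 / r ^ n" .
    have "1 \<le> 1 / r ^ n" using rn by (simp add: field_simps)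
    hence N: "1 \<le> N" using N1 by linarith
    have "norm (dif i ((dif i ^^ j) (g n)) k) \<le> 2 * (2 ^ j * B n) / real N + real N * (C * q ^ n * B n)"
      by (rule landau_step[OF dif_pow_bound[OF B] _ N]) (use D in simp)
    also have "\<dots> \<le> 2 * (2 ^ j * B n) * r ^ n + 2 / r ^ n * (C * q ^ n * B n)"
    proof (rule add_mono)
      have "1 / real N \<le> r ^ n" using N1 N rn by (simp add: field_simps)
      hence "2 * (2 ^ j * B n) * (1 / real N) \<le> 2 * (2 ^ j * B n) * r ^ n" using B0 by (intro mult_left_mono) auto
      thus "2 * (2 ^ j * B n) / real N \<le> 2 * (2 ^ j * B n) * r ^ n" by simp
      show "real N * (C * q ^ n * B n) \<le> 2 / r ^ n * (C * q ^ n * B n)"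
        using N2 C q B0 by (intro mult_right_mono mult_nonneg_nonneg) auto
    qed
    also have "2 / r ^ n * (C * q ^ n * B n) = 2 * C * r ^ n * B n"
    proof -
      have "q ^ n = r ^ n * r ^ n" by (simp add: power_mult_distrib flip: r(3))
      thus ?thesis using rn by simp
    qed
    finally show ?thesis by (simp add: algebra_simps)
  qed
  thus ?thesis using r C by (intro exI[of _ "2 * 2 ^ j + 2 * C"] exI[of _ r]) auto
qed

lemma difference_decay:
  fixes g :: "nat \<Rightarrow> ('n::finite) filt"
  assumes B: "\<And>n k. norm (g n k) \<le> B n"
  shows "1 \<le> m \<Longrightarrow> 0 < q \<Longrightarrow> q < 1 \<Longrightarrow> 0 \<le> C \<Longrightarrow> (\<And>n k. norm ((dif i ^^ m) (g n) k) \<le> C * q ^ n * B n) \<Longrightarrow>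
    \<exists>C' r. 0 < r \<and> r < 1 \<and> 0 \<le> C' \<and> (\<forall>n k. norm (dif i (g n) k) \<le> C' * r ^ n * B n)"
proof (induction m arbitrary: q C)
  case (Suc m)
  show ?case
  proof (cases m)
    case 0
    with Suc.prems show ?thesis by auto
  next
    case j: (Suc j)
    from difference_decay_step[where g = g and i = i and j = j and C = C and q = q, OF B] Suc.prems j obtain C' r where
      r: "0 < r" "r < 1" "0 \<le> C'" "\<And>n k. norm ((dif i ^^ m) (g n) k) \<le> C' * r ^ n * B n" by auto
    show ?thesis by (rule Suc.IH[OF _ r]) (simp add: j)
  qed
qed simp

lemma path_bound:
  assumes Y: "\<And>i k. norm (dif i g k) \<le> Y"
  shows "norm (g (k + e) - g k) \<le> real (l1 e) * Y"
proof (induction "l1 e" arbitrary: e)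
  case 0
  hence "e = 0" by (metis l1_step nat.distinct(1))
  thus ?case by (simp add: l1_def)
next
  case (Suc n)
  hence "e \<noteq> 0" by (auto simp: l1_def)
  then obtain i s where s: "s = axis i 1 \<or> s = - axis i 1" "l1 e = Suc (l1 (e - s))" by (rule l1_step)
  have IH: "norm (g (k + (e - s)) - g k) \<le> real (l1 (e - s)) * Y" using Suc s(2) by simp
  have "norm (g (k + e) - g (k + (e - s))) \<le> Y"
    using s(1)
  proof
    assume "s = axis i 1"
    thus ?thesis using Y[of i "k + e"] by (simp add: dif_def algebra_simps)
  next
    assume "s = - axis i 1"
    thus ?thesis using Y[of i "k + e + axis i 1"] by (simp add: dif_def algebra_simps norm_minus_commute)
  qed
  hence "norm ((g (k + (e - s)) - g k) + (g (k + e) - g (k + (e - s)))) \<le> real (l1 (e - s)) * Y + Y"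
    using IH by (intro norm_triangle_mono)
  thus ?case by (simp add: s(2) algebra_simps)
qed

lemma l1_le_norm: "real (l1 e) \<le> CARD('n) * norm (rvec e)" for e :: "int^'n"
proof -
  have "real (l1 e) = (\<Sum>i\<in>UNIV. \<bar>rvec e $ i\<bar>)"
    unfolding l1_def by (simp add: sum_nonneg)
  also have "\<dots> \<le> (\<Sum>i\<in>(UNIV::'n set). norm (rvec e))" by (intro sum_mono component_le_norm_cart)
  finally show ?thesis by simp
qed

locale interp = dilation_card M for M :: "int^'n^'n" +
  fixes a :: "'n filt"
  assumes al0: "a \<in> l0" and a0: "fseries a 0 = 1" and ai: "interpolatory M a"
    and sr_pos: "0 < sr a M" and sm: "0 < sm_inf a M"
begin

abbreviation "dd \<equiv> real (d_M M)"

lemma dd_pos: "0 < dd"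
  using d_pos by simp

abbreviation "A \<equiv> iter_filter a M"

lemma Al0: "A n \<in> l0"
  by (rule iter_l0[OF al0])

text \<open>\<open>fv n k\<close> will be the value of the refinable function at \<open>M\<^sup>-\<^sup>n k\<close>.\<close>

definition fv :: "nat \<Rightarrow> 'n filt" where "fv n k = of_real (dd ^ n) * A n k"

lemma fv_l0: "fv n \<in> l0"
  unfolding fv_def[abs_def] by (intro l0_scale Al0)

lemma fv_0: "fv 0 = delta"
  by (simp add: fv_def fun_eq_iff iter_0[OF al0])

lemma nabla_axis: "nabla_delta (axis i r :: nat^'n) = (dif i ^^ r) delta"
proof (induction r)
  case 0
  show ?case by (simp add: nabla_delta_0)
next
  case (Suc r)
  have "axis i (Suc r) = axis i r + (axis i 1 :: nat^'n)" by (simp add: axis_def vec_eq_iff)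
  thus ?case using Suc by (simp add: nabla_delta_add_axis[simplified])
qed

lemma dif_pow_l0: "u \<in> l0 \<Longrightarrow> (dif i ^^ r) u \<in> l0"
  by (induction r) (auto intro: dif_l0)

lemma conv_nabla_axis:
  fixes w :: "'n filt"
  shows "w \<in> l0 \<Longrightarrow> conv (nabla_delta (axis i r)) w = (dif i ^^ r) w"
proof -
  assume w: "w \<in> l0"
  have "conv ((dif i ^^ r) delta) w = (dif i ^^ r) w"
  proof (induction r)
    case 0 thus ?case using conv_comm[OF delta_l0 w] conv_delta[OF w] by simp
  next
    case (Suc r)
    thus ?case using w by (simp add: conv_dif dif_pow_l0)
  qed
  thus ?thesis by (simp add: nabla_axis)
qed

lemma rho_lt_1: "rho_inf (sr a M) a M < 1"
proof (cases "rho_inf (sr a M) a M = 0")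
  case False
  let ?\<rho> = "rho_inf (sr a M) a M"
  have "0 < - log (spec_radius M) ?\<rho>" using sm False by (simp add: sm_inf_def Let_def)
  hence l: "log (spec_radius M) ?\<rho> < 0" by simp
  show ?thesis
  proof (rule ccontr)
    assume "\<not> ?thesis"
    hence "0 \<le> log (spec_radius M) ?\<rho>" using spec_radius_gt_1[OF dil] by (simp add: zero_le_log_cancel_iff)
    thus False using l by simp
  qed
qed simp

lemma mdeg_axis: "mdeg (axis i r :: nat^'n) = r"
  by (simp add: mdeg_def axis_def)

lemma high_difference_decay:
  "\<exists>C q. 0 < q \<and> q < 1 \<and> 0 \<le> C \<and> (\<forall>n k. norm ((dif i ^^ sr a M) (fv n) k) \<le> C * q ^ n)"
proof -
  define m where "m = sr a M"
  let ?x = "\<lambda>\<mu> n. linf_norm (conv (nabla_delta \<mu>) (A n))"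
  define L where "L \<mu> = lim (\<lambda>n. ?x \<mu> n powr (1 / real n))" for \<mu> :: "nat^'n"
  have conv: "(\<lambda>n. ?x \<mu> n powr (1 / real n)) \<longlonglongrightarrow> L \<mu>" for \<mu>
    unfolding L_def using iter_root_convergent[OF al0 nabla_delta_l0] by (simp add: convergent_LIMSEQ_iff)
  have "L (axis i m) \<le> (SUP \<mu>\<in>{\<mu>. mdeg \<mu> = m}. L \<mu>)"
    by (rule cSUP_upper) (auto simp: mdeg_axis finite_mdeg)
  hence "dd * L (axis i m) \<le> rho_inf m a M"
    unfolding rho_inf_def L_def by (intro mult_left_mono) auto
  hence "dd * L (axis i m) < 1" using rho_lt_1 by (simp add: m_def)
  hence Ld: "L (axis i m) < 1 / dd" using dd_pos by (simp add: field_simps)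
  have "0 \<le> L (axis i m)" by (rule LIMSEQ_le_const[OF conv]) auto
  define s where "s = (L (axis i m) + 1 / dd) / 2"
  have s: "L (axis i m) < s" "0 < s" "s < 1 / dd"
  proof -
    have gen: "x < (x + y) / 2 \<and> 0 < (x + y) / 2 \<and> (x + y) / 2 < y" if "x < y" "0 \<le> x" for x y :: real
      using that by auto
    show "L (axis i m) < s" "0 < s" "s < 1 / dd"
      using gen[OF Ld \<open>0 \<le> L (axis i m)\<close>] by (auto simp: s_def)
  qed
  have x0: "0 \<le> ?x \<mu> n" for \<mu> n by (intro linf_nonneg conv_l0 nabla_delta_l0 Al0)
  from geometric_bound_of_root_limit[OF x0 conv s(1,2)] obtain K where K: "\<And>n. ?x (axis i m) n \<le> K * s ^ n" by blast
  define q where "q = dd * s"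
  have q: "0 < q" "q < 1" using s dd_pos by (auto simp: q_def field_simps)
  have "norm ((dif i ^^ m) (fv n) k) \<le> K * q ^ n" for n k
  proof -
    have sc: "(dif i ^^ r) (fv n) = (\<lambda>k. of_real (dd ^ n) * (dif i ^^ r) (A n) k)" for r
      by (induction r) (auto simp: fv_def[abs_def] dif_scale)
    have "norm ((dif i ^^ m) (fv n) k) = dd ^ n * norm ((dif i ^^ m) (A n) k)"
      by (simp add: sc norm_mult norm_power)
    also have "norm ((dif i ^^ m) (A n) k) \<le> ?x (axis i m) n"
      using linf_ge[OF dif_pow_l0[OF Al0]] by (simp add: conv_nabla_axis Al0)
    also have "\<dots> \<le> K * s ^ n" by (rule K)
    finally show ?thesis using dd_pos by (simp add: q_def power_mult_distrib mult_left_mono mult_ac)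
  qed
  moreover have "0 \<le> K" using K[of 0] x0[of "axis i m" 0] by simp
  ultimately show ?thesis using q unfolding m_def by blast
qed

lemma A_0: "A (Suc n) (M *v k) = A n k / of_nat (d_M M)"
proof -
  have "A (Suc n) (M *v k) = pair (A n) (\<lambda>j. a (M *v (k - j)))"
    by (simp add: iter_Suc_pair[OF al0] matrix_vector_mult_diff_distrib)
  also have "\<dots> = conv (A n) delta k / of_nat (d_M M)"
  proof -
    have "a (M *v (k - j)) = 1 / of_nat (d_M M) * delta (k - j)" for j
      using ai unfolding interpolatory_def delta_def by simp
    thus ?thesis unfolding conv_pair by (simp only: pair_scale_right) simp
  qed
  finally show ?thesis by (simp add: conv_delta Al0)
qed

lemma fv_refine: "fv (Suc n) (M *v k) = fv n k"
  using d_pos by (simp add: fv_def A_0)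

lemma fv_at_0: "fv n 0 = 1"
proof (induction n)
  case (Suc n)
  thus ?case using fv_refine[of n 0] by simp
qed (simp add: fv_0 delta_def)

lemma fv_difference: "\<exists>C r. 0 < r \<and> r < 1 \<and> 0 \<le> C \<and> (\<forall>n i k. norm (dif i (fv n) k) \<le> C * r ^ n)"
proof -
  define B where "B n = linf_norm (fv n)" for n
  have B: "norm (fv n k) \<le> B n" for n k unfolding B_def by (rule linf_ge[OF fv_l0])
  have B1: "1 \<le> B n" for n using B[of n 0] by (simp add: fv_at_0)
  have "\<exists>C r. 0 < r \<and> r < 1 \<and> 0 \<le> C \<and> (\<forall>n k. norm (dif i (fv n) k) \<le> C * r ^ n * B n)" for i
  proof -
    obtain C q where C: "0 < q" "q < 1" "0 \<le> C" "\<And>n k. norm ((dif i ^^ sr a M) (fv n) k) \<le> C * q ^ n"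
      using high_difference_decay by blast
    have "norm ((dif i ^^ sr a M) (fv n) k) \<le> C * q ^ n * B n" for n k
    proof -
      have "C * q ^ n * 1 \<le> C * q ^ n * B n" using C B1 by (intro mult_left_mono) auto
      thus ?thesis using C(4)[of n k] by simp
    qed
    from difference_decay[OF B _ C(1,2,3) this] sr_pos show ?thesis by simp
  qed
  then obtain C r where Cr: "\<And>i. 0 < r i" "\<And>i. r i < 1" "\<And>i. 0 \<le> C i"
    "\<And>i n k. norm (dif i (fv n) k) \<le> C i * r i ^ n * B n" by metis
  define r0 where "r0 = Max (range r)"
  have rle: "r i \<le> r0" for i by (simp add: r0_def)
  have "r0 \<in> range r" unfolding r0_def by (rule Max_in) auto
  hence r0: "0 < r0" "r0 < 1" using Cr by auto
  define C0 where "C0 = (\<Sum>i\<in>UNIV. C i)"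
  have C0: "0 \<le> C0" "C i \<le> C0" for i unfolding C0_def using Cr by (auto intro: sum_nonneg member_le_sum)
  have dB: "norm (dif i (fv n) k) \<le> C0 * r0 ^ n * B n" for i n k
  proof -
    have "C i * r i ^ n * B n \<le> C0 * r0 ^ n * B n"
      using C0 Cr rle r0 B1[of n] by (intro mult_mono power_mono) (auto intro: less_imp_le)
    thus ?thesis using Cr(4)[of i n k] by linarith
  qed
  obtain E where E: "E > 0" "\<And>x. norm (fwd x) \<le> E * norm x" using fwd_bound by blast
  define C1 where "C1 = real CARD('n) * (E * real CARD('n)) * C0"
  have C1: "0 \<le> C1" unfolding C1_def using E C0 by simp
  have Bstep: "B (Suc n) \<le> B n + C1 * r0 ^ Suc n * B (Suc n)" for n
    unfolding B_def[of "Suc n"]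
  proof (rule linf_le)
    fix k
    define j where "j = vfloor (bwd (rvec k))"
    have "rvec (k - M *v j) = fwd (vfrac (bwd (rvec k)))"
      by (simp add: j_def vfrac_def rvec_diff rvec_mv matrix_vector_mult_diff_distrib)
    hence "norm (rvec (k - M *v j)) \<le> E * norm (vfrac (bwd (rvec k)))" using E(2) by simp
    also have "\<dots> \<le> E * real CARD('n)" using E(1) by (intro mult_left_mono norm_cube vfrac_cube) auto
    finally have "norm (rvec (k - M *v j)) \<le> E * real CARD('n)" .
    hence l: "real (l1 (k - M *v j)) \<le> real CARD('n) * (E * real CARD('n))"
      using l1_le_norm[of "k - M *v j"] by (meson mult_left_mono of_nat_0_le_iff order_trans)
    have "norm (fv (Suc n) (M *v j + (k - M *v j)) - fv (Suc n) (M *v j)) \<le> real (l1 (k - M *v j)) * (C0 * r0 ^ Suc n * B (Suc n))"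
      by (rule path_bound[OF dB])
    also have "\<dots> \<le> (real CARD('n) * (E * real CARD('n))) * (C0 * r0 ^ Suc n * B (Suc n))"
      using l C0 r0 B1[of "Suc n"] by (intro mult_right_mono) auto
    finally have "norm (fv (Suc n) k - fv n j) \<le> C1 * r0 ^ Suc n * B (Suc n)"
      by (simp add: fv_refine C1_def mult_ac)
    moreover have "norm (fv (Suc n) k) \<le> norm (fv n j) + norm (fv (Suc n) k - fv n j)"
      by (metis add.commute diff_add_cancel norm_triangle_ineq)
    ultimately show "norm (fv (Suc n) k) \<le> B n + C1 * r0 ^ Suc n * linf_norm (fv (Suc n))"
      using B[of n j] unfolding B_def by linarith
  qed
  have "(\<lambda>n. C1 * r0 ^ Suc n) \<longlonglongrightarrow> C1 * 0"
    using r0 by (intro tendsto_mult tendsto_const LIMSEQ_Suc LIMSEQ_power_zero) auto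
  hence "eventually (\<lambda>n. C1 * r0 ^ Suc n < 1 / 2) sequentially" by (rule order_tendstoD) simp
  then obtain n0 where n0: "\<And>n. n \<ge> n0 \<Longrightarrow> C1 * r0 ^ Suc n < 1 / 2" by (auto simp: eventually_sequentially)
  have Bexp: "B (n0 + j) \<le> B n0 * exp (\<Sum>i<j. 2 * (C1 * r0 ^ Suc (n0 + i)))" for j
  proof (induction j)
    case (Suc j)
    define e where "e = C1 * r0 ^ Suc (n0 + j)"
    have e: "0 \<le> e" "e < 1 / 2" unfolding e_def using n0[of "n0 + j"] C1 r0 by auto
    have "B (Suc (n0 + j)) * (1 - e) \<le> B (n0 + j)" using Bstep[of "n0 + j"] by (simp add: e_def algebra_simps)
    moreover have "B (Suc (n0 + j)) * 1 \<le> B (Suc (n0 + j)) * ((1 - e) * (1 + 2 * e))"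
    proof (intro mult_left_mono)
      have "0 \<le> e * (1 - 2 * e)" using e by (intro mult_nonneg_nonneg) auto
      thus "1 \<le> (1 - e) * (1 + 2 * e)" by (simp add: algebra_simps)
    qed (use B1[of "Suc (n0 + j)"] in simp)
    moreover have "B (Suc (n0 + j)) * (1 - e) * (1 + 2 * e) \<le> B (n0 + j) * (1 + 2 * e)"
      using calculation(1) e by (intro mult_right_mono) auto
    ultimately have "B (Suc (n0 + j)) \<le> B (n0 + j) * (1 + 2 * e)"
      by (simp only: mult.assoc mult_1_right)
    also have "\<dots> \<le> B (n0 + j) * exp (2 * e)"
      using B1[of "n0 + j"] by (intro mult_left_mono exp_ge_add_one_self) auto
    also have "\<dots> \<le> (B n0 * exp (\<Sum>i<j. 2 * (C1 * r0 ^ Suc (n0 + i)))) * exp (2 * e)"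
      by (intro mult_right_mono Suc) auto
    finally show ?case by (simp add: e_def mult.assoc flip: exp_add)
  qed simp
  define D where "D = B n0 * exp (2 * C1 * (1 / (1 - r0)))"
  have BD: "B (n0 + j) \<le> D" for j
  proof -
    have "(\<Sum>i<j. 2 * (C1 * r0 ^ Suc (n0 + i))) \<le> (\<Sum>i<j. 2 * C1 * r0 ^ i)"
    proof (rule sum_mono)
      fix i
      have "r0 ^ Suc (n0 + i) \<le> r0 ^ i" using r0 by (intro power_decreasing) auto
      thus "2 * (C1 * r0 ^ Suc (n0 + i)) \<le> 2 * C1 * r0 ^ i" using C1 by (simp add: mult_left_mono)
    qed
    also have "\<dots> = 2 * C1 * (\<Sum>i<j. r0 ^ i)" by (simp add: sum_distrib_left)
    also have "\<dots> \<le> 2 * C1 * (1 / (1 - r0))"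
    proof (intro mult_left_mono)
      have "(\<Sum>i<j. r0 ^ i) \<le> (\<Sum>i. r0 ^ i)" using r0 by (intro sum_le_suminf summable_geometric) auto
      thus "(\<Sum>i<j. r0 ^ i) \<le> 1 / (1 - r0)" using r0 by (simp add: suminf_geometric)
    qed (use C1 in simp)
    finally show ?thesis
      using Bexp[of j] B1[of n0] unfolding D_def by (meson exp_le_cancel_iff mult_left_mono order_trans zero_le_one)
  qed
  define D' where "D' = D + (\<Sum>n\<le>n0. B n)"
  have D': "B n \<le> D'" for n
  proof (cases "n \<le> n0")
    case True
    have "B n \<le> (\<Sum>n\<le>n0. B n)" using True B1 by (intro member_le_sum) (auto intro: order_trans[OF zero_le_one])
    moreover have "0 \<le> D" unfolding D_def using B1[of n0] by simp
    ultimately show ?thesis by (simp add: D'_def)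
  next
    case False
    have "0 \<le> (\<Sum>n\<le>n0. B n)" using B1 by (intro sum_nonneg) (auto intro: order_trans[OF zero_le_one])
    thus ?thesis using BD[of "n - n0"] False by (simp add: D'_def)
  qed
  have "norm (dif i (fv n) k) \<le> (C0 * D') * r0 ^ n" for n i k
  proof -
    have "C0 * r0 ^ n * B n \<le> C0 * r0 ^ n * D'" using C0 r0 D' by (intro mult_left_mono) auto
    thus ?thesis using dB[of i n k] by (simp add: mult_ac)
  qed
  moreover have "0 \<le> C0 * D'" using C0 D'[of 0] B1[of 0] by simp
  ultimately show ?thesis using r0 by blast
qed

lemma fv_modulus: "\<exists>C r. 0 < r \<and> r < 1 \<and> 0 \<le> C \<and> (\<forall>n j k. norm (fv n j - fv n k) \<le> C * r ^ n * norm (rvec j - rvec k))"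
proof -
  obtain C r where C: "0 < r" "r < 1" "0 \<le> C" "\<And>n i k. norm (dif i (fv n) k) \<le> C * r ^ n" using fv_difference by blast
  have "norm (fv n j - fv n k) \<le> (real CARD('n) * C) * r ^ n * norm (rvec j - rvec k)" for n j k
  proof -
    have "norm (fv n (k + (j - k)) - fv n k) \<le> real (l1 (j - k)) * (C * r ^ n)" by (rule path_bound[OF C(4)])
    also have "\<dots> \<le> (real CARD('n) * norm (rvec (j - k))) * (C * r ^ n)"
      using C by (intro mult_right_mono l1_le_norm) auto
    finally show ?thesis by (simp add: rvec_diff mult_ac)
  qed
  thus ?thesis using C by (intro exI[of _ "real CARD('n) * C"] exI[of _ r]) auto
qed

end

section \<open>The refinable function\<close>

lemma geometric_limit:
  fixes u :: "nat \<Rightarrow> complex"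
  assumes step: "\<And>n. norm (u (Suc n) - u n) \<le> D * r ^ n" and r: "0 < r" "r < 1" and D: "0 \<le> D"
  shows "u \<longlonglongrightarrow> lim u" "norm (lim u - u n) \<le> D / (1 - r) * r ^ n"
proof -
  have sum: "norm (u (n + p) - u n) \<le> D / (1 - r) * r ^ n" for n p
  proof -
    have "u (n + p) - u n = (\<Sum>i<p. u (n + Suc i) - u (n + i))"
      using sum_lessThan_telescope[of "\<lambda>i. u (n + i)" p] by simp
    also have "norm \<dots> \<le> (\<Sum>i<p. D * r ^ n * r ^ i)"
      by (intro sum_norm_le) (use step[of "n + _"] in \<open>simp add: power_add mult_ac\<close>)
    also have "\<dots> = D * r ^ n * (\<Sum>i<p. r ^ i)" by (simp add: sum_distrib_left)
    also have "\<dots> \<le> D * r ^ n * (1 / (1 - r))"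
    proof (intro mult_left_mono)
      have "(\<Sum>i<p. r ^ i) \<le> (\<Sum>i. r ^ i)" using r by (intro sum_le_suminf summable_geometric) auto
      thus "(\<Sum>i<p. r ^ i) \<le> 1 / (1 - r)" using r by (simp add: suminf_geometric)
    qed (use D r in auto)
    finally show ?thesis by simp
  qed
  have "summable (\<lambda>n. u (Suc n) - u n)"
    by (rule summable_comparison_test'[where g = "\<lambda>n. D * r ^ n" and N = 0])
       (use step r in \<open>auto intro!: summable_mult summable_geometric\<close>)
  hence "(\<lambda>n. \<Sum>i<n. u (Suc i) - u i) \<longlonglongrightarrow> (\<Sum>n. u (Suc n) - u n)" by (rule summable_LIMSEQ)
  hence "(\<lambda>n. u n - u 0) \<longlonglongrightarrow> (\<Sum>n. u (Suc n) - u n)" by (simp add: sum_lessThan_telescope)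
  hence "(\<lambda>n. (u n - u 0) + u 0) \<longlonglongrightarrow> (\<Sum>n. u (Suc n) - u n) + u 0" by (intro tendsto_intros)
  hence "convergent u" unfolding convergent_def by auto
  thus lim: "u \<longlonglongrightarrow> lim u" by (simp add: convergent_LIMSEQ_iff)
  have "(\<lambda>p. norm (u (n + p) - u n)) \<longlonglongrightarrow> norm (lim u - u n)"
    using LIMSEQ_ignore_initial_segment[OF lim, of n] by (intro tendsto_intros) (simp add: add.commute)
  thus "norm (lim u - u n) \<le> D / (1 - r) * r ^ n"
    by (rule LIMSEQ_le_const2) (use sum in auto)
qed

context dilation
begin

abbreviation "fwdn n x \<equiv> ((\<lambda>x. fwd x) ^^ n) x"
abbreviation "bwdn n x \<equiv> ((\<lambda>x. bwd x) ^^ n) x"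
abbreviation "mvn n k \<equiv> ((\<lambda>k. M *v k) ^^ n) k"

lemma fwdn_linear: "linear (\<lambda>x. fwdn n x)"
proof (induction n)
  case (Suc n)
  show ?case using linear_compose[OF Suc matrix_vector_mul_linear[of "rmat M"]] by (simp add: o_def)
qed (simp add: linear_ident)

lemma bwdn_linear: "linear (\<lambda>x. bwdn n x)"
proof (induction n)
  case (Suc n)
  show ?case using linear_compose[OF Suc matrix_vector_mul_linear[of "matrix_inv (rmat M)"]] by (simp add: o_def)
qed (simp add: linear_ident)

lemmas fwdn_diff = linear_diff[OF fwdn_linear]
lemmas bwdn_diff = linear_diff[OF bwdn_linear]
lemmas bwdn_add = linear_add[OF bwdn_linear]

lemma fwdn_Suc: "fwdn (Suc n) x = fwdn n (fwd x)"
  by (simp add: funpow_swap1)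

lemma bwdn_fwdn [simp]: "bwdn n (fwdn n x) = x"
  by (induction n arbitrary: x) (simp_all add: funpow_swap1)

lemma fwdn_bwdn [simp]: "fwdn n (bwdn n x) = x"
  by (induction n arbitrary: x) (simp_all add: funpow_swap1)

lemma fwdn_rvec: "fwdn n (rvec k) = rvec (mvn n k)"
  by (induction n) (auto simp: rvec_mv)

lemma mvn_inj: "mvn n j = mvn n k \<longleftrightarrow> j = k"
  by (induction n) (auto simp: mv_inj)

lemma mvn_add: "mvn n (j + k) = mvn n j + mvn n k"
  by (induction n) (auto simp: matrix_vector_right_distrib)

lemma vfloor_fwdn_shift: "vfloor (fwdn n (x - rvec k)) = vfloor (fwdn n x) - mvn n k"
  by (simp add: fwdn_diff fwdn_rvec vfloor_diff)

lemma floor_refine_bound: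
  "\<exists>E>0. \<forall>y. norm (rvec (vfloor (fwd y)) - rvec (M *v vfloor y)) \<le> E"
proof -
  obtain E where E: "E > 0" "\<And>x. norm (fwd x) \<le> E * norm x" using fwd_bound by blast
  have "norm (rvec (vfloor (fwd y)) - rvec (M *v vfloor y)) \<le> E * CARD('n) + CARD('n)" for y
  proof -
    have "rvec (vfloor (fwd y)) - rvec (M *v vfloor y) = fwd (vfrac y) - vfrac (fwd y)"
      by (simp add: vfrac_def rvec_mv matrix_vector_mult_diff_distrib)
    also have "norm \<dots> \<le> norm (fwd (vfrac y)) + norm (vfrac (fwd y))" by (rule norm_triangle_ineq4)
    also have "norm (fwd (vfrac y)) \<le> E * norm (vfrac y)" by (rule E)
    also have "E * norm (vfrac y) \<le> E * CARD('n)" using E(1) by (intro mult_left_mono norm_cube vfrac_cube) auto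
    also have "norm (vfrac (fwd y)) \<le> CARD('n)" by (intro norm_cube vfrac_cube)
    finally show ?thesis by simp
  qed
  thus ?thesis using E(1) by (intro exI[of _ "E * CARD('n) + CARD('n)"]) (auto intro: add_pos_pos)
qed

end

context interp
begin

definition gn :: "nat \<Rightarrow> 'n cfun" where "gn n x = fv n (vfloor (fwdn n x))"

definition phi :: "'n cfun" where "phi x = lim (\<lambda>n. gn n x)"

lemma phi_approx:
  "\<exists>C r. 0 < r \<and> r < 1 \<and> 0 \<le> C \<and> (\<forall>x. (\<lambda>n. gn n x) \<longlonglongrightarrow> phi x) \<and> (\<forall>n x. norm (phi x - gn n x) \<le> C * r ^ n)
    \<and> (\<forall>n j k. norm (fv n j - fv n k) \<le> C * r ^ n * norm (rvec j - rvec k))"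
proof -
  obtain C r where C: "0 < r" "r < 1" "0 \<le> C" "\<And>n j k. norm (fv n j - fv n k) \<le> C * r ^ n * norm (rvec j - rvec k)"
    using fv_modulus by blast
  obtain E where E: "E > 0" "\<And>y. norm (rvec (vfloor (fwd y)) - rvec (M *v vfloor y)) \<le> E" using floor_refine_bound by blast
  have step: "norm (gn (Suc n) x - gn n x) \<le> C * E * r ^ n" for n x
  proof -
    have "gn (Suc n) x - gn n x = fv (Suc n) (vfloor (fwd (fwdn n x))) - fv (Suc n) (M *v vfloor (fwdn n x))"
      by (simp add: gn_def fv_refine)
    also have "norm \<dots> \<le> C * r ^ Suc n * norm (rvec (vfloor (fwd (fwdn n x))) - rvec (M *v vfloor (fwdn n x)))"
      by (rule C)
    also have "\<dots> \<le> C * r ^ n * E"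
      using C E by (intro mult_mono mult_left_mono power_decreasing) auto
    finally show ?thesis by (simp add: mult_ac)
  qed
  have CE: "0 \<le> C * E" using C E by simp
  have lim: "(\<lambda>n. gn n x) \<longlonglongrightarrow> phi x" "norm (phi x - gn n x) \<le> C * E / (1 - r) * r ^ n" for n x
    unfolding phi_def using geometric_limit[of "\<lambda>n. gn n x", OF step C(1,2) CE] by auto
  have "norm (phi x - gn n x) \<le> (C + C * E / (1 - r)) * r ^ n" for n x
  proof -
    have "C * E / (1 - r) * r ^ n \<le> (C + C * E / (1 - r)) * r ^ n" using C by (intro mult_right_mono) auto
    thus ?thesis using lim(2)[of x n] by linarith
  qed
  moreover have "norm (fv n j - fv n k) \<le> (C + C * E / (1 - r)) * r ^ n * norm (rvec j - rvec k)" for n j k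
  proof -
    have "0 \<le> C * E / (1 - r)" using CE C by simp
    hence "C * r ^ n * norm (rvec j - rvec k) \<le> (C + C * E / (1 - r)) * r ^ n * norm (rvec j - rvec k)"
      using C by (intro mult_right_mono) auto
    thus ?thesis using C(4)[of n j k] by linarith
  qed
  moreover have "0 \<le> C + C * E / (1 - r)" using CE C by simp
  ultimately show ?thesis using C lim(1) by blast
qed

lemma gn_tendsto: "(\<lambda>n. gn n x) \<longlonglongrightarrow> phi x"
  using phi_approx by blast

lemma phi_int: "phi (rvec k) = (if k = 0 then 1 else 0)"
proof -
  have fvm: "fv n (mvn n k) = delta k" for n
    by (induction n) (auto simp: fv_0 fv_refine)
  have "gn n (rvec k) = delta k" for n unfolding gn_def fwdn_rvec by (simp add: fvm)
  hence "(\<lambda>n. delta k) \<longlonglongrightarrow> phi (rvec k)" using gn_tendsto[of "rvec k"] by simp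
  hence "phi (rvec k) = delta k" by (metis LIMSEQ_unique tendsto_const)
  thus ?thesis by (simp add: delta_def)
qed

lemma phi_modulus:
  "\<exists>r. 0 < r \<and> r < 1 \<and> (\<forall>R. \<exists>C\<ge>0. \<forall>n x y. norm (fwdn n (x - y)) \<le> R \<longrightarrow> norm (phi x - phi y) \<le> C * r ^ n)"
proof -
  obtain C r where C: "0 < r" "r < 1" "0 \<le> C" "\<And>n x. norm (phi x - gn n x) \<le> C * r ^ n"
    "\<And>n j k. norm (fv n j - fv n k) \<le> C * r ^ n * norm (rvec j - rvec k)" using phi_approx by blast
  have "\<exists>D\<ge>0. \<forall>n x y. norm (fwdn n (x - y)) \<le> R \<longrightarrow> norm (phi x - phi y) \<le> D * r ^ n" for R
  proof (intro exI conjI allI impI)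
    define c where "c = real CARD('n)"
    show "0 \<le> 2 * C + C * (\<bar>R\<bar> + 2 * c)" using C by (simp add: c_def)
    fix n x y assume R: "norm (fwdn n (x - y)) \<le> R"
    let ?j = "vfloor (fwdn n x)" and ?k = "vfloor (fwdn n y)"
    have "rvec ?j - rvec ?k = fwdn n (x - y) - vfrac (fwdn n x) + vfrac (fwdn n y)"
      by (simp add: vfrac_def fwdn_diff)
    also have "norm \<dots> \<le> norm (fwdn n (x - y)) + norm (vfrac (fwdn n x)) + norm (vfrac (fwdn n y))"
      by (meson add_mono norm_triangle_ineq norm_triangle_ineq4 order_refl order_trans)
    also have "\<dots> \<le> \<bar>R\<bar> + 2 * c"
      using R norm_cube[OF vfrac_cube[of "fwdn n x"]] norm_cube[OF vfrac_cube[of "fwdn n y"]] by (simp add: c_def)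
    finally have "C * r ^ n * norm (rvec ?j - rvec ?k) \<le> C * r ^ n * (\<bar>R\<bar> + 2 * c)"
      using C by (intro mult_left_mono) auto
    hence "norm (gn n x - gn n y) \<le> C * r ^ n * (\<bar>R\<bar> + 2 * c)" using C(5)[of n ?j ?k] unfolding gn_def by linarith
    moreover have "phi x - phi y = (phi x - gn n x) + (gn n x - gn n y) - (phi y - gn n y)" by simp
    hence "norm (phi x - phi y) \<le> norm (phi x - gn n x) + norm (gn n x - gn n y) + norm (phi y - gn n y)"
      using norm_triangle_ineq4[of "(phi x - gn n x) + (gn n x - gn n y)" "phi y - gn n y"]
        norm_triangle_ineq[of "phi x - gn n x" "gn n x - gn n y"] by simp
    ultimately have "norm (phi x - phi y) \<le> C * r ^ n + C * r ^ n * (\<bar>R\<bar> + 2 * c) + C * r ^ n"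
      using C(4)[of x n] C(4)[of y n] by linarith
    thus "norm (phi x - phi y) \<le> (2 * C + C * (\<bar>R\<bar> + 2 * c)) * r ^ n" by (simp add: algebra_simps)
  qed
  thus ?thesis using C by blast
qed

lemma phi_continuous: "continuous_on UNIV phi"
  unfolding continuous_on_iff
proof (intro ballI allI impI)
  fix x :: "real^'n" and e :: real assume e: "0 < e"
  obtain r where r: "0 < r" "r < 1" "\<And>R. \<exists>C\<ge>0. \<forall>n x y. norm (fwdn n (x - y)) \<le> R \<longrightarrow> norm (phi x - phi y) \<le> C * r ^ n"
    using phi_modulus by blast
  obtain C where C: "\<And>n x y. norm (fwdn n (x - y)) \<le> 1 \<Longrightarrow> norm (phi x - phi y) \<le> C * r ^ n" using r(3)[of 1] by blast
  have "(\<lambda>n. C * r ^ n) \<longlonglongrightarrow> C * 0" using r by (intro tendsto_mult tendsto_const LIMSEQ_power_zero) auto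
  hence "eventually (\<lambda>n. C * r ^ n < e) sequentially" by (rule order_tendstoD) (simp add: e)
  then obtain n where n: "C * r ^ n < e" by (auto simp: eventually_sequentially)
  obtain B where B: "B > 0" "\<And>x. norm (fwdn n x) \<le> B * norm x" using linear_bounded_pos[OF fwdn_linear[of n]] by blast
  show "\<exists>d>0. \<forall>x'\<in>UNIV. dist x' x < d \<longrightarrow> dist (phi x') (phi x) < e"
  proof (intro exI[of _ "1 / B"] conjI ballI impI)
    fix x' assume "dist x' x < 1 / B"
    hence "B * norm (x' - x) \<le> 1" using B(1) by (simp add: dist_norm field_simps)
    hence "norm (fwdn n (x' - x)) \<le> 1" using B(2)[of "x' - x"] by linarith
    from C[OF this] n show "dist (phi x') (phi x) < e" by (simp add: dist_norm)
  qed (use B in auto)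
qed

lemma gn_support: "\<exists>R. \<forall>n x. gn n x \<noteq> 0 \<longrightarrow> norm x \<le> R"
proof -
  obtain C \<rho> where C: "0 < \<rho>" "\<rho> < 1" "0 < C" "\<And>n x. norm (bwdn n x) \<le> C * \<rho> ^ n * norm x" using decay by blast
  define D where "D = (\<Sum>s | a s \<noteq> 0. norm (rvec s))"
  have D: "norm (rvec s) \<le> D" if "a s \<noteq> 0" for s
    unfolding D_def using that l0_finite[OF al0] by (intro member_le_sum) auto
  have D0: "0 \<le> D" unfolding D_def by (intro sum_nonneg) auto
  have A: "norm (bwdn n (rvec k)) \<le> C * D * (\<Sum>i\<le>n. \<rho> ^ i)" if "A n k \<noteq> 0" for n k
    using that
  proof (induction n arbitrary: k)
    case 0
    hence "k = 0" by (simp add: iter_0[OF al0] delta_def split: if_splits)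
    thus ?case using C D0 by simp
  next
    case (Suc n)
    have "\<exists>j. A n j \<noteq> 0 \<and> a (k - M *v j) \<noteq> 0"
    proof (rule ccontr)
      assume "\<not> ?thesis"
      hence "pair (A n) (\<lambda>j. a (k - M *v j)) = pair (A n) (\<lambda>j. 0)" by (intro pair_cong) auto
      thus False using Suc(2) by (simp add: iter_Suc_pair[OF al0])
    qed
    then obtain j where j: "A n j \<noteq> 0" "a (k - M *v j) \<noteq> 0" by blast
    have "rvec k = fwd (rvec j) + rvec (k - M *v j)" by (simp add: rvec_diff rvec_mv)
    hence "bwdn (Suc n) (rvec k) = bwdn (Suc n) (fwd (rvec j)) + bwdn (Suc n) (rvec (k - M *v j))"
      by (metis bwdn_add)
    also have "bwdn (Suc n) (fwd (rvec j)) = bwdn n (rvec j)" by (simp add: funpow_swap1)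
    also have "norm (bwdn n (rvec j) + bwdn (Suc n) (rvec (k - M *v j))) \<le> C * D * (\<Sum>i\<le>n. \<rho> ^ i) + C * \<rho> ^ Suc n * D"
    proof (rule norm_triangle_mono[OF Suc(1)[OF j(1)]])
      have "C * \<rho> ^ Suc n * norm (rvec (k - M *v j)) \<le> C * \<rho> ^ Suc n * D"
        using C by (intro mult_left_mono D j) auto
      thus "norm (bwdn (Suc n) (rvec (k - M *v j))) \<le> C * \<rho> ^ Suc n * D" using C(4) order_trans by blast
    qed
    finally show ?case by (simp add: algebra_simps)
  qed
  define R where "R = C * D * (1 / (1 - \<rho>)) + C * CARD('n)"
  have "norm x \<le> R" if "gn n x \<noteq> 0" for n x
  proof -
    let ?k = "vfloor (fwdn n x)"
    have "A n ?k \<noteq> 0" using that by (auto simp: gn_def fv_def)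
    hence "norm (bwdn n (rvec ?k)) \<le> C * D * (\<Sum>i\<le>n. \<rho> ^ i)" by (rule A)
    also have "\<dots> \<le> C * D * (1 / (1 - \<rho>))"
    proof (intro mult_left_mono)
      have "(\<Sum>i<Suc n. \<rho> ^ i) \<le> (\<Sum>i. \<rho> ^ i)" using C by (intro sum_le_suminf summable_geometric) auto
      thus "(\<Sum>i\<le>n. \<rho> ^ i) \<le> 1 / (1 - \<rho>)" using C by (simp add: suminf_geometric lessThan_Suc_atMost)
    qed (use C D0 in auto)
    finally have 1: "norm (bwdn n (rvec ?k)) \<le> C * D * (1 / (1 - \<rho>))" .
    have "norm (bwdn n (vfrac (fwdn n x))) \<le> C * \<rho> ^ n * norm (vfrac (fwdn n x))" by (rule C)
    also have "\<dots> \<le> C * 1 * CARD('n)"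
      using C by (intro mult_mono norm_cube vfrac_cube power_le_one) auto
    finally have 2: "norm (bwdn n (vfrac (fwdn n x))) \<le> C * CARD('n)" by simp
    have "fwdn n x = rvec ?k + vfrac (fwdn n x)" by (simp add: vfrac_def)
    hence "x = bwdn n (rvec ?k) + bwdn n (vfrac (fwdn n x))" by (metis bwdn_add bwdn_fwdn)
    hence "norm x \<le> norm (bwdn n (rvec ?k)) + norm (bwdn n (vfrac (fwdn n x)))" by (metis norm_triangle_ineq)
    thus ?thesis using 1 2 by (simp add: R_def)
  qed
  thus ?thesis by blast
qed

lemma phi_support: "\<exists>R. \<forall>x. phi x \<noteq> 0 \<longrightarrow> norm x \<le> R"
proof -
  obtain R where R: "\<And>n x. gn n x \<noteq> 0 \<Longrightarrow> norm x \<le> R" using gn_support by blast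
  have "phi x = 0" if "\<not> norm x \<le> R" for x
  proof -
    have "gn n x = 0" for n using R that by blast
    thus ?thesis using gn_tendsto[of x] by (simp add: LIMSEQ_const_iff)
  qed
  thus ?thesis by blast
qed

lemma phi_refinement: "phi x = of_nat (d_M M) * pair a (\<lambda>k. phi (fwd x - rvec k))"
proof -
  have "gn (Suc n) x = of_nat (d_M M) * pair a (\<lambda>k. gn n (fwd x - rvec k))" for n
  proof -
    have "gn (Suc n) x = of_real (dd ^ Suc n) * pair a (\<lambda>k. A n (vfloor (fwdn n (fwd x)) - mvn n k))"
      unfolding gn_def fv_def fwdn_Suc iter_Suc'[OF al0] ..
    also have "\<dots> = of_nat (d_M M) * (of_real (dd ^ n) * pair a (\<lambda>k. A n (vfloor (fwdn n (fwd x)) - mvn n k)))"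
      by simp
    finally show ?thesis by (simp add: gn_def fv_def vfloor_fwdn_shift flip: pair_scale_right)
  qed
  moreover have "(\<lambda>n. of_nat (d_M M) * pair a (\<lambda>k. gn n (fwd x - rvec k))) \<longlonglongrightarrow> of_nat (d_M M) * pair a (\<lambda>k. phi (fwd x - rvec k))"
    unfolding pair_def by (intro tendsto_intros gn_tendsto)
  ultimately have "(\<lambda>n. gn (Suc n) x) \<longlonglongrightarrow> of_nat (d_M M) * pair a (\<lambda>k. phi (fwd x - rvec k))" by simp
  thus ?thesis using LIMSEQ_Suc[OF gn_tendsto[of x]] LIMSEQ_unique by blast
qed

lemma iter_coset_sum: "pair (A n) (\<lambda>j. if j - p \<in> range (\<lambda>k. mvn n k) then 1 else 0) = 1 / of_nat (d_M M) ^ n"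
proof (induction n arbitrary: p)
  case 0
  have "range (\<lambda>k. mvn 0 k) = UNIV" by auto
  thus ?case by (simp add: iter_0[OF al0])
next
  case (Suc n)
  let ?q = "\<lambda>n j. if j \<in> range (\<lambda>k. mvn n k) then 1 else (0 :: complex)"
  have "pair (A (Suc n)) (\<lambda>j. ?q (Suc n) (j - p)) = pair (A n) (\<lambda>j. pair a (\<lambda>k. ?q (Suc n) (M *v j + k - p)))"
    by (simp add: iter_Suc[OF al0] pair_conv push_l0 Al0 al0 pair_push)
  also have "\<dots> = pair a (\<lambda>k. pair (A n) (\<lambda>j. ?q (Suc n) (M *v j + k - p)))" by (rule pair_swap)
  also have "\<dots> = pair a (\<lambda>k. 1 / of_nat (d_M M) ^ n * (if lat (k - p) then 1 else 0))"
  proof (rule pair_cong)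
    fix k
    show "pair (A n) (\<lambda>j. ?q (Suc n) (M *v j + k - p)) = 1 / of_nat (d_M M) ^ n * (if lat (k - p) then 1 else 0)"
    proof (cases "lat (k - p)")
      case True
      then obtain i where i: "k - p = M *v i" by (auto simp: lat_def)
      have "M *v j + k - p \<in> range (\<lambda>k. mvn (Suc n) k) \<longleftrightarrow> j - (- i) \<in> range (\<lambda>k. mvn n k)" for j
      proof -
        have eq: "M *v j + k - p = M *v (j - (- i))" using i by (simp add: matrix_vector_right_distrib algebra_simps)
        show ?thesis unfolding eq by (auto simp: image_iff mv_inj)
      qed
      thus ?thesis using True Suc[of "- i"] by simp
    next
      case False
      have "M *v j + k - p \<notin> range (\<lambda>k. mvn (Suc n) k)" for j
      proof
        assume "M *v j + k - p \<in> range (\<lambda>k. mvn (Suc n) k)"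
        then obtain i where "M *v j + k - p = M *v mvn n i" by auto
        hence "k - p = M *v (mvn n i - j)" by (simp add: matrix_vector_mult_diff_distrib algebra_simps)
        thus False using False by (auto simp: lat_def)
      qed
      thus ?thesis using False by simp
    qed
  qed
  also have "\<dots> = 1 / of_nat (d_M M) ^ n * (1 / of_nat (d_M M))"
    using coset_moments[OF al0 a0 ai pdeg_const[of 1] sr_pos, of p]
    by (simp only: pair_scale_right pair_restrict[OF al0])
  finally show ?case by simp
qed

lemma fv_partition:
  assumes F: "finite F" "\<And>k. fv n (p - mvn n k) \<noteq> 0 \<Longrightarrow> k \<in> F"
  shows "(\<Sum>k\<in>F. fv n (p - mvn n k)) = 1"
proof -
  let ?q = "\<lambda>j. if j - p \<in> range (\<lambda>k. mvn n k) then 1 else (0::complex)"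
  let ?I = "(\<lambda>k. p - mvn n k) ` F"
  have d: "(of_nat (d_M M) :: complex) \<noteq> 0" using d_pos by simp
  have neg: "- mvn n k = mvn n (- k)" for k using mvn_add[of n k "- k"] mvn_add[of n 0 0] by (simp add: add_eq_0_iff)
  have Z: "A n j = 0" if "j - p = mvn n i" "j \<notin> ?I" for i j
  proof (rule ccontr)
    assume "A n j \<noteq> 0"
    have j: "j = p - mvn n (- i)" using that(1) by (simp add: algebra_simps flip: neg)
    have "fv n (p - mvn n (- i)) \<noteq> 0" using \<open>A n j \<noteq> 0\<close> d_pos j by (simp add: fv_def)
    hence "- i \<in> F" by (rule F(2))
    thus False using that(2) j by blast
  qed
  have "1 / of_nat (d_M M) ^ n = pair (A n) ?q" by (rule iter_coset_sum[symmetric])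
  also have "\<dots> = (\<Sum>j\<in>{j. A n j \<noteq> 0} \<union> ?I. A n j * ?q j)"
    by (rule pair_superset) (use F l0_finite[OF Al0] in auto)
  also have "\<dots> = (\<Sum>j\<in>?I. A n j * ?q j)"
    by (rule sum.mono_neutral_right) (use F l0_finite[OF Al0] Z in auto)
  also have "\<dots> = (\<Sum>k\<in>F. A n (p - mvn n k))"
  proof (subst sum.reindex)
    show "inj_on (\<lambda>k. p - mvn n k) F" by (auto simp: inj_on_def mvn_inj)
    have "- mvn n k \<in> range (\<lambda>k. mvn n k)" for k using neg by auto
    thus "sum ((\<lambda>j. A n j * ?q j) \<circ> (\<lambda>k. p - mvn n k)) F = (\<Sum>k\<in>F. A n (p - mvn n k))" by simp
  qed
  finally have "(\<Sum>k\<in>F. A n (p - mvn n k)) = 1 / of_nat (d_M M) ^ n" ..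
  thus ?thesis using d by (simp add: fv_def sum_distrib_left[symmetric])
qed

lemma phi_partition:
  assumes F: "finite F" "\<And>k. phi (x - rvec k) \<noteq> 0 \<Longrightarrow> k \<in> F"
  shows "(\<Sum>k\<in>F. phi (x - rvec k)) = 1"
proof -
  obtain R where R: "\<And>n x. gn n x \<noteq> 0 \<Longrightarrow> norm x \<le> R" using gn_support by blast
  define G where "G = F \<union> {k. norm (rvec k - x) \<le> R}"
  have G: "finite G" unfolding G_def using F finite_int_ball by blast
  have 1: "(\<Sum>k\<in>G. gn n (x - rvec k)) = 1" for n
    unfolding gn_def vfloor_fwdn_shift
  proof (rule fv_partition[OF G])
    fix k assume "fv n (vfloor (fwdn n x) - mvn n k) \<noteq> 0"
    hence "gn n (x - rvec k) \<noteq> 0" unfolding gn_def vfloor_fwdn_shift .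
    hence "norm (x - rvec k) \<le> R" by (rule R)
    thus "k \<in> G" by (simp add: G_def norm_minus_commute)
  qed
  have "(\<lambda>n. \<Sum>k\<in>G. gn n (x - rvec k)) \<longlonglongrightarrow> (\<Sum>k\<in>G. phi (x - rvec k))"
    by (intro tendsto_intros gn_tendsto)
  hence "(\<Sum>k\<in>G. phi (x - rvec k)) = 1" unfolding 1 by (simp add: LIMSEQ_const_iff)
  moreover have "(\<Sum>k\<in>G. phi (x - rvec k)) = (\<Sum>k\<in>F. phi (x - rvec k))"
    by (rule sum.mono_neutral_right) (use F G in \<open>auto simp: G_def\<close>)
  ultimately show ?thesis by simp
qed

end

section \<open>Lebesgue measure under the dilation\<close>

lemma unit_cube_Basis: "(unit_cube :: (real^'n) set) = {x. \<forall>b\<in>Basis. 0 \<le> x \<bullet> b \<and> x \<bullet> b < 1}"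
  by (auto simp: Basis_vec_def unit_cube_def inner_axis)

lemma unit_cube_borel [measurable]: "unit_cube \<in> sets borel"
proof -
  have "(unit_cube :: (real^'n) set) = (\<Inter>i\<in>UNIV. {x. 0 \<le> x $ i} \<inter> {x. x $ i < 1})"
    by (auto simp: unit_cube_def)
  also have "\<dots> \<in> sets borel"
    by (intro sets.finite_INT sets.Int borel_closed borel_open closed_halfspace_component_ge_cart[unfolded]
        open_halfspace_component_lt_cart) (auto intro: closed_halfspace_component_ge_cart)
  finally show ?thesis .
qed

lemma emeasure_unit_cube: "emeasure lborel (unit_cube :: (real^'n) set) = 1"
proof (rule antisym)
  have "emeasure lborel (unit_cube :: (real^'n) set) \<le> emeasure lborel (cbox 0 (One :: real^'n))"
    by (intro emeasure_mono) (auto simp: unit_cube_Basis mem_box less_imp_le)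
  thus "emeasure lborel (unit_cube :: (real^'n) set) \<le> 1" by (simp add: emeasure_lborel_cbox_eq)
  have "emeasure lborel (box 0 (One :: real^'n)) \<le> emeasure lborel (unit_cube :: (real^'n) set)"
    by (intro emeasure_mono) (auto simp: unit_cube_Basis mem_box less_imp_le)
  thus "1 \<le> emeasure lborel (unit_cube :: (real^'n) set)" by (simp add: emeasure_lborel_box_eq)
qed

lemma nn_integral_translate:
  fixes f :: "real^'n \<Rightarrow> ennreal"
  assumes [measurable]: "f \<in> borel_measurable borel"
  shows "(\<integral>\<^sup>+x. f (x + c) \<partial>lborel) = (\<integral>\<^sup>+x. f x \<partial>lborel)"
proof -
  have "(\<integral>\<^sup>+x. f x \<partial>lborel) = (\<integral>\<^sup>+x. f x \<partial>(distr lborel borel ((+) c)))" by (simp add: lborel_distr_plus)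
  also have "\<dots> = (\<integral>\<^sup>+x. f (c + x) \<partial>lborel)" by (rule nn_integral_distr) auto
  finally show ?thesis by (simp add: add.commute)
qed

lemma nn_integral_reflect:
  fixes f :: "real^'n \<Rightarrow> ennreal"
  assumes [measurable]: "f \<in> borel_measurable borel"
  shows "(\<integral>\<^sup>+x. f (- x) \<partial>lborel) = (\<integral>\<^sup>+x. f x \<partial>lborel)"
proof -
  have "(lborel :: (real^'n) measure) = distr lborel borel (\<lambda>x. - x)"
    using lborel_affine[of "-1" "0::real^'n"] by (simp add: density_1)
  hence "(\<integral>\<^sup>+x. f x \<partial>lborel) = (\<integral>\<^sup>+x. f x \<partial>(distr lborel borel (\<lambda>x::real^'n. - x)))" by simp
  also have "\<dots> = (\<integral>\<^sup>+x. f (- x) \<partial>lborel)" by (rule nn_integral_distr) auto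
  finally show ?thesis ..
qed

lemma integral_translate:
  fixes f :: "real^'n \<Rightarrow> complex"
  assumes [measurable]: "f \<in> borel_measurable borel"
  shows "(\<integral>x. f (x - c) \<partial>lborel) = (\<integral>x. f x \<partial>lborel)"
    and "integrable lborel (\<lambda>x. f (x - c)) \<longleftrightarrow> integrable lborel f"
proof -
  have d: "distr lborel borel ((+) (- c)) = (lborel :: (real^'n) measure)" by (rule lborel_distr_plus)
  have "(\<integral>x. f x \<partial>(distr lborel borel ((+) (- c)))) = (\<integral>x. f (- c + x) \<partial>lborel)" by (rule integral_distr) auto
  thus "(\<integral>x. f (x - c) \<partial>lborel) = (\<integral>x. f x \<partial>lborel)" unfolding d by simp
  have "integrable (distr lborel borel ((+) (- c))) f \<longleftrightarrow> integrable lborel (\<lambda>x. f (- c + x))"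
    by (rule integrable_distr_eq) auto
  thus "integrable lborel (\<lambda>x. f (x - c)) \<longleftrightarrow> integrable lborel f" unfolding d by simp
qed

context dilation
begin

lemma fwd_measurable [measurable]: "(\<lambda>x. fwd x) \<in> borel_measurable borel"
  by (intro borel_measurable_continuous_onI linear_continuous_on linear_conv_bounded_linear[THEN iffD1] matrix_vector_mul_linear)

text \<open>Uniqueness of Haar measure: the measure \<open>f \<mapsto> \<integral> f (M x) dx\<close> is translation invariant, and
  comparing it with Lebesgue measure by Fubini's theorem shows that both are proportional.\<close>

lemma nn_integral_fwd_proportional:
  fixes f g :: "real^'n \<Rightarrow> ennreal"
  assumes [measurable]: "f \<in> borel_measurable borel" "g \<in> borel_measurable borel"
  shows "(\<integral>\<^sup>+x. f x \<partial>lborel) * (\<integral>\<^sup>+y. g (fwd y) \<partial>lborel) = (\<integral>\<^sup>+y. f (fwd y) \<partial>lborel) * (\<integral>\<^sup>+x. g x \<partial>lborel)"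
proof -
  have "(\<integral>\<^sup>+x. f x \<partial>lborel) * (\<integral>\<^sup>+y. g (fwd y) \<partial>lborel) = (\<integral>\<^sup>+y. (\<integral>\<^sup>+x. f x \<partial>lborel) * g (fwd y) \<partial>lborel)"
    by (rule nn_integral_cmult[symmetric]) measurable
  also have "\<dots> = (\<integral>\<^sup>+y. (\<integral>\<^sup>+x. f (x + fwd y) * g (fwd y) \<partial>lborel) \<partial>lborel)"
  proof (rule nn_integral_cong)
    fix y
    have "(\<integral>\<^sup>+x. f (x + fwd y) * g (fwd y) \<partial>lborel) = (\<integral>\<^sup>+x. f (x + fwd y) \<partial>lborel) * g (fwd y)"
      by (rule nn_integral_multc) measurable
    thus "(\<integral>\<^sup>+x. f x \<partial>lborel) * g (fwd y) = (\<integral>\<^sup>+x. f (x + fwd y) * g (fwd y) \<partial>lborel)"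
      by (simp add: nn_integral_translate)
  qed
  also have "\<dots> = (\<integral>\<^sup>+x. (\<integral>\<^sup>+y. f (x + fwd y) * g (fwd y) \<partial>lborel) \<partial>lborel)"
    by (rule lborel_pair.Fubini') measurable
  also have "\<dots> = (\<integral>\<^sup>+x. (\<integral>\<^sup>+y. f (fwd y) * g (fwd y - x) \<partial>lborel) \<partial>lborel)"
  proof (rule nn_integral_cong)
    fix x
    have "(\<integral>\<^sup>+y. f (x + fwd y) * g (fwd y) \<partial>lborel) = (\<integral>\<^sup>+y. (\<lambda>y. f (x + fwd y) * g (fwd y)) (y + bwd (- x)) \<partial>lborel)"
      by (rule nn_integral_translate[symmetric]) measurable
    thus "(\<integral>\<^sup>+y. f (x + fwd y) * g (fwd y) \<partial>lborel) = (\<integral>\<^sup>+y. f (fwd y) * g (fwd y - x) \<partial>lborel)"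
      by (simp add: matrix_vector_right_distrib)
  qed
  also have "\<dots> = (\<integral>\<^sup>+y. (\<integral>\<^sup>+x. f (fwd y) * g (fwd y - x) \<partial>lborel) \<partial>lborel)"
    by (rule lborel_pair.Fubini'[symmetric]) measurable
  also have "\<dots> = (\<integral>\<^sup>+y. f (fwd y) * (\<integral>\<^sup>+x. g x \<partial>lborel) \<partial>lborel)"
  proof (rule nn_integral_cong)
    fix y
    have "(\<integral>\<^sup>+x. f (fwd y) * g (fwd y - x) \<partial>lborel) = f (fwd y) * (\<integral>\<^sup>+x. g (fwd y - x) \<partial>lborel)"
      by (rule nn_integral_cmult) measurable
    also have "(\<integral>\<^sup>+x. g (fwd y - x) \<partial>lborel) = (\<integral>\<^sup>+x. (\<lambda>x. g (fwd y + x)) (- x) \<partial>lborel)" by simp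
    also have "\<dots> = (\<integral>\<^sup>+x. g (x + fwd y) \<partial>lborel)" by (subst nn_integral_reflect) (auto simp: add.commute)
    also have "\<dots> = (\<integral>\<^sup>+x. g x \<partial>lborel)" by (rule nn_integral_translate) simp
    finally show "(\<integral>\<^sup>+x. f (fwd y) * g (fwd y - x) \<partial>lborel) = f (fwd y) * (\<integral>\<^sup>+x. g x \<partial>lborel)" .
  qed
  also have "\<dots> = (\<integral>\<^sup>+y. f (fwd y) \<partial>lborel) * (\<integral>\<^sup>+x. g x \<partial>lborel)"
    by (rule nn_integral_multc) measurable
  finally show ?thesis .
qed

end

context dilation_card
begin

lemma fwd_cube_measurable [measurable]: "{x. bwd x \<in> unit_cube} \<in> sets borel"
proof -
  have [measurable]: "(\<lambda>x. bwd x) \<in> borel_measurable borel"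
    by (intro borel_measurable_continuous_onI linear_continuous_on linear_conv_bounded_linear[THEN iffD1] matrix_vector_mul_linear)
  show ?thesis by measurable
qed

text \<open>The image of the unit cube and the union of its translates by \<open>\<Gamma>\<^sub>M\<close> are both fundamental domains
  of the lattice \<open>M \<int>\<^sup>d\<close>.\<close>

lemma nn_integral_fwd_cube: "(\<integral>\<^sup>+x. indicator {x. bwd x \<in> unit_cube} x \<partial>lborel) = ennreal (real (d_M M))"
proof -
  let ?U = "{x. bwd x \<in> unit_cube}" and ?C = "unit_cube :: (real^'n) set"
  obtain E where E: "E > 0" "\<And>x. norm (fwd x) \<le> E * norm x" using fwd_bound by blast
  obtain D where D: "D > 0" "\<And>x. norm (bwd x) \<le> D * norm x"
    using linear_bounded_pos[OF matrix_vector_mul_linear[of "matrix_inv (rmat M)"]] by blast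
  let ?c = "real CARD('n)"
  define N where "N = (\<Sum>g\<in>Gamma_M M. norm (rvec g))"
  have N: "norm (rvec g) \<le> N" if "g \<in> Gamma_M M" for g
    unfolding N_def using that finite_Gamma by (intro member_le_sum) auto
  define F where "F = {k::int^'n. norm (rvec k) \<le> D * (E * ?c + ?c + N) + ?c}"
  have F: "finite F" unfolding F_def by (rule finite_int_bounded)
  have sum1: "(\<Sum>k\<in>F. \<Sum>g\<in>Gamma_M M. indicator ?C (x - rvec (g + M *v k))) = (1 :: ennreal)" if x: "x \<in> ?U" for x
  proof -
    obtain g0 k0 where g0: "g0 \<in> Gamma_M M" "vfloor x = g0 + M *v k0" using Gamma_rep by blast
    have iff: "x - rvec (g + M *v k) \<in> ?C \<longleftrightarrow> g = g0 \<and> k = k0" if "g \<in> Gamma_M M" for g k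
    proof
      assume "x - rvec (g + M *v k) \<in> ?C"
      moreover have "x - rvec (vfloor x) \<in> ?C" using vfrac_cube[of x] by (simp add: vfrac_def)
      moreover have "(x - rvec (g + M *v k)) - (x - rvec (vfloor x)) = rvec (vfloor x - (g + M *v k))" by (simp add: rvec_diff)
      ultimately have "vfloor x - (g + M *v k) = 0" by (rule cube_diff_rvec(1))
      hence "g + M *v k = g0 + M *v k0" using g0 by simp
      thus "g = g0 \<and> k = k0" using Gamma_unique that g0 by blast
    qed (use vfrac_cube[of x] g0 in \<open>simp add: vfrac_def\<close>)
    have "norm x \<le> E * ?c"
    proof -
      have "norm (fwd (bwd x)) \<le> E * norm (bwd x)" by (rule E)
      also have "\<dots> \<le> E * ?c" using x E(1) by (intro mult_left_mono norm_cube) auto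
      finally show ?thesis by simp
    qed
    moreover have "fwd (rvec k0) = x - vfrac x - rvec g0" using arg_cong[OF g0(2), of rvec] by (simp add: vfrac_def rvec_add rvec_mv)
    hence "rvec k0 = bwd (x - vfrac x - rvec g0)" by (metis bwd_fwd)
    hence "norm (rvec k0) \<le> D * norm (x - vfrac x - rvec g0)" using D(2) by simp
    moreover have "norm (x - vfrac x - rvec g0) \<le> norm x + norm (vfrac x) + norm (rvec g0)"
      by (meson add_mono norm_triangle_ineq4 order_refl order_trans)
    ultimately have "norm (rvec k0) \<le> D * (E * ?c + ?c + N)"
      using N[OF g0(1)] norm_cube[OF vfrac_cube[of x]] D(1)
      by (smt (verit, best) mult_left_mono)
    hence k0: "k0 \<in> F" unfolding F_def by simp
    have "(\<Sum>k\<in>F. \<Sum>g\<in>Gamma_M M. indicator ?C (x - rvec (g + M *v k)))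
        = (\<Sum>k\<in>F. \<Sum>g\<in>Gamma_M M. if g = g0 then if k = k0 then 1 else 0 else (0::ennreal))"
      using iff by (intro sum.cong refl) (auto simp: indicator_def)
    thus ?thesis using F finite_Gamma k0 g0 by simp
  qed
  have sum2: "(\<Sum>k\<in>F. indicator ?U (x + rvec (g + M *v k))) = (1 :: ennreal)" if x: "x \<in> ?C" and g: "g \<in> Gamma_M M" for x g
  proof -
    define k0 where "k0 = - vfloor (bwd (x + rvec g))"
    have iff: "x + rvec (g + M *v k) \<in> ?U \<longleftrightarrow> k = k0" for k
    proof -
      have eq: "bwd (x + rvec (g + M *v k)) = bwd (x + rvec g) + rvec k"
        by (simp add: rvec_add rvec_mv matrix_vector_right_distrib)
      show ?thesis
      proof
        assume "x + rvec (g + M *v k) \<in> ?U"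
        hence "bwd (x + rvec g) + rvec k \<in> ?C" by (simp add: eq)
        moreover have "vfrac (bwd (x + rvec g)) \<in> ?C" by (rule vfrac_cube)
        moreover have "(bwd (x + rvec g) + rvec k) - vfrac (bwd (x + rvec g)) = rvec (k + vfloor (bwd (x + rvec g)))"
          by (simp add: vfrac_def rvec_add)
        ultimately have "k + vfloor (bwd (x + rvec g)) = 0" by (rule cube_diff_rvec(1))
        thus "k = k0" by (simp add: k0_def add_eq_0_iff2)
      next
        assume "k = k0"
        thus "x + rvec (g + M *v k) \<in> ?U"
          using vfrac_cube[of "bwd (x + rvec g)"] unfolding mem_Collect_eq eq vfrac_def
          by (simp add: k0_def rvec_minus)
      qed
    qed
    have "rvec k0 = vfrac (bwd (x + rvec g)) - bwd (x + rvec g)" by (simp add: k0_def vfrac_def rvec_minus)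
    hence "norm (rvec k0) \<le> norm (vfrac (bwd (x + rvec g))) + norm (bwd (x + rvec g))"
      by (metis norm_triangle_ineq4)
    also have "norm (bwd (x + rvec g)) \<le> D * norm (x + rvec g)" by (rule D)
    also have "D * norm (x + rvec g) \<le> D * (E * ?c + ?c + N)"
    proof (intro mult_left_mono)
      have "norm (x + rvec g) \<le> norm x + norm (rvec g)" by (rule norm_triangle_ineq)
      thus "norm (x + rvec g) \<le> E * ?c + ?c + N" using norm_cube[OF x] N[OF g] E(1)
        by (smt (verit) mult_nonneg_nonneg of_nat_0_le_iff)
    qed (use D in simp)
    finally have "k0 \<in> F" using norm_cube[OF vfrac_cube[of "bwd (x + rvec g)"]] by (simp add: F_def)
    moreover have "(\<Sum>k\<in>F. indicator ?U (x + rvec (g + M *v k))) = (\<Sum>k\<in>F. if k = k0 then 1 else (0::ennreal))"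
      using iff by (intro sum.cong refl) (auto simp: indicator_def)
    ultimately show ?thesis using F by simp
  qed
  have "(\<integral>\<^sup>+x. indicator ?U x \<partial>lborel)
      = (\<integral>\<^sup>+x. (\<Sum>k\<in>F. \<Sum>g\<in>Gamma_M M. indicator ?U x * indicator ?C (x - rvec (g + M *v k))) \<partial>lborel)"
  proof (rule nn_integral_cong)
    fix x
    show "indicator ?U x = (\<Sum>k\<in>F. \<Sum>g\<in>Gamma_M M. indicator ?U x * indicator ?C (x - rvec (g + M *v k)) :: ennreal)"
      using sum1[of x] by (cases "x \<in> ?U") (simp_all only: indicator_simps mult_1 mult_zero_left sum.neutral_const, simp)
  qed
  also have "\<dots> = (\<Sum>k\<in>F. \<Sum>g\<in>Gamma_M M. (\<integral>\<^sup>+x. indicator ?U x * indicator ?C (x - rvec (g + M *v k)) \<partial>lborel))"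
    by (simp add: nn_integral_sum)
  also have "\<dots> = (\<Sum>k\<in>F. \<Sum>g\<in>Gamma_M M. (\<integral>\<^sup>+x. indicator ?U (x + rvec (g + M *v k)) * indicator ?C x \<partial>lborel))"
  proof (intro sum.cong refl)
    fix k g
    have "(\<integral>\<^sup>+x. indicator ?U x * indicator ?C (x - rvec (g + M *v k)) \<partial>lborel)
        = (\<integral>\<^sup>+x. (\<lambda>x. indicator ?U x * indicator ?C (x - rvec (g + M *v k)) :: ennreal) (x + rvec (g + M *v k)) \<partial>lborel)"
      by (rule nn_integral_translate[symmetric]) measurable
    thus "(\<integral>\<^sup>+x. indicator ?U x * indicator ?C (x - rvec (g + M *v k)) \<partial>lborel)
        = (\<integral>\<^sup>+x. indicator ?U (x + rvec (g + M *v k)) * indicator ?C x \<partial>lborel)" by simp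
  qed
  also have "\<dots> = (\<Sum>g\<in>Gamma_M M. \<Sum>k\<in>F. (\<integral>\<^sup>+x. indicator ?U (x + rvec (g + M *v k)) * indicator ?C x \<partial>lborel))"
    by (rule sum.swap)
  also have "\<dots> = (\<Sum>g\<in>Gamma_M M. (\<integral>\<^sup>+x. (\<Sum>k\<in>F. indicator ?U (x + rvec (g + M *v k)) * indicator ?C x) \<partial>lborel))"
    by (simp add: nn_integral_sum)
  also have "\<dots> = (\<Sum>g\<in>Gamma_M M. (\<integral>\<^sup>+x. indicator ?C x \<partial>lborel))"
  proof (intro sum.cong refl nn_integral_cong)
    fix x g assume g: "g \<in> Gamma_M M"
    show "(\<Sum>k\<in>F. indicator ?U (x + rvec (g + M *v k)) * indicator ?C x) = (indicator ?C x :: ennreal)"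
      using sum2[OF _ g, of x] by (cases "x \<in> ?C") (simp_all add: sum_distrib_right[symmetric])
  qed
  also have "\<dots> = ennreal (real (d_M M))" by (simp add: emeasure_unit_cube card_Gamma ennreal_of_nat_eq_real_of_nat)
  finally show ?thesis .
qed

lemma distr_fwd: "distr lborel borel (\<lambda>x. fwd x) = density lborel (\<lambda>_. ennreal (1 / real (d_M M)))"
proof (rule measure_eqI)
  fix E assume "E \<in> sets (distr lborel borel (\<lambda>x. fwd x))"
  hence [measurable]: "E \<in> sets borel" by simp
  define c where "c = (\<integral>\<^sup>+y. indicator unit_cube (fwd y) \<partial>lborel)"
  have *: "(\<integral>\<^sup>+x. f x \<partial>lborel) * c = (\<integral>\<^sup>+y. f (fwd y) \<partial>lborel)" if [measurable]: "f \<in> borel_measurable borel" for f :: "real^'n \<Rightarrow> ennreal"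
    using nn_integral_fwd_proportional[of f "indicator unit_cube"] by (simp add: c_def emeasure_unit_cube)
  have "(\<integral>\<^sup>+y. indicator {x. bwd x \<in> unit_cube} (fwd y) \<partial>lborel) = (\<integral>\<^sup>+(y::real^'n). indicator unit_cube y \<partial>lborel)"
    by (intro nn_integral_cong) (simp add: indicator_def)
  hence "ennreal (real (d_M M)) * c = 1"
    using *[of "indicator {x. bwd x \<in> unit_cube}"] by (simp only: nn_integral_fwd_cube) (simp add: emeasure_unit_cube)
  hence c: "c = ennreal (1 / real (d_M M))"
  proof -
    assume 1: "ennreal (real (d_M M)) * c = 1"
    have "ennreal (1 / real (d_M M)) * (ennreal (real (d_M M)) * c) = c"
      using d_pos by (simp add: mult.assoc[symmetric] flip: ennreal_mult)
    thus ?thesis using 1 by simp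
  qed
  have "emeasure (distr lborel borel (\<lambda>x. fwd x)) E = (\<integral>\<^sup>+y. indicator E (fwd y) \<partial>lborel)"
  proof -
    have "emeasure (distr lborel borel (\<lambda>x. fwd x)) E = (\<integral>\<^sup>+y. indicator E y \<partial>(distr lborel borel (\<lambda>x. fwd x)))" by simp
    also have "\<dots> = (\<integral>\<^sup>+y. indicator E (fwd y) \<partial>lborel)" by (rule nn_integral_distr) auto
    finally show ?thesis .
  qed
  also have "\<dots> = (\<integral>\<^sup>+x. indicator E x \<partial>lborel) * c" using *[of "indicator E"] by simp
  also have "\<dots> = emeasure (density lborel (\<lambda>_. ennreal (1 / real (d_M M)))) E"
    by (simp add: c emeasure_density nn_integral_cmult) (simp add: mult.commute)
  finally show "emeasure (distr lborel borel (\<lambda>x. fwd x)) E = emeasure (density lborel (\<lambda>_. ennreal (1 / real (d_M M)))) E" .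
qed simp

lemma integral_fwd:
  fixes f :: "real^'n \<Rightarrow> complex"
  assumes [measurable]: "f \<in> borel_measurable borel"
  shows "(\<integral>x. f (fwd x) \<partial>lborel) = (\<integral>x. f x \<partial>lborel) / of_nat (d_M M)"
    and "integrable lborel (\<lambda>x. f (fwd x)) \<longleftrightarrow> integrable lborel f"
proof -
  have "(\<integral>x. f (fwd x) \<partial>lborel) = (\<integral>x. f x \<partial>(distr lborel borel (\<lambda>x. fwd x)))" by (rule integral_distr[symmetric]) auto
  also have "\<dots> = (\<integral>x. (1 / real (d_M M)) *\<^sub>R f x \<partial>lborel)" unfolding distr_fwd by (rule integral_density) auto
  finally show "(\<integral>x. f (fwd x) \<partial>lborel) = (\<integral>x. f x \<partial>lborel) / of_nat (d_M M)" by (simp add: scaleR_conv_of_real)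
  have "integrable lborel (\<lambda>x. f (fwd x)) \<longleftrightarrow> integrable (distr lborel borel (\<lambda>x. fwd x)) f" by (rule integrable_distr_eq[symmetric]) auto
  also have "\<dots> \<longleftrightarrow> integrable lborel (\<lambda>x. (1 / real (d_M M)) *\<^sub>R f x)" unfolding distr_fwd by (rule integrable_density) auto
  also have "\<dots> \<longleftrightarrow> integrable lborel f"
  proof
    assume int: "integrable lborel (\<lambda>x. (1 / real (d_M M)) *\<^sub>R f x)"
    have "integrable lborel (\<lambda>x. real (d_M M) *\<^sub>R ((1 / real (d_M M)) *\<^sub>R f x))"
      by (rule integrable_scaleR_right) (rule int)
    moreover have "(\<lambda>x. real (d_M M) *\<^sub>R ((1 / real (d_M M)) *\<^sub>R f x)) = f" using d_pos by auto
    ultimately show "integrable lborel f" by (simp only:)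
  qed simp
  finally show "integrable lborel (\<lambda>x. f (fwd x)) \<longleftrightarrow> integrable lborel f" .
qed

lemma integral_fwdn:
  fixes f :: "real^'n \<Rightarrow> complex"
  assumes f[measurable]: "f \<in> borel_measurable borel"
  shows "(\<integral>x. f (fwdn n x) \<partial>lborel) = (\<integral>x. f x \<partial>lborel) / of_nat (d_M M) ^ n"
    and "integrable lborel (\<lambda>x. f (fwdn n x)) \<longleftrightarrow> integrable lborel f"
proof (induction n)
  case (Suc n)
  {
    case 1
    have "(\<integral>x. f (fwdn (Suc n) x) \<partial>lborel) = (\<integral>x. (\<lambda>y. f (fwdn n y)) (fwd x) \<partial>lborel)" by (simp add: funpow_swap1)
    also have "\<dots> = (\<integral>x. f (fwdn n x) \<partial>lborel) / of_nat (d_M M)" by (rule integral_fwd) measurable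
    finally show ?case using Suc(1) by simp
  next
    case 2
    have "integrable lborel (\<lambda>x. f (fwdn (Suc n) x)) \<longleftrightarrow> integrable lborel (\<lambda>x. (\<lambda>y. f (fwdn n y)) (fwd x))" by (simp add: funpow_swap1)
    also have "\<dots> \<longleftrightarrow> integrable lborel (\<lambda>x. f (fwdn n x))" by (rule integral_fwd) measurable
    finally show ?case using Suc(2) by simp
  }
qed simp_all

end

section \<open>Fourier transforms of continuous functions with compact support\<close>

definition cc :: "('n::finite) cfun \<Rightarrow> bool" where
  "cc f \<longleftrightarrow> continuous_on UNIV f \<and> (\<exists>R. \<forall>x. f x \<noteq> 0 \<longrightarrow> norm x \<le> R)"

lemma cc_continuous: "cc f \<Longrightarrow> continuous_on UNIV f"
  by (simp add: cc_def)

lemma cc_measurable: "cc f \<Longrightarrow> f \<in> borel_measurable borel"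
  by (simp add: cc_def borel_measurable_continuous_onI)

lemma cc_support: "cc f \<Longrightarrow> \<exists>R. \<forall>x. f x \<noteq> 0 \<longrightarrow> norm x \<le> R"
  by (simp add: cc_def)

lemma cc_supportD:
  assumes "cc f"
  obtains R where "0 < R" "\<And>x. f x \<noteq> 0 \<Longrightarrow> norm x \<le> R"
proof -
  obtain R where "\<And>x. f x \<noteq> 0 \<Longrightarrow> norm x \<le> R" using cc_support[OF assms] by blast
  hence R': "norm x \<le> max R 1" if "f x \<noteq> 0" for x using that by (simp add: le_max_iff_disj)
  have "0 < max R 1" by (rule less_le_trans[OF zero_less_one max.cobounded2])
  thus thesis using R' by (rule that)
qed

lemma cc_mult: "cc f \<Longrightarrow> continuous_on UNIV g \<Longrightarrow> cc (\<lambda>x. f x * g x)"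
  unfolding cc_def by (auto intro!: continuous_intros)

lemma cc_zero: "cc (\<lambda>x. 0)"
  by (simp add: cc_def)

lemma cc_add:
  assumes "cc f" "cc g" shows "cc (\<lambda>x. f x + g x)"
proof -
  obtain R S where R: "\<And>x. f x \<noteq> 0 \<Longrightarrow> norm x \<le> R" "\<And>x. g x \<noteq> 0 \<Longrightarrow> norm x \<le> S"
    using assms unfolding cc_def by blast
  have "norm x \<le> max R S" if "f x + g x \<noteq> 0" for x
    using R(1)[of x] R(2)[of x] that by (cases "f x = 0") (auto simp: le_max_iff_disj)
  thus ?thesis using assms unfolding cc_def by (auto intro!: continuous_intros)
qed

lemma cc_scale: "cc f \<Longrightarrow> cc (\<lambda>x. c * f x)"
  using cc_mult[of f "\<lambda>_. c"] by (simp add: mult.commute)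

lemma cc_diff: "cc f \<Longrightarrow> cc g \<Longrightarrow> cc (\<lambda>x. f x - g x)"
  using cc_add[OF _ cc_scale[of g "-1"], of f] by simp

lemma cc_sum: "(\<And>i. i \<in> I \<Longrightarrow> cc (f i)) \<Longrightarrow> cc (\<lambda>x. \<Sum>i\<in>I. f i x)"
  by (induction I rule: infinite_finite_induct) (auto intro: cc_zero cc_add)

lemma cc_cnj: "cc f \<Longrightarrow> cc (\<lambda>x. cnj (f x))"
  unfolding cc_def by (auto intro!: continuous_intros)

lemma cc_bounded: "cc f \<Longrightarrow> \<exists>B>0. \<forall>x. norm (f x) \<le> B"
proof -
  assume f: "cc f"
  then obtain R where R: "\<And>x. f x \<noteq> 0 \<Longrightarrow> norm x \<le> R" using cc_support by blast
  have "bounded (f ` cball 0 R)"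
    by (intro compact_imp_bounded compact_continuous_image continuous_on_subset[OF cc_continuous[OF f]]) auto
  then obtain B where B: "\<And>x. x \<in> cball 0 R \<Longrightarrow> norm (f x) \<le> B" unfolding bounded_iff by blast
  have "norm (f x) \<le> max B 1" for x
    using B[of x] R[of x] by (cases "f x = 0") (auto simp: le_max_iff_disj)
  thus ?thesis by (intro exI[of _ "max B 1"]) auto
qed

lemma cc_integrable: "cc f \<Longrightarrow> integrable lborel f"
proof -
  assume f: "cc f"
  then obtain R where R: "\<And>x. f x \<noteq> 0 \<Longrightarrow> norm x \<le> R" using cc_support by blast
  have "integrable lborel (\<lambda>x. indicator (cball 0 R) x *\<^sub>R f x)"
    by (intro borel_integrable_compact continuous_on_subset[OF cc_continuous[OF f]]) auto
  moreover have "(\<lambda>x. indicator (cball 0 R) x *\<^sub>R f x) = f" using R by (auto simp: indicator_def fun_eq_iff)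
  ultimately show ?thesis by simp
qed

lemma cc_L2: "cc f \<Longrightarrow> f \<in> L2"
proof -
  assume f: "cc f"
  have "integrable lborel (\<lambda>x. f x * cnj (f x))"
    by (intro cc_integrable cc_mult f cc_continuous cc_cnj)
  hence "integrable lborel (\<lambda>x. Re (f x * cnj (f x)))" by (rule integrable_Re)
  moreover have "Re (f x * cnj (f x)) = (norm (f x))\<^sup>2" for x by (simp add: cmod_power2 flip: power2_eq_square)
  ultimately show ?thesis using cc_measurable[OF f] by (simp add: L2_def)
qed

lemma cc_compactly_supported: "cc f \<Longrightarrow> compactly_supported f"
proof -
  assume "cc f"
  then obtain R where R: "\<And>x. f x \<noteq> 0 \<Longrightarrow> norm x \<le> R" using cc_support by blast
  hence "bounded {x. f x \<noteq> 0}" unfolding bounded_iff by blast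
  thus ?thesis unfolding compactly_supported_def by (rule compact_closure[THEN iffD2])
qed

lemma cc_uniformly_continuous:
  assumes f: "cc f" and e: "0 < e"
  shows "\<exists>d>0. \<forall>x y. norm (x - y) < d \<longrightarrow> norm (f x - f y) < e"
proof -
  obtain R where R: "\<And>x. f x \<noteq> 0 \<Longrightarrow> norm x \<le> R" using cc_support[OF f] by blast
  have "uniformly_continuous_on (cball 0 (R + 1)) f"
    by (intro compact_uniformly_continuous continuous_on_subset[OF cc_continuous[OF f]]) auto
  then obtain d where d: "d > 0" "\<And>x y. norm x \<le> R + 1 \<Longrightarrow> norm y \<le> R + 1 \<Longrightarrow> norm (x - y) < d \<Longrightarrow> norm (f x - f y) < e"
    using e unfolding uniformly_continuous_on_def by (auto simp: dist_norm)
  have "norm (f x - f y) < e" if xy: "norm (x - y) < min d 1" for x y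
  proof (cases "norm x \<le> R \<or> norm y \<le> R")
    case True
    have "norm x \<le> norm y + norm (x - y)" "norm y \<le> norm x + norm (x - y)"
      by (metis add.commute diff_add_cancel norm_triangle_ineq, metis norm_minus_commute add.commute diff_add_cancel norm_triangle_ineq)
    hence "norm x \<le> R + 1" "norm y \<le> R + 1" using True xy by auto
    thus ?thesis using d(2) xy by simp
  next
    case False
    hence "f x = 0" "f y = 0" using R by blast+
    thus ?thesis using e by simp
  qed
  thus ?thesis using d(1) by (intro exI[of _ "min d 1"]) auto
qed

definition ex :: "real^'n \<Rightarrow> real^'n \<Rightarrow> complex" where
  "ex \<xi> x = exp (- \<i> * complex_of_real (x \<bullet> \<xi>))"

lemma fourier_ex: "fourier f \<xi> = (\<integral>x. f x * ex \<xi> x \<partial>lborel)"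
  by (simp add: fourier_def ex_def)

lemma ex_continuous: "continuous_on UNIV (ex \<xi>)"
  unfolding ex_def by (intro continuous_intros)

lemma ex_measurable [measurable]: "ex \<xi> \<in> borel_measurable borel"
  by (intro borel_measurable_continuous_onI ex_continuous)

lemma norm_ex [simp]: "norm (ex \<xi> x) = 1"
  by (simp add: ex_def)

lemma ex_add: "ex \<xi> (x + y) = ex \<xi> x * ex \<xi> y"
  by (simp add: ex_def inner_add_left ring_distribs exp_diff flip: exp_add)

lemma ex_rvec: "ex \<xi> (rvec k) = chr k \<xi>"
  by (simp add: ex_def chr_def)

lemma ex_0 [simp]: "ex 0 x = 1"
  by (simp add: ex_def)

lemma fourier_0: "fourier f 0 = (\<integral>x. f x \<partial>lborel)"
  by (simp add: fourier_ex)

lemma cc_ex: "cc f \<Longrightarrow> cc (\<lambda>x. f x * ex \<xi> x)"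
  by (intro cc_mult ex_continuous)

lemma has_vector_derivative_quadratic:
  fixes F :: "real \<Rightarrow> complex"
  assumes "\<And>t. norm (F t - F 0 - of_real t * D) \<le> K * t\<^sup>2"
  shows "(F has_vector_derivative D) (at 0)"
  unfolding has_vector_derivative_def has_derivative_iff_norm
proof (intro conjI)
  show "bounded_linear (\<lambda>x. x *\<^sub>R D)" by (rule bounded_linear_scaleR_left)
  have "((\<lambda>t. K * \<bar>t\<bar>) \<longlongrightarrow> K * \<bar>0\<bar>) (at 0)" by (intro tendsto_intros)
  hence lim: "((\<lambda>t. K * \<bar>t\<bar>) \<longlongrightarrow> 0) (at (0::real))" by simp
  show "((\<lambda>y. norm (F y - F 0 - (y - 0) *\<^sub>R D) / norm (y - 0)) \<longlongrightarrow> 0) (at 0)"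
  proof (rule tendsto_sandwich[OF _ _ tendsto_const lim])
    show "\<forall>\<^sub>F t in at 0. norm (F t - F 0 - (t - 0) *\<^sub>R D) / norm (t - 0) \<le> K * \<bar>t\<bar>"
      unfolding eventually_at_filter
    proof (intro always_eventually allI impI)
      fix t :: real assume "t \<noteq> 0"
      have "norm (F t - F 0 - (t - 0) *\<^sub>R D) \<le> K * \<bar>t\<bar> * \<bar>t\<bar>"
        using assms[of t] by (simp add: scaleR_conv_of_real power2_eq_square mult.assoc)
      thus "norm (F t - F 0 - (t - 0) *\<^sub>R D) / norm (t - 0) \<le> K * \<bar>t\<bar>"
        using \<open>t \<noteq> 0\<close> by (simp add: divide_le_eq)
    qed
  qed simp
qed

lemma exp_quadratic: "norm (exp (- \<i> * complex_of_real s) - 1 - (- \<i> * complex_of_real s)) \<le> s\<^sup>2"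
proof -
  have "norm (exp (- \<i> * complex_of_real s) - (\<Sum>k\<le>1. (- \<i> * complex_of_real s) ^ k / fact k))
      \<le> exp \<bar>Re (- \<i> * complex_of_real s)\<bar> * norm (- \<i> * complex_of_real s) ^ Suc 1 / fact 1"
    by (rule Taylor_exp)
  thus ?thesis by (simp add: norm_mult power2_eq_square algebra_simps)
qed

lemma norm_exp_minus_one: "norm (exp (- \<i> * complex_of_real s) - 1) \<le> \<bar>s\<bar>"
proof -
  have "norm (exp (- \<i> * complex_of_real s) - (\<Sum>k\<le>0. (- \<i> * complex_of_real s) ^ k / fact k))
      \<le> exp \<bar>Re (- \<i> * complex_of_real s)\<bar> * norm (- \<i> * complex_of_real s) ^ Suc 0 / fact 0"
    by (rule Taylor_exp)
  thus ?thesis by (simp add: norm_mult)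
qed

lemma partial_fourier:
  assumes f: "cc f"
  shows "partial i (fourier f) = fourier (\<lambda>x. - \<i> * complex_of_real (x $ i) * f x)"
proof
  fix \<xi>
  define D where "D = fourier (\<lambda>x. - \<i> * complex_of_real (x $ i) * f x) \<xi>"
  define K where "K = (\<integral>x. norm (f x * of_real ((x $ i)\<^sup>2)) \<partial>lborel)"
  have ccD: "cc (\<lambda>x. - \<i> * complex_of_real (x $ i) * f x)"
    using cc_mult[OF f, of "\<lambda>x. - \<i> * complex_of_real (x $ i)"] by (simp add: continuous_intros mult.commute)
  have cont: "continuous_on UNIV (\<lambda>x::real^'a. complex_of_real ((x $ i)\<^sup>2))" by (intro continuous_intros)
  have intK: "integrable lborel (\<lambda>x. norm (f x * of_real ((x $ i)\<^sup>2)))"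
    by (intro integrable_norm cc_integrable cc_mult[OF f cont])
  have "norm (fourier f (\<xi> + t *\<^sub>R axis i 1) - fourier f (\<xi> + 0 *\<^sub>R axis i 1) - of_real t * D) \<le> K * t\<^sup>2" for t
  proof -
    have ex: "ex (\<xi> + t *\<^sub>R axis i 1) x = ex \<xi> x * exp (- \<i> * complex_of_real (t * x $ i))" for x
      by (simp add: ex_def inner_add_right inner_axis algebra_simps flip: exp_add)
    have int1: "integrable lborel (\<lambda>x. f x * ex \<eta> x)" for \<eta> by (intro cc_integrable cc_ex f)
    have int2: "integrable lborel (\<lambda>x. of_real t * (- \<i> * complex_of_real (x $ i) * f x * ex \<xi> x))"
      by (intro integrable_mult_right cc_integrable cc_ex ccD)
    have "fourier f (\<xi> + t *\<^sub>R axis i 1) - fourier f (\<xi> + 0 *\<^sub>R axis i 1) - of_real t * D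
      = (\<integral>x. f x * ex (\<xi> + t *\<^sub>R axis i 1) x - f x * ex \<xi> x - of_real t * (- \<i> * complex_of_real (x $ i) * f x * ex \<xi> x) \<partial>lborel)"
      using int1 int2 by (simp add: fourier_ex D_def)
    also have "norm \<dots> \<le> (\<integral>x. norm (f x * of_real ((x $ i)\<^sup>2)) * t\<^sup>2 \<partial>lborel)"
    proof (rule order_trans[OF Bochner_Integration.integral_norm_bound integral_mono], goal_cases)
      case 1
      show ?case using int1 int2 by (intro integrable_norm) simp
    next
      case 2
      show ?case using intK by simp
    next
      case (3 x)
      have "f x * ex (\<xi> + t *\<^sub>R axis i 1) x - f x * ex \<xi> x - of_real t * (- \<i> * complex_of_real (x $ i) * f x * ex \<xi> x)
        = f x * ex \<xi> x * (exp (- \<i> * complex_of_real (t * x $ i)) - 1 - (- \<i> * complex_of_real (t * x $ i)))"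
        unfolding ex by (simp add: algebra_simps)
      also have "norm \<dots> \<le> norm (f x) * (t * x $ i)\<^sup>2"
        unfolding norm_mult norm_ex mult_1_right by (intro mult_left_mono exp_quadratic) simp
      finally show ?case
        by (simp add: norm_mult norm_power power_mult_distrib mult_ac)
    qed
    also have "\<dots> = K * t\<^sup>2" by (simp add: K_def)
    finally show ?thesis .
  qed
  from has_vector_derivative_quadratic[of "\<lambda>t. fourier f (\<xi> + t *\<^sub>R axis i 1)", OF this]
  show "partial i (fourier f) \<xi> = fourier (\<lambda>x. - \<i> * complex_of_real (x $ i) * f x) \<xi>"
    unfolding D_def by (rule partialI)
qed

lemma fmono_continuous: "continuous_on UNIV (fmono \<nu>)"
  unfolding fmono_def by (intro continuous_intros)

lemma mpartial_fourier:
  assumes f: "cc f"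
  shows "mpartial \<mu> (fourier f) = fourier (\<lambda>x. fmono \<mu> x * f x)"
proof -
  have "partial i (fourier (\<lambda>x. fmono \<nu> x * f x)) = fourier (\<lambda>x. fmono (\<nu> + axis i 1) x * f x)" for \<nu> i
  proof -
    have "cc (\<lambda>x. fmono \<nu> x * f x)" using cc_mult[OF f fmono_continuous] by (simp add: mult.commute)
    from partial_fourier[OF this, of i] show ?thesis by (simp only: fmono_add_axis mult.assoc)
  qed
  from mpartial_family[of "\<lambda>\<nu>. fourier (\<lambda>x. fmono \<nu> x * f x)", OF this, of \<mu>] show ?thesis by simp
qed

lemma pdeg_continuous: "pdeg n p \<Longrightarrow> continuous_on UNIV p"
  by (induction rule: pdeg.induct) (auto intro!: continuous_intros)

lemma pdeg_translate_integral:
  "pdeg n p \<Longrightarrow> cc f \<Longrightarrow> pdeg n (\<lambda>c. \<integral>y. p (y + c) * f y \<partial>lborel)"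
proof (induction arbitrary: f rule: pdeg.induct)
  case (pdeg_const c)
  show ?case by (simp add: pdeg.pdeg_const)
next
  case (pdeg_coord n p i)
  have cont: "continuous_on UNIV (\<lambda>y. p (y + c))" for c
    by (rule continuous_on_compose2[OF pdeg_continuous[OF pdeg_coord(1)]]) (auto intro!: continuous_intros)
  have f1: "cc (\<lambda>y. f y * complex_of_real (y $ i))" by (intro cc_mult pdeg_coord continuous_intros)
  have "(\<integral>y. complex_of_real ((y + c) $ i) * p (y + c) * f y \<partial>lborel)
      = (\<integral>y. p (y + c) * (f y * complex_of_real (y $ i)) \<partial>lborel) + complex_of_real (c $ i) * (\<integral>y. p (y + c) * f y \<partial>lborel)" for c
  proof -
    have i1: "integrable lborel (\<lambda>y. (f y * complex_of_real (y $ i)) * p (y + c))" by (intro cc_integrable cc_mult f1 cont)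
    have i2: "integrable lborel (\<lambda>y. f y * p (y + c))" by (intro cc_integrable cc_mult pdeg_coord cont)
    have "(\<integral>y. complex_of_real ((y + c) $ i) * p (y + c) * f y \<partial>lborel)
        = (\<integral>y. (f y * complex_of_real (y $ i)) * p (y + c) + complex_of_real (c $ i) * (f y * p (y + c)) \<partial>lborel)"
      by (intro Bochner_Integration.integral_cong refl) (simp add: algebra_simps)
    also have "\<dots> = (\<integral>y. (f y * complex_of_real (y $ i)) * p (y + c) \<partial>lborel) + complex_of_real (c $ i) * (\<integral>y. f y * p (y + c) \<partial>lborel)"
      using i1 i2 by simp
    finally show ?thesis by (simp add: mult_ac)
  qed
  thus ?case
    using pdeg_add[OF pdeg_Suc[OF pdeg_coord(2)[OF f1]] pdeg.pdeg_coord[OF pdeg_coord(2)[OF pdeg_coord(3)], of i]] by simp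
next
  case (pdeg_add n p q)
  have cont: "continuous_on UNIV (\<lambda>y. p (y + c))" "continuous_on UNIV (\<lambda>y. q (y + c))" for c
    by (rule continuous_on_compose2[OF pdeg_continuous[OF pdeg_add(1)]], auto intro!: continuous_intros)
       (rule continuous_on_compose2[OF pdeg_continuous[OF pdeg_add(2)]], auto intro!: continuous_intros)
  have "(\<integral>y. (p (y + c) + q (y + c)) * f y \<partial>lborel) = (\<integral>y. p (y + c) * f y \<partial>lborel) + (\<integral>y. q (y + c) * f y \<partial>lborel)" for c
  proof -
    have "integrable lborel (\<lambda>y. f y * p (y + c))" "integrable lborel (\<lambda>y. f y * q (y + c))"
      by (intro cc_integrable cc_mult pdeg_add cont)+
    thus ?thesis by (simp add: ring_distribs mult.commute)
  qed
  thus ?case using pdeg.pdeg_add[OF pdeg_add(3)[OF pdeg_add(5)] pdeg_add(4)[OF pdeg_add(5)]] by simp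
qed (auto intro: pdeg.pdeg_Suc)

lemma pair_integral:
  assumes "\<And>k. u k \<noteq> 0 \<Longrightarrow> integrable lborel (F k)"
  shows "(\<integral>x. pair u (\<lambda>k. F k x) \<partial>lborel) = pair u (\<lambda>k. \<integral>x. F k x \<partial>lborel)"
  unfolding pair_def using assms by (subst Bochner_Integration.integral_sum) auto

context dilation_card
begin

lemma cc_fwdn: "cc f \<Longrightarrow> cc (\<lambda>x. f (fwdn n x - c))"
  unfolding cc_def
proof (elim conjE exE, intro conjI)
  assume cont: "continuous_on UNIV f"
  have "continuous_on UNIV (\<lambda>x. fwdn n x)"
    by (intro linear_continuous_on linear_conv_bounded_linear[THEN iffD1] fwdn_linear)
  thus "continuous_on UNIV (\<lambda>x. f (fwdn n x - c))"
    by (intro continuous_on_compose2[OF cont] continuous_intros) auto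
  fix R assume R: "\<forall>x. f x \<noteq> 0 \<longrightarrow> norm x \<le> R"
  obtain B where B: "B > 0" "\<And>x. norm (bwdn n x) \<le> B * norm x" using linear_bounded_pos[OF bwdn_linear[of n]] by blast
  have "norm x \<le> B * (R + norm c)" if "f (fwdn n x - c) \<noteq> 0" for x
  proof -
    have "norm (fwdn n x) \<le> norm (fwdn n x - c) + norm c" by (metis diff_add_cancel norm_triangle_ineq)
    also have "\<dots> \<le> R + norm c" using R that by simp
    finally have "B * norm (fwdn n x) \<le> B * (R + norm c)" using B(1) by simp
    thus ?thesis using B(2)[of "fwdn n x"] by simp
  qed
  thus "\<exists>R. \<forall>x. f (fwdn n x - c) \<noteq> 0 \<longrightarrow> norm x \<le> R" by blast
qed

lemma cc_fwd: "cc f \<Longrightarrow> cc (\<lambda>x. f (fwd x - c))"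
  using cc_fwdn[of f 1 c] by simp

lemma cc_translate: "cc f \<Longrightarrow> cc (\<lambda>x::real^'n. f (x - c))"
  using cc_fwdn[of f 0 c] by simp

definition wav :: "'n cfun \<Rightarrow> 'n filt \<Rightarrow> 'n cfun" where
  "wav \<phi> b x = of_nat (d_M M) * pair b (\<lambda>k. \<phi> (fwd x - rvec k))"

lemma cc_wav: "cc \<phi> \<Longrightarrow> cc (wav \<phi> b)"
  unfolding wav_def[abs_def] pair_def by (intro cc_scale cc_sum cc_fwd)

lemma integral_wav:
  assumes \<phi>: "cc \<phi>" and p: "continuous_on UNIV p"
  shows "(\<integral>x. wav \<phi> b x * p x \<partial>lborel) = pair b (\<lambda>k. \<integral>y. p (bwd (y + rvec k)) * \<phi> y \<partial>lborel)"
proof -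
  have pb: "continuous_on UNIV (\<lambda>y. p (bwd y))"
    by (rule continuous_on_compose2[OF p]) (auto intro!: linear_continuous_on linear_conv_bounded_linear[THEN iffD1] matrix_vector_mul_linear)
  have "(\<integral>x. wav \<phi> b x * p x \<partial>lborel) = (\<integral>x. pair b (\<lambda>k. of_nat (d_M M) * (\<phi> (fwd x - rvec k) * p x)) \<partial>lborel)"
    unfolding wav_def pair_def by (intro Bochner_Integration.integral_cong refl) (simp add: sum_distrib_left sum_distrib_right mult_ac)
  also have "\<dots> = pair b (\<lambda>k. \<integral>x. of_nat (d_M M) * (\<phi> (fwd x - rvec k) * p x) \<partial>lborel)"
    by (intro pair_integral integrable_mult_right cc_integrable cc_mult cc_fwd \<phi> p)
  also have "\<dots> = pair b (\<lambda>k. \<integral>y. p (bwd (y + rvec k)) * \<phi> y \<partial>lborel)"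
  proof (rule pair_cong)
    fix k
    let ?G = "\<lambda>y. \<phi> (y - rvec k) * p (bwd y)"
    have m: "?G \<in> borel_measurable borel" by (intro cc_measurable cc_mult cc_translate \<phi> pb)
    have "(\<integral>x. of_nat (d_M M) * (\<phi> (fwd x - rvec k) * p x) \<partial>lborel) = of_nat (d_M M) * (\<integral>x. ?G (fwd x) \<partial>lborel)" by simp
    also have "\<dots> = (\<integral>y. ?G y \<partial>lborel)" using d_pos by (subst integral_fwd[OF m]) simp
    also have "\<dots> = (\<integral>y. (\<lambda>y. \<phi> y * p (bwd (y + rvec k))) (y - rvec k) \<partial>lborel)" by simp
    also have "\<dots> = (\<integral>y. \<phi> y * p (bwd (y + rvec k)) \<partial>lborel)"
    proof (rule integral_translate(1))
      have "continuous_on UNIV (\<lambda>y. p (bwd (y + rvec k)))"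
        by (rule continuous_on_compose2[OF pb]) (auto intro!: continuous_intros)
      thus "(\<lambda>y. \<phi> y * p (bwd (y + rvec k))) \<in> borel_measurable borel" by (intro cc_measurable cc_mult \<phi>)
    qed
    finally show "(\<integral>x. of_nat (d_M M) * (\<phi> (fwd x - rvec k) * p x) \<partial>lborel) = (\<integral>y. p (bwd (y + rvec k)) * \<phi> y \<partial>lborel)"
      by (simp add: mult.commute)
  qed
  finally show ?thesis .
qed

lemma ex_bwd: "ex \<xi> (bwd y) = ex (mat_inv_T M \<xi>) y"
  by (simp add: ex_def inner_bwd)

lemma fourier_wav:
  assumes "cc \<phi>"
  shows "fourier (wav \<phi> b) \<xi> = fseries b (mat_inv_T M \<xi>) * fourier \<phi> (mat_inv_T M \<xi>)"
proof -
  have "fourier (wav \<phi> b) \<xi> = pair b (\<lambda>k. \<integral>y. ex (mat_inv_T M \<xi>) (y + rvec k) * \<phi> y \<partial>lborel)"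
    unfolding fourier_ex integral_wav[OF assms ex_continuous] ex_bwd ..
  also have "\<dots> = pair b (\<lambda>k. fourier \<phi> (mat_inv_T M \<xi>) * chr k (mat_inv_T M \<xi>))"
    unfolding fourier_ex ex_add ex_rvec
    by (intro pair_cong) (simp add: mult_ac flip: integral_mult_left_zero integral_mult_right_zero)
  finally show ?thesis by (simp add: pair_scale_right fseries_pair)
qed

lemma has_fourier_wav: "cc \<phi> \<Longrightarrow> has_fourier (wav \<phi> b) (wavelet_series M \<phi> b)"
  by (simp add: has_fourier_def wavelet_series_def fourier_wav cc_integrable cc_wav)

lemma vanish_order_wav:
  assumes \<phi>: "cc \<phi>" and b: "vmom m b"
  shows "vanish_order (fourier (wav \<phi> b)) m"
  unfolding vanish_order_def agree_order_def mpartial_zero mpartial_fourier[OF cc_wav[OF \<phi>]]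
proof (intro allI impI)
  fix \<mu> :: "nat^'n" assume \<mu>: "mdeg \<mu> < m"
  have "pdeg (mdeg \<mu>) (\<lambda>y. fmono \<mu> (matrix_inv (rmat M) *v y + 0))" by (rule pdeg_affine[OF pdeg_monomial])
  hence "pdeg (mdeg \<mu>) (\<lambda>c. \<integral>y. fmono \<mu> (bwd (y + c)) * \<phi> y \<partial>lborel)"
    using pdeg_translate_integral[OF _ \<phi>, of "mdeg \<mu>" "\<lambda>y. fmono \<mu> (bwd y)"] by simp
  from vmomD[OF b this \<mu>] have "(\<integral>x. wav \<phi> b x * fmono \<mu> x \<partial>lborel) = 0"
    by (simp add: integral_wav[OF \<phi> fmono_continuous])
  thus "fourier (\<lambda>x. fmono \<mu> x * wav \<phi> b x) 0 = 0" by (simp add: fourier_0 mult.commute)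
qed

end

context interp
begin

lemma cc_phi: "cc phi"
  unfolding cc_def using phi_continuous phi_support by blast

lemma gn_sum: "gn n x = (\<Sum>k | fv n k \<noteq> 0. fv n k * indicator unit_cube (fwdn n x - rvec k))"
proof -
  have iff: "fwdn n x - rvec k \<in> unit_cube \<longleftrightarrow> k = vfloor (fwdn n x)" for k
  proof
    assume "fwdn n x - rvec k \<in> unit_cube"
    moreover have "vfrac (fwdn n x) \<in> unit_cube" by (rule vfrac_cube)
    moreover have "(fwdn n x - rvec k) - vfrac (fwdn n x) = rvec (vfloor (fwdn n x) - k)" by (simp add: vfrac_def rvec_diff)
    ultimately have "vfloor (fwdn n x) - k = 0" by (rule cube_diff_rvec(1))
    thus "k = vfloor (fwdn n x)" by simp
  qed (use vfrac_cube[of "fwdn n x"] in \<open>simp add: vfrac_def\<close>)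
  have "(\<Sum>k | fv n k \<noteq> 0. fv n k * indicator unit_cube (fwdn n x - rvec k))
      = (\<Sum>k | fv n k \<noteq> 0. if k = vfloor (fwdn n x) then fv n k else 0)"
    by (intro sum.cong refl) (auto simp: indicator_def iff)
  also have "\<dots> = gn n x" using l0_finite[OF fv_l0[of n]] by (simp add: gn_def)
  finally show ?thesis by simp
qed

definition cube_ft :: "real^'n \<Rightarrow> complex" where
  "cube_ft \<eta> = (\<integral>y. indicator unit_cube y * ex \<eta> y \<partial>lborel)"

lemma cube_integrable: "integrable lborel (\<lambda>y::real^'n. indicator unit_cube y * ex \<eta> y)"
proof (rule Bochner_Integration.integrable_bound)
  show "integrable lborel (indicator unit_cube :: real^'n \<Rightarrow> real)"
    by (simp add: emeasure_unit_cube)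
  show "AE y::real^'n in lborel. norm (indicator unit_cube y * ex \<eta> y) \<le> norm (indicator unit_cube y :: real)"
    by (simp add: norm_mult indicator_def)
qed measurable

lemma ex_bwdn: "ex \<xi> x = ex ((mat_inv_T M ^^ n) \<xi>) (fwdn n x)"
  by (simp add: ex_def inner_bwd_pow)

lemma integral_gn: "(\<integral>x. gn n x * ex \<xi> x \<partial>lborel) = fseries (A n) ((mat_inv_T M ^^ n) \<xi>) * cube_ft ((mat_inv_T M ^^ n) \<xi>)"
proof -
  define \<eta> where "\<eta> = (mat_inv_T M ^^ n) \<xi>"
  define G where "G k y = indicator unit_cube (y - rvec k) * ex \<eta> y" for k y
  have G_eq: "G k = (\<lambda>y. (\<lambda>y. chr k \<eta> * (indicator unit_cube y * ex \<eta> y)) (y - rvec k))" for k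
  proof
    fix y
    have "ex \<eta> y = ex \<eta> ((y - rvec k) + rvec k)" by simp
    also have "\<dots> = ex \<eta> (y - rvec k) * chr k \<eta>" by (simp only: ex_add ex_rvec)
    finally have "ex \<eta> y = ex \<eta> (y - rvec k) * chr k \<eta>" .
    thus "G k y = chr k \<eta> * (indicator unit_cube (y - rvec k) * ex \<eta> (y - rvec k))" by (simp add: G_def)
  qed
  have m: "(\<lambda>y. chr k \<eta> * (indicator unit_cube y * ex \<eta> y)) \<in> borel_measurable borel" for k by measurable
  have Gi: "integrable lborel (G k)" for k
    unfolding G_eq integral_translate(2)[OF m] using cube_integrable by (rule integrable_mult_right)
  have GI: "(\<integral>y. G k y \<partial>lborel) = chr k \<eta> * cube_ft \<eta>" for k
    unfolding G_eq integral_translate(1)[OF m] by (simp add: cube_ft_def)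
  have "(\<integral>x. gn n x * ex \<xi> x \<partial>lborel) = (\<integral>x. (\<lambda>y. pair (fv n) (\<lambda>k. G k y)) (fwdn n x) \<partial>lborel)"
    unfolding gn_sum pair_def G_def \<eta>_def
    by (intro Bochner_Integration.integral_cong refl) (simp add: sum_distrib_right mult.assoc flip: ex_bwdn)
  also have "\<dots> = (\<integral>y. pair (fv n) (\<lambda>k. G k y) \<partial>lborel) / of_nat (d_M M) ^ n"
  proof (rule integral_fwdn(1))
    show "(\<lambda>y. pair (fv n) (\<lambda>k. G k y)) \<in> borel_measurable borel" unfolding pair_def G_def by measurable
  qed
  also have "(\<integral>y. pair (fv n) (\<lambda>k. G k y) \<partial>lborel) = pair (fv n) (\<lambda>k. cube_ft \<eta> * chr k \<eta>)"
    using Gi by (subst pair_integral) (auto simp: GI mult.commute)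
  also have "\<dots> = of_nat (d_M M) ^ n * (fseries (A n) \<eta> * cube_ft \<eta>)"
    unfolding pair_scale_right fseries_pair fv_def[abs_def] pair_scale_left by simp
  finally show ?thesis using d_pos by (simp add: \<eta>_def)
qed

lemma fseries_lipschitz: "\<exists>C\<ge>0. \<forall>\<eta>. norm (fseries a \<eta> - 1) \<le> C * norm \<eta>"
proof (intro exI conjI allI)
  let ?C = "\<Sum>k | a k \<noteq> 0. norm (a k) * (2 * norm (rvec k))"
  show "0 \<le> ?C" by (intro sum_nonneg) auto
  fix \<eta>
  have "fseries a \<eta> - 1 = (\<Sum>k | a k \<noteq> 0. a k * (chr k \<eta> - 1))"
    using a0 by (simp add: fseries_pair pair_def ring_distribs sum_subtractf)
  also have "norm \<dots> \<le> (\<Sum>k | a k \<noteq> 0. norm (a k) * (2 * norm (rvec k)) * norm \<eta>)"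
  proof (rule sum_norm_le)
    fix k
    have "norm (chr k \<eta> - 1) \<le> \<bar>rvec k \<bullet> \<eta>\<bar>"
      unfolding chr_def by (rule norm_exp_minus_one)
    also have "\<dots> \<le> norm (rvec k) * norm \<eta>" by (rule Cauchy_Schwarz_ineq2)
    also have "\<dots> \<le> 2 * norm (rvec k) * norm \<eta>" by simp
    finally show "norm (a k * (chr k \<eta> - 1)) \<le> norm (a k) * (2 * norm (rvec k)) * norm \<eta>"
      by (simp add: norm_mult mult_left_mono mult.assoc)
  qed
  finally show "norm (fseries a \<eta> - 1) \<le> ?C * norm \<eta>" by (simp add: sum_distrib_right)
qed

lemma refinable_product: "(\<lambda>n. fseries (A n) ((mat_inv_T M ^^ n) \<xi>)) \<longlonglongrightarrow> refinable_fourier M a \<xi>"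
proof -
  let ?f = "\<lambda>j. fseries a ((mat_inv_T M ^^ Suc j) \<xi>)"
  obtain C where C: "0 \<le> C" "\<And>\<eta>. norm (fseries a \<eta> - 1) \<le> C * norm \<eta>" using fseries_lipschitz by blast
  obtain D \<rho> where D: "0 < \<rho>" "\<rho> < 1" "0 < D" "\<And>n x. norm ((mat_inv_T M ^^ n) x) \<le> D * \<rho> ^ n * norm x" using decay_T by blast
  have "summable (\<lambda>j. norm (?f j - 1))"
  proof (rule summable_comparison_test'[where N = 0])
    show "summable (\<lambda>j. C * (D * norm \<xi>) * \<rho> ^ Suc j)" using D by (intro summable_mult) (simp add: summable_geometric)
    fix j
    have "norm (?f j - 1) \<le> C * norm ((mat_inv_T M ^^ Suc j) \<xi>)" by (rule C)
    also have "\<dots> \<le> C * (D * \<rho> ^ Suc j * norm \<xi>)" by (intro mult_left_mono D C)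
    finally show "norm (norm (?f j - 1)) \<le> C * (D * norm \<xi>) * \<rho> ^ Suc j" by (simp add: mult_ac)
  qed
  hence "convergent_prod ?f"
    by (intro abs_convergent_prod_imp_convergent_prod) (simp add: abs_convergent_prod_conv_summable)
  hence "(\<lambda>n. \<Prod>i\<le>n. ?f i) \<longlonglongrightarrow> prodinf ?f" by (rule convergent_prod_LIMSEQ)
  hence lim: "(\<lambda>n. \<Prod>i<n. ?f i) \<longlonglongrightarrow> prodinf ?f" unfolding LIMSEQ_lessThan_iff_atMost .
  have "fseries (A n) ((mat_inv_T M ^^ n) \<xi>) = (\<Prod>i<n. ?f i)" for n
  proof -
    have cancel: "(mat_T M ^^ i) ((mat_inv_T M ^^ (i + j)) x) = (mat_inv_T M ^^ j) x" for i j x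
    proof (induction i)
      case (Suc i)
      have "(mat_T M ^^ Suc i) ((mat_inv_T M ^^ (Suc i + j)) x) = (mat_T M ^^ i) (mat_T M (mat_inv_T M ((mat_inv_T M ^^ (i + j)) x)))"
        by (subst funpow_Suc_right) simp
      thus ?case using Suc by simp
    qed simp
    have "fseries (A n) ((mat_inv_T M ^^ n) \<xi>) = (\<Prod>i<n. fseries a ((mat_T M ^^ i) ((mat_inv_T M ^^ n) \<xi>)))"
      by (rule has_fseriesD[OF iter_filter_has_fseries[OF al0]])
    also have "\<dots> = (\<Prod>i<n. ?f (n - Suc i))"
    proof (rule prod.cong[OF refl])
      fix i assume "i \<in> {..<n}"
      hence "n = i + Suc (n - Suc i)" by auto
      thus "fseries a ((mat_T M ^^ i) ((mat_inv_T M ^^ n) \<xi>)) = ?f (n - Suc i)" using cancel[of i "Suc (n - Suc i)" \<xi>] by metis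
    qed
    also have "\<dots> = (\<Prod>i<n. ?f i)" by (rule prod.nat_diff_reindex)
    finally show ?thesis .
  qed
  thus ?thesis using lim by (simp add: refinable_fourier_def)
qed

lemma cube_ft_tendsto: "(\<lambda>n. cube_ft ((mat_inv_T M ^^ n) \<xi>)) \<longlonglongrightarrow> 1"
proof -
  obtain D \<rho> where D: "0 < \<rho>" "\<rho> < 1" "0 < D" "\<And>n x. norm ((mat_inv_T M ^^ n) x) \<le> D * \<rho> ^ n * norm x" using decay_T by blast
  have "(\<lambda>n. D * \<rho> ^ n * norm \<xi>) \<longlonglongrightarrow> D * 0 * norm \<xi>" using D by (intro tendsto_intros) auto
  hence "(\<lambda>n. D * \<rho> ^ n * norm \<xi>) \<longlonglongrightarrow> 0" by simp
  hence lim0: "(\<lambda>n. (mat_inv_T M ^^ n) \<xi>) \<longlonglongrightarrow> 0"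
    by (rule Lim_null_comparison[OF always_eventually, rotated]) (intro allI D(4))
  have "(\<lambda>n. cube_ft ((mat_inv_T M ^^ n) \<xi>)) \<longlonglongrightarrow> (\<integral>(y::real^'n). indicator unit_cube y * 1 \<partial>lborel)"
    unfolding cube_ft_def
  proof (rule integral_dominated_convergence[where w = "indicator unit_cube"])
    show "integrable lborel (indicator unit_cube :: real^'n \<Rightarrow> real)" by (simp add: emeasure_unit_cube)
    show "AE y in lborel. (\<lambda>n. indicator unit_cube y * ex ((mat_inv_T M ^^ n) \<xi>) y) \<longlonglongrightarrow> indicator unit_cube y * 1"
    proof (intro AE_I2 tendsto_mult tendsto_const)
      fix y
      have "(\<lambda>n. ex ((mat_inv_T M ^^ n) \<xi>) y) \<longlonglongrightarrow> exp (- \<i> * complex_of_real (y \<bullet> 0))"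
        unfolding ex_def by (intro tendsto_intros lim0)
      thus "(\<lambda>n. ex ((mat_inv_T M ^^ n) \<xi>) y) \<longlonglongrightarrow> 1" by simp
    qed
    show "AE y in lborel. norm (indicator unit_cube y * ex ((mat_inv_T M ^^ n) \<xi>) y) \<le> indicator unit_cube y" for n
      by (simp add: norm_mult indicator_def)
  qed measurable
  moreover have "(\<integral>(y::real^'n). indicator unit_cube y * 1 \<partial>lborel) = (1 :: complex)"
  proof -
    have "(\<integral>(y::real^'n). indicator unit_cube y * 1 \<partial>lborel) = (\<integral>(y::real^'n). complex_of_real (indicator unit_cube y) \<partial>lborel)"
      by (intro Bochner_Integration.integral_cong refl) (simp add: indicator_def)
    also have "\<dots> = complex_of_real (\<integral>(y::real^'n). indicator unit_cube y \<partial>lborel)"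
      by (rule integral_complex_of_real)
    finally show ?thesis by (simp add: measure_def emeasure_unit_cube)
  qed
  ultimately show ?thesis by simp
qed

lemma gn_measurable [measurable]: "gn n \<in> borel_measurable borel"
  unfolding gn_sum[abs_def] by measurable

lemma fourier_phi: "fourier phi \<xi> = refinable_fourier M a \<xi>"
proof -
  obtain C r where C: "0 < r" "r < 1" "0 \<le> C" "\<And>n x. norm (phi x - gn n x) \<le> C * r ^ n" using phi_approx by blast
  obtain R where R: "\<And>n x. gn n x \<noteq> 0 \<Longrightarrow> norm x \<le> R" using gn_support by blast
  obtain B where B: "\<And>x. norm (phi x) \<le> B" using cc_bounded[OF cc_phi] by blast
  have gb: "norm (gn n x) \<le> B + C" for n x
  proof -
    have "norm (gn n x) \<le> norm (phi x) + norm (phi x - gn n x)"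
      by (metis add_diff_cancel_left' diff_add_cancel norm_minus_commute norm_triangle_sub)
    moreover have "C * r ^ n \<le> C" using C by (simp add: mult_left_le power_le_one)
    ultimately show ?thesis using B[of x] C(4)[of x n] by linarith
  qed
  have "(\<lambda>n. \<integral>x. gn n x * ex \<xi> x \<partial>lborel) \<longlonglongrightarrow> (\<integral>x. phi x * ex \<xi> x \<partial>lborel)"
  proof (rule integral_dominated_convergence[where w = "\<lambda>x. (B + C) * indicator (cball 0 R) x"])
    show "integrable lborel (\<lambda>x::real^'n. (B + C) * indicator (cball 0 R) x)"
      by (intro integrable_mult_right integrable_real_indicator) (use emeasure_lborel_cball_finite[of "0::real^'n" R] in auto)
    show "AE x in lborel. (\<lambda>n. gn n x * ex \<xi> x) \<longlonglongrightarrow> phi x * ex \<xi> x"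
      by (intro AE_I2 tendsto_intros gn_tendsto)
    show "AE x in lborel. norm (gn n x * ex \<xi> x) \<le> (B + C) * indicator (cball 0 R) x" for n
      using gb R by (intro AE_I2) (auto simp: norm_mult indicator_def)
    show "(\<lambda>x. phi x * ex \<xi> x) \<in> borel_measurable lborel" using cc_measurable[OF cc_ex[OF cc_phi]] by simp
  qed measurable
  moreover have "(\<lambda>n. \<integral>x. gn n x * ex \<xi> x \<partial>lborel) \<longlonglongrightarrow> refinable_fourier M a \<xi> * 1"
    unfolding integral_gn by (intro tendsto_mult refinable_product cube_ft_tendsto)
  ultimately show ?thesis using LIMSEQ_unique unfolding fourier_ex by fastforce
qed

lemma standard_refinable_phi: "standard_refinable M a phi"
  unfolding standard_refinable_def has_fourier_def using cc_integrable[OF cc_phi] fourier_phi by blast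

lemma integral_phi: "(\<integral>x. phi x \<partial>lborel) = 1"
proof -
  have "(mat_inv_T M ^^ n) 0 = 0" for n by (induction n) (auto simp: mat_inv_T_def)
  hence "refinable_fourier M a 0 = prodinf (\<lambda>j. 1 :: complex)" unfolding refinable_fourier_def by (simp only: a0)
  thus ?thesis using fourier_phi[of 0] by (simp add: fourier_0)
qed

lemma fundamental_phi: "fundamental phi"
  by (simp add: fundamental_def phi_continuous phi_int)

lemma phi_wav: "phi = wav phi a"
  unfolding wav_def[abs_def] by (rule ext) (rule phi_refinement)

end

section \<open>The Hilbert space of square integrable functions\<close>

lemma cnj_measurable [measurable]: "cnj \<in> borel_measurable borel"
  by (intro borel_measurable_continuous_onI continuous_intros)

lemma L2_measurable: "f \<in> L2 \<Longrightarrow> f \<in> borel_measurable borel"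
  by (simp add: L2_def)

lemma L2_I: "f \<in> borel_measurable borel \<Longrightarrow> integrable lborel (\<lambda>x. (norm (f x))\<^sup>2) \<Longrightarrow> f \<in> L2"
  by (simp add: L2_def)

lemma L2_sq_integrable: "f \<in> L2 \<Longrightarrow> integrable lborel (\<lambda>x. (norm (f x))\<^sup>2)"
  by (simp add: L2_def)

lemma L2_dominated:
  assumes f: "f \<in> L2" and g: "g \<in> borel_measurable borel" and le: "\<And>x. norm (g x) \<le> c * norm (f x)"
  shows "g \<in> L2"
proof (rule L2_I[OF g], rule Bochner_Integration.integrable_bound)
  show "integrable lborel (\<lambda>x. c\<^sup>2 * (norm (f x))\<^sup>2)" using L2_sq_integrable[OF f] by simp
  show "(\<lambda>x. (norm (g x))\<^sup>2) \<in> borel_measurable lborel" using g by measurable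
  show "AE x in lborel. norm ((norm (g x))\<^sup>2) \<le> norm (c\<^sup>2 * (norm (f x))\<^sup>2)"
    using le by (intro AE_I2) (simp add: power_mono flip: power_mult_distrib)
qed

lemma L2_scale: "f \<in> L2 \<Longrightarrow> (\<lambda>x. c * f x) \<in> L2"
  by (rule L2_dominated[of f _ "norm c"]) (auto simp: norm_mult intro: borel_measurable_times L2_measurable)

lemma L2_prod_integrable:
  assumes "f \<in> L2" "g \<in> L2"
  shows "integrable lborel (\<lambda>x. f x * cnj (g x))"
proof (rule Bochner_Integration.integrable_bound)
  show "integrable lborel (\<lambda>x. (norm (f x))\<^sup>2 + (norm (g x))\<^sup>2)"
    using assms by (intro Bochner_Integration.integrable_add L2_sq_integrable)
  have [measurable]: "f \<in> borel_measurable borel" "g \<in> borel_measurable borel" using assms by (auto intro: L2_measurable)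
  show "(\<lambda>x. f x * cnj (g x)) \<in> borel_measurable lborel" by measurable
  have "norm (f x) * norm (g x) \<le> (norm (f x))\<^sup>2 + (norm (g x))\<^sup>2" for x
    using sum_squares_bound[of "norm (f x)" "norm (g x)"] mult_nonneg_nonneg[OF norm_ge_zero[of "f x"] norm_ge_zero[of "g x"]]
    by linarith
  thus "AE x in lborel. norm (f x * cnj (g x)) \<le> norm ((norm (f x))\<^sup>2 + (norm (g x))\<^sup>2)"
    by (intro AE_I2) (simp add: norm_mult)
qed

lemma L2_add:
  assumes "f \<in> L2" "g \<in> L2"
  shows "(\<lambda>x. f x + g x) \<in> L2"
proof (rule L2_I)
  have [measurable]: "f \<in> borel_measurable borel" "g \<in> borel_measurable borel" using assms by (auto intro: L2_measurable)
  show "(\<lambda>x. f x + g x) \<in> borel_measurable borel" by measurable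
  show "integrable lborel (\<lambda>x. (norm (f x + g x))\<^sup>2)"
  proof (rule Bochner_Integration.integrable_bound)
    show "integrable lborel (\<lambda>x. 2 * (norm (f x))\<^sup>2 + 2 * (norm (g x))\<^sup>2)"
      using assms by (intro Bochner_Integration.integrable_add integrable_mult_right L2_sq_integrable)
    have "(norm (f x + g x))\<^sup>2 \<le> 2 * (norm (f x))\<^sup>2 + 2 * (norm (g x))\<^sup>2" for x
    proof -
      have "(norm (f x + g x))\<^sup>2 \<le> (norm (f x) + norm (g x))\<^sup>2" by (intro power_mono norm_triangle_ineq) simp
      also have "\<dots> \<le> 2 * (norm (f x))\<^sup>2 + 2 * (norm (g x))\<^sup>2"
        unfolding power2_sum using sum_squares_bound[of "norm (f x)" "norm (g x)"] by linarith
      finally show ?thesis .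
    qed
    thus "AE x in lborel. norm ((norm (f x + g x))\<^sup>2) \<le> norm (2 * (norm (f x))\<^sup>2 + 2 * (norm (g x))\<^sup>2)" by simp
  qed measurable
qed

lemma L2_diff: "f \<in> L2 \<Longrightarrow> g \<in> L2 \<Longrightarrow> (\<lambda>x. f x - g x) \<in> L2"
  using L2_add[OF _ L2_scale[of g "-1"], of f] by simp

lemma L2_zero: "(\<lambda>x. 0) \<in> L2"
  by (rule L2_I) auto

lemma L2_sum: "(\<And>i. i \<in> I \<Longrightarrow> f i \<in> L2) \<Longrightarrow> (\<lambda>x. \<Sum>i\<in>I. f i x) \<in> L2"
  by (induction I rule: infinite_finite_induct) (auto intro: L2_zero L2_add)

lemma L2_inner_add_left: "f \<in> L2 \<Longrightarrow> g \<in> L2 \<Longrightarrow> h \<in> L2 \<Longrightarrow> L2_inner (\<lambda>x. f x + g x) h = L2_inner f h + L2_inner g h"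
  unfolding L2_inner_def
  by (subst Bochner_Integration.integral_add[symmetric]) (auto intro: L2_prod_integrable simp: ring_distribs)

lemma L2_inner_scale_left: "L2_inner (\<lambda>x. c * f x) h = c * L2_inner f h"
  unfolding L2_inner_def by (simp add: mult.assoc)

lemma L2_inner_commute: "L2_inner g f = cnj (L2_inner f g)"
proof -
  have "cnj (L2_inner f g) = (\<integral>x. cnj (f x * cnj (g x)) \<partial>lborel)"
    unfolding L2_inner_def by (rule Bochner_Integration.integral_cnj[symmetric])
  thus ?thesis by (simp add: L2_inner_def mult.commute del: Bochner_Integration.integral_cnj)
qed

lemma L2_inner_diff_left: "f \<in> L2 \<Longrightarrow> g \<in> L2 \<Longrightarrow> h \<in> L2 \<Longrightarrow> L2_inner (\<lambda>x. f x - g x) h = L2_inner f h - L2_inner g h"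
  unfolding L2_inner_def
  by (subst Bochner_Integration.integral_diff[symmetric]) (auto intro: L2_prod_integrable simp: left_diff_distrib)

lemma L2_inner_sum_left: "(\<And>i. i \<in> I \<Longrightarrow> f i \<in> L2) \<Longrightarrow> h \<in> L2 \<Longrightarrow> L2_inner (\<lambda>x. \<Sum>i\<in>I. f i x) h = (\<Sum>i\<in>I. L2_inner (f i) h)"
proof (induction I rule: infinite_finite_induct)
  case (insert i I)
  thus ?case by (simp add: L2_inner_add_left L2_sum)
qed (simp_all add: L2_inner_def)

lemma L2_inner_scale_right: "L2_inner h (\<lambda>x. c * f x) = cnj c * L2_inner h f"
  by (simp add: L2_inner_commute[of h] L2_inner_scale_left)

lemma L2_inner_sum_right: "(\<And>i. i \<in> I \<Longrightarrow> f i \<in> L2) \<Longrightarrow> h \<in> L2 \<Longrightarrow> L2_inner h (\<lambda>x. \<Sum>i\<in>I. f i x) = (\<Sum>i\<in>I. L2_inner h (f i))"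
  by (simp add: L2_inner_commute[of h] L2_inner_sum_left)

lemma L2_inner_diff_right: "f \<in> L2 \<Longrightarrow> g \<in> L2 \<Longrightarrow> h \<in> L2 \<Longrightarrow> L2_inner h (\<lambda>x. f x - g x) = L2_inner h f - L2_inner h g"
  by (simp add: L2_inner_commute[of h] L2_inner_diff_left)

lemma L2_norm_nonneg: "0 \<le> L2_norm f"
  unfolding L2_norm_def by simp

lemma L2_norm_sq: "(L2_norm f)\<^sup>2 = (\<integral>x. (norm (f x))\<^sup>2 \<partial>lborel)"
  unfolding L2_norm_def by simp

lemma L2_inner_self: "L2_inner f f = complex_of_real ((L2_norm f)\<^sup>2)"
proof -
  have "f x * cnj (f x) = complex_of_real ((norm (f x))\<^sup>2)" for x
    by (simp add: complex_norm_square[symmetric] del: of_real_power)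
  hence "L2_inner f f = (\<integral>x. complex_of_real ((norm (f x))\<^sup>2) \<partial>lborel)" by (simp add: L2_inner_def)
  also have "\<dots> = complex_of_real (\<integral>x. (norm (f x))\<^sup>2 \<partial>lborel)" by (rule integral_complex_of_real)
  finally show ?thesis by (simp only: L2_norm_sq)
qed

lemma L2_Cauchy_Schwarz:
  assumes f: "f \<in> L2" and g: "g \<in> L2"
  shows "norm (L2_inner f g) \<le> L2_norm f * L2_norm g"
proof -
  define z where "z = L2_inner f g"
  define a b where "a = (L2_norm f)\<^sup>2" and "b = (L2_norm g)\<^sup>2"
  have key: "0 \<le> a - 2 * t * (norm z)\<^sup>2 + t\<^sup>2 * (norm z)\<^sup>2 * b" for t :: real
  proof -
    define c where "c = of_real t * z"
    have "complex_of_real ((L2_norm (\<lambda>x. f x - c * g x))\<^sup>2) = L2_inner (\<lambda>x. f x - c * g x) (\<lambda>x. f x - c * g x)"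
      by (rule L2_inner_self[symmetric])
    also have "\<dots> = L2_inner f f - cnj c * L2_inner f g - c * L2_inner g f + c * cnj c * L2_inner g g"
      using f g by (simp add: L2_inner_diff_left L2_inner_diff_right L2_scale L2_diff L2_inner_scale_left L2_inner_scale_right algebra_simps)
    also have "\<dots> = complex_of_real (a - 2 * t * (norm z)\<^sup>2 + t\<^sup>2 * (norm z)\<^sup>2 * b)"
    proof -
      have zz: "z * cnj z = complex_of_real ((norm z)\<^sup>2)" by (simp add: complex_norm_square[symmetric] del: of_real_power)
      have "L2_inner f f - cnj c * L2_inner f g - c * L2_inner g f + c * cnj c * L2_inner g g
        = of_real a - of_real t * (z * cnj z) - of_real t * (z * cnj z) + of_real t * of_real t * (z * cnj z) * of_real b"
        by (simp add: L2_inner_self a_def b_def c_def L2_inner_commute[of g f] z_def algebra_simps)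
      thus ?thesis unfolding zz by (simp add: power2_eq_square algebra_simps)
    qed
    finally have "(L2_norm (\<lambda>x. f x - c * g x))\<^sup>2 = a - 2 * t * (norm z)\<^sup>2 + t\<^sup>2 * (norm z)\<^sup>2 * b"
      by (simp only: of_real_eq_iff)
    thus ?thesis by (metis zero_le_power2)
  qed
  have a0: "0 \<le> a" "0 \<le> b" by (simp_all add: a_def b_def)
  have "(norm z)\<^sup>2 \<le> a * b"
  proof (cases "b = 0")
    case False
    have "0 \<le> a - (norm z)\<^sup>2 / b" using key[of "1 / b"] False by (simp add: power2_eq_square field_simps)
    thus ?thesis using False a0 by (simp add: field_simps)
  next
    case True
    have "z = 0"
    proof (rule ccontr)
      assume "z \<noteq> 0"
      hence "0 < (norm z)\<^sup>2" by simp
      moreover have "0 \<le> a - 2 * ((a + 1) / (2 * (norm z)\<^sup>2)) * (norm z)\<^sup>2" using key[of "(a + 1) / (2 * (norm z)\<^sup>2)"] True by simp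
      ultimately show False by simp
    qed
    thus ?thesis using True by simp
  qed
  hence "(norm z)\<^sup>2 \<le> (L2_norm f * L2_norm g)\<^sup>2" by (simp add: a_def b_def power_mult_distrib)
  thus ?thesis unfolding z_def by (rule power2_le_imp_le) (simp add: L2_norm_nonneg)
qed

lemma L2_norm_triangle:
  assumes f: "f \<in> L2" and g: "g \<in> L2"
  shows "L2_norm (\<lambda>x. f x + g x) \<le> L2_norm f + L2_norm g"
proof (rule power2_le_imp_le)
  let ?h = "\<lambda>x. f x + g x"
  have h: "?h \<in> L2" using f g by (rule L2_add)
  have "complex_of_real ((L2_norm ?h)\<^sup>2) = L2_inner f ?h + L2_inner g ?h"
    unfolding L2_inner_self[symmetric] using f g h by (rule L2_inner_add_left)
  hence "(L2_norm ?h)\<^sup>2 = norm (L2_inner f ?h + L2_inner g ?h)" by (metis norm_of_real abs_power2)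
  also have "\<dots> \<le> L2_norm f * L2_norm ?h + L2_norm g * L2_norm ?h"
    by (intro norm_triangle_mono L2_Cauchy_Schwarz f g h)
  finally have "L2_norm ?h * L2_norm ?h \<le> (L2_norm f + L2_norm g) * L2_norm ?h" by (simp add: power2_eq_square algebra_simps)
  hence "L2_norm ?h \<le> L2_norm f + L2_norm g"
    using L2_norm_nonneg[of ?h] L2_norm_nonneg[of f] L2_norm_nonneg[of g]
    by (cases "L2_norm ?h = 0") (auto simp: mult_le_cancel_right)
  thus "(L2_norm ?h)\<^sup>2 \<le> (L2_norm f + L2_norm g)\<^sup>2" by (rule power_mono[OF _ L2_norm_nonneg])
qed (simp add: L2_norm_nonneg)

lemma L2_norm_triangle_diff:
  assumes "f \<in> L2" "g \<in> L2" "h \<in> L2"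
  shows "L2_norm (\<lambda>x. f x - h x) \<le> L2_norm (\<lambda>x. f x - g x) + L2_norm (\<lambda>x. g x - h x)"
  using L2_norm_triangle[OF L2_diff[OF assms(1,2)] L2_diff[OF assms(2,3)]] by simp

lemma L2_norm_minus_commute: "L2_norm (\<lambda>x. f x - g x) = L2_norm (\<lambda>x. g x - f x)"
  unfolding L2_norm_def by (simp add: norm_minus_commute)

section \<open>Density of continuous functions with compact support\<close>

lemma L2_limit:
  fixes f :: "'n::finite cfun"
  assumes [measurable]: "f \<in> borel_measurable borel" "\<And>i. s i \<in> borel_measurable borel" and w: "integrable lborel w"
    and dom: "\<And>i x. (norm (f x - s i x))\<^sup>2 \<le> w x" and lim: "AE x in lborel. (\<lambda>i. s i x) \<longlonglongrightarrow> f x" and e: "0 < e"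
  shows "\<exists>i. L2_norm (\<lambda>x. f x - s i x) < e"
proof -
  have "(\<lambda>i. \<integral>x. (norm (f x - s i x))\<^sup>2 \<partial>lborel) \<longlonglongrightarrow> (\<integral>x. (0::real) \<partial>(lborel :: (real^'n) measure))"
  proof (rule integral_dominated_convergence[OF _ _ w])
    show "AE x in lborel. (\<lambda>i. (norm (f x - s i x))\<^sup>2) \<longlonglongrightarrow> 0"
      using lim
    proof eventually_elim
      case (elim x)
      have "(\<lambda>i. (norm (f x - s i x))\<^sup>2) \<longlonglongrightarrow> (norm (f x - f x))\<^sup>2" by (intro tendsto_intros elim)
      thus ?case by simp
    qed
    show "AE x in lborel. norm ((norm (f x - s i x))\<^sup>2) \<le> w x" for i using dom by simp
  qed measurable
  hence "(\<lambda>i. (L2_norm (\<lambda>x. f x - s i x))\<^sup>2) \<longlonglongrightarrow> 0" by (simp add: L2_norm_sq)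
  hence "eventually (\<lambda>i. (L2_norm (\<lambda>x. f x - s i x))\<^sup>2 < e\<^sup>2) sequentially"
    by (rule order_tendstoD) (use e in simp)
  then obtain i where "(L2_norm (\<lambda>x. f x - s i x))\<^sup>2 < e\<^sup>2" by (auto simp: eventually_sequentially)
  hence "L2_norm (\<lambda>x. f x - s i x) < e" using e by (simp add: power2_less_imp_less)
  thus ?thesis by blast
qed

lemma L2_dense:
  fixes f :: "'n::finite cfun"
  assumes f: "f \<in> L2" and e: "0 < e"
  shows "\<exists>g. cc g \<and> L2_norm (\<lambda>x. f x - g x) < e"
proof -
  have [measurable]: "f \<in> borel_measurable borel" by (rule L2_measurable[OF f])
  define h where "h n x = (if norm x \<le> real n \<and> norm (f x) \<le> real n then f x else 0)" for n x
  have hm[measurable]: "h n \<in> borel_measurable borel" for n unfolding h_def[abs_def] by measurable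
  have "\<exists>n. L2_norm (\<lambda>x. f x - h n x) < e / 2"
  proof (rule L2_limit[OF _ _ L2_sq_integrable[OF f]])
    have "(\<lambda>n. h n x) \<longlonglongrightarrow> f x" for x
    proof (rule tendsto_eventually)
      obtain N where N: "max (norm x) (norm (f x)) \<le> real N" using real_arch_simple by blast
      have "h n x = f x" if "n \<ge> N" for n using N that by (simp add: h_def)
      thus "eventually (\<lambda>n. h n x = f x) sequentially" by (auto simp: eventually_sequentially)
    qed
    thus "AE x in lborel. (\<lambda>n. h n x) \<longlonglongrightarrow> f x" by simp
  qed (use e in \<open>auto simp: h_def\<close>)
  then obtain n where n: "L2_norm (\<lambda>x. f x - h n x) < e / 2" by blast
  define K where "K = real n + 1"
  have K: "0 < K" by (simp add: K_def)
  have hK: "norm (h n x) \<le> K" "h n x \<noteq> 0 \<Longrightarrow> norm x \<le> K - 1" for x by (auto simp: h_def K_def split: if_splits)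
  have "h n measurable_on UNIV" using hm[of n] by (intro lebesgue_measurable_imp_measurable_on measurable_completion) auto
  then obtain N g where N: "negligible N" and g: "\<And>i. continuous_on UNIV (g i)" "\<And>x. x \<notin> N \<Longrightarrow> (\<lambda>i. g i x) \<longlonglongrightarrow> h n x"
    unfolding measurable_on_def by auto
  define cut where "cut z = complex_of_real (K / max K (norm z)) * z" for z :: complex
  define s where "s i x = cut (g i x) * complex_of_real (max 0 (min 1 (K - norm x)))" for i x
  have cut: "norm (cut z) \<le> K" for z
    unfolding cut_def norm_mult norm_of_real using K by (simp add: field_simps max_def)
  have cutc: "continuous_on UNIV cut" unfolding cut_def using K by (intro continuous_intros) auto
  have sc: "cc (s i)" for i
    unfolding cc_def s_def
    by (intro conjI continuous_intros continuous_on_compose2[OF cutc g(1)] exI[of _ K]) (auto simp: max_def split: if_splits)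
  have "\<exists>i. L2_norm (\<lambda>x. h n x - s i x) < e / 2"
  proof (rule L2_limit)
    show "integrable lborel (\<lambda>x. (2 * K)\<^sup>2 * indicator (cball (0::real^'n) K) x)"
      by (intro integrable_mult_right) (use emeasure_lborel_cball_finite[of 0 K] in \<open>simp add: integrable_indicator_iff\<close>)
    fix i x
    show "(norm (h n x - s i x))\<^sup>2 \<le> (2 * K)\<^sup>2 * indicator (cball 0 K) x"
    proof (cases "norm x \<le> K")
      case True
      have "norm (s i x) \<le> K * 1" unfolding s_def norm_mult by (intro mult_mono cut) (use K in auto)
      hence "norm (h n x - s i x) \<le> 2 * K" using norm_triangle_ineq4[of "h n x" "s i x"] hK(1)[of x] by linarith
      from power_mono[OF this norm_ge_zero, of 2] show ?thesis using True by simp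
    next
      case False
      thus ?thesis using hK(2)[of x] by (auto simp: s_def)
    qed
  next
    have "(\<lambda>i. s i x) \<longlonglongrightarrow> h n x" if x: "x \<notin> N" for x
    proof -
      have "isCont cut (h n x)" using cutc by (simp add: continuous_on_eq_continuous_at)
      hence "(\<lambda>i. cut (g i x)) \<longlonglongrightarrow> cut (h n x)" using g(2)[OF x] by (rule isCont_tendsto_compose)
      also have "cut (h n x) = h n x" using hK(1)[of x] K by (simp add: cut_def max_absorb1)
      finally have "(\<lambda>i. s i x) \<longlonglongrightarrow> h n x * complex_of_real (max 0 (min 1 (K - norm x)))" unfolding s_def by (intro tendsto_intros)
      also have "h n x * complex_of_real (max 0 (min 1 (K - norm x))) = h n x" using hK(2)[of x] by (cases "h n x = 0") auto
      finally show ?thesis .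
    qed
    moreover have "AE x in lebesgue. x \<notin> N" using N by (intro AE_not_in) (simp add: negligible_iff_null_sets)
    ultimately show "AE x in lborel. (\<lambda>i. s i x) \<longlonglongrightarrow> h n x" unfolding AE_completion_iff by auto
  qed (use e cc_measurable[OF sc] in auto)
  then obtain i where i: "L2_norm (\<lambda>x. h n x - s i x) < e / 2" by blast
  have "h n \<in> L2" by (rule L2_dominated[OF f, of _ 1]) (auto simp: h_def)
  from L2_norm_triangle_diff[OF f this cc_L2[OF sc[of i]]] n i have "L2_norm (\<lambda>x. f x - s i x) < e" by linarith
  thus ?thesis using sc by blast
qed

section \<open>Bessel families\<close>

definition bessel :: "'i set \<Rightarrow> ('i \<Rightarrow> ('n::finite) cfun) \<Rightarrow> real \<Rightarrow> bool" where
  "bessel J e C \<longleftrightarrow> 0 \<le> C \<and> (\<forall>i\<in>J. e i \<in> L2) \<and>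
    (\<forall>I f. finite I \<longrightarrow> I \<subseteq> J \<longrightarrow> f \<in> L2 \<longrightarrow> (\<Sum>i\<in>I. (norm (L2_inner f (e i)))\<^sup>2) \<le> C * (L2_norm f)\<^sup>2)"

lemma besselD:
  "bessel J e C \<Longrightarrow> finite I \<Longrightarrow> I \<subseteq> J \<Longrightarrow> f \<in> L2 \<Longrightarrow> (\<Sum>i\<in>I. (norm (L2_inner f (e i)))\<^sup>2) \<le> C * (L2_norm f)\<^sup>2"
  by (simp add: bessel_def)

lemma norm_sum_prod_le:
  "norm (\<Sum>i\<in>I. c i * z i :: complex) \<le> sqrt (\<Sum>i\<in>I. (norm (c i))\<^sup>2) * sqrt (\<Sum>i\<in>I. (norm (z i))\<^sup>2)"
proof -
  have "norm (\<Sum>i\<in>I. c i * z i) \<le> (\<Sum>i\<in>I. \<bar>norm (c i)\<bar> * \<bar>norm (z i)\<bar>)"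
    by (intro sum_norm_le) (simp add: norm_mult)
  also have "\<dots> \<le> L2_set (\<lambda>i. norm (c i)) I * L2_set (\<lambda>i. norm (z i)) I" by (rule L2_set_mult_ineq)
  finally show ?thesis by (simp add: L2_set_def)
qed

lemma bessel_synthesis:
  assumes b: "bessel J e C" and I: "finite I" "I \<subseteq> J"
  shows "(L2_norm (\<lambda>x. \<Sum>i\<in>I. c i * e i x))\<^sup>2 \<le> C * (\<Sum>i\<in>I. (norm (c i))\<^sup>2)"
proof -
  define g where "g x = (\<Sum>i\<in>I. c i * e i x)" for x
  define S where "S = (\<Sum>i\<in>I. (norm (c i))\<^sup>2)"
  have S0: "0 \<le> S" unfolding S_def by (intro sum_nonneg) simp
  have C0: "0 \<le> C" using b by (simp add: bessel_def)
  have e: "e i \<in> L2" if "i \<in> I" for i using b I that by (auto simp: bessel_def)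
  have g: "g \<in> L2" unfolding g_def[abs_def] by (intro L2_sum L2_scale e)
  have "complex_of_real ((L2_norm g)\<^sup>2) = (\<Sum>i\<in>I. c i * L2_inner (e i) g)"
    unfolding L2_inner_self[symmetric]
    by (subst (1) g_def[abs_def]) (simp add: L2_inner_sum_left L2_scale e g L2_inner_scale_left)
  hence "(L2_norm g)\<^sup>2 = norm (\<Sum>i\<in>I. c i * L2_inner (e i) g)" by (metis norm_of_real abs_power2)
  also have "\<dots> \<le> sqrt S * sqrt (\<Sum>i\<in>I. (norm (L2_inner (e i) g))\<^sup>2)"
    unfolding S_def by (rule norm_sum_prod_le)
  also have "(\<Sum>i\<in>I. (norm (L2_inner (e i) g))\<^sup>2) = (\<Sum>i\<in>I. (norm (L2_inner g (e i)))\<^sup>2)"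
    by (intro sum.cong refl) (simp add: L2_inner_commute[of _ g])
  also have "sqrt S * sqrt (\<Sum>i\<in>I. (norm (L2_inner g (e i)))\<^sup>2) \<le> sqrt S * sqrt (C * (L2_norm g)\<^sup>2)"
    using besselD[OF b I g] S0 by (intro mult_left_mono real_sqrt_le_mono) auto
  also have "\<dots> = sqrt (C * S) * L2_norm g" by (simp add: real_sqrt_mult L2_norm_nonneg)
  finally have "L2_norm g * L2_norm g \<le> sqrt (C * S) * L2_norm g" by (simp add: power2_eq_square)
  hence "L2_norm g \<le> sqrt (C * S)" using L2_norm_nonneg[of g] C0 S0
    by (cases "L2_norm g = 0") (auto simp: mult_le_cancel_right)
  hence "(L2_norm g)\<^sup>2 \<le> (sqrt (C * S))\<^sup>2" by (rule power_mono[OF _ L2_norm_nonneg])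
  thus ?thesis using C0 S0 by (simp add: S_def g_def[abs_def])
qed

lemma bessel_schur:
  fixes e :: "'i \<Rightarrow> 'n::finite cfun"
  assumes C: "0 \<le> C" and e: "\<And>i. i \<in> J \<Longrightarrow> e i \<in> L2" and w: "\<And>i. 0 < w i"
    and schur: "\<And>I i. finite I \<Longrightarrow> I \<subseteq> J \<Longrightarrow> i \<in> J \<Longrightarrow> (\<Sum>i'\<in>I. norm (L2_inner (e i) (e i')) * w i') \<le> C * w i"
  shows "bessel J e C"
  unfolding bessel_def
proof (intro conjI C ballI e allI impI)
  fix I and f :: "'n cfun" assume I: "finite I" "I \<subseteq> J" and f: "f \<in> L2"
  define c where "c i = L2_inner f (e i)" for i
  define g where "g x = (\<Sum>i\<in>I. c i * e i x)" for x
  define S where "S = (\<Sum>i\<in>I. (norm (c i))\<^sup>2)"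
  define G where "G i i' = norm (L2_inner (e i) (e i'))" for i i'
  have eI: "e i \<in> L2" if "i \<in> I" for i using e I that by auto
  have g: "g \<in> L2" unfolding g_def[abs_def] by (intro L2_sum L2_scale eI)
  have S0: "0 \<le> S" unfolding S_def by (intro sum_nonneg) simp
  have "L2_inner f g = (\<Sum>i\<in>I. cnj (c i) * c i)"
    unfolding g_def[abs_def] by (simp add: L2_inner_sum_right L2_scale eI f L2_inner_scale_right c_def)
  also have "\<dots> = complex_of_real S"
    unfolding S_def of_real_sum by (intro sum.cong refl) (metis complex_norm_square mult.commute)
  finally have "S = norm (L2_inner f g)" using S0 by simp
  also have "\<dots> \<le> L2_norm f * L2_norm g" by (rule L2_Cauchy_Schwarz[OF f g])
  finally have 1: "S \<le> L2_norm f * L2_norm g" .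
  have "complex_of_real ((L2_norm g)\<^sup>2) = (\<Sum>i\<in>I. \<Sum>i'\<in>I. c i * cnj (c i') * L2_inner (e i) (e i'))"
  proof -
    have "complex_of_real ((L2_norm g)\<^sup>2) = (\<Sum>i\<in>I. c i * L2_inner (e i) g)"
      unfolding L2_inner_self[symmetric]
      by (subst (1) g_def[abs_def]) (simp add: L2_inner_sum_left L2_scale eI g L2_inner_scale_left)
    also have "\<dots> = (\<Sum>i\<in>I. c i * (\<Sum>i'\<in>I. cnj (c i') * L2_inner (e i) (e i')))"
      unfolding g_def[abs_def] by (intro sum.cong refl arg_cong2[where f = "(*)"]) (simp add: L2_inner_sum_right L2_scale eI L2_inner_scale_right)
    finally show ?thesis by (simp add: sum_distrib_left mult.assoc)
  qed
  hence "(L2_norm g)\<^sup>2 = norm (\<Sum>i\<in>I. \<Sum>i'\<in>I. c i * cnj (c i') * L2_inner (e i) (e i'))" by (metis norm_of_real abs_power2)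
  also have "\<dots> \<le> (\<Sum>i\<in>I. \<Sum>i'\<in>I. norm (c i) * norm (c i') * G i i')"
    unfolding G_def by (intro sum_norm_le) (simp add: norm_mult)
  also have "\<dots> \<le> (\<Sum>i\<in>I. \<Sum>i'\<in>I. (norm (c i))\<^sup>2 * (G i i' * w i') / (2 * w i) + (norm (c i'))\<^sup>2 * (G i' i * w i) / (2 * w i'))"
  proof (intro sum_mono)
    fix i i' assume "i \<in> I" "i' \<in> I"
    have sym: "G i' i = G i i'" unfolding G_def by (subst L2_inner_commute) simp
    have G0: "0 \<le> G i i'" by (simp add: G_def)
    have am: "2 * (norm (c i) * w i') * (norm (c i') * w i) \<le> (norm (c i) * w i')\<^sup>2 + (norm (c i') * w i)\<^sup>2" by (rule sum_squares_bound)
    have "norm (c i) * norm (c i') = 2 * (norm (c i) * w i') * (norm (c i') * w i) / (2 * w i * w i')"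
      using w[of i] w[of i'] by (simp add: field_simps)
    also have "\<dots> \<le> ((norm (c i) * w i')\<^sup>2 + (norm (c i') * w i)\<^sup>2) / (2 * w i * w i')"
      by (rule divide_right_mono[OF am]) (use w[of i] w[of i'] in simp)
    also have "\<dots> = (norm (c i))\<^sup>2 * w i' / (2 * w i) + (norm (c i'))\<^sup>2 * w i / (2 * w i')"
      using w[of i] w[of i'] by (simp add: field_simps power2_eq_square)
    finally have "norm (c i) * norm (c i') * G i i' \<le> ((norm (c i))\<^sup>2 * w i' / (2 * w i) + (norm (c i'))\<^sup>2 * w i / (2 * w i')) * G i i'"
      by (rule mult_right_mono[OF _ G0])
    thus "norm (c i) * norm (c i') * G i i' \<le> (norm (c i))\<^sup>2 * (G i i' * w i') / (2 * w i) + (norm (c i'))\<^sup>2 * (G i' i * w i) / (2 * w i')"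
      unfolding sym by (simp add: algebra_simps)
  qed
  also have "\<dots> = (\<Sum>i\<in>I. \<Sum>i'\<in>I. (norm (c i))\<^sup>2 * (G i i' * w i') / w i)"
  proof -
    have "(\<Sum>i\<in>I. \<Sum>i'\<in>I. (norm (c i'))\<^sup>2 * (G i' i * w i) / (2 * w i')) = (\<Sum>i\<in>I. \<Sum>i'\<in>I. (norm (c i))\<^sup>2 * (G i i' * w i') / (2 * w i))"
      by (rule sum.swap)
    moreover have "(norm (c i))\<^sup>2 * (G i i' * w i') / w i = (norm (c i))\<^sup>2 * (G i i' * w i') / (2 * w i) + (norm (c i))\<^sup>2 * (G i i' * w i') / (2 * w i)" for i i'
      using field_sum_of_halves[of "(norm (c i))\<^sup>2 * (G i i' * w i') / w i"]
      by (simp only: divide_divide_eq_left mult.commute[of 2])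
    ultimately show ?thesis by (simp only: sum.distrib)
  qed
  also have "\<dots> = (\<Sum>i\<in>I. (norm (c i))\<^sup>2 / w i * (\<Sum>i'\<in>I. G i i' * w i'))"
    by (simp add: sum_distrib_left)
  also have "\<dots> \<le> (\<Sum>i\<in>I. (norm (c i))\<^sup>2 / w i * (C * w i))"
    unfolding G_def using I w by (intro sum_mono mult_left_mono schur) (auto simp: less_imp_le)
  also have "\<dots> = C * S" unfolding S_def sum_distrib_left
  proof (intro sum.cong refl)
    fix i show "(norm (c i))\<^sup>2 / w i * (C * w i) = C * (norm (c i))\<^sup>2" using w[of i] by simp
  qed
  finally have 2: "(L2_norm g)\<^sup>2 \<le> C * S" .
  have "S * S \<le> (L2_norm f * L2_norm g)\<^sup>2"
    unfolding power2_eq_square using 1 S0 by (intro mult_mono) (auto intro: mult_nonneg_nonneg L2_norm_nonneg)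
  also have "\<dots> \<le> (L2_norm f)\<^sup>2 * (C * S)" unfolding power_mult_distrib using 2 by (intro mult_left_mono) auto
  finally have "S * S \<le> (C * (L2_norm f)\<^sup>2) * S" by (simp add: mult_ac)
  hence "S \<le> C * (L2_norm f)\<^sup>2" using S0 C
    by (cases "S = 0") (auto simp: mult_le_cancel_right)
  thus "(\<Sum>i\<in>I. (norm (L2_inner f (e i)))\<^sup>2) \<le> C * (L2_norm f)\<^sup>2" by (simp add: S_def c_def)
qed

lemma count_ball: "\<exists>N. \<forall>x::real^'n. card {k. norm (rvec k - x) \<le> R} \<le> N"
proof (intro exI allI)
  fix x :: "real^'n"
  let ?S = "{k::int^'n. norm (rvec k) \<le> R + CARD('n)}"
  have "(\<lambda>k. k - vfloor x) ` {k. norm (rvec k - x) \<le> R} \<subseteq> ?S"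
  proof safe
    fix k :: "int^'n" assume k: "norm (rvec k - x) \<le> R"
    have "rvec (k - vfloor x) = (rvec k - x) + vfrac x" by (simp add: vfrac_def rvec_diff)
    also have "norm \<dots> \<le> R + CARD('n)" by (intro norm_triangle_mono k norm_cube vfrac_cube)
    finally show "norm (rvec (k - vfloor x)) \<le> R + CARD('n)" .
  qed
  hence "card ((\<lambda>k. k - vfloor x) ` {k. norm (rvec k - x) \<le> R}) \<le> card ?S" by (rule card_mono[OF finite_int_bounded])
  thus "card {k. norm (rvec k - x) \<le> R} \<le> card ?S" by (simp add: card_image inj_on_def)
qed

context dilation_card
begin

lemma count_bwdn:
  assumes "\<And>x::real^'n. card {k. norm (rvec k - x) \<le> R} \<le> N"
  shows "finite {l. norm (bwdn n (rvec l) - y) \<le> R} \<and> card {l. norm (bwdn n (rvec l) - y) \<le> R} \<le> N * d_M M ^ n"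
proof (induction n arbitrary: y)
  case 0
  show ?case using finite_int_ball assms by simp
next
  case (Suc n)
  let ?S = "\<lambda>g. (\<lambda>l. g + M *v l) ` {l. norm (bwdn n (rvec l) - (y - bwdn n (bwd (rvec g)))) \<le> R}"
  have sub: "{l. norm (bwdn (Suc n) (rvec l) - y) \<le> R} \<subseteq> (\<Union>g\<in>Gamma_M M. ?S g)"
  proof safe
    fix l assume l: "norm (bwdn (Suc n) (rvec l) - y) \<le> R"
    obtain g k where g: "g \<in> Gamma_M M" "l = g + M *v k" using Gamma_rep by blast
    have "bwdn (Suc n) (rvec l) = bwdn n (bwd (rvec l))" by (simp add: funpow_swap1)
    also have "bwd (rvec l) = bwd (rvec g) + rvec k"
      unfolding g rvec_add rvec_mv by (simp add: matrix_vector_right_distrib)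
    finally have "bwdn (Suc n) (rvec l) - y = bwdn n (rvec k) - (y - bwdn n (bwd (rvec g)))" by (simp add: bwdn_add)
    hence "norm (bwdn n (rvec k) - (y - bwdn n (bwd (rvec g)))) \<le> R" using l by (simp only:)
    hence "l \<in> ?S g" unfolding g(2) by blast
    thus "l \<in> (\<Union>g\<in>Gamma_M M. ?S g)" using g(1) by blast
  qed
  have fin: "finite (\<Union>g\<in>Gamma_M M. ?S g)" using finite_Gamma Suc by blast
  have "card {l. norm (bwdn (Suc n) (rvec l) - y) \<le> R} \<le> card (\<Union>g\<in>Gamma_M M. ?S g)" by (rule card_mono[OF fin sub])
  also have "\<dots> \<le> (\<Sum>g\<in>Gamma_M M. card (?S g))" by (rule card_UN_le[OF finite_Gamma])
  also have "\<dots> \<le> (\<Sum>g\<in>Gamma_M M. N * d_M M ^ n)"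
    by (intro sum_mono order_trans[OF card_image_le[OF conjunct1[OF Suc]] conjunct2[OF Suc]])
  also have "\<dots> = N * d_M M ^ Suc n" by (simp add: card_Gamma)
  finally show ?case using finite_subset[OF sub fin] by blast
qed

definition sd :: real where "sd = sqrt (real (d_M M))"

abbreviation "ds \<equiv> dilate_shift M"

lemma sd_pos: "0 < sd" using d_pos by (simp add: sd_def)

lemma sd_sq: "sd * sd = real (d_M M)" by (simp add: sd_def)

lemma sd_power_sq: "sd ^ n * sd ^ n = real (d_M M) ^ n"
  by (simp add: sd_sq flip: power_mult_distrib)

lemma dilate_shift_eq: "ds f j k x = complex_of_real (sd ^ j) * f (fwdn j x - rvec k)"
proof -
  have "real (d_M M) powr (real j / 2) = (real (d_M M) powr (1 / 2)) powr real j" by (simp add: powr_powr)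
  also have "\<dots> = sd ^ j" unfolding sd_def using d_pos by (simp add: powr_half_sqrt powr_realpow)
  finally show ?thesis by (simp add: dilate_shift_def)
qed

lemma shift_eq: "shift f k = ds f 0 k"
  by (rule ext) (simp add: dilate_shift_eq shift_def)

lemma cc_dilate_shift: "cc f \<Longrightarrow> cc (ds f j k)"
  unfolding dilate_shift_eq[abs_def] by (intro cc_scale cc_fwdn)

lemma inner_dilate_shift:
  assumes f: "cc f" and g: "cc g"
  shows "L2_inner (ds f (j + n) k') (ds g j k)
    = complex_of_real (sd ^ n) * (\<integral>y. f (fwdn n y - rvec k') * cnj (g (y - rvec k)) \<partial>lborel)"
proof -
  let ?F = "\<lambda>y. f (fwdn n y - rvec k') * cnj (g (y - rvec k))"
  have m: "?F \<in> borel_measurable borel"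
    by (intro cc_measurable cc_mult cc_fwdn f cc_continuous cc_cnj cc_translate g)
  have "fwdn (j + n) x = fwdn n (fwdn j x)" for x by (metis funpow_add o_apply add.commute)
  hence "L2_inner (ds f (j + n) k') (ds g j k)
      = (\<integral>x. complex_of_real (sd ^ n * real (d_M M) ^ j) * ?F (fwdn j x) \<partial>lborel)"
    unfolding L2_inner_def dilate_shift_eq sd_power_sq[symmetric]
    by (intro Bochner_Integration.integral_cong refl) (simp add: power_add mult_ac)
  also have "\<dots> = complex_of_real (sd ^ n * real (d_M M) ^ j) * ((\<integral>x. ?F x \<partial>lborel) / of_nat (d_M M) ^ j)"
    by (subst integral_mult_right_zero) (simp only: integral_fwdn(1)[OF m])
  finally show ?thesis using d_pos by simp
qed

lemma gram_bound:
  assumes f: "cc f" and g: "cc g" and R: "\<And>x. f x \<noteq> 0 \<Longrightarrow> norm x \<le> R"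
    and D: "\<And>y. norm (fwdn n y - rvec k') \<le> R \<Longrightarrow> norm (g (y - rvec k) - c) \<le> D"
  shows "norm (L2_inner (ds f (j + n) k') (ds g j k) - cnj c * (\<integral>x. f x \<partial>lborel) / complex_of_real (sd ^ n)) \<le> D * (\<integral>x. norm (f x) \<partial>lborel) / sd ^ n"
proof -
  let ?h = "\<lambda>y. f (fwdn n y - rvec k')"
  let ?N = "\<lambda>y. complex_of_real (norm (f (y - rvec k')))"
  have fm: "(\<lambda>y. f (y - rvec k')) \<in> borel_measurable borel" by (intro cc_measurable cc_translate f)
  have Nm: "?N \<in> borel_measurable borel" using fm by measurable
  have h: "integrable lborel ?h" by (intro cc_integrable cc_fwdn f)
  have hg: "integrable lborel (\<lambda>y. ?h y * cnj (g (y - rvec k)))"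
    by (intro cc_integrable cc_mult cc_fwdn f cc_continuous cc_cnj cc_translate g)
  have hI: "(\<integral>y. ?h y \<partial>lborel) = (\<integral>x. f x \<partial>lborel) / of_nat (d_M M) ^ n"
    using integral_fwdn(1)[OF fm, of n] integral_translate(1)[OF cc_measurable[OF f], of "rvec k'"] by simp
  let ?D = "(\<integral>y. ?h y * cnj (g (y - rvec k)) \<partial>lborel) - cnj c * (\<integral>y. ?h y \<partial>lborel)"
  have "?D = (\<integral>y. ?h y * cnj (g (y - rvec k)) - cnj c * ?h y \<partial>lborel)"
    using h hg by simp
  also have "norm \<dots> \<le> (\<integral>y. D * norm (?h y) \<partial>lborel)"
  proof (rule Bochner_Integration.integral_norm_bound_integral)
    show "integrable lborel (\<lambda>y. ?h y * cnj (g (y - rvec k)) - cnj c * ?h y)" using h hg by simp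
    show "integrable lborel (\<lambda>y. D * norm (?h y))" using h by simp
    fix y
    have "norm (?h y * cnj (g (y - rvec k)) - cnj c * ?h y) = norm (?h y * cnj (g (y - rvec k) - c))"
      by (simp add: algebra_simps)
    also have "\<dots> = norm (g (y - rvec k) - c) * norm (?h y)" unfolding norm_mult complex_mod_cnj by (rule mult.commute)
    also have "\<dots> \<le> D * norm (?h y)"
    proof (cases "?h y = 0")
      case False
      show ?thesis by (rule mult_right_mono[OF D[OF R[OF False]] norm_ge_zero])
    qed simp
    finally show "norm (?h y * cnj (g (y - rvec k)) - cnj c * ?h y) \<le> D * norm (?h y)" .
  qed
  also have "(\<integral>y. D * norm (?h y) \<partial>lborel) = D * ((\<integral>x. norm (f x) \<partial>lborel) / real (d_M M) ^ n)"
  proof -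
    have Nf: "(\<lambda>y. complex_of_real (norm (f y))) \<in> borel_measurable borel" using cc_measurable[OF f] by measurable
    have "complex_of_real (\<integral>y. norm (?h y) \<partial>lborel) = (\<integral>y. ?N (fwdn n y) \<partial>lborel)" by (rule integral_complex_of_real[symmetric])
    also have "\<dots> = (\<integral>y. complex_of_real (norm (f y)) \<partial>lborel) / of_nat (d_M M) ^ n"
      unfolding integral_fwdn(1)[OF Nm] using integral_translate(1)[OF Nf, of "rvec k'"] by simp
    also have "\<dots> = complex_of_real ((\<integral>x. norm (f x) \<partial>lborel) / real (d_M M) ^ n)" by (simp add: integral_complex_of_real)
    finally show ?thesis by (simp only: of_real_eq_iff integral_mult_right_zero)
  qed
  finally have "norm ?D \<le> D * ((\<integral>x. norm (f x) \<partial>lborel) / real (d_M M) ^ n)" .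
  hence "sd ^ n * norm ?D \<le> sd ^ n * (D * ((\<integral>x. norm (f x) \<partial>lborel) / real (d_M M) ^ n))"
    using sd_pos by (intro mult_left_mono) auto
  also have "\<dots> = D * (\<integral>x. norm (f x) \<partial>lborel) / sd ^ n" using sd_pos by (simp add: field_simps flip: sd_power_sq)
  finally have *: "norm (complex_of_real (sd ^ n) * ?D) \<le> D * (\<integral>x. norm (f x) \<partial>lborel) / sd ^ n"
    unfolding norm_mult norm_of_real using sd_pos by simp
  have "of_nat (d_M M) ^ n = complex_of_real (sd ^ n) * complex_of_real (sd ^ n)"
    by (metis sd_power_sq of_real_mult of_real_of_nat_eq of_real_power)
  hence "complex_of_real (sd ^ n) * (\<integral>y. ?h y \<partial>lborel) = (\<integral>x. f x \<partial>lborel) / complex_of_real (sd ^ n)"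
    unfolding hI using sd_pos by simp
  hence "complex_of_real (sd ^ n) * ?D = L2_inner (ds f (j + n) k') (ds g j k) - cnj c * (\<integral>x. f x \<partial>lborel) / complex_of_real (sd ^ n)"
    unfolding inner_dilate_shift[OF f g] by (simp add: algebra_simps)
  with * show ?thesis by (simp only:)
qed

end

lemma sum_le_card_mult:
  fixes g :: "'a \<Rightarrow> real"
  assumes S: "finite S" and z: "\<And>k. k \<in> L \<Longrightarrow> k \<notin> S \<Longrightarrow> g k = 0" and b: "\<And>k. g k \<le> b" "0 \<le> b" and L: "finite L"
  shows "(\<Sum>k\<in>L. g k) \<le> real (card S) * b"
proof -
  have "(\<Sum>k\<in>L. g k) = (\<Sum>k\<in>L \<inter> S. g k)" by (rule sum.mono_neutral_right) (use z L in auto)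
  also have "\<dots> \<le> real (card (L \<inter> S)) * b" using b(1) by (intro sum_bounded_above)
  also have "\<dots> \<le> real (card S) * b" using S b(2) by (intro mult_right_mono) (auto intro: card_mono)
  finally show ?thesis .
qed

lemma sum_geometric_dist:
  assumes r: "0 < r" "r < (1::real)" and F: "finite F"
  shows "(\<Sum>i\<in>F. r ^ ((j - i) + (i - j))) \<le> 2 / (1 - r)"
proof -
  have geo: "(\<Sum>i\<in>G. r ^ h i) \<le> 1 / (1 - r)" if "finite G" "inj_on h G" for G :: "nat set" and h
  proof -
    have "(\<Sum>i\<in>G. r ^ h i) = (\<Sum>n\<in>h ` G. r ^ n)" using that by (simp add: sum.reindex)
    also have "\<dots> \<le> (\<Sum>n. r ^ n)" using r that by (intro sum_le_suminf summable_geometric) auto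
    finally show ?thesis using r by (simp add: suminf_geometric)
  qed
  have "F = {i\<in>F. i \<le> j} \<union> {i\<in>F. j < i}" by auto
  hence "(\<Sum>i\<in>F. r ^ ((j - i) + (i - j))) = (\<Sum>i\<in>{i\<in>F. i \<le> j}. r ^ ((j - i) + (i - j))) + (\<Sum>i\<in>{i\<in>F. j < i}. r ^ ((j - i) + (i - j)))"
    using F by (metis (no_types, lifting) sum.union_disjoint disjoint_iff finite_Un leD mem_Collect_eq)
  also have "\<dots> \<le> 1 / (1 - r) + 1 / (1 - r)"
    using F by (intro add_mono geo) (auto simp: inj_on_def)
  finally show ?thesis by simp
qed

context dilation_card
begin

text \<open>The test of Schur with the weights \<open>d\<^sub>M\<^sup>-\<^sup>j\<^sup>/\<^sup>2\<close>: between levels \<open>j\<close> and \<open>j + n\<close> the number of overlapping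
  elements grows by \<open>d\<^sub>M\<^sup>n\<close> in one direction only, which these weights balance.\<close>

lemma bessel_dilates:
  assumes f: "cc f" and K: "0 \<le> K" and r: "0 < r" "r < 1"
    and gram: "\<And>j n k k'. j \<in> J \<Longrightarrow> j + n \<in> J \<Longrightarrow> norm (L2_inner (ds f (j + n) k') (ds f j k)) \<le> K * r ^ n / sd ^ n"
  shows "\<exists>C. bessel (J \<times> UNIV) (\<lambda>(j, k). ds f j k) C"
proof -
  obtain R where R: "0 < R" "\<And>x. f x \<noteq> 0 \<Longrightarrow> norm x \<le> R" using cc_supportD[OF f] by blast
  obtain C \<rho> where C: "0 < \<rho>" "\<rho> < 1" "0 < C" "\<And>n x. norm (bwdn n x) \<le> C * \<rho> ^ n * norm x" using decay by blast
  define R' where "R' = C * R + R"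
  obtain N where N: "\<And>x::real^'n. card {k. norm (rvec k - x) \<le> R'} \<le> N" using count_ball[of R'] by blast
  have bw: "norm (bwdn n x) \<le> C * norm x" for n x
  proof -
    have "C * \<rho> ^ n * norm x \<le> C * 1 * norm x" using C by (intro mult_right_mono mult_left_mono power_le_one) auto
    thus ?thesis using C(4)[of n x] by simp
  qed
  have disj: "L2_inner (ds f (j + n) k') (ds f j k) = 0"
    if "\<not> norm (bwdn n (rvec k') - rvec k) \<le> R'" for j n k k'
  proof -
    have "f (fwdn n y - rvec k') * cnj (f (y - rvec k)) = 0" for y
    proof (rule ccontr)
      assume "f (fwdn n y - rvec k') * cnj (f (y - rvec k)) \<noteq> 0"
      hence y: "norm (fwdn n y - rvec k') \<le> R" "norm (y - rvec k) \<le> R" using R(2) by auto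
      have "norm (bwdn n (fwdn n y - rvec k')) \<le> C * R" using bw[of n "fwdn n y - rvec k'"] mult_left_mono[OF y(1), of C] C(3) by linarith
      hence "norm (y - bwdn n (rvec k')) \<le> C * R" by (simp add: bwdn_diff)
      hence "norm ((y - rvec k) - (y - bwdn n (rvec k'))) \<le> R + C * R" using y(2) norm_triangle_ineq4[of "y - rvec k" "y - bwdn n (rvec k')"] by linarith
      thus False using that by (simp add: R'_def)
    qed
    thus ?thesis unfolding inner_dilate_shift[OF f f] by (simp only: Bochner_Integration.integral_zero mult_zero_right)
  qed
  have level: "(\<Sum>k'\<in>L. norm (L2_inner (ds f j k) (ds f j' k')) * (1 / sd ^ j')) \<le> N * K * r ^ ((j - j') + (j' - j)) * (1 / sd ^ j)"
    if j: "j \<in> J" "j' \<in> J" and L: "finite L" for j j' k L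
  proof (cases "j \<le> j'")
    case True
    define n where "n = j' - j"
    have jn: "j' = j + n" using True by (simp add: n_def)
    let ?S = "{k'. norm (bwdn n (rvec k') - rvec k) \<le> R'}"
    have sym: "norm (L2_inner (ds f j k) (ds f j' k')) = norm (L2_inner (ds f (j + n) k') (ds f j k))" for k'
      unfolding jn by (subst L2_inner_commute) simp
    have S: "finite ?S" "card ?S \<le> N * d_M M ^ n" using count_bwdn[OF N] by blast+
    have "(\<Sum>k'\<in>L. norm (L2_inner (ds f j k) (ds f j' k')) * (1 / sd ^ j')) \<le> real (card ?S) * (K * r ^ n / sd ^ n * (1 / sd ^ (j + n)))"
    proof (rule sum_le_card_mult[OF S(1) _ _ _ L])
      fix k'
      show "norm (L2_inner (ds f j k) (ds f j' k')) * (1 / sd ^ j') \<le> K * r ^ n / sd ^ n * (1 / sd ^ (j + n))"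
        unfolding sym unfolding jn by (rule mult_right_mono[OF gram]) (use j jn sd_pos in auto)
      assume "k' \<notin> ?S"
      thus "norm (L2_inner (ds f j k) (ds f j' k')) * (1 / sd ^ j') = 0"
        unfolding sym using disj[of n k' k j] by simp
    qed (use K r sd_pos in simp)
    also have "\<dots> \<le> real (N * d_M M ^ n) * (K * r ^ n / sd ^ n * (1 / sd ^ (j + n)))"
      using S(2) K r sd_pos by (intro mult_right_mono of_nat_mono) auto
    also have "\<dots> = N * K * r ^ n * (1 / sd ^ j)" using sd_pos by (simp add: power_add field_simps flip: sd_power_sq)
    finally show ?thesis by (simp add: jn)
  next
    case False
    define n where "n = j - j'"
    have jn: "j = j' + n" using False by (simp add: n_def)
    let ?S = "{k'. norm (rvec k' - bwdn n (rvec k)) \<le> R'}"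
    have "(\<Sum>k'\<in>L. norm (L2_inner (ds f j k) (ds f j' k')) * (1 / sd ^ j')) \<le> real (card ?S) * (K * r ^ n / sd ^ n * (1 / sd ^ j'))"
    proof (rule sum_le_card_mult[OF finite_int_ball _ _ _ L])
      fix k'
      show "norm (L2_inner (ds f j k) (ds f j' k')) * (1 / sd ^ j') \<le> K * r ^ n / sd ^ n * (1 / sd ^ j')"
        unfolding jn by (rule mult_right_mono[OF gram]) (use j jn sd_pos in auto)
      assume "k' \<notin> ?S"
      thus "norm (L2_inner (ds f j k) (ds f j' k')) * (1 / sd ^ j') = 0"
        unfolding jn using disj[of n k k' j'] by (simp add: norm_minus_commute)
    qed (use K r sd_pos in simp)
    also have "\<dots> \<le> real N * (K * r ^ n / sd ^ n * (1 / sd ^ j'))"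
      using N K r sd_pos by (intro mult_right_mono of_nat_mono) auto
    also have "\<dots> = N * K * r ^ n * (1 / sd ^ j)" using sd_pos by (simp add: jn power_add field_simps)
    finally show ?thesis by (simp add: jn)
  qed
  have "bessel (J \<times> UNIV) (\<lambda>(j, k). ds f j k) (N * K * (2 / (1 - r)))"
  proof (rule bessel_schur[where w = "\<lambda>(j, k). 1 / sd ^ j"])
    show "0 \<le> N * K * (2 / (1 - r))" using K r by simp
    show "(case i of (j, k) \<Rightarrow> ds f j k) \<in> L2" for i
      by (simp add: case_prod_beta cc_L2 cc_dilate_shift f)
    show "0 < (case i of (j, k) \<Rightarrow> 1 / sd ^ j)" for i :: "nat \<times> (int^'n)" using sd_pos by (simp add: case_prod_beta)
    fix I :: "(nat \<times> (int^'n)) set" and i assume I: "finite I" "I \<subseteq> J \<times> UNIV" and i: "i \<in> J \<times> (UNIV :: (int^'n) set)"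
    obtain j k where jk: "i = (j, k)" "j \<in> J" using i by auto
    let ?g = "\<lambda>j' k'. norm (L2_inner (ds f j k) (ds f j' k')) * (1 / sd ^ j')"
    have "(\<Sum>i'\<in>I. norm (L2_inner (case i of (j, k) \<Rightarrow> ds f j k) (case i' of (j, k) \<Rightarrow> ds f j k)) * (case i' of (j, k) \<Rightarrow> 1 / sd ^ j))
        = (\<Sum>(j', k')\<in>I. ?g j' k')" unfolding jk by (intro sum.cong refl) (simp add: case_prod_beta)
    also have "\<dots> \<le> (\<Sum>(j', k')\<in>fst ` I \<times> snd ` I. ?g j' k')"
    proof (rule sum_mono2)
      show "I \<subseteq> fst ` I \<times> snd ` I" by force
      fix b show "0 \<le> (case b of (j', k') \<Rightarrow> ?g j' k')" unfolding case_prod_beta using sd_pos by (intro mult_nonneg_nonneg) auto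
    qed (use I in auto)
    also have "\<dots> = (\<Sum>j'\<in>fst ` I. \<Sum>k'\<in>snd ` I. ?g j' k')" by (rule sum.cartesian_product[symmetric])
    also have "\<dots> \<le> (\<Sum>j'\<in>fst ` I. N * K * r ^ ((j - j') + (j' - j)) * (1 / sd ^ j))"
      using I jk by (intro sum_mono level) auto
    also have "\<dots> = N * K * (1 / sd ^ j) * (\<Sum>j'\<in>fst ` I. r ^ ((j - j') + (j' - j)))" by (simp add: sum_distrib_left mult_ac)
    also have "\<dots> \<le> N * K * (1 / sd ^ j) * (2 / (1 - r))"
      using K sd_pos I by (intro mult_left_mono sum_geometric_dist r) auto
    also have "\<dots> = N * K * (2 / (1 - r)) * (case i of (j, k) \<Rightarrow> 1 / sd ^ j)" by (simp add: jk)
    finally show "(\<Sum>i'\<in>I. norm (L2_inner (case i of (j, k) \<Rightarrow> ds f j k) (case i' of (j, k) \<Rightarrow> ds f j k)) * (case i' of (j, k) \<Rightarrow> 1 / sd ^ j))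
        \<le> N * K * (2 / (1 - r)) * (case i of (j, k) \<Rightarrow> 1 / sd ^ j)" .
  qed
  thus ?thesis by blast
qed

lemma bessel_shift:
  fixes f :: "'n cfun"
  assumes f: "cc f"
  shows "\<exists>C. bessel UNIV (shift f) C"
proof -
  obtain B where B: "0 < B" "\<And>x. norm (f x) \<le> B" using cc_bounded[OF f] by blast
  obtain R where R: "0 < R" "\<And>x. f x \<noteq> 0 \<Longrightarrow> norm x \<le> R" using cc_supportD[OF f] by blast
  have "\<exists>C. bessel ({0} \<times> UNIV) (\<lambda>(j, k). ds f j k) C"
  proof (rule bessel_dilates[OF f])
    show "0 \<le> B * (\<integral>x. norm (f x) \<partial>lborel)" using B(1) by simp
    show "0 < 1 / (2::real)" "1 / 2 < (1::real)" by auto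
    fix j n k k' assume "j \<in> {0}" "j + n \<in> {0::nat}"
    hence n: "n = 0" by simp
    have "norm (L2_inner (ds f (j + n) k') (ds f j k) - cnj 0 * (\<integral>x. f x \<partial>lborel) / complex_of_real (sd ^ n)) \<le> B * (\<integral>x. norm (f x) \<partial>lborel) / sd ^ n"
      by (rule gram_bound[OF f f R(2)]) (simp_all add: B(2))
    thus "norm (L2_inner (ds f (j + n) k') (ds f j k)) \<le> B * (\<integral>x. norm (f x) \<partial>lborel) * (1 / 2) ^ n / sd ^ n"
      by (simp add: n)
  qed
  then obtain C where C: "bessel ({0} \<times> UNIV) (\<lambda>(j, k). ds f j k) C" by blast
  have "bessel UNIV (shift f) C"
    unfolding bessel_def
  proof (intro conjI allI impI ballI)
    show "0 \<le> C" using C by (simp add: bessel_def)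
    show "shift f k \<in> L2" for k unfolding shift_eq by (intro cc_L2 cc_dilate_shift f)
    fix I :: "(int^'n) set" and g :: "'n cfun" assume I: "finite I" "I \<subseteq> UNIV" and g: "g \<in> L2"
    have "(\<Sum>k\<in>I. (norm (L2_inner g (shift f k)))\<^sup>2) = (\<Sum>i\<in>Pair 0 ` I. (norm (L2_inner g (case i of (j, k) \<Rightarrow> ds f j k)))\<^sup>2)"
      by (subst sum.reindex) (auto simp: inj_on_def shift_eq)
    also have "\<dots> \<le> C * (L2_norm g)\<^sup>2" using I by (intro besselD[OF C] g) auto
    finally show "(\<Sum>k\<in>I. (norm (L2_inner g (shift f k)))\<^sup>2) \<le> C * (L2_norm g)\<^sup>2" .
  qed
  thus ?thesis by blast
qed

lemma bessel_wavelet: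
  assumes f: "cc f" and z: "(\<integral>x. f x \<partial>lborel) = 0" and r: "0 < r" "r < 1"
    and mod: "\<And>R. \<exists>C\<ge>0. \<forall>n x y. norm (fwdn n (x - y)) \<le> R \<longrightarrow> norm (f x - f y) \<le> C * r ^ n"
  shows "\<exists>C. bessel UNIV (\<lambda>(j, k). ds f j k) C"
proof -
  obtain R where R: "0 < R" "\<And>x. f x \<noteq> 0 \<Longrightarrow> norm x \<le> R" using cc_supportD[OF f] by blast
  obtain C where C: "0 \<le> C" "\<And>n x y. norm (fwdn n (x - y)) \<le> R \<Longrightarrow> norm (f x - f y) \<le> C * r ^ n" using mod[of R] by blast
  have "\<exists>C. bessel (UNIV \<times> UNIV) (\<lambda>(j, k). ds f j k) C"
  proof (rule bessel_dilates[OF f _ r])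
    show "0 \<le> C * (\<integral>x. norm (f x) \<partial>lborel)" using C(1) by simp
    fix j n k k'
    let ?c = "f (bwdn n (rvec k') - rvec k)"
    have "norm (L2_inner (ds f (j + n) k') (ds f j k) - cnj ?c * (\<integral>x. f x \<partial>lborel) / complex_of_real (sd ^ n)) \<le> C * r ^ n * (\<integral>x. norm (f x) \<partial>lborel) / sd ^ n"
    proof (rule gram_bound[OF f f R(2)])
      fix y assume "norm (fwdn n y - rvec k') \<le> R"
      thus "norm (f (y - rvec k) - ?c) \<le> C * r ^ n"
        by (intro C(2)) (simp add: fwdn_diff)
    qed
    thus "norm (L2_inner (ds f (j + n) k') (ds f j k)) \<le> C * (\<integral>x. norm (f x) \<partial>lborel) * r ^ n / sd ^ n"
      by (simp add: mult_ac z)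
  qed
  thus ?thesis by simp
qed

lemma modulus_wav:
  assumes mod: "\<And>R. \<exists>C\<ge>0. \<forall>n x y. norm (fwdn n (x - y)) \<le> R \<longrightarrow> norm (\<phi> x - \<phi> y) \<le> C * r ^ n"
  shows "\<exists>C\<ge>0. \<forall>n x y. norm (fwdn n (x - y)) \<le> R \<longrightarrow> norm (wav \<phi> b x - wav \<phi> b y) \<le> C * r ^ n"
proof -
  obtain B where B: "B > 0" "\<And>x. norm (fwd x) \<le> B * norm x" using fwd_bound by blast
  obtain C where C: "0 \<le> C" "\<And>n x y. norm (fwdn n (x - y)) \<le> B * R \<Longrightarrow> norm (\<phi> x - \<phi> y) \<le> C * r ^ n" using mod[of "B * R"] by blast
  define S where "S = (\<Sum>k | b k \<noteq> 0. norm (b k))"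
  have "norm (wav \<phi> b x - wav \<phi> b y) \<le> real (d_M M) * S * C * r ^ n" if xy: "norm (fwdn n (x - y)) \<le> R" for n x y
  proof -
    have "norm (fwdn n (fwd x - fwd y)) = norm (fwd (fwdn n (x - y)))"
      by (simp add: matrix_vector_mult_diff_distrib[symmetric] funpow_swap1)
    also have "\<dots> \<le> B * R" using B(2)[of "fwdn n (x - y)"] mult_left_mono[OF xy, of B] B(1) by linarith
    finally have 1: "norm (fwdn n (fwd x - fwd y)) \<le> B * R" .
    have "norm (wav \<phi> b x - wav \<phi> b y) = real (d_M M) * norm (pair b (\<lambda>k. \<phi> (fwd x - rvec k) - \<phi> (fwd y - rvec k)))"
      by (simp add: wav_def pair_diff_right norm_mult flip: right_diff_distrib)
    also have "norm (pair b (\<lambda>k. \<phi> (fwd x - rvec k) - \<phi> (fwd y - rvec k))) \<le> (\<Sum>k | b k \<noteq> 0. norm (b k) * (C * r ^ n))"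
      unfolding pair_def
    proof (intro sum_norm_le)
      fix k
      have "norm (\<phi> (fwd x - rvec k) - \<phi> (fwd y - rvec k)) \<le> C * r ^ n" by (rule C(2)) (simp add: 1)
      thus "norm (b k * (\<phi> (fwd x - rvec k) - \<phi> (fwd y - rvec k))) \<le> norm (b k) * (C * r ^ n)"
        unfolding norm_mult by (intro mult_left_mono) auto
    qed
    also have "(\<Sum>k | b k \<noteq> 0. norm (b k) * (C * r ^ n)) = S * (C * r ^ n)" by (simp add: S_def sum_distrib_right)
    finally show ?thesis by (simp add: mult.assoc mult_left_mono)
  qed
  moreover have "0 \<le> real (d_M M) * S * C" using C(1) by (auto simp: S_def intro!: mult_nonneg_nonneg sum_nonneg)
  ultimately show ?thesis by blast
qed

end

section \<open>Dual frame expansions\<close>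

lemma besselL2: "bessel J e C \<Longrightarrow> i \<in> J \<Longrightarrow> e i \<in> L2"
  by (simp add: bessel_def)

lemma bessel_Un:
  fixes e :: "'i \<Rightarrow> 'n::finite cfun"
  assumes b: "bessel J e C" and b': "bessel J' e C'"
  shows "bessel (J \<union> J') e (C + C')"
  unfolding bessel_def
proof (intro conjI ballI allI impI)
  show "0 \<le> C + C'" using b b' by (simp add: bessel_def)
  show "e i \<in> L2" if "i \<in> J \<union> J'" for i using b b' that by (auto simp: bessel_def)
  fix I and f :: "'n cfun" assume I: "finite I" "I \<subseteq> J \<union> J'" and f: "f \<in> L2"
  have "(\<Sum>i\<in>I. (norm (L2_inner f (e i)))\<^sup>2) = (\<Sum>i\<in>I \<inter> J. (norm (L2_inner f (e i)))\<^sup>2) + (\<Sum>i\<in>I - J. (norm (L2_inner f (e i)))\<^sup>2)"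
    by (rule sum.Int_Diff[OF I(1)])
  also have "\<dots> \<le> C * (L2_norm f)\<^sup>2 + C' * (L2_norm f)\<^sup>2"
    using I by (intro add_mono besselD[OF b] besselD[OF b'] f) auto
  finally show "(\<Sum>i\<in>I. (norm (L2_inner f (e i)))\<^sup>2) \<le> (C + C') * (L2_norm f)\<^sup>2" by (simp add: distrib_right)
qed

lemma bessel_image:
  fixes e :: "'i \<Rightarrow> 'n::finite cfun"
  assumes b: "bessel J (\<lambda>i. e (h i)) C"
  shows "bessel (h ` J) e C"
  unfolding bessel_def
proof (intro conjI ballI allI impI)
  show "0 \<le> C" using b by (simp add: bessel_def)
  show "e i \<in> L2" if "i \<in> h ` J" for i using b that by (auto simp: bessel_def)
  fix I and f :: "'n cfun" assume I: "finite I" "I \<subseteq> h ` J" and f: "f \<in> L2"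
  obtain U where U: "U \<subseteq> J" "inj_on h U" "I = h ` U" using I(2) subset_image_inj[of I h J] by blast
  have "finite U" using I(1) U by (simp add: finite_image_iff)
  have "(\<Sum>i\<in>I. (norm (L2_inner f (e i)))\<^sup>2) = (\<Sum>i\<in>U. (norm (L2_inner f (e (h i))))\<^sup>2)"
    unfolding U(3) by (simp add: sum.reindex[OF U(2)])
  also have "\<dots> \<le> C * (L2_norm f)\<^sup>2" by (rule besselD[OF b \<open>finite U\<close> U(1) f])
  finally show "(\<Sum>i\<in>I. (norm (L2_inner f (e i)))\<^sup>2) \<le> C * (L2_norm f)\<^sup>2" .
qed

lemma bessel_UN:
  assumes "finite L" "\<And>l. l \<in> L \<Longrightarrow> \<exists>C. bessel (J l) e C"
  shows "\<exists>C. bessel (\<Union>l\<in>L. J l) e C"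
  using assms
proof (induction L rule: finite_induct)
  case empty
  have "bessel {} e 0" by (simp add: bessel_def)
  thus ?case by auto
next
  case (insert l L)
  have "\<exists>C. bessel (J l) e C" "\<exists>C. bessel (\<Union>l\<in>L. J l) e C" using insert by auto
  then obtain C C' where "bessel (J l) e C" "bessel (\<Union>l\<in>L. J l) e C'" by blast
  from bessel_Un[OF this] show ?case by (metis UN_insert)
qed

lemma bessel_summable:
  assumes b: "bessel J e C" and f: "f \<in> L2"
  shows "(\<lambda>i. (norm (L2_inner f (e i)))\<^sup>2) summable_on J" "(\<Sum>\<^sub>\<infinity>i\<in>J. (norm (L2_inner f (e i)))\<^sup>2) \<le> C * (L2_norm f)\<^sup>2"
proof -
  show s: "(\<lambda>i. (norm (L2_inner f (e i)))\<^sup>2) summable_on J"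
    by (rule nonneg_bdd_above_summable_on) (auto intro!: bdd_aboveI2[where M = "C * (L2_norm f)\<^sup>2"] besselD[OF b _ _ f])
  show "(\<Sum>\<^sub>\<infinity>i\<in>J. (norm (L2_inner f (e i)))\<^sup>2) \<le> C * (L2_norm f)\<^sup>2"
    by (rule infsum_le_finite_sums[OF s]) (rule besselD[OF b _ _ f])
qed

text \<open>The remainder \<open>h\<close> of a partial sum is again continuous with compact support, so the weak identity may be
  tested against \<open>h\<close> itself; this bounds its norm by a tail of the coefficients.\<close>

lemma dual_expansion_cc:
  fixes e e' :: "'i \<Rightarrow> 'n::finite cfun"
  assumes b: "bessel J e C" and b': "bessel J e' C'" and cc: "\<And>i. i \<in> J \<Longrightarrow> cc (e' i)"
    and weak: "\<And>f g \<epsilon> I. cc f \<Longrightarrow> cc g \<Longrightarrow> 0 < \<epsilon> \<Longrightarrow> finite I \<Longrightarrow> I \<subseteq> J \<Longrightarrow>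
      \<exists>I'. finite I' \<and> I \<subseteq> I' \<and> I' \<subseteq> J \<and> norm (L2_inner f g - (\<Sum>i\<in>I'. L2_inner f (e i) * L2_inner (e' i) g)) < \<epsilon>"
    and f: "cc f" and \<epsilon>: "0 < \<epsilon>"
  shows "\<exists>I0. finite I0 \<and> I0 \<subseteq> J \<and> (\<forall>I. finite I \<longrightarrow> I0 \<subseteq> I \<longrightarrow> I \<subseteq> J \<longrightarrow> L2_norm (\<lambda>x. f x - (\<Sum>i\<in>I. L2_inner f (e i) * e' i x)) \<le> \<epsilon>)"
proof -
  define p where "p i = (norm (L2_inner f (e i)))\<^sup>2" for i
  have fL: "f \<in> L2" by (rule cc_L2[OF f])
  have C': "0 \<le> C'" using b' by (simp add: bessel_def)
  define \<delta> where "\<delta> = \<epsilon>\<^sup>2 / (C' + 1)"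
  have \<delta>: "0 < \<delta>" "\<delta> * C' \<le> \<epsilon>\<^sup>2" using \<epsilon> C' by (simp_all add: \<delta>_def field_simps)
  have p: "p summable_on J" unfolding p_def[abs_def] by (rule bessel_summable(1)[OF b fL])
  obtain I0 where I0: "finite I0" "I0 \<subseteq> J" "dist (sum p I0) (infsum p J) \<le> \<delta>"
    using infsum_finite_approximation[OF p \<delta>(1)] by blast
  have "L2_norm (\<lambda>x. f x - (\<Sum>i\<in>I. L2_inner f (e i) * e' i x)) \<le> \<epsilon>" if I: "finite I" "I0 \<subseteq> I" "I \<subseteq> J" for I
  proof -
    define h where "h x = f x - (\<Sum>i\<in>I. L2_inner f (e i) * e' i x)" for x
    define X where "X = L2_norm h"
    have X0: "0 \<le> X" unfolding X_def by (rule L2_norm_nonneg)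
    have hc: "cc h" unfolding h_def[abs_def] by (intro cc_diff f cc_sum cc_scale cc) (use I in auto)
    have hL: "h \<in> L2" by (rule cc_L2[OF hc])
    have e': "e' i \<in> L2" if "i \<in> J" for i by (rule cc_L2[OF cc[OF that]])
    have inner: "L2_inner h h = L2_inner f h - (\<Sum>i\<in>I. L2_inner f (e i) * L2_inner (e' i) h)"
    proof -
      have "L2_inner h h = L2_inner f h - L2_inner (\<lambda>x. \<Sum>i\<in>I. L2_inner f (e i) * e' i x) h"
        by (subst (1) h_def[abs_def], rule L2_inner_diff_left[OF fL _ hL], intro L2_sum L2_scale e') (use I in auto)
      also have "L2_inner (\<lambda>x. \<Sum>i\<in>I. L2_inner f (e i) * e' i x) h = (\<Sum>i\<in>I. L2_inner f (e i) * L2_inner (e' i) h)"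
        using I by (subst L2_inner_sum_left) (auto simp: L2_inner_scale_left intro!: L2_scale e' hL)
      finally show ?thesis .
    qed
    have "X\<^sup>2 \<le> sqrt \<delta> * sqrt (C' * X\<^sup>2) + r" if r: "0 < r" for r
    proof -
      obtain I' where I': "finite I'" "I \<subseteq> I'" "I' \<subseteq> J"
        "norm (L2_inner f h - (\<Sum>i\<in>I'. L2_inner f (e i) * L2_inner (e' i) h)) < r"
        using weak[OF f hc r I(1,3)] by blast
      have "(\<Sum>i\<in>I' - I. p i) = sum p I' - sum p I" by (rule sum_diff[OF I'(1,2)])
      also have "\<dots> \<le> infsum p J - sum p I0"
        by (intro diff_mono finite_sum_le_infsum sum_mono2 p I' I) (auto simp: p_def)
      also have "\<dots> \<le> \<delta>" using I0(3) by (simp add: dist_real_def)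
      finally have tail: "(\<Sum>i\<in>I' - I. p i) \<le> \<delta>" .
      have "(\<Sum>i\<in>I' - I. (norm (L2_inner (e' i) h))\<^sup>2) = (\<Sum>i\<in>I' - I. (norm (L2_inner h (e' i)))\<^sup>2)"
        by (intro sum.cong refl) (simp add: L2_inner_commute[of _ h])
      also have "\<dots> \<le> C' * X\<^sup>2" unfolding X_def using I' by (intro besselD[OF b' _ _ hL]) auto
      finally have tail': "(\<Sum>i\<in>I' - I. (norm (L2_inner (e' i) h))\<^sup>2) \<le> C' * X\<^sup>2" .
      have "norm (\<Sum>i\<in>I' - I. L2_inner f (e i) * L2_inner (e' i) h) \<le> sqrt (\<Sum>i\<in>I' - I. p i) * sqrt (\<Sum>i\<in>I' - I. (norm (L2_inner (e' i) h))\<^sup>2)"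
        unfolding p_def by (rule norm_sum_prod_le)
      also have "\<dots> \<le> sqrt \<delta> * sqrt (C' * X\<^sup>2)"
        using tail tail' \<delta>(1) by (intro mult_mono real_sqrt_le_mono) (auto intro: sum_nonneg)
      finally have 1: "norm (\<Sum>i\<in>I' - I. L2_inner f (e i) * L2_inner (e' i) h) \<le> sqrt \<delta> * sqrt (C' * X\<^sup>2)" .
      have "L2_inner h h = (L2_inner f h - (\<Sum>i\<in>I'. L2_inner f (e i) * L2_inner (e' i) h)) + (\<Sum>i\<in>I' - I. L2_inner f (e i) * L2_inner (e' i) h)"
        unfolding inner by (simp add: sum_diff[OF I'(1,2)])
      hence "norm (L2_inner h h) \<le> r + sqrt \<delta> * sqrt (C' * X\<^sup>2)"
        using norm_triangle_mono[OF less_imp_le[OF I'(4)] 1] by simp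
      thus ?thesis unfolding L2_inner_self X_def[symmetric] norm_of_real by (simp del: of_real_power)
    qed
    hence "X\<^sup>2 \<le> sqrt \<delta> * sqrt (C' * X\<^sup>2)" by (rule field_le_epsilon)
    also have "\<dots> = sqrt (\<delta> * C') * X" using X0 by (simp add: real_sqrt_mult)
    also have "\<dots> \<le> \<epsilon> * X"
      using \<delta>(2) \<epsilon> X0 by (intro mult_right_mono real_le_lsqrt) (auto simp: \<delta>_def C')
    finally have "X * X \<le> \<epsilon> * X" by (simp add: power2_eq_square)
    thus ?thesis unfolding h_def[abs_def, symmetric] X_def[symmetric] using X0 \<epsilon>
      by (cases "X = 0") (auto simp: mult_le_cancel_right)
  qed
  thus ?thesis using I0 by blast
qed

lemma dual_expansion:
  fixes e e' :: "'i \<Rightarrow> 'n::finite cfun"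
  assumes b: "bessel J e C" and b': "bessel J e' C'"
    and expand: "\<And>f \<epsilon>. cc f \<Longrightarrow> 0 < \<epsilon> \<Longrightarrow> \<exists>I0. finite I0 \<and> I0 \<subseteq> J \<and>
      (\<forall>I. finite I \<longrightarrow> I0 \<subseteq> I \<longrightarrow> I \<subseteq> J \<longrightarrow> L2_norm (\<lambda>x. f x - (\<Sum>i\<in>I. L2_inner f (e i) * e' i x)) \<le> \<epsilon>)"
    and f: "f \<in> L2"
  shows "((\<lambda>I. L2_norm (\<lambda>x. f x - (\<Sum>i\<in>I. L2_inner f (e i) * e' i x))) \<longlongrightarrow> 0) (finite_subsets_at_top J)"
proof (rule tendstoI)
  fix \<epsilon> :: real assume \<epsilon>: "0 < \<epsilon>"
  have C: "0 \<le> C" "0 \<le> C'" using b b' by (simp_all add: bessel_def)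
  define \<eta> where "\<eta> = \<epsilon> / (2 * (1 + sqrt (C * C')))"
  have pos: "0 < 1 + sqrt (C * C')" using C by (simp add: add_pos_nonneg)
  have \<eta>: "0 < \<eta>" using \<epsilon> pos by (simp add: \<eta>_def)
  obtain g where g: "cc g" "L2_norm (\<lambda>x. f x - g x) < \<eta>" using L2_dense[OF f \<eta>] by blast
  have gL: "g \<in> L2" by (rule cc_L2[OF g(1)])
  obtain I0 where I0: "finite I0" "I0 \<subseteq> J"
    "\<And>I. finite I \<Longrightarrow> I0 \<subseteq> I \<Longrightarrow> I \<subseteq> J \<Longrightarrow> L2_norm (\<lambda>x. g x - (\<Sum>i\<in>I. L2_inner g (e i) * e' i x)) \<le> \<epsilon> / 4"
    using expand[OF g(1), of "\<epsilon> / 4"] \<epsilon> by auto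
  have "L2_norm (\<lambda>x. f x - (\<Sum>i\<in>I. L2_inner f (e i) * e' i x)) < \<epsilon>" if I: "finite I" "I0 \<subseteq> I" "I \<subseteq> J" for I
  proof -
    define u where "u x = f x - g x" for x
    have uL: "u \<in> L2" unfolding u_def[abs_def] by (rule L2_diff[OF f gL])
    have eL: "e i \<in> L2" "e' i \<in> L2" if "i \<in> I" for i using besselL2[OF b, of i] besselL2[OF b', of i] that I(3) by blast+
    have "L2_inner u (e i) = L2_inner f (e i) - L2_inner g (e i)" if "i \<in> I" for i
      unfolding u_def[abs_def] by (rule L2_inner_diff_left[OF f gL eL(1)[OF that]])
    hence "(\<Sum>i\<in>I. L2_inner u (e i) * e' i x) = (\<Sum>i\<in>I. L2_inner f (e i) * e' i x) - (\<Sum>i\<in>I. L2_inner g (e i) * e' i x)" for x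
      by (simp add: left_diff_distrib sum_subtractf)
    hence split: "(\<lambda>x. f x - (\<Sum>i\<in>I. L2_inner f (e i) * e' i x))
        = (\<lambda>x. (u x - (\<Sum>i\<in>I. L2_inner u (e i) * e' i x)) + (g x - (\<Sum>i\<in>I. L2_inner g (e i) * e' i x)))"
      by (simp add: u_def fun_eq_iff)
    have SL: "(\<lambda>x. \<Sum>i\<in>I. c i * e' i x) \<in> L2" for c by (intro L2_sum L2_scale eL)
    have "(L2_norm (\<lambda>x. \<Sum>i\<in>I. L2_inner u (e i) * e' i x))\<^sup>2 \<le> C' * (\<Sum>i\<in>I. (norm (L2_inner u (e i)))\<^sup>2)"
      by (rule bessel_synthesis[OF b' I(1,3)])
    also have "\<dots> \<le> C' * (C * (L2_norm u)\<^sup>2)" by (intro mult_left_mono besselD[OF b I(1,3) uL] C)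
    also have "\<dots> = (sqrt (C * C') * L2_norm u)\<^sup>2" using C by (simp add: power_mult_distrib)
    finally have Su: "L2_norm (\<lambda>x. \<Sum>i\<in>I. L2_inner u (e i) * e' i x) \<le> sqrt (C * C') * L2_norm u"
      by (rule power2_le_imp_le) (simp add: C L2_norm_nonneg)
    have "L2_norm (\<lambda>x. u x - (\<Sum>i\<in>I. L2_inner u (e i) * e' i x)) \<le> L2_norm u + L2_norm (\<lambda>x. \<Sum>i\<in>I. L2_inner u (e i) * e' i x)"
      using L2_norm_triangle_diff[OF uL L2_zero SL[of "\<lambda>i. L2_inner u (e i)"]] L2_norm_minus_commute[of "\<lambda>x. 0" "\<lambda>x. \<Sum>i\<in>I. L2_inner u (e i) * e' i x"] by simp
    also have "\<dots> \<le> (1 + sqrt (C * C')) * L2_norm u" using Su by (simp add: algebra_simps)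
    also have "\<dots> \<le> (1 + sqrt (C * C')) * \<eta>" using g(2) pos by (intro mult_left_mono) (auto simp: u_def[abs_def])
    also have "\<dots> = \<epsilon> / 2" unfolding \<eta>_def using less_imp_neq[OF pos] by (simp only: times_divide_eq_right mult_divide_mult_cancel_left mult.commute[of 2] nonzero_mult_divide_mult_cancel_left)
    finally have 1: "L2_norm (\<lambda>x. u x - (\<Sum>i\<in>I. L2_inner u (e i) * e' i x)) \<le> \<epsilon> / 2" .
    have "L2_norm (\<lambda>x. f x - (\<Sum>i\<in>I. L2_inner f (e i) * e' i x))
        \<le> L2_norm (\<lambda>x. u x - (\<Sum>i\<in>I. L2_inner u (e i) * e' i x)) + L2_norm (\<lambda>x. g x - (\<Sum>i\<in>I. L2_inner g (e i) * e' i x))"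
      unfolding split by (intro L2_norm_triangle L2_diff uL gL SL)
    also have "\<dots> \<le> \<epsilon> / 2 + \<epsilon> / 4" by (intro add_mono 1 I0(3) I)
    also have "\<dots> < \<epsilon>" using \<epsilon> by simp
    finally show ?thesis .
  qed
  thus "eventually (\<lambda>I. dist (L2_norm (\<lambda>x. f x - (\<Sum>i\<in>I. L2_inner f (e i) * e' i x))) 0 < \<epsilon>) (finite_subsets_at_top J)"
    unfolding eventually_finite_subsets_at_top dist_real_def using I0(1,2)
    by (intro exI[of _ I0]) (simp add: abs_of_nonneg[OF L2_norm_nonneg])
qed

lemma norm_le_analysis:
  fixes e e' :: "'i \<Rightarrow> 'n::finite cfun"
  assumes e: "\<And>i. i \<in> J \<Longrightarrow> e' i \<in> L2" and f: "f \<in> L2"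
    and lim: "((\<lambda>I. L2_norm (\<lambda>x. f x - (\<Sum>i\<in>I. L2_inner f (e i) * e' i x))) \<longlongrightarrow> 0) (finite_subsets_at_top J)"
    and P: "\<And>I. finite I \<Longrightarrow> I \<subseteq> J \<Longrightarrow> (\<Sum>i\<in>I. (norm (L2_inner f (e i)))\<^sup>2) \<le> P"
    and P': "\<And>I. finite I \<Longrightarrow> I \<subseteq> J \<Longrightarrow> (\<Sum>i\<in>I. (norm (L2_inner f (e' i)))\<^sup>2) \<le> P'"
  shows "(L2_norm f)\<^sup>2 \<le> sqrt P * sqrt P'"
proof (rule field_le_epsilon)
  fix r :: real assume r: "0 < r"
  define \<epsilon> where "\<epsilon> = r / (L2_norm f + 1)"
  have n: "0 < L2_norm f + 1" using L2_norm_nonneg[of f] by linarith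
  have \<epsilon>: "0 < \<epsilon>" "\<epsilon> * L2_norm f \<le> r" using r n L2_norm_nonneg[of f] by (simp_all add: \<epsilon>_def field_simps)
  have "eventually (\<lambda>I. L2_norm (\<lambda>x. f x - (\<Sum>i\<in>I. L2_inner f (e i) * e' i x)) < \<epsilon>) (finite_subsets_at_top J)"
    by (rule order_tendstoD(2)[OF lim \<epsilon>(1)])
  then obtain I where I: "finite I" "I \<subseteq> J" "L2_norm (\<lambda>x. f x - (\<Sum>i\<in>I. L2_inner f (e i) * e' i x)) < \<epsilon>"
    unfolding eventually_finite_subsets_at_top by blast
  define S where "S x = (\<Sum>i\<in>I. L2_inner f (e i) * e' i x)" for x
  have eI: "e' i \<in> L2" if "i \<in> I" for i using e I that by auto
  have SL: "S \<in> L2" unfolding S_def[abs_def] by (intro L2_sum L2_scale eI)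
  have "L2_inner f f = L2_inner (\<lambda>x. f x - S x) f + L2_inner S f"
    by (simp add: L2_inner_diff_left f SL)
  also have "L2_inner S f = (\<Sum>i\<in>I. L2_inner f (e i) * L2_inner (e' i) f)"
    unfolding S_def[abs_def] by (subst L2_inner_sum_left) (auto simp: L2_inner_scale_left intro!: L2_scale eI f)
  finally have "(L2_norm f)\<^sup>2 = norm (L2_inner (\<lambda>x. f x - S x) f + (\<Sum>i\<in>I. L2_inner f (e i) * L2_inner (e' i) f))"
    unfolding L2_inner_self by (metis norm_of_real abs_power2)
  also have "\<dots> \<le> \<epsilon> * L2_norm f + sqrt P * sqrt P'"
  proof (rule norm_triangle_mono)
    have "norm (L2_inner (\<lambda>x. f x - S x) f) \<le> L2_norm (\<lambda>x. f x - S x) * L2_norm f"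
      by (rule L2_Cauchy_Schwarz[OF L2_diff[OF f SL] f])
    also have "\<dots> \<le> \<epsilon> * L2_norm f" using I(3) by (intro mult_right_mono L2_norm_nonneg) (simp add: S_def)
    finally show "norm (L2_inner (\<lambda>x. f x - S x) f) \<le> \<epsilon> * L2_norm f" .
    have "norm (\<Sum>i\<in>I. L2_inner f (e i) * L2_inner (e' i) f) \<le> sqrt (\<Sum>i\<in>I. (norm (L2_inner f (e i)))\<^sup>2) * sqrt (\<Sum>i\<in>I. (norm (L2_inner (e' i) f))\<^sup>2)"
      by (rule norm_sum_prod_le)
    also have "(\<Sum>i\<in>I. (norm (L2_inner (e' i) f))\<^sup>2) = (\<Sum>i\<in>I. (norm (L2_inner f (e' i)))\<^sup>2)"
      by (intro sum.cong refl) (simp add: L2_inner_commute[of _ f])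
    also have "sqrt (\<Sum>i\<in>I. (norm (L2_inner f (e i)))\<^sup>2) * sqrt (\<Sum>i\<in>I. (norm (L2_inner f (e' i)))\<^sup>2) \<le> sqrt P * sqrt P'"
      using P[of "{}"] by (intro mult_mono real_sqrt_le_mono P P' I) (auto intro: sum_nonneg)
    finally show "norm (\<Sum>i\<in>I. L2_inner f (e i) * L2_inner (e' i) f) \<le> sqrt P * sqrt P'" .
  qed
  also have "\<dots> \<le> sqrt P * sqrt P' + r" using \<epsilon>(2) by simp
  finally show "(L2_norm f)\<^sup>2 \<le> sqrt P * sqrt P' + r" .
qed

lemma sq_le_sqrt_imp:
  assumes "x\<^sup>2 \<le> sqrt P * sqrt (C * x\<^sup>2)" "0 \<le> P" "0 \<le> C" "0 \<le> x"
  shows "x\<^sup>2 \<le> C * P"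
proof (cases "x = 0")
  case False
  have "x * x \<le> sqrt (P * C) * x" using assms by (simp add: real_sqrt_mult power2_eq_square mult.assoc)
  hence "x \<le> sqrt (P * C)" using False assms(4) by (simp add: mult_le_cancel_right)
  hence "x\<^sup>2 \<le> (sqrt (P * C))\<^sup>2" using assms(4) by (rule power_mono)
  thus ?thesis using assms by (simp add: mult.commute)
qed (use assms in simp)

lemma infsum_ennreal_eq:
  assumes "p summable_on A" "\<And>i. i \<in> A \<Longrightarrow> 0 \<le> p i"
  shows "(\<Sum>\<^sub>\<infinity>i\<in>A. ennreal (p i)) = ennreal (infsum p A)"
proof (rule infsumI)
  have "(sum p \<longlongrightarrow> infsum p A) (finite_subsets_at_top A)" using has_sum_infsum[OF assms(1)] by (simp add: has_sum_def)
  hence "((\<lambda>F. ennreal (sum p F)) \<longlongrightarrow> ennreal (infsum p A)) (finite_subsets_at_top A)" by (rule tendsto_ennrealI)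
  moreover have "eventually (\<lambda>F. ennreal (sum p F) = (\<Sum>i\<in>F. ennreal (p i))) (finite_subsets_at_top A)"
    by (intro eventually_finite_subsets_at_top_weakI sum_ennreal[symmetric]) (use assms in auto)
  ultimately show "((\<lambda>i. ennreal (p i)) has_sum ennreal (infsum p A)) A"
    unfolding has_sum_def by (rule Lim_transform_eventually)
qed

abbreviation frame_index :: "nat \<Rightarrow> ('k + nat \<times> nat \<times> 'k) set" where
  "frame_index s \<equiv> UNIV <+> {..<s} \<times> UNIV \<times> UNIV"

lemma infsum_framelet_index:
  fixes p :: "(int^'n) + nat \<times> nat \<times> (int^'n) \<Rightarrow> real"
  assumes p: "p summable_on (frame_index s)" and p0: "\<And>i. 0 \<le> p i"
  shows "(\<Sum>\<^sub>\<infinity>k\<in>UNIV. ennreal (p (Inl k))) + (\<Sum>l<s. \<Sum>\<^sub>\<infinity>j\<in>UNIV. \<Sum>\<^sub>\<infinity>k\<in>UNIV. ennreal (p (Inr (l, j, k))))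
    = ennreal (infsum p (frame_index s))"
proof -
  let ?J = "frame_index s :: ((int^'n) + nat \<times> nat \<times> (int^'n)) set"
  have J: "?J = range Inl \<union> Inr ` ({..<s} \<times> UNIV \<times> UNIV)" by (auto simp: Plus_def)
  have sl: "p summable_on range Inl" and sr: "p summable_on Inr ` ({..<s} \<times> UNIV \<times> UNIV)"
    by (rule summable_on_subset_banach[OF p]; auto)+
  have sl': "(\<lambda>k. p (Inl k)) summable_on UNIV" using sl by (simp add: summable_on_reindex o_def)
  have sr': "(\<lambda>t. p (Inr t)) summable_on {..<s} \<times> (UNIV \<times> UNIV)" using sr by (simp add: summable_on_reindex o_def)
  have eta: "(\<lambda>(j, k). p (Inr (l, j, k))) = (\<lambda>t. p (Inr (l, t)))" for l by (auto simp: fun_eq_iff)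
  have eta': "(\<lambda>(l, t). p (Inr (l, t))) = (\<lambda>t. p (Inr t))" by (auto simp: fun_eq_iff)
  have sll: "(\<lambda>(j, k). p (Inr (l, j, k))) summable_on UNIV \<times> UNIV" if "l < s" for l
  proof -
    have "(\<lambda>t. p (Inr t)) summable_on Pair l ` (UNIV \<times> UNIV)" by (rule summable_on_subset_banach[OF sr']) (use that in auto)
    hence "(\<lambda>t. p (Inr (l, t))) summable_on UNIV" by (simp add: summable_on_reindex inj_on_def o_def)
    thus ?thesis by (simp add: eta)
  qed
  have lev: "(\<Sum>\<^sub>\<infinity>j\<in>UNIV. \<Sum>\<^sub>\<infinity>k\<in>UNIV. ennreal (p (Inr (l, j, k)))) = ennreal (\<Sum>\<^sub>\<infinity>t\<in>UNIV. p (Inr (l, t)))"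
    if l: "l < s" for l
  proof -
    have k: "(\<lambda>k. p (Inr (l, j, k))) summable_on UNIV" for j
    proof -
      have "(\<lambda>(j, k). p (Inr (l, j, k))) summable_on Pair j ` UNIV" by (rule summable_on_subset_banach[OF sll[OF l]]) auto
      thus ?thesis by (simp add: summable_on_reindex inj_on_def o_def)
    qed
    have j: "(\<lambda>j. \<Sum>\<^sub>\<infinity>k\<in>UNIV. p (Inr (l, j, k))) summable_on UNIV"
      using summable_on_Sigma_banach[OF sll[OF l]] by simp
    have "(\<Sum>\<^sub>\<infinity>j\<in>UNIV. \<Sum>\<^sub>\<infinity>k\<in>UNIV. ennreal (p (Inr (l, j, k)))) = (\<Sum>\<^sub>\<infinity>j\<in>UNIV. ennreal (\<Sum>\<^sub>\<infinity>k\<in>UNIV. p (Inr (l, j, k))))"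
      by (intro infsum_cong infsum_ennreal_eq k p0)
    also have "\<dots> = ennreal (\<Sum>\<^sub>\<infinity>j\<in>UNIV. \<Sum>\<^sub>\<infinity>k\<in>UNIV. p (Inr (l, j, k)))"
      by (intro infsum_ennreal_eq j infsum_nonneg p0)
    also have "(\<Sum>\<^sub>\<infinity>j\<in>UNIV. \<Sum>\<^sub>\<infinity>k\<in>UNIV. p (Inr (l, j, k))) = (\<Sum>\<^sub>\<infinity>t\<in>UNIV. p (Inr (l, t)))"
      using infsum_Sigma'_banach[OF sll[OF l]] by (simp add: eta)
    finally show ?thesis .
  qed
  have "infsum p ?J = infsum p (range Inl) + infsum p (Inr ` ({..<s} \<times> UNIV \<times> UNIV))"
    unfolding J by (intro infsum_Un_disjoint sl sr) auto
  also have "infsum p (range Inl) = (\<Sum>\<^sub>\<infinity>k\<in>UNIV. p (Inl k))" by (simp add: infsum_reindex o_def)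
  also have "infsum p (Inr ` ({..<s} \<times> UNIV \<times> UNIV)) = (\<Sum>\<^sub>\<infinity>t\<in>{..<s} \<times> UNIV. p (Inr t))" by (simp add: infsum_reindex o_def)
  also have "\<dots> = (\<Sum>l<s. \<Sum>\<^sub>\<infinity>t\<in>UNIV. p (Inr (l, t)))"
    using infsum_Sigma'_banach[of "\<lambda>l t. p (Inr (l, t))" "{..<s}" "\<lambda>_. UNIV"] sr' by (simp add: eta')
  finally have "ennreal (infsum p ?J) = ennreal (\<Sum>\<^sub>\<infinity>k\<in>UNIV. p (Inl k)) + (\<Sum>l<s. ennreal (\<Sum>\<^sub>\<infinity>t\<in>UNIV. p (Inr (l, t))))"
    by (simp add: ennreal_plus sum_nonneg infsum_nonneg p0)
  also have "\<dots> = (\<Sum>\<^sub>\<infinity>k\<in>UNIV. ennreal (p (Inl k))) + (\<Sum>l<s. \<Sum>\<^sub>\<infinity>j\<in>UNIV. \<Sum>\<^sub>\<infinity>k\<in>UNIV. ennreal (p (Inr (l, j, k))))"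
    using lev by (simp add: infsum_ennreal_eq[OF sl' p0])
  finally show ?thesis by simp
qed

lemma framelet_from_bessel:
  fixes \<phi> :: "'n::finite cfun"
  assumes L2: "\<phi> \<in> L2" "set \<psi>s \<subseteq> L2"
    and b: "bessel (frame_index (length \<psi>s)) (framelet_elem M \<phi> \<psi>s) C" and D: "0 \<le> D"
    and lower: "\<And>f. f \<in> L2 \<Longrightarrow> (L2_norm f)\<^sup>2 \<le> D * (\<Sum>\<^sub>\<infinity>i\<in>frame_index (length \<psi>s). (norm (L2_inner f (framelet_elem M \<phi> \<psi>s i)))\<^sup>2)"
  shows "framelet M \<phi> \<psi>s"
  unfolding framelet_def
proof (intro conjI L2 exI ballI)
  have C: "0 \<le> C" using b by (simp add: bessel_def)
  show "0 < 1 / (D + 1)" "0 < C + 1" using C D by auto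
  fix f :: "'n cfun" assume f: "f \<in> L2"
  define p where "p i = (norm (L2_inner f (framelet_elem M \<phi> \<psi>s i)))\<^sup>2" for i
  let ?J = "frame_index (length \<psi>s) :: ((int^'n) + nat \<times> nat \<times> (int^'n)) set"
  have s: "p summable_on ?J" unfolding p_def[abs_def] by (rule bessel_summable(1)[OF b f])
  have S: "(\<Sum>\<^sub>\<infinity>k\<in>UNIV. ennreal ((norm (L2_inner f (shift \<phi> k)))\<^sup>2))
      + (\<Sum>l<length \<psi>s. \<Sum>\<^sub>\<infinity>j\<in>UNIV. \<Sum>\<^sub>\<infinity>k\<in>UNIV. ennreal ((norm (L2_inner f (dilate_shift M (\<psi>s ! l) j k)))\<^sup>2)) = ennreal (infsum p ?J)"
    using infsum_framelet_index[OF s] by (simp add: p_def)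
  have i0: "0 \<le> infsum p ?J" by (intro infsum_nonneg) (simp add: p_def)
  have n0: "0 \<le> (L2_norm f)\<^sup>2" by simp
  have "infsum p ?J \<le> C * (L2_norm f)\<^sup>2" unfolding p_def[abs_def] by (rule bessel_summable(2)[OF b f])
  hence up: "infsum p ?J \<le> (C + 1) * (L2_norm f)\<^sup>2" using n0 unfolding distrib_right by linarith
  have "(L2_norm f)\<^sup>2 \<le> D * infsum p ?J" unfolding p_def[abs_def] by (rule lower[OF f])
  hence "(L2_norm f)\<^sup>2 \<le> (D + 1) * infsum p ?J" using i0 unfolding distrib_right by linarith
  hence low: "1 / (D + 1) * (L2_norm f)\<^sup>2 \<le> infsum p ?J" using D by (simp add: field_simps)
  show "let S = (\<Sum>\<^sub>\<infinity>k\<in>UNIV. ennreal ((norm (L2_inner f (shift \<phi> k)))\<^sup>2))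
      + (\<Sum>l<length \<psi>s. \<Sum>\<^sub>\<infinity>j\<in>UNIV. \<Sum>\<^sub>\<infinity>k\<in>UNIV. ennreal ((norm (L2_inner f (dilate_shift M (\<psi>s ! l) j k)))\<^sup>2))
    in ennreal (1 / (D + 1) * (L2_norm f)\<^sup>2) \<le> S \<and> S \<le> ennreal ((C + 1) * (L2_norm f)\<^sup>2)"
    unfolding S Let_def using low up by (intro conjI ennreal_leI)
qed

section \<open>The cascade of quasi-projections\<close>

lemma pair_shift:
  assumes b: "b \<in> l0" and S: "finite S" "\<And>m. m \<notin> S \<Longrightarrow> F m = 0"
  shows "pair b (\<lambda>n. F (c + n)) = (\<Sum>m\<in>S. b (m - c) * F m)"
proof -
  let ?B = "{n. b n \<noteq> 0}"
  have fin: "finite ?B" by (rule l0_finite[OF b])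
  have "pair b (\<lambda>n. F (c + n)) = (\<Sum>m\<in>(\<lambda>n. c + n) ` ?B. b (m - c) * F m)"
    unfolding pair_def by (subst sum.reindex) (auto simp: inj_on_def)
  also have "\<dots> = (\<Sum>m\<in>(\<lambda>n. c + n) ` ?B \<union> S. b (m - c) * F m)"
  proof (rule sum.mono_neutral_left)
    show "\<forall>m\<in>((\<lambda>n. c + n) ` ?B \<union> S) - (\<lambda>n. c + n) ` ?B. b (m - c) * F m = 0"
    proof
      fix m assume "m \<in> ((\<lambda>n. c + n) ` ?B \<union> S) - (\<lambda>n. c + n) ` ?B"
      hence "m \<notin> (\<lambda>n. c + n) ` ?B" by blast
      hence "b (m - c) = 0" using image_eqI[of m "\<lambda>n. c + n" "m - c" ?B] by auto
      thus "b (m - c) * F m = 0" by simp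
    qed
  qed (use fin S in auto)
  also have "\<dots> = (\<Sum>m\<in>S. b (m - c) * F m)"
    by (rule sum.mono_neutral_right) (use fin S in auto)
  finally show ?thesis .
qed

context dilation_card
begin

lemma mv_minus: "M *v (- k) = - (M *v k)"
  by (simp add: matrix_vector_mult_def vec_eq_iff sum_negf)

lemma card_Omega: "card (Omega_M M) = d_M M"
proof -
  have lat0: "lat g \<longleftrightarrow> g = 0" if g: "g \<in> Gamma_M M" for g
  proof
    assume "lat g"
    then obtain k where "g = M *v k" by (auto simp: lat_def)
    hence "g + M *v 0 = 0 + M *v k" by simp
    thus "g = 0" by (rule Gamma_unique(1)[OF g Gamma_0])
  qed simp
  have "(\<Sum>g\<in>Gamma_M M. \<Sum>\<omega>\<in>Omega_M M. chr g ((2 * pi) *\<^sub>R \<omega>)) = (\<Sum>g\<in>Gamma_M M. if g = 0 then of_nat (card (Omega_M M)) else 0)"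
    by (intro sum.cong refl) (simp add: sum_chr_Omega lat0)
  also have "\<dots> = of_nat (card (Omega_M M))" using finite_Gamma Gamma_0 by (simp add: sum.delta)
  finally have 1: "(\<Sum>g\<in>Gamma_M M. \<Sum>\<omega>\<in>Omega_M M. chr g ((2 * pi) *\<^sub>R \<omega>)) = of_nat (card (Omega_M M))" .
  have "(\<Sum>\<omega>\<in>Omega_M M. \<Sum>g\<in>Gamma_M M. chr g ((2 * pi) *\<^sub>R \<omega>)) = (\<Sum>\<omega>\<in>Omega_M M. if \<omega> = 0 then of_nat (card (Gamma_M M)) else 0)"
    by (intro sum.cong refl sum_chr_Gamma)
  also have "\<dots> = of_nat (card (Gamma_M M))" using finite_Omega Omega_0 by (simp add: sum.delta)
  finally have "of_nat (card (Gamma_M M)) = (of_nat (card (Omega_M M)) :: complex)"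
    unfolding 1[symmetric] by (subst sum.swap) simp
  thus ?thesis by (simp only: of_nat_eq_iff card_Gamma)
qed

text \<open>Summing the filter bank identity over \<open>\<Omega>\<^sub>M\<close> against characters isolates one coset of \<open>M \<int>\<^sup>d\<close>.\<close>

lemma perfect_reconstruction:
  assumes L: "finite L" and B: "\<And>l. l \<in> L \<Longrightarrow> B l \<in> l0" "\<And>l. l \<in> L \<Longrightarrow> B' l \<in> l0"
    and pr: "\<And>\<xi> \<omega>. \<omega> \<in> Omega_M M \<Longrightarrow> (\<Sum>l\<in>L. cnj (fseries (B l) \<xi>) * fseries (B' l) (\<xi> + (2 * pi) *\<^sub>R \<omega>)) = (if \<omega> = 0 then 1 else 0)"
  shows "(\<Sum>l\<in>L. cnj (pair (B l) (\<lambda>j. cnj (if lat (j - m) then B' l (j + (m' - m)) else 0)))) = (if m = m' then 1 / of_nat (d_M M) else 0)"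
proof -
  define v where "v l n = (if lat (n - m') then B' l n else 0)" for l n
  have v0: "v l \<in> l0" if "l \<in> L" for l unfolding v_def[abs_def] by (rule l0_restrict[OF B(2)[OF that]])
  have vs: "of_nat (d_M M) * fseries (v l) \<xi> = (\<Sum>\<omega>\<in>Omega_M M. chr (- m') ((2 * pi) *\<^sub>R \<omega>) * fseries (B' l) (\<xi> + (2 * pi) *\<^sub>R \<omega>))"
    if l: "l \<in> L" for l \<xi>
  proof -
    have "of_nat (d_M M) * fseries (v l) \<xi> = pair (B' l) (\<lambda>n. of_nat (d_M M) * (if lat (n - m') then chr n \<xi> else 0))"
      unfolding fseries_pair v_def[abs_def] pair_restrict[OF B(2)[OF l]] pair_scale_right ..
    also have "\<dots> = pair (B' l) (\<lambda>n. \<Sum>\<omega>\<in>Omega_M M. chr (- m') ((2 * pi) *\<^sub>R \<omega>) * chr n (\<xi> + (2 * pi) *\<^sub>R \<omega>))"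
    proof (rule pair_cong)
      fix n
      have "of_nat (d_M M) * (if lat (n - m') then chr n \<xi> else 0) = (\<Sum>\<omega>\<in>Omega_M M. chr (- m' + n) ((2 * pi) *\<^sub>R \<omega>)) * chr n \<xi>"
        by (simp add: sum_chr_Omega card_Omega)
      thus "of_nat (d_M M) * (if lat (n - m') then chr n \<xi> else 0) = (\<Sum>\<omega>\<in>Omega_M M. chr (- m') ((2 * pi) *\<^sub>R \<omega>) * chr n (\<xi> + (2 * pi) *\<^sub>R \<omega>))"
        by (simp only: chr_add chr_add_right sum_distrib_right sum_distrib_left mult_ac)
    qed
    finally show ?thesis by (simp only: pair_sum_right pair_scale_right fseries_pair)
  qed
  define u where "u k = (\<Sum>l\<in>L. conv (adj (B l)) (v l) k)" for k
  have hu: "has_fseries u (\<lambda>\<xi>. \<Sum>l\<in>L. cnj (fseries (B l) \<xi>) * fseries (v l) \<xi>)"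
    unfolding u_def[abs_def] using L B(1) v0
  proof (induction L rule: finite_induct)
    case (insert l L)
    thus ?case by (simp add: has_fseries_add has_fseries_conv has_fseries_adj has_fseries_self)
  qed (simp add: has_fseries_def fseries_def)
  have sum1: "(\<Sum>l\<in>L. cnj (fseries (B l) \<xi>) * fseries (v l) \<xi>) = 1 / of_nat (d_M M)" for \<xi>
  proof -
    have "of_nat (d_M M) * (\<Sum>l\<in>L. cnj (fseries (B l) \<xi>) * fseries (v l) \<xi>)
        = (\<Sum>l\<in>L. cnj (fseries (B l) \<xi>) * (\<Sum>\<omega>\<in>Omega_M M. chr (- m') ((2 * pi) *\<^sub>R \<omega>) * fseries (B' l) (\<xi> + (2 * pi) *\<^sub>R \<omega>)))"
      by (simp add: sum_distrib_left mult.left_commute flip: vs)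
    also have "\<dots> = (\<Sum>\<omega>\<in>Omega_M M. chr (- m') ((2 * pi) *\<^sub>R \<omega>) * (\<Sum>l\<in>L. cnj (fseries (B l) \<xi>) * fseries (B' l) (\<xi> + (2 * pi) *\<^sub>R \<omega>)))"
      unfolding sum_distrib_left by (subst sum.swap) (simp add: mult_ac)
    also have "\<dots> = (\<Sum>\<omega>\<in>Omega_M M. if \<omega> = 0 then 1 else 0)" by (intro sum.cong refl) (simp add: pr)
    also have "\<dots> = 1" using finite_Omega Omega_0 by (simp add: sum.delta)
    finally show ?thesis using d_pos by (simp add: field_simps)
  qed
  have "has_fseries (\<lambda>k. 1 / of_nat (d_M M) * delta k) (\<lambda>\<xi>. 1 / of_nat (d_M M) * 1)" by (intro has_fseries_scale has_fseries_delta)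
  hence "u = (\<lambda>k. 1 / of_nat (d_M M) * delta k)"
    using hu by (intro fseries_unique) (auto simp: has_fseries_def sum1)
  hence "u (m' - m) = (if m = m' then 1 / of_nat (d_M M) else 0)" by (simp add: delta_def)
  moreover have "conv (adj (B l)) (v l) (m' - m) = cnj (pair (B l) (\<lambda>j. cnj (if lat (j - m) then B' l (j + (m' - m)) else 0)))" for l
    unfolding conv_pair pair_adj v_def by (intro arg_cong[where f = cnj] pair_cong) (simp add: algebra_simps)
  ultimately show ?thesis unfolding u_def by simp
qed

lemma coset_pair_sum:
  assumes b: "b \<in> l0" and K: "finite K" "\<And>k. b (m - M *v k) \<noteq> 0 \<Longrightarrow> k \<in> K"
  shows "(\<Sum>k\<in>K. cnj (b (m - M *v k)) * b' (m' - M *v k)) = cnj (pair b (\<lambda>j. cnj (if lat (j - m) then b' (j + (m' - m)) else 0)))"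
proof -
  let ?h = "\<lambda>j. cnj (b j) * (if lat (j - m) then b' (j + (m' - m)) else 0)"
  let ?I = "(\<lambda>k. m - M *v k) ` K" and ?B = "{j. b j \<noteq> 0}"
  have fin: "finite ?B" by (rule l0_finite[OF b])
  have lat: "lat (- (M *v k))" for k
    unfolding lat_def using rangeI[of "\<lambda>j. M *v j" "- k"] by (simp add: mv_minus)
  have "cnj (pair b (\<lambda>j. cnj (if lat (j - m) then b' (j + (m' - m)) else 0))) = (\<Sum>j\<in>?B. ?h j)"
    by (simp add: pair_def)
  also have "\<dots> = (\<Sum>j\<in>?B \<union> ?I. ?h j)" using fin K(1) by (intro sum.mono_neutral_left) auto
  also have "\<dots> = (\<Sum>j\<in>?I. ?h j)"
  proof (rule sum.mono_neutral_right)
    show "\<forall>j\<in>(?B \<union> ?I) - ?I. ?h j = 0"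
    proof
      fix j assume j: "j \<in> (?B \<union> ?I) - ?I"
      show "?h j = 0"
      proof (rule ccontr)
        assume nz: "?h j \<noteq> 0"
        hence "lat (j - m)" "b j \<noteq> 0" by (auto split: if_splits)
        then obtain k where k: "j - m = M *v k" by (auto simp: lat_def)
        hence "j = m - M *v (- k)" by (simp add: mv_minus algebra_simps)
        moreover from this have "- k \<in> K" using K(2)[of "- k"] \<open>b j \<noteq> 0\<close> by simp
        ultimately show False using j by blast
      qed
    qed
  qed (use fin K in auto)
  also have "\<dots> = (\<Sum>k\<in>K. ?h (m - M *v k))" by (subst sum.reindex) (auto simp: inj_on_def mv_inj)
  also have "\<dots> = (\<Sum>k\<in>K. cnj (b (m - M *v k)) * b' (m' - M *v k))" by (intro sum.cong refl) (simp add: lat)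
  finally show ?thesis ..
qed

lemma dilate_shift_wav:
  "ds (wav \<phi> b) j k = (\<lambda>x. \<Sum>n | b n \<noteq> 0. (complex_of_real sd * b n) * ds \<phi> (Suc j) (M *v k + n) x)"
proof
  fix x
  have d: "of_nat (d_M M) = complex_of_real sd * complex_of_real sd"
    by (metis sd_sq of_real_mult of_real_of_nat_eq)
  have "fwd (fwdn j x - rvec k) - rvec n = fwdn (Suc j) x - rvec (M *v k + n)" for n
    by (simp add: matrix_vector_mult_diff_distrib rvec_add rvec_mv)
  thus "ds (wav \<phi> b) j k x = (\<Sum>n | b n \<noteq> 0. (complex_of_real sd * b n) * ds \<phi> (Suc j) (M *v k + n) x)"
    unfolding dilate_shift_eq wav_def pair_def d by (simp add: sum_distrib_left mult_ac)
qed

lemma finite_inner: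
  assumes f: "cc f" and \<phi>: "cc \<phi>"
  shows "finite {k. L2_inner f (ds \<phi> j k) \<noteq> 0}"
proof -
  obtain R where R: "0 < R" "\<And>x. f x \<noteq> 0 \<Longrightarrow> norm x \<le> R" using cc_supportD[OF f] by blast
  obtain R' where R': "0 < R'" "\<And>x. \<phi> x \<noteq> 0 \<Longrightarrow> norm x \<le> R'" using cc_supportD[OF \<phi>] by blast
  obtain B where B: "B > 0" "\<And>x. norm (fwdn j x) \<le> B * norm x" using linear_bounded_pos[OF fwdn_linear[of j]] by blast
  have "L2_inner f (ds \<phi> j k) = 0" if k: "\<not> norm (rvec k) \<le> B * R + R'" for k
  proof -
    have "f x * cnj (ds \<phi> j k x) = 0" for x
    proof (rule ccontr)
      assume "f x * cnj (ds \<phi> j k x) \<noteq> 0"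
      hence nz: "f x \<noteq> 0" "\<phi> (fwdn j x - rvec k) \<noteq> 0" by (auto simp: dilate_shift_eq)
      have "norm (fwdn j x) \<le> B * R" using B(2)[of x] mult_left_mono[OF R(2)[OF nz(1)], of B] B(1) by linarith
      moreover have "norm (rvec k) \<le> norm (fwdn j x) + norm (fwdn j x - rvec k)" using norm_triangle_ineq4[of "fwdn j x" "fwdn j x - rvec k"] by simp
      ultimately show False using R'(2)[OF nz(2)] k by linarith
    qed
    thus ?thesis unfolding L2_inner_def by (simp only: Bochner_Integration.integral_zero)
  qed
  hence "{k. L2_inner f (ds \<phi> j k) \<noteq> 0} \<subseteq> {k. norm (rvec k) \<le> B * R + R'}" by blast
  thus ?thesis using finite_int_bounded finite_subset by blast
qed

definition quasi :: "'n cfun \<Rightarrow> 'n cfun \<Rightarrow> 'n cfun \<Rightarrow> 'n cfun \<Rightarrow> nat \<Rightarrow> complex" where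
  "quasi \<phi> \<phi>' f g j = (\<Sum>k | L2_inner f (ds \<phi> j k) \<noteq> 0. L2_inner f (ds \<phi> j k) * L2_inner (ds \<phi>' j k) g)"

lemma quasi_superset:
  "finite K \<Longrightarrow> {k. L2_inner f (ds \<phi> j k) \<noteq> 0} \<subseteq> K \<Longrightarrow>
    quasi \<phi> \<phi>' f g j = (\<Sum>k\<in>K. L2_inner f (ds \<phi> j k) * L2_inner (ds \<phi>' j k) g)"
  unfolding quasi_def by (rule sum.mono_neutral_left) auto

lemma telescope:
  assumes L: "finite L" and B: "\<And>l. l \<in> L \<Longrightarrow> B l \<in> l0" "\<And>l. l \<in> L \<Longrightarrow> B' l \<in> l0"
    and pr: "\<And>\<xi> \<omega>. \<omega> \<in> Omega_M M \<Longrightarrow> (\<Sum>l\<in>L. cnj (fseries (B l) \<xi>) * fseries (B' l) (\<xi> + (2 * pi) *\<^sub>R \<omega>)) = (if \<omega> = 0 then 1 else 0)"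
    and cc: "cc f" "cc g" "cc \<phi>" "cc \<phi>'"
  shows "\<exists>K0. finite K0 \<and> (\<forall>K. finite K \<longrightarrow> K0 \<subseteq> K \<longrightarrow>
    (\<Sum>l\<in>L. \<Sum>k\<in>K. L2_inner f (ds (wav \<phi> (B l)) j k) * L2_inner (ds (wav \<phi>' (B' l)) j k) g) = quasi \<phi> \<phi>' f g (Suc j))"
proof -
  define F where "F m = L2_inner f (ds \<phi> (Suc j) m)" for m
  define G where "G m = L2_inner (ds \<phi>' (Suc j) m) g" for m
  define S where "S = {m. F m \<noteq> 0} \<union> {m. L2_inner g (ds \<phi>' (Suc j) m) \<noteq> 0}"
  have S: "finite S" unfolding S_def F_def using finite_inner cc by blast
  have Gc: "G m = cnj (L2_inner g (ds \<phi>' (Suc j) m))" for m unfolding G_def by (rule L2_inner_commute)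
  have out: "F m = 0" "G m = 0" if "m \<notin> S" for m using that unfolding S_def Gc by auto
  have fL: "f \<in> L2" "g \<in> L2" by (simp_all add: cc_L2 cc)
  have dL: "ds \<phi> i k \<in> L2" "ds \<phi>' i k \<in> L2" for i k by (simp_all add: cc_L2 cc_dilate_shift cc)
  have 1: "L2_inner f (ds (wav \<phi> b) j k) = complex_of_real sd * (\<Sum>m\<in>S. cnj (b (m - M *v k)) * F m)"
    if b: "b \<in> l0" for b k
  proof -
    have "L2_inner f (ds (wav \<phi> b) j k) = (\<Sum>n | b n \<noteq> 0. complex_of_real sd * (cnj (b n) * F (M *v k + n)))"
      unfolding dilate_shift_wav F_def
      by (subst L2_inner_sum_right) (auto simp: L2_inner_scale_right mult.assoc intro!: L2_scale dL fL)
    also have "\<dots> = complex_of_real sd * cnj (pair b (\<lambda>n. cnj (F (M *v k + n))))"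
      by (simp add: pair_def sum_distrib_left)
    also have "pair b (\<lambda>n. cnj (F (M *v k + n))) = (\<Sum>m\<in>S. b (m - M *v k) * cnj (F m))"
      by (rule pair_shift[OF b S]) (simp add: out)
    finally show ?thesis by simp
  qed
  have 2: "L2_inner (ds (wav \<phi>' b) j k) g = complex_of_real sd * (\<Sum>m\<in>S. b (m - M *v k) * G m)"
    if b: "b \<in> l0" for b k
  proof -
    have "L2_inner (ds (wav \<phi>' b) j k) g = (\<Sum>n | b n \<noteq> 0. complex_of_real sd * (b n * G (M *v k + n)))"
      unfolding dilate_shift_wav G_def
      by (subst L2_inner_sum_left) (auto simp: L2_inner_scale_left mult.assoc intro!: L2_scale dL fL)
    also have "\<dots> = complex_of_real sd * pair b (\<lambda>n. G (M *v k + n))" by (simp add: pair_def sum_distrib_left)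
    also have "pair b (\<lambda>n. G (M *v k + n)) = (\<Sum>m\<in>S. b (m - M *v k) * G m)" by (rule pair_shift[OF b S]) (simp add: out)
    finally show ?thesis .
  qed
  define K0 where "K0 = (\<Union>l\<in>L. \<Union>m\<in>S. {k. B l (m - M *v k) \<noteq> 0})"
  have "finite {k. B l (m - M *v k) \<noteq> 0}" if "l \<in> L" for l m
  proof -
    have "inj (\<lambda>k. m - M *v k)" by (simp add: inj_def mv_inj)
    thus ?thesis using finite_vimageI[OF l0_finite[OF B(1)[OF that]], of "\<lambda>k. m - M *v k"] by (simp add: vimage_def)
  qed
  hence K0: "finite K0" unfolding K0_def using L S by blast
  have "(\<Sum>l\<in>L. \<Sum>k\<in>K. L2_inner f (ds (wav \<phi> (B l)) j k) * L2_inner (ds (wav \<phi>' (B' l)) j k) g) = quasi \<phi> \<phi>' f g (Suc j)"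
    if K: "finite K" "K0 \<subseteq> K" for K
  proof -
    have d: "complex_of_real sd * complex_of_real sd = of_nat (d_M M)"
      by (metis sd_sq of_real_mult of_real_of_nat_eq)
    have "(\<Sum>l\<in>L. \<Sum>k\<in>K. L2_inner f (ds (wav \<phi> (B l)) j k) * L2_inner (ds (wav \<phi>' (B' l)) j k) g)
        = (\<Sum>l\<in>L. \<Sum>k\<in>K. \<Sum>m\<in>S. \<Sum>m'\<in>S. of_nat (d_M M) * (F m * G m') * (cnj (B l (m - M *v k)) * B' l (m' - M *v k)))"
    proof (intro sum.cong refl)
      fix l k assume l: "l \<in> L"
      have "L2_inner f (ds (wav \<phi> (B l)) j k) * L2_inner (ds (wav \<phi>' (B' l)) j k) g
          = of_nat (d_M M) * ((\<Sum>m\<in>S. cnj (B l (m - M *v k)) * F m) * (\<Sum>m'\<in>S. B' l (m' - M *v k) * G m'))"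
        unfolding 1[OF B(1)[OF l]] 2[OF B(2)[OF l]] d[symmetric] by (simp only: mult_ac)
      also have "\<dots> = (\<Sum>m\<in>S. \<Sum>m'\<in>S. of_nat (d_M M) * (F m * G m') * (cnj (B l (m - M *v k)) * B' l (m' - M *v k)))"
        unfolding sum_product by (simp only: sum_distrib_left mult_ac)
      finally show "L2_inner f (ds (wav \<phi> (B l)) j k) * L2_inner (ds (wav \<phi>' (B' l)) j k) g
          = (\<Sum>m\<in>S. \<Sum>m'\<in>S. of_nat (d_M M) * (F m * G m') * (cnj (B l (m - M *v k)) * B' l (m' - M *v k)))" .
    qed
    also have "\<dots> = (\<Sum>l\<in>L. \<Sum>m\<in>S. \<Sum>k\<in>K. \<Sum>m'\<in>S. of_nat (d_M M) * (F m * G m') * (cnj (B l (m - M *v k)) * B' l (m' - M *v k)))"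
      by (rule sum.cong[OF refl], rule sum.swap)
    also have "\<dots> = (\<Sum>l\<in>L. \<Sum>m\<in>S. \<Sum>m'\<in>S. \<Sum>k\<in>K. of_nat (d_M M) * (F m * G m') * (cnj (B l (m - M *v k)) * B' l (m' - M *v k)))"
      by (rule sum.cong[OF refl], rule sum.cong[OF refl], rule sum.swap)
    also have "\<dots> = (\<Sum>l\<in>L. \<Sum>m\<in>S. \<Sum>m'\<in>S. of_nat (d_M M) * (F m * G m') * cnj (pair (B l) (\<lambda>j. cnj (if lat (j - m) then B' l (j + (m' - m)) else 0))))"
    proof (intro sum.cong refl)
      fix l m m' assume lm: "l \<in> L" "m \<in> S"
      have "(\<Sum>k\<in>K. cnj (B l (m - M *v k)) * B' l (m' - M *v k)) = cnj (pair (B l) (\<lambda>j. cnj (if lat (j - m) then B' l (j + (m' - m)) else 0)))"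
        by (rule coset_pair_sum[OF B(1)[OF lm(1)] K(1)]) (use lm K(2) in \<open>auto simp: K0_def\<close>)
      thus "(\<Sum>k\<in>K. of_nat (d_M M) * (F m * G m') * (cnj (B l (m - M *v k)) * B' l (m' - M *v k)))
          = of_nat (d_M M) * (F m * G m') * cnj (pair (B l) (\<lambda>j. cnj (if lat (j - m) then B' l (j + (m' - m)) else 0)))"
        by (simp only: sum_distrib_left[symmetric])
    qed
    also have "\<dots> = (\<Sum>m\<in>S. \<Sum>l\<in>L. \<Sum>m'\<in>S. of_nat (d_M M) * (F m * G m') * cnj (pair (B l) (\<lambda>j. cnj (if lat (j - m) then B' l (j + (m' - m)) else 0))))"
      by (rule sum.swap)
    also have "\<dots> = (\<Sum>m\<in>S. \<Sum>m'\<in>S. \<Sum>l\<in>L. of_nat (d_M M) * (F m * G m') * cnj (pair (B l) (\<lambda>j. cnj (if lat (j - m) then B' l (j + (m' - m)) else 0))))"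
      by (rule sum.cong[OF refl], rule sum.swap)
    also have "\<dots> = (\<Sum>m\<in>S. \<Sum>m'\<in>S. of_nat (d_M M) * (F m * G m') * (if m = m' then 1 / of_nat (d_M M) else 0))"
      by (simp only: sum_distrib_left[symmetric] perfect_reconstruction[OF L B pr])
    also have "\<dots> = (\<Sum>m\<in>S. \<Sum>m'\<in>S. if m = m' then F m * G m' else 0)"
      using d_pos by (intro sum.cong refl) simp
    also have "\<dots> = (\<Sum>m\<in>S. F m * G m)" using S by (intro sum.cong refl) (simp add: sum.delta')
    also have "\<dots> = quasi \<phi> \<phi>' f g (Suc j)"
      unfolding F_def G_def by (rule quasi_superset[OF S, symmetric]) (auto simp: S_def F_def)
    finally show ?thesis .
  qed
  thus ?thesis using K0 by blast
qed

end

context dilation_card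
begin

lemma quasi_projection_close:
  assumes f: "cc f" and \<phi>: "cc \<phi>" "cc \<phi>'" and int: "(\<integral>x. \<phi> x \<partial>lborel) = 1"
    and part: "\<And>x F. finite F \<Longrightarrow> (\<And>k. \<phi>' (x - rvec k) \<noteq> 0 \<Longrightarrow> k \<in> F) \<Longrightarrow> (\<Sum>k\<in>F. \<phi>' (x - rvec k)) = 1"
    and \<epsilon>: "0 < \<epsilon>"
  shows "\<exists>j0. \<forall>j\<ge>j0. \<forall>x. norm ((\<Sum>k | L2_inner f (ds \<phi> j k) \<noteq> 0.
    L2_inner f (ds \<phi> j k) * ds \<phi>' j k x) - f x) \<le> \<epsilon>"
proof -
  obtain R1 where R1: "0 < R1" "\<And>x. \<phi> x \<noteq> 0 \<Longrightarrow> norm x \<le> R1" using cc_supportD[OF \<phi>(1)] by blast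
  obtain R2 where R2: "0 < R2" "\<And>x. \<phi>' x \<noteq> 0 \<Longrightarrow> norm x \<le> R2" using cc_supportD[OF \<phi>(2)] by blast
  define R where "R = max R1 R2"
  have R: "0 < R" "\<And>x. \<phi> x \<noteq> 0 \<Longrightarrow> norm x \<le> R" "\<And>x. \<phi>' x \<noteq> 0 \<Longrightarrow> norm x \<le> R"
    using R1 R2 by (auto simp: R_def le_max_iff_disj)
  obtain b where b: "0 < b" "\<And>x. norm (\<phi>' x) \<le> b" using cc_bounded[OF \<phi>(2)] by blast
  obtain N where N: "\<And>x::real^'n. card {k. norm (rvec k - x) \<le> R} \<le> N" using count_ball[of R] by blast
  obtain C \<rho> where C: "0 < \<rho>" "\<rho> < 1" "0 < C" "\<And>n x. norm (bwdn n x) \<le> C * \<rho> ^ n * norm x" using decay by blast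
  define a where "a = (\<integral>x. norm (\<phi> x) \<partial>lborel)"
  have a: "0 \<le> a" by (simp add: a_def)
  define \<eta> where "\<eta> = \<epsilon> / (real N * a * b + 1)"
  have den: "0 < real N * a * b + 1" using a b by (simp add: add_nonneg_pos)
  have \<eta>: "0 < \<eta>" using \<epsilon> den by (simp add: \<eta>_def)
  have \<eta>b: "real N * (\<eta> * a * b) \<le> \<epsilon>"
  proof -
    have "real N * (\<eta> * a * b) = \<eta> * (real N * a * b)" by (simp only: mult_ac)
    also have "\<dots> \<le> \<eta> * (real N * a * b + 1)" using \<eta> by simp
    also have "\<dots> = \<epsilon>" using den by (simp add: \<eta>_def)
    finally show ?thesis .
  qed
  obtain \<delta> where \<delta>: "0 < \<delta>" "\<And>x y. norm (x - y) < \<delta> \<Longrightarrow> norm (f x - f y) < \<eta>"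
    using cc_uniformly_continuous[OF f \<eta>] by blast
  have "(\<lambda>j. C * \<rho> ^ j * (2 * R)) \<longlonglongrightarrow> C * 0 * (2 * R)" using C by (intro tendsto_intros) auto
  hence "eventually (\<lambda>j. C * \<rho> ^ j * (2 * R) < \<delta>) sequentially" using \<delta>(1) by (intro order_tendstoD(2)) auto
  then obtain j0 where j0: "\<And>j. j \<ge> j0 \<Longrightarrow> C * \<rho> ^ j * (2 * R) < \<delta>" by (auto simp: eventually_sequentially)
  show ?thesis
  proof (intro exI allI impI)
    fix j x assume j: "j \<ge> j0"
    define c where "c k = L2_inner f (ds \<phi> j k)" for k
    define S where "S = {k. norm (rvec k - fwdn j x) \<le> R}"
    have finS: "finite S" unfolding S_def by (rule finite_int_ball)
    have finc: "finite {k. c k \<noteq> 0}" unfolding c_def by (rule finite_inner[OF f \<phi>(1)])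
    have z: "\<phi>' (fwdn j x - rvec k) = 0" if "k \<notin> S" for k
      using R(3)[of "fwdn j x - rvec k"] that by (auto simp: S_def norm_minus_commute)
    have one: "(\<Sum>k\<in>S. \<phi>' (fwdn j x - rvec k)) = 1" by (rule part[OF finS]) (use z in blast)
    have coef: "norm (c k * complex_of_real (sd ^ j) - f x) \<le> \<eta> * a" if k: "k \<in> S" for k
    proof -
      have f0: "ds f 0 0 = f" by (rule ext) (simp add: dilate_shift_eq)
      have "norm (L2_inner (ds \<phi> (0 + j) k) (ds f 0 0) - cnj (f x) * (\<integral>x. \<phi> x \<partial>lborel) / complex_of_real (sd ^ j)) \<le> \<eta> * (\<integral>x. norm (\<phi> x) \<partial>lborel) / sd ^ j"
      proof (rule gram_bound[OF \<phi>(1) f R(2)])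
        fix y assume y: "norm (fwdn j y - rvec k) \<le> R"
        have "fwdn j (y - x) = (fwdn j y - rvec k) + (rvec k - fwdn j x)" by (simp add: fwdn_diff)
        also have "norm \<dots> \<le> R + R" by (rule norm_triangle_mono[OF y]) (use k in \<open>simp add: S_def\<close>)
        finally have "norm (fwdn j (y - x)) \<le> 2 * R" by simp
        hence "C * \<rho> ^ j * norm (fwdn j (y - x)) \<le> C * \<rho> ^ j * (2 * R)" using C by (intro mult_left_mono) auto
        hence "norm (y - x) < \<delta>" using C(4)[of j "fwdn j (y - x)"] j0[OF j] unfolding bwdn_fwdn by linarith
        from \<delta>(2)[OF this] show "norm (f (y - rvec 0) - f x) \<le> \<eta>" by simp
      qed
      hence 1: "norm (L2_inner (ds \<phi> j k) f - cnj (f x) / complex_of_real (sd ^ j)) \<le> \<eta> * a / sd ^ j"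
        by (simp add: f0 int a_def)
      have "c k - f x / complex_of_real (sd ^ j) = cnj (L2_inner (ds \<phi> j k) f - cnj (f x) / complex_of_real (sd ^ j))"
        unfolding c_def by (simp add: L2_inner_commute[of f])
      hence 2: "norm (c k - f x / complex_of_real (sd ^ j)) \<le> \<eta> * a / sd ^ j" using 1 by (simp only: complex_mod_cnj)
      have "c k * complex_of_real (sd ^ j) - f x = (c k - f x / complex_of_real (sd ^ j)) * complex_of_real (sd ^ j)"
        using sd_pos by (simp add: left_diff_distrib)
      also have "norm \<dots> = norm (c k - f x / complex_of_real (sd ^ j)) * sd ^ j"
        unfolding norm_mult norm_of_real using sd_pos by simp
      also have "\<dots> \<le> \<eta> * a / sd ^ j * sd ^ j" by (rule mult_right_mono[OF 2]) (use sd_pos in simp)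
      finally show ?thesis using sd_pos by simp
    qed
    have "(\<Sum>k | c k \<noteq> 0. c k * ds \<phi>' j k x) = (\<Sum>k\<in>{k. c k \<noteq> 0} \<union> S. c k * ds \<phi>' j k x)"
      using finS finc by (intro sum.mono_neutral_left) auto
    also have "\<dots> = (\<Sum>k\<in>S. c k * ds \<phi>' j k x)"
      using finS finc by (intro sum.mono_neutral_right) (auto simp: z dilate_shift_eq)
    finally have "(\<Sum>k | c k \<noteq> 0. c k * ds \<phi>' j k x) - f x
        = (\<Sum>k\<in>S. c k * ds \<phi>' j k x) - f x * (\<Sum>k\<in>S. \<phi>' (fwdn j x - rvec k))" by (simp only: one mult_1_right)
    also have "\<dots> = (\<Sum>k\<in>S. (c k * complex_of_real (sd ^ j) - f x) * \<phi>' (fwdn j x - rvec k))"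
      unfolding dilate_shift_eq sum_distrib_left sum_subtractf[symmetric] by (intro sum.cong refl) (simp add: algebra_simps)
    also have "norm \<dots> \<le> (\<Sum>k\<in>S. \<eta> * a * b)"
    proof (rule sum_norm_le)
      fix k assume "k \<in> S"
      from coef[OF this] show "norm ((c k * complex_of_real (sd ^ j) - f x) * \<phi>' (fwdn j x - rvec k)) \<le> \<eta> * a * b"
        unfolding norm_mult by (rule mult_mono) (use \<eta> a b in auto)
    qed
    also have "\<dots> = real (card S) * (\<eta> * a * b)" by simp
    also have "\<dots> \<le> real N * (\<eta> * a * b)" using N \<eta> a b unfolding S_def by (intro mult_right_mono of_nat_mono) auto
    also note \<eta>b
    finally show "norm ((\<Sum>k | L2_inner f (ds \<phi> j k) \<noteq> 0. L2_inner f (ds \<phi> j k) * ds \<phi>' j k x) - f x) \<le> \<epsilon>"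
      by (simp only: c_def)
  qed
qed

lemma quasi_tendsto:
  assumes f: "cc f" and g: "cc g" and \<phi>: "cc \<phi>" "cc \<phi>'" and int: "(\<integral>x. \<phi> x \<partial>lborel) = 1"
    and part: "\<And>x F. finite F \<Longrightarrow> (\<And>k. \<phi>' (x - rvec k) \<noteq> 0 \<Longrightarrow> k \<in> F) \<Longrightarrow> (\<Sum>k\<in>F. \<phi>' (x - rvec k)) = 1"
  shows "quasi \<phi> \<phi>' f g \<longlonglongrightarrow> L2_inner f g"
proof (rule LIMSEQ_I)
  fix r :: real assume r: "0 < r"
  define G where "G = (\<integral>x. norm (g x) \<partial>lborel)"
  have G: "0 \<le> G" by (simp add: G_def)
  define \<epsilon> where "\<epsilon> = r / (G + 1)"
  have \<epsilon>: "0 < \<epsilon>" "\<epsilon> * G < r" using r G by (simp_all add: \<epsilon>_def field_simps)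
  obtain j0 where j0: "\<And>j x. j \<ge> j0 \<Longrightarrow> norm ((\<Sum>k | L2_inner f (ds \<phi> j k) \<noteq> 0.
      L2_inner f (ds \<phi> j k) * ds \<phi>' j k x) - f x) \<le> \<epsilon>"
    using quasi_projection_close[OF f \<phi> int part \<epsilon>(1)] by blast
  have "norm (quasi \<phi> \<phi>' f g j - L2_inner f g) < r" if j: "j \<ge> j0" for j
  proof -
    define P where "P x = (\<Sum>k | L2_inner f (ds \<phi> j k) \<noteq> 0. L2_inner f (ds \<phi> j k) * ds \<phi>' j k x)" for x
    have Pc: "cc P" unfolding P_def[abs_def] by (rule cc_sum, rule cc_scale, rule cc_dilate_shift, rule \<phi>(2))
    have "quasi \<phi> \<phi>' f g j = L2_inner P g"
      unfolding quasi_def P_def[abs_def]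
      by (subst L2_inner_sum_left) (auto simp: L2_inner_scale_left intro!: L2_scale[OF cc_L2[OF cc_dilate_shift[OF \<phi>(2)]]] cc_L2[OF g])
    hence "quasi \<phi> \<phi>' f g j - L2_inner f g = (\<integral>x. (P x - f x) * cnj (g x) \<partial>lborel)"
      by (simp add: L2_inner_diff_left[symmetric] cc_L2 Pc f g) (simp add: L2_inner_def)
    also have "norm \<dots> \<le> (\<integral>x. \<epsilon> * norm (g x) \<partial>lborel)"
    proof (rule Bochner_Integration.integral_norm_bound_integral)
      show "integrable lborel (\<lambda>x. (P x - f x) * cnj (g x))"
        by (intro cc_integrable cc_mult cc_diff Pc f cc_continuous cc_cnj g)
      show "integrable lborel (\<lambda>x. \<epsilon> * norm (g x))" using cc_integrable[OF g] by simp
      show "norm ((P x - f x) * cnj (g x)) \<le> \<epsilon> * norm (g x)" for x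
        using mult_right_mono[OF j0[OF j, of x] norm_ge_zero[of "g x"]] by (simp add: norm_mult P_def)
    qed
    also have "\<dots> = \<epsilon> * G" by (simp add: G_def)
    also note \<epsilon>(2)
    finally show ?thesis .
  qed
  thus "\<exists>no. \<forall>n\<ge>no. norm (quasi \<phi> \<phi>' f g n - L2_inner f g) < r" by blast
qed

lemma weak_expansion:
  assumes len: "length bs = length bs'" and l0: "a \<in> l0" "a' \<in> l0" "set bs \<subseteq> l0" "set bs' \<subseteq> l0"
    and fb: "dual_filter_bank M a bs a' bs'"
    and \<phi>: "cc \<phi>" "cc \<phi>'" "\<phi> = wav \<phi> a" "\<phi>' = wav \<phi>' a'" and int: "(\<integral>x. \<phi> x \<partial>lborel) = 1"
    and part: "\<And>x F. finite F \<Longrightarrow> (\<And>k. \<phi>' (x - rvec k) \<noteq> 0 \<Longrightarrow> k \<in> F) \<Longrightarrow> (\<Sum>k\<in>F. \<phi>' (x - rvec k)) = 1"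
    and f: "cc f" and g: "cc g" and \<epsilon>: "0 < \<epsilon>"
    and I: "finite I" "I \<subseteq> frame_index (length bs)"
  shows "\<exists>I'. finite I' \<and> I \<subseteq> I' \<and> I' \<subseteq> frame_index (length bs) \<and>
    norm (L2_inner f g - (\<Sum>i\<in>I'. L2_inner f (framelet_elem M \<phi> (map (wav \<phi>) bs) i) * L2_inner (framelet_elem M \<phi>' (map (wav \<phi>') bs') i) g)) < \<epsilon>"
proof -
  define s where "s = length bs"
  define t where "t l j k = L2_inner f (ds (wav \<phi> (bs ! l)) j k) * L2_inner (ds (wav \<phi>' (bs' ! l)) j k) g" for l j k
  define q where "q j k = L2_inner f (ds \<phi> j k) * L2_inner (ds \<phi>' j k) g" for j k
  define Kf where "Kf = (\<lambda>i. case i of Inl k \<Rightarrow> k | Inr (l, j, k) \<Rightarrow> k) ` I"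
  define Jf where "Jf = (\<lambda>i. case i of Inl k \<Rightarrow> 0 | Inr (l, j, k) \<Rightarrow> j) ` I"
  have fin: "finite Kf" "finite Jf" using I(1) by (simp_all add: Kf_def Jf_def)
  have step: "\<exists>K. finite K \<and> Kf \<subseteq> K \<and> quasi \<phi> \<phi>' f g (Suc j) = quasi \<phi> \<phi>' f g j + (\<Sum>l<s. \<Sum>k\<in>K. t l j k)" for j
  proof -
    have mem: "(a # bs) ! l \<in> l0" "(a' # bs') ! l \<in> l0" if "l \<in> {..<Suc s}" for l
      using that l0 len by (auto simp: s_def nth_Cons' subset_iff)
    have "(\<Sum>l<Suc s. cnj (fseries ((a # bs) ! l) \<xi>) * fseries ((a' # bs') ! l) (\<xi> + (2 * pi) *\<^sub>R \<omega>)) = (if \<omega> = 0 then 1 else 0)"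
      if "\<omega> \<in> Omega_M M" for \<xi> \<omega>
      unfolding sum.lessThan_Suc_shift nth_Cons_0 nth_Cons_Suc s_def using fb that unfolding dual_filter_bank_def by blast
    from telescope[OF _ mem this f g \<phi>(1,2), of j] obtain K0 where K0: "finite K0"
      "\<And>K. finite K \<Longrightarrow> K0 \<subseteq> K \<Longrightarrow> (\<Sum>l<Suc s. \<Sum>k\<in>K. L2_inner f (ds (wav \<phi> ((a # bs) ! l)) j k) * L2_inner (ds (wav \<phi>' ((a' # bs') ! l)) j k) g) = quasi \<phi> \<phi>' f g (Suc j)"
      by auto
    define K where "K = K0 \<union> Kf \<union> {k. L2_inner f (ds \<phi> j k) \<noteq> 0}"
    have sub: "K0 \<subseteq> K" by (auto simp: K_def)
    have K: "finite K" unfolding K_def using K0 fin finite_inner[OF f \<phi>(1)] by blast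
    have "quasi \<phi> \<phi>' f g (Suc j) = (\<Sum>k\<in>K. q j k) + (\<Sum>l<s. \<Sum>k\<in>K. t l j k)"
      using K0(2)[OF K sub] unfolding sum.lessThan_Suc_shift by (simp add: q_def t_def \<phi>(3,4)[symmetric])
    also have "(\<Sum>k\<in>K. q j k) = quasi \<phi> \<phi>' f g j"
      unfolding q_def by (rule quasi_superset[OF K, symmetric]) (auto simp: K_def)
    finally show ?thesis using K by (intro exI[of _ K]) (auto simp: K_def)
  qed
  obtain K where K: "\<And>j. finite (K j)" "\<And>j. Kf \<subseteq> K j"
    "\<And>j. quasi \<phi> \<phi>' f g (Suc j) = quasi \<phi> \<phi>' f g j + (\<Sum>l<s. \<Sum>k\<in>K j. t l j k)"
    using step by metis
  have tel: "quasi \<phi> \<phi>' f g n = quasi \<phi> \<phi>' f g 0 + (\<Sum>j<n. \<Sum>l<s. \<Sum>k\<in>K j. t l j k)" for n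
    by (induction n) (simp_all add: K(3))
  define Z where "Z = Kf \<union> {k. L2_inner f (ds \<phi> 0 k) \<noteq> 0}"
  have Z: "finite Z" unfolding Z_def using fin finite_inner[OF f \<phi>(1)] by blast
  have q0: "quasi \<phi> \<phi>' f g 0 = (\<Sum>k\<in>Z. q 0 k)" unfolding q_def by (rule quasi_superset[OF Z]) (auto simp: Z_def)
  obtain n1 where n1: "\<And>n. n \<ge> n1 \<Longrightarrow> norm (quasi \<phi> \<phi>' f g n - L2_inner f g) < \<epsilon>"
    using LIMSEQ_D[OF quasi_tendsto[OF f g \<phi>(1,2) int part] \<epsilon>] by blast
  define n where "n = max n1 (Suc (Max (insert 0 Jf)))"
  have Jn: "j < n" if "j \<in> Jf" for j using that fin(2) by (auto simp: n_def less_max_iff_disj less_Suc_eq_le intro: Max_ge)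
  let ?R = "{..<s} \<times> (SIGMA j:{..<n}. K j)"
  define I' where "I' = Inl ` Z \<union> Inr ` ?R"
  have fR: "finite ?R" using K(1) by (intro finite_cartesian_product finite_SigmaI) auto
  have "finite I'" unfolding I'_def using Z fR by blast
  moreover have "I \<subseteq> I'"
  proof
    fix i assume i: "i \<in> I"
    show "i \<in> I'"
    proof (cases i)
      case (Inl k)
      hence "k \<in> Kf" using i unfolding Kf_def by force
      thus ?thesis by (simp add: Inl I'_def Z_def)
    next
      case (Inr z)
      obtain l j k where z: "z = (l, j, k)" by (cases z) auto
      have "k \<in> Kf" "j \<in> Jf" using i unfolding Kf_def Jf_def Inr z by force+
      moreover have "l < s" using i I(2) by (auto simp: Inr z s_def)
      ultimately show ?thesis using K(2)[of j] Jn by (auto simp: Inr z I'_def)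
    qed
  qed
  moreover have "I' \<subseteq> frame_index (length bs)" by (auto simp: I'_def s_def)
  moreover have "(\<Sum>i\<in>I'. L2_inner f (framelet_elem M \<phi> (map (wav \<phi>) bs) i) * L2_inner (framelet_elem M \<phi>' (map (wav \<phi>') bs') i) g) = quasi \<phi> \<phi>' f g n"
  proof -
    let ?T = "\<lambda>i. L2_inner f (framelet_elem M \<phi> (map (wav \<phi>) bs) i) * L2_inner (framelet_elem M \<phi>' (map (wav \<phi>') bs') i) g"
    have "(\<Sum>i\<in>I'. ?T i) = (\<Sum>i\<in>Inl ` Z. ?T i) + (\<Sum>i\<in>Inr ` ?R. ?T i)"
      unfolding I'_def using Z fR by (intro sum.union_disjoint) auto
    also have "(\<Sum>i\<in>Inl ` Z. ?T i) = (\<Sum>k\<in>Z. q 0 k)"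
      by (subst sum.reindex) (simp_all add: q_def shift_eq)
    also have "(\<Sum>i\<in>Inr ` ?R. ?T i) = (\<Sum>(l, j, k)\<in>?R. t l j k)"
      by (subst sum.reindex) (auto intro!: sum.cong simp: t_def s_def len)
    also have "\<dots> = (\<Sum>l<s. \<Sum>(j, k)\<in>(SIGMA j:{..<n}. K j). t l j k)"
      by (simp add: sum.cartesian_product)
    also have "\<dots> = (\<Sum>l<s. \<Sum>j<n. \<Sum>k\<in>K j. t l j k)" using K(1) by (simp add: sum.Sigma)
    also have "\<dots> = (\<Sum>j<n. \<Sum>l<s. \<Sum>k\<in>K j. t l j k)" by (rule sum.swap)
    finally show ?thesis unfolding tel[of n] q0 .
  qed
  moreover have "norm (L2_inner f g - quasi \<phi> \<phi>' f g n) < \<epsilon>"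
    using n1[of n] by (simp add: n_def norm_minus_commute)
  ultimately show ?thesis by (intro exI[of _ I']) simp
qed

end

context dilation_card
begin

lemma bessel_framelet:
  assumes \<phi>: "cc \<phi>" and b: "\<And>b. b \<in> set bs \<Longrightarrow> vmom m b" "0 < m" and r: "0 < r" "r < 1"
    and mod: "\<And>R. \<exists>C\<ge>0. \<forall>n x y. norm (fwdn n (x - y)) \<le> R \<longrightarrow> norm (\<phi> x - \<phi> y) \<le> C * r ^ n"
  shows "\<exists>C. bessel (frame_index (length bs)) (framelet_elem M \<phi> (map (wav \<phi>) bs)) C"
proof -
  let ?e = "framelet_elem M \<phi> (map (wav \<phi>) bs)"
  obtain C0 where "bessel UNIV (shift \<phi>) C0" using bessel_shift[OF \<phi>] by blast
  hence "bessel UNIV (\<lambda>k. ?e (Inl k)) C0" by (simp cong: if_cong)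
  hence 0: "bessel (range Inl) ?e C0" by (rule bessel_image)
  have "\<exists>C. bessel (\<Union>l\<in>{..<length bs}. range (\<lambda>i. Inr (l, i))) ?e C"
  proof (rule bessel_UN)
    fix l assume l: "l \<in> {..<length bs}"
    define c where "c = bs ! l"
    have c: "vmom m c" using b(1) l by (simp add: c_def)
    have "pair c (\<lambda>k. 1) = 0" using vmomD[OF c pdeg.pdeg_const[of 1] b(2)] .
    hence "fseries c 0 = 0" by (simp add: fseries_pair)
    moreover have "mat_inv_T M 0 = 0" by (simp add: mat_inv_T_def)
    ultimately have z: "(\<integral>x. wav \<phi> c x \<partial>lborel) = 0"
      using fourier_wav[OF \<phi>, of c 0] by (simp add: fourier_0)
    obtain C where C: "bessel UNIV (\<lambda>(j, k). ds (wav \<phi> c) j k) C"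
      using bessel_wavelet[OF cc_wav[OF \<phi>] z r modulus_wav[OF mod]] by blast
    have "(\<lambda>i. ?e (Inr (l, i))) = (\<lambda>(j, k). ds (wav \<phi> c) j k)"
      using l by (auto simp: fun_eq_iff c_def)
    hence "bessel UNIV (\<lambda>i. ?e (Inr (l, i))) C" using C by simp
    hence "bessel (range (\<lambda>i. Inr (l, i))) ?e C" by (rule bessel_image)
    thus "\<exists>C. bessel (range (\<lambda>i. Inr (l, i))) ?e C" by blast
  qed simp
  then obtain C1 where 1: "bessel (\<Union>l\<in>{..<length bs}. range (\<lambda>i. Inr (l, i))) ?e C1" by blast
  have J: "frame_index (length bs) = range Inl \<union> (\<Union>l\<in>{..<length bs}. range (\<lambda>i. Inr (l, i)))"
    by (auto simp: Plus_def)
  show ?thesis unfolding J using bessel_Un[OF 0 1] by blast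
qed

lemma dual_framelet_wav:
  assumes len: "length bs = length bs'" and l0: "a \<in> l0" "a' \<in> l0" "set bs \<subseteq> l0" "set bs' \<subseteq> l0"
    and fb: "dual_filter_bank M a bs a' bs'"
    and \<phi>: "cc \<phi>" "cc \<phi>'" "\<phi> = wav \<phi> a" "\<phi>' = wav \<phi>' a'" and int: "(\<integral>x. \<phi> x \<partial>lborel) = 1"
    and part: "\<And>x F. finite F \<Longrightarrow> (\<And>k. \<phi>' (x - rvec k) \<noteq> 0 \<Longrightarrow> k \<in> F) \<Longrightarrow> (\<Sum>k\<in>F. \<phi>' (x - rvec k)) = 1"
    and b: "bessel (frame_index (length bs)) (framelet_elem M \<phi> (map (wav \<phi>) bs)) C"
    and b': "bessel (frame_index (length bs)) (framelet_elem M \<phi>' (map (wav \<phi>') bs')) C'"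
  shows "dual_framelet M \<phi> (map (wav \<phi>) bs) \<phi>' (map (wav \<phi>') bs')"
proof -
  let ?J = "frame_index (length bs) :: ((int^'n) + nat \<times> nat \<times> (int^'n)) set"
  let ?e = "framelet_elem M \<phi> (map (wav \<phi>) bs)" and ?e' = "framelet_elem M \<phi>' (map (wav \<phi>') bs')"
  have C: "0 \<le> C" "0 \<le> C'" using b b' by (simp_all add: bessel_def)
  have cc': "cc (?e' i)" if "i \<in> ?J" for i
    using that len by (auto simp: shift_eq intro!: cc_dilate_shift cc_wav \<phi>)
  have lim: "((\<lambda>I. L2_norm (\<lambda>x. f x - (\<Sum>i\<in>I. L2_inner f (?e i) * ?e' i x))) \<longlongrightarrow> 0) (finite_subsets_at_top ?J)"
    if f: "f \<in> L2" for f
    by (rule dual_expansion[OF b b' dual_expansion_cc[OF b b' cc' weak_expansion[OF len l0 fb \<phi> int part]] f])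
  have P: "(\<Sum>i\<in>I. (norm (L2_inner f (e i)))\<^sup>2) \<le> (\<Sum>\<^sub>\<infinity>i\<in>?J. (norm (L2_inner f (e i)))\<^sup>2)"
    if "bessel ?J e B" "f \<in> L2" "finite I" "I \<subseteq> ?J" for e B f I
    by (rule finite_sum_le_infsum[OF bessel_summable(1)[OF that(1,2)] that(3,4)]) simp
  have P0: "0 \<le> (\<Sum>\<^sub>\<infinity>i\<in>?J. (norm (L2_inner f (e i)))\<^sup>2)" for f :: "'n cfun" and e
    by (intro infsum_nonneg) simp
  have L2: "\<phi> \<in> L2" "\<phi>' \<in> L2" "set (map (wav \<phi>) bs) \<subseteq> L2" "set (map (wav \<phi>') bs') \<subseteq> L2"
    using \<phi>(1,2) by (auto intro: cc_L2 cc_wav)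
  have "framelet M \<phi> (map (wav \<phi>) bs)"
  proof (rule framelet_from_bessel[OF L2(1,3)])
    show "bessel (frame_index (length (map (wav \<phi>) bs))) ?e C" using b by simp
    show "0 \<le> C'" by (rule C)
    fix f :: "'n cfun" assume f: "f \<in> L2"
    have "(L2_norm f)\<^sup>2 \<le> sqrt (\<Sum>\<^sub>\<infinity>i\<in>?J. (norm (L2_inner f (?e i)))\<^sup>2) * sqrt (C' * (L2_norm f)\<^sup>2)"
      by (rule norm_le_analysis[OF besselL2[OF b'] f lim[OF f] P[OF b f] besselD[OF b' _ _ f]])
    from sq_le_sqrt_imp[OF this P0 C(2) L2_norm_nonneg]
    show "(L2_norm f)\<^sup>2 \<le> C' * (\<Sum>\<^sub>\<infinity>i\<in>frame_index (length (map (wav \<phi>) bs)). (norm (L2_inner f (?e i)))\<^sup>2)" by simp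
  qed
  moreover have "framelet M \<phi>' (map (wav \<phi>') bs')"
  proof (rule framelet_from_bessel[OF L2(2,4)])
    show "bessel (frame_index (length (map (wav \<phi>') bs'))) ?e' C'" using b' len by simp
    show "0 \<le> C" by (rule C)
    fix f :: "'n cfun" assume f: "f \<in> L2"
    have "(L2_norm f)\<^sup>2 \<le> sqrt (C * (L2_norm f)\<^sup>2) * sqrt (\<Sum>\<^sub>\<infinity>i\<in>?J. (norm (L2_inner f (?e' i)))\<^sup>2)"
      by (rule norm_le_analysis[OF besselL2[OF b'] f lim[OF f] besselD[OF b _ _ f] P[OF b' f]])
    hence "(L2_norm f)\<^sup>2 \<le> sqrt (\<Sum>\<^sub>\<infinity>i\<in>?J. (norm (L2_inner f (?e' i)))\<^sup>2) * sqrt (C * (L2_norm f)\<^sup>2)" by (simp only: mult.commute)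
    from sq_le_sqrt_imp[OF this P0 C(1) L2_norm_nonneg]
    show "(L2_norm f)\<^sup>2 \<le> C * (\<Sum>\<^sub>\<infinity>i\<in>frame_index (length (map (wav \<phi>') bs')). (norm (L2_inner f (?e' i)))\<^sup>2)"
      using len by simp
  qed
  ultimately show ?thesis unfolding dual_framelet_def using len lim by simp
qed

lemma vm_wav:
  assumes "cc \<phi>" "\<And>b. b \<in> set bs \<Longrightarrow> vmom m b" "bs \<noteq> []"
  shows "enat m \<le> Min (vm_fun ` set (map (wav \<phi>) bs))"
proof (subst Min_ge_iff)
  show "\<forall>x\<in>vm_fun ` set (map (wav \<phi>) bs). enat m \<le> x"
    using assms by (auto simp: vm_fun_def intro!: SUP_upper vanish_order_wav)
qed (use assms in auto)

end

theorem theorem2p2: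
  fixes M :: "int^'n^'n" and \<gamma> :: "nat \<Rightarrow> int^'n" and a a' :: "int^'n \<Rightarrow> complex"
    and n1 n2 :: nat
  assumes "dilation_matrix M"
    and "bij_betw \<gamma> {1..d_M M} (Gamma_M M)" and "\<gamma> 1 = 0"
    and "a \<in> l0" and "a' \<in> l0"
    and "interpolatory M a" and "interpolatory M a'"
    and "fseries a 0 = 1" and "fseries a' 0 = 1"
    and "0 < n1" and "0 < n2"
    and "n1 + n2 = min (sr a M) (sr a' M)"
  shows
    "(\<exists>bs bs'. filter_bank_claims M a a' n1 n2 bs bs')
     \<and> (\<forall>j\<in>{2..d_M M}.
          has_fseries (h_filter M a a' (\<gamma> j)) (h_series M a a' (\<gamma> j))
          \<and> (\<exists>s u u'. h_factorization (h_filter M a a' (\<gamma> j)) n1 n2 s u u'))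
     \<and> (\<forall>(s :: nat \<Rightarrow> nat) u u'.
          (\<forall>j\<in>{2..d_M M}. h_factorization (h_filter M a a' (\<gamma> j)) n1 n2 (s j) (u j) (u' j)) \<longrightarrow>
          (let bs = map filter_of (b_series M \<gamma> a s u);
               bs' = map filter_of (b_dual_series M \<gamma> a' s u')
           in list_all2 has_fseries bs (b_series M \<gamma> a s u)
              \<and> list_all2 has_fseries bs' (b_dual_series M \<gamma> a' s u')
              \<and> filter_bank_claims M a a' n1 n2 bs bs'
              \<and> (0 < sm_inf a M \<and> 0 < sm_inf a' M \<longrightarrow>
                  (\<exists>\<phi> \<phi>' \<psi>s \<psi>s'.
                     standard_refinable M a \<phi> \<and> standard_refinable M a' \<phi>'
                     \<and> list_all2 has_fourier \<psi>s (map (wavelet_series M \<phi>) bs)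
                     \<and> list_all2 has_fourier \<psi>s' (map (wavelet_series M \<phi>') bs')
                     \<and> (\<forall>\<psi>\<in>set \<psi>s \<union> set \<psi>s'. compactly_supported \<psi>)
                     \<and> dual_framelet M \<phi> \<psi>s \<phi>' \<psi>s'
                     \<and> fundamental \<phi> \<and> fundamental \<phi>'
                     \<and> enat n1 \<le> Min (vm_fun ` set \<psi>s)
                     \<and> enat n2 \<le> Min (vm_fun ` set \<psi>s')))))"
proof -
  note \<gamma> = assms(2,3) and a = assms(4,8,6) and a' = assms(5,9,7) and n = assms(12)
  interpret dilation_card M
    using assms(1) bij_betw_same_card[OF assms(2)] by unfold_locales auto
  have sr: "0 < sr a M" "0 < sr a' M" "n1 + n2 \<le> sr a M" "n1 + n2 \<le> sr a' M" using assms(10,12) by linarith+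
  note h = h_filter_props[OF a a' sr(3,4)]
  have fac: "\<exists>s u u'. h_factorization (h_filter M a a' (\<gamma> j)) n1 n2 s u u'" for j
    by (rule h_factorization_exists[OF has_fseries_l0[OF h(1)] h(2)])
  have bank: "list_all2 has_fseries bs (b_series M \<gamma> a s u)
      \<and> list_all2 has_fseries bs' (b_dual_series M \<gamma> a' s u')
      \<and> filter_bank_claims M a a' n1 n2 bs bs'
      \<and> (0 < sm_inf a M \<and> 0 < sm_inf a' M \<longrightarrow>
          (\<exists>\<phi> \<phi>' \<psi>s \<psi>s'.
             standard_refinable M a \<phi> \<and> standard_refinable M a' \<phi>'
             \<and> list_all2 has_fourier \<psi>s (map (wavelet_series M \<phi>) bs)
             \<and> list_all2 has_fourier \<psi>s' (map (wavelet_series M \<phi>') bs')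
             \<and> (\<forall>\<psi>\<in>set \<psi>s \<union> set \<psi>s'. compactly_supported \<psi>)
             \<and> dual_framelet M \<phi> \<psi>s \<phi>' \<psi>s'
             \<and> fundamental \<phi> \<and> fundamental \<phi>'
             \<and> enat n1 \<le> Min (vm_fun ` set \<psi>s)
             \<and> enat n2 \<le> Min (vm_fun ` set \<psi>s')))"
      (is "_ \<and> _ \<and> _ \<and> (_ \<longrightarrow> ?framelet)")
    if su: "\<forall>j\<in>{2..d_M M}. h_factorization (h_filter M a a' (\<gamma> j)) n1 n2 (s j) (u j) (u' j)"
      and bs: "bs = map filter_of (b_series M \<gamma> a s u)" "bs' = map filter_of (b_dual_series M \<gamma> a' s u')" for s u u' bs bs'
  proof (intro conjI impI)
    note fb = filter_bank[OF \<gamma> a a' n bspec[OF su], folded bs]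
    show "list_all2 has_fseries bs (b_series M \<gamma> a s u)" by (rule fb(1))
    show "list_all2 has_fseries bs' (b_dual_series M \<gamma> a' s u')" by (rule fb(2))
    show "filter_bank_claims M a a' n1 n2 bs bs'" by (rule fb(3))
    assume sm: "0 < sm_inf a M \<and> 0 < sm_inf a' M"
    interpret A: interp M a using a sr(1) sm by unfold_locales auto
    interpret A': interp M a' using a' sr(2) sm by unfold_locales auto
    define \<phi> \<phi>' where "\<phi> = A.phi" and "\<phi>' = A'.phi"
    have cc: "cc \<phi>" "cc \<phi>'" by (simp_all add: \<phi>_def \<phi>'_def A.cc_phi A'.cc_phi)
    have wav: "\<phi> = wav \<phi> a" "\<phi>' = wav \<phi>' a'" unfolding \<phi>_def \<phi>'_def by (rule A.phi_wav, rule A'.phi_wav)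
    have dfb: "dual_filter_bank M a bs a' bs'" "bs \<noteq> []" using fb(3) by (simp_all add: filter_bank_claims_def)
    have len: "length bs = length bs'" using dfb(1) by (simp add: dual_filter_bank_def)
    have bl0: "set bs \<subseteq> l0" "set bs' \<subseteq> l0" using fb(4,5) by blast+
    have vm: "\<And>b. b \<in> set bs \<Longrightarrow> vmom n1 b" "\<And>b. b \<in> set bs' \<Longrightarrow> vmom n2 b" using fb(4,5) by blast+
    obtain r where r: "0 < r" "r < 1" "\<And>R. \<exists>C\<ge>0. \<forall>n x y. norm (fwdn n (x - y)) \<le> R \<longrightarrow> norm (\<phi> x - \<phi> y) \<le> C * r ^ n"
      unfolding \<phi>_def using A.phi_modulus by blast
    obtain r' where r': "0 < r'" "r' < 1" "\<And>R. \<exists>C\<ge>0. \<forall>n x y. norm (fwdn n (x - y)) \<le> R \<longrightarrow> norm (\<phi>' x - \<phi>' y) \<le> C * r' ^ n"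
      unfolding \<phi>'_def using A'.phi_modulus by blast
    obtain C where C: "bessel (frame_index (length bs)) (framelet_elem M \<phi> (map (wav \<phi>) bs)) C"
      using bessel_framelet[OF cc(1) vm(1) assms(10) r] by blast
    obtain C' where C': "bessel (frame_index (length bs)) (framelet_elem M \<phi>' (map (wav \<phi>') bs')) C'"
      using bessel_framelet[OF cc(2) vm(2) assms(11) r'] unfolding len by blast
    have df: "dual_framelet M \<phi> (map (wav \<phi>) bs) \<phi>' (map (wav \<phi>') bs')"
      by (rule dual_framelet_wav[OF len a(1) a'(1) bl0 dfb(1) cc wav _ _ C C'])
         (unfold \<phi>_def \<phi>'_def, rule A.integral_phi, rule A'.phi_partition)
    show ?framelet
    proof (intro exI conjI)
      show "standard_refinable M a \<phi>" unfolding \<phi>_def by (rule A.standard_refinable_phi)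
      show "standard_refinable M a' \<phi>'" unfolding \<phi>'_def by (rule A'.standard_refinable_phi)
      show "list_all2 has_fourier (map (wav \<phi>) bs) (map (wavelet_series M \<phi>) bs)"
        "list_all2 has_fourier (map (wav \<phi>') bs') (map (wavelet_series M \<phi>') bs')"
        by (simp_all add: list_all2_conv_all_nth has_fourier_wav cc)
      show "\<forall>\<psi>\<in>set (map (wav \<phi>) bs) \<union> set (map (wav \<phi>') bs'). compactly_supported \<psi>"
        using cc by (auto intro: cc_compactly_supported cc_wav)
      show "dual_framelet M \<phi> (map (wav \<phi>) bs) \<phi>' (map (wav \<phi>') bs')" by (rule df)
      show "fundamental \<phi>" unfolding \<phi>_def by (rule A.fundamental_phi)
      show "fundamental \<phi>'" unfolding \<phi>'_def by (rule A'.fundamental_phi)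
      show "enat n1 \<le> Min (vm_fun ` set (map (wav \<phi>) bs))" by (rule vm_wav[OF cc(1) vm(1) dfb(2)])
      show "enat n2 \<le> Min (vm_fun ` set (map (wav \<phi>') bs'))" by (rule vm_wav[OF cc(2) vm(2)]) (use dfb(2) len in auto)
    qed
  qed
  have "\<exists>bs bs'. filter_bank_claims M a a' n1 n2 bs bs'"
  proof -
    obtain s u u' where "\<forall>j. h_factorization (h_filter M a a' (\<gamma> j)) n1 n2 (s j) (u j) (u' j)" using fac by metis
    thus ?thesis using bank[OF _ refl refl, of s u u'] by blast
  qed
  thus ?thesis unfolding Let_def using bank[OF _ refl refl] fac h(1) by blast
qed

end
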